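(* Let $\mathcal C$ be a finite tensor category over $k$. The natural isomorphism $\kappa_{2,3}:A_2\Rightarrow A_3$ is an isomorphism of Hopf monads. If $\mathcal C$ is pivotal, then $\kappa_{i,j}:A_i\Rightarrow A_j$ is an isomorphism of Hopf monads for all $i,j\in\{1,2,3,4\}$.
   Context: Fix an algebraically closed field $k$. A finite tensor category is a $k$-linear abelian rigid monoidal category with finite-dimensional Hom-spaces, all objects of finite length, finitely many isomorphism classes of simple objects, enough projectives, $k$-bilinear tensor product and simple unit $\mathbf 1$. Coherence isomorphisms are suppressed. Left duals: $\mathrm{ev}^l_X:X^\vee\otimes X\to\mathbf 1$, $\mathrm{coev}^l_X:\mathbf 1\to X\otimes X^\vee$; right duals: $\mathrm{ev}^r_X:X\otimes{}^\vee X\to\mathbf 1$, $\mathrm{coev}^r_X:\mathbf 1\to{}^\vee X\otimes X$. $\gamma_{V,W}:V^\vee\otimes W^\vee\to(W\otimes V)^\vee$ and $\gamma^r_{V,W}:{}^\vee V\otimes{}^\vee W\to{}^\vee(W\otimes V)$ are the canonical isomorphisms. Pivotal: equipped with a monoidal natural isomorphism $\delta:\mathrm{id}\Rightarrow(-)^{\vee\vee}$; then $p_X:X^\vee\to{}^\vee X$ is $(\mathrm{id}\otimes\mathrm{ev}^l_{X^\vee})(\mathrm{id}\otimes\delta_X\otimes\mathrm{id})(\mathrm{coev}^r_X\otimes\mathrm{id}_{X^\vee})$. A bimonad is a monad whose functor is lax comonoidal and whose multiplication and unit are comonoidal natural transformations; a Hopf monad is a bimonad whose category of modules is rigid (equivalently,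 with left and right antipodes). A morphism of Hopf monads is a morphism of monads that is comonoidal. Functors: $A_1(V)=\int^X{}^\vee X\otimes(V\otimes X)$, $A_2(V)=\int^XX^\vee\otimes(V\otimes X)$, $A_3(V)=\int^X(X\otimes V)\otimes{}^\vee X$, $A_4(V)=\int^X(X\otimes V)\otimes X^\vee$, with universal dinatural transformations $\iota_i(V)_X$. $A_2,A_3$ are Hopf monads, and in the pivotal case so are $A_1,A_4$, with structure: - multiplication $\mu_i(V):A_iA_i(V)\to A_i(V)$: composed with the iterated dinatural transformation ($X$ inner, $Y$ outer) it equals, for $i=1,2$, $\iota_i(V)_{X\otimes Y}$ precomposed with $\gamma^r_{Y,X}$ ($i=1$) resp. $\gamma_{Y,X}$ ($i=2$) on the duals, and for $i=3,4$, $\iota_i(V)_{Y\otimes X}$ precomposed with $\gamma^r_{X,Y}$ ($i=3$) resp. $\gamma_{X,Y}$ ($i=4$); - unit $V\cong\mathbf 1\otimes V\otimes\mathbf 1\xrightarrow{\iota_i(V)_{\mathbf 1}}A_i(V)$; - comultiplication $\Delta_i(U,V):A_i(U\otimes V)\to A_i(U)\otimes A_i(V)$: composed with $\iota_i(U\otimes V)_X$ it is $(\iota_i(U)_X\otimes\iota_i(V)_X)$ after inserting between $U$ and $V$ the morphism $\mathrm{coev}^l_X$ ($i=2$), $\mathrm{coev}^r_X$ ($i=3$), $(\mathrm{id}_X\otimes p_X)\mathrm{coev}^l_X$ ($i=1$), $(p_X^{-1}\otimes\mathrm{id}_X)\mathrm{coev}^r_X$ ($i=4$); - counit $\epsilon_i$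 with $\epsilon_2\iota_2(\mathbf 1)_X=\mathrm{ev}^l_X$, $\epsilon_3\iota_3(\mathbf 1)_X=\mathrm{ev}^r_X$, $\epsilon_1\iota_1(\mathbf 1)_X=\mathrm{ev}^l_X(p_X^{-1}\otimes\mathrm{id})$, $\epsilon_4\iota_4(\mathbf 1)_X=\mathrm{ev}^r_X(\mathrm{id}\otimes p_X)$. The canonical natural isomorphisms $\kappa_{i,j}$ are defined by $(\kappa_{i,j})_V\circ\iota_i(V)_X=\iota_j(V)_{X'}\circ(\text{canonical isomorphism of components})$, where $X'$ is $X$, $X^\vee$ or ${}^\vee X$ as appropriate: $(\kappa_{2,3})_V\circ\iota_2(V)_X=\iota_3(V)_{X^\vee}\circ(\mathrm{id}_{X^\vee\otimes V}\otimes\nu_X)$ with $\nu_X:X\to{}^\vee(X^\vee)$ the canonical isomorphism; in the pivotal case $(\kappa_{1,2})_V\circ\iota_1(V)_X=\iota_2(V)_X\circ(p_X^{-1}\otimes\mathrm{id})$, $(\kappa_{3,4})_V\circ\iota_3(V)_X=\iota_4(V)_X\circ(\mathrm{id}\otimes p_X^{-1})$, and the remaining $\kappa_{i,j}$ are composites and inverses of these. *)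

theory Defs
  imports "HOL-Computational_Algebra.Polynomial"
begin

section \<open>Categories, monoidal categories, duals\<close>

text \<open>
  A category has a set of objects and a set of arrows, each arrow carrying its source and target.
  The operation \<open>\<otimes>\<close> is the tensor product of objects and \<open>\<boxtimes>\<close> that of arrows.  Monoidal
  categories are not assumed strict: the coherence isomorphisms that one usually suppresses are
  written out.  The associator is \<open>assoc X Y Z : (X \<otimes> Y) \<otimes> Z \<rightarrow> X \<otimes> (Y \<otimes> Z)\<close>, the unitors are
  \<open>lun X : \<one> \<otimes> X \<rightarrow> X\<close> and \<open>run X : X \<otimes> \<one> \<rightarrow> X\<close>.
\<close>

record ('o, 'm) moncat =
  objs :: "'o set"
  arrs :: "'m set"
  src :: "'m \<Rightarrow> 'o"
  tgt :: "'m \<Rightarrow> 'o"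
  ide :: "'o \<Rightarrow> 'm"
  cmp :: "'m \<Rightarrow> 'm \<Rightarrow> 'm" (infixr "\<cdot>\<index>" 55)
  tens :: "'o \<Rightarrow> 'o \<Rightarrow> 'o" (infixl "\<otimes>\<index>" 70)
  tensa :: "'m \<Rightarrow> 'm \<Rightarrow> 'm" (infixl "\<boxtimes>\<index>" 70)
  uno :: "'o" ("\<one>\<index>")
  assoc :: "'o \<Rightarrow> 'o \<Rightarrow> 'o \<Rightarrow> 'm"
  lun :: "'o \<Rightarrow> 'm"
  run :: "'o \<Rightarrow> 'm"

text \<open>
  Chosen duals: \<open>ld X\<close> is the left dual \<open>X\<^sup>\<or>\<close> with \<open>evl X : ld X \<otimes> X \<rightarrow> \<one>\<close> and
  \<open>coevl X : \<one> \<rightarrow> X \<otimes> ld X\<close>; \<open>rd X\<close> is the right dual \<open>\<^sup>\<or>X\<close> with \<open>evr X : X \<otimes> rd X \<rightarrow> \<one>\<close> and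
  \<open>coevr X : \<one> \<rightarrow> rd X \<otimes> X\<close>.
\<close>

record ('o, 'm) rigidcat = "('o, 'm) moncat" +
  ld :: "'o \<Rightarrow> 'o"
  evl :: "'o \<Rightarrow> 'm"
  coevl :: "'o \<Rightarrow> 'm"
  rd :: "'o \<Rightarrow> 'o"
  evr :: "'o \<Rightarrow> 'm"
  coevr :: "'o \<Rightarrow> 'm"

record ('o, 'm, 'k) tensorcat = "('o, 'm) rigidcat" +
  add :: "'m \<Rightarrow> 'm \<Rightarrow> 'm" (infixl "\<oplus>\<index>" 65)
  zer :: "'o \<Rightarrow> 'o \<Rightarrow> 'm"
  scale :: "'k \<Rightarrow> 'm \<Rightarrow> 'm"

context
  fixes C :: "('o, 'm, 'x) moncat_scheme" (structure)
begin

definition hom :: "'o \<Rightarrow> 'o \<Rightarrow> 'm set" where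
  "hom X Y = {f \<in> arrs C. src C f = X \<and> tgt C f = Y}"

definition inverse_arrows :: "'m \<Rightarrow> 'm \<Rightarrow> bool" where
  "inverse_arrows f g \<longleftrightarrow>
     f \<in> arrs C \<and> g \<in> hom (tgt C f) (src C f) \<and>
     g \<cdot> f = ide C (src C f) \<and> f \<cdot> g = ide C (tgt C f)"

definition iso :: "'m \<Rightarrow> bool" where
  "iso f \<longleftrightarrow> (\<exists>g. inverse_arrows f g)"

definition inv_arr :: "'m \<Rightarrow> 'm" where
  "inv_arr f = (THE g. inverse_arrows f g)"

definition isomorphic :: "'o \<Rightarrow> 'o \<Rightarrow> bool" where
  "isomorphic X Y \<longleftrightarrow> (\<exists>f \<in> hom X Y. iso f)"

definition mono :: "'m \<Rightarrow> bool" where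
  "mono f \<longleftrightarrow> f \<in> arrs C \<and>
     (\<forall>W \<in> objs C. \<forall>g \<in> hom W (src C f). \<forall>h \<in> hom W (src C f). f \<cdot> g = f \<cdot> h \<longrightarrow> g = h)"

definition epi :: "'m \<Rightarrow> bool" where
  "epi f \<longleftrightarrow> f \<in> arrs C \<and>
     (\<forall>W \<in> objs C. \<forall>g \<in> hom (tgt C f) W. \<forall>h \<in> hom (tgt C f) W. g \<cdot> f = h \<cdot> f \<longrightarrow> g = h)"

definition projective :: "'o \<Rightarrow> bool" where
  "projective P \<longleftrightarrow> P \<in> objs C \<and>
     (\<forall>q f. epi q \<and> f \<in> hom P (tgt C q) \<longrightarrow> (\<exists>g \<in> hom P (src C q). q \<cdot> g = f))"

text \<open>\<open>Y\<close> is a left dual of \<open>X\<close>; equivalently, \<open>X\<close> is a right dual of \<open>Y\<close>.\<close>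

definition dual_pair :: "'o \<Rightarrow> 'o \<Rightarrow> 'm \<Rightarrow> 'm \<Rightarrow> bool" where
  "dual_pair X Y e c \<longleftrightarrow>
     X \<in> objs C \<and> Y \<in> objs C \<and> e \<in> hom (Y \<otimes> X) \<one> \<and> c \<in> hom \<one> (X \<otimes> Y) \<and>
     run C X \<cdot> (ide C X \<boxtimes> e) \<cdot> assoc C X Y X \<cdot> (c \<boxtimes> ide C X) \<cdot> inv_arr (lun C X) = ide C X \<and>
     lun C Y \<cdot> (e \<boxtimes> ide C Y) \<cdot> inv_arr (assoc C Y X Y) \<cdot> (ide C Y \<boxtimes> c) \<cdot> inv_arr (run C Y) = ide C Y"

end

locale category =
  fixes C :: "('o, 'm, 'x) moncat_scheme" (structure)
  assumes src_obj: "f \<in> arrs C \<Longrightarrow> src C f \<in> objs C"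
    and tgt_obj: "f \<in> arrs C \<Longrightarrow> tgt C f \<in> objs C"
    and ide_hom: "X \<in> objs C \<Longrightarrow> ide C X \<in> hom C X X"
    and cmp_hom: "f \<in> hom C X Y \<Longrightarrow> g \<in> hom C Y Z \<Longrightarrow> g \<cdot> f \<in> hom C X Z"
    and cmp_ide_left: "f \<in> hom C X Y \<Longrightarrow> ide C Y \<cdot> f = f"
    and cmp_ide_right: "f \<in> hom C X Y \<Longrightarrow> f \<cdot> ide C X = f"
    and cmp_assoc:
      "f \<in> hom C W X \<Longrightarrow> g \<in> hom C X Y \<Longrightarrow> h \<in> hom C Y Z \<Longrightarrow> (h \<cdot> g) \<cdot> f = h \<cdot> (g \<cdot> f)"

locale monoidal_category = category +
  assumes uno_obj: "\<one> \<in> objs C"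
    and tens_obj: "X \<in> objs C \<Longrightarrow> Y \<in> objs C \<Longrightarrow> X \<otimes> Y \<in> objs C"
    and tensa_hom:
      "f \<in> hom C X X' \<Longrightarrow> g \<in> hom C Y Y' \<Longrightarrow> f \<boxtimes> g \<in> hom C (X \<otimes> Y) (X' \<otimes> Y')"
    and tensa_ide: "X \<in> objs C \<Longrightarrow> Y \<in> objs C \<Longrightarrow> ide C X \<boxtimes> ide C Y = ide C (X \<otimes> Y)"
    and interchange:
      "f \<in> hom C X X' \<Longrightarrow> f' \<in> hom C X' X'' \<Longrightarrow> g \<in> hom C Y Y' \<Longrightarrow> g' \<in> hom C Y' Y'' \<Longrightarrow>
       (f' \<cdot> f) \<boxtimes> (g' \<cdot> g) = (f' \<boxtimes> g') \<cdot> (f \<boxtimes> g)"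
    and assoc_hom:
      "X \<in> objs C \<Longrightarrow> Y \<in> objs C \<Longrightarrow> Z \<in> objs C \<Longrightarrow>
       assoc C X Y Z \<in> hom C ((X \<otimes> Y) \<otimes> Z) (X \<otimes> (Y \<otimes> Z))"
    and assoc_iso:
      "X \<in> objs C \<Longrightarrow> Y \<in> objs C \<Longrightarrow> Z \<in> objs C \<Longrightarrow> iso C (assoc C X Y Z)"
    and assoc_natural:
      "f \<in> hom C X X' \<Longrightarrow> g \<in> hom C Y Y' \<Longrightarrow> h \<in> hom C Z Z' \<Longrightarrow>
       assoc C X' Y' Z' \<cdot> ((f \<boxtimes> g) \<boxtimes> h) = (f \<boxtimes> (g \<boxtimes> h)) \<cdot> assoc C X Y Z"
    and lun_hom: "X \<in> objs C \<Longrightarrow> lun C X \<in> hom C (\<one> \<otimes> X) X"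
    and lun_iso: "X \<in> objs C \<Longrightarrow> iso C (lun C X)"
    and lun_natural: "f \<in> hom C X Y \<Longrightarrow> lun C Y \<cdot> (ide C \<one> \<boxtimes> f) = f \<cdot> lun C X"
    and run_hom: "X \<in> objs C \<Longrightarrow> run C X \<in> hom C (X \<otimes> \<one>) X"
    and run_iso: "X \<in> objs C \<Longrightarrow> iso C (run C X)"
    and run_natural: "f \<in> hom C X Y \<Longrightarrow> run C Y \<cdot> (f \<boxtimes> ide C \<one>) = f \<cdot> run C X"
    and pentagon:
      "W \<in> objs C \<Longrightarrow> X \<in> objs C \<Longrightarrow> Y \<in> objs C \<Longrightarrow> Z \<in> objs C \<Longrightarrow>
       (ide C W \<boxtimes> assoc C X Y Z) \<cdot> assoc C W (X \<otimes> Y) Z \<cdot> (assoc C W X Y \<boxtimes> ide C Z)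
         = assoc C W X (Y \<otimes> Z) \<cdot> assoc C (W \<otimes> X) Y Z"
    and triangle:
      "X \<in> objs C \<Longrightarrow> Y \<in> objs C \<Longrightarrow>
       (ide C X \<boxtimes> lun C Y) \<cdot> assoc C X \<one> Y = run C X \<boxtimes> ide C Y"

locale rigid_category = monoidal_category C
  for C :: "('o, 'm, 'x) rigidcat_scheme" (structure) +
  assumes left_dual: "X \<in> objs C \<Longrightarrow> dual_pair C X (ld C X) (evl C X) (coevl C X)"
    and right_dual: "X \<in> objs C \<Longrightarrow> dual_pair C (rd C X) X (evr C X) (coevr C X)"


section \<open>Finite tensor categories\<close>

context
  fixes C :: "('o, 'm, 'k::field, 'x) tensorcat_scheme" (structure)
begin

inductive_set lin_span :: "'o \<Rightarrow> 'o \<Rightarrow> 'm set \<Rightarrow> 'm set" for X Y S where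
  zero: "zer C X Y \<in> lin_span X Y S"
| step: "f \<in> lin_span X Y S \<Longrightarrow> g \<in> S \<Longrightarrow> scale C c g \<oplus> f \<in> lin_span X Y S"

definition zero_object :: "'o \<Rightarrow> bool" where
  "zero_object Z \<longleftrightarrow> Z \<in> objs C \<and>
     (\<forall>X \<in> objs C. (\<exists>!f. f \<in> hom C X Z) \<and> (\<exists>!f. f \<in> hom C Z X))"

definition biproduct :: "'o \<Rightarrow> 'o \<Rightarrow> 'o \<Rightarrow> bool" where
  "biproduct X Y P \<longleftrightarrow> P \<in> objs C \<and>
     (\<exists>i \<in> hom C X P. \<exists>j \<in> hom C Y P. \<exists>p \<in> hom C P X. \<exists>q \<in> hom C P Y.
        p \<cdot> i = ide C X \<and> q \<cdot> j = ide C Y \<and> q \<cdot> i = zer C X Y \<and> p \<cdot> j = zer C Y X \<and>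
        (i \<cdot> p) \<oplus> (j \<cdot> q) = ide C P)"

definition is_kernel :: "'m \<Rightarrow> 'm \<Rightarrow> bool" where
  "is_kernel k f \<longleftrightarrow> f \<in> arrs C \<and> k \<in> arrs C \<and> tgt C k = src C f \<and>
     f \<cdot> k = zer C (src C k) (tgt C f) \<and>
     (\<forall>W \<in> objs C. \<forall>g \<in> hom C W (src C f). f \<cdot> g = zer C W (tgt C f) \<longrightarrow>
        (\<exists>!h. h \<in> hom C W (src C k) \<and> k \<cdot> h = g))"

definition is_cokernel :: "'m \<Rightarrow> 'm \<Rightarrow> bool" where
  "is_cokernel q f \<longleftrightarrow> f \<in> arrs C \<and> q \<in> arrs C \<and> src C q = tgt C f \<and>
     q \<cdot> f = zer C (src C f) (tgt C q) \<and>
     (\<forall>W \<in> objs C. \<forall>g \<in> hom C (tgt C f) W. g \<cdot> f = zer C (src C f) W \<longrightarrow>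
        (\<exists>!h. h \<in> hom C (tgt C q) W \<and> h \<cdot> q = g))"

definition simple_object :: "'o \<Rightarrow> bool" where
  "simple_object S \<longleftrightarrow> S \<in> objs C \<and> \<not> zero_object S \<and>
     (\<forall>m. mono C m \<and> tgt C m = S \<longrightarrow> zero_object (src C m) \<or> iso C m)"

text \<open>Existence of a composition series, built up by extensions
  \<open>0 \<rightarrow> Y \<rightarrow> X \<rightarrow> S \<rightarrow> 0\<close> with \<open>S\<close> simple.\<close>

inductive finite_length :: "'o \<Rightarrow> bool" where
  zero: "zero_object Z \<Longrightarrow> finite_length Z"
| ext: "finite_length Y \<Longrightarrow> k \<in> hom C Y X \<Longrightarrow> q \<in> hom C X S \<Longrightarrow>
        is_kernel k q \<Longrightarrow> is_cokernel q k \<Longrightarrow> simple_object S \<Longrightarrow> finite_length X"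

end

locale linear_category = category C
  for C :: "('o, 'm, 'k::field, 'x) tensorcat_scheme" (structure) +
  assumes add_hom: "f \<in> hom C X Y \<Longrightarrow> g \<in> hom C X Y \<Longrightarrow> f \<oplus> g \<in> hom C X Y"
    and zer_hom: "X \<in> objs C \<Longrightarrow> Y \<in> objs C \<Longrightarrow> zer C X Y \<in> hom C X Y"
    and scale_hom: "f \<in> hom C X Y \<Longrightarrow> scale C c f \<in> hom C X Y"
    and add_assoc:
      "f \<in> hom C X Y \<Longrightarrow> g \<in> hom C X Y \<Longrightarrow> h \<in> hom C X Y \<Longrightarrow> (f \<oplus> g) \<oplus> h = f \<oplus> (g \<oplus> h)"
    and add_commute: "f \<in> hom C X Y \<Longrightarrow> g \<in> hom C X Y \<Longrightarrow> f \<oplus> g = g \<oplus> f"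
    and add_zer: "f \<in> hom C X Y \<Longrightarrow> zer C X Y \<oplus> f = f"
    and add_inverse: "f \<in> hom C X Y \<Longrightarrow> \<exists>g \<in> hom C X Y. g \<oplus> f = zer C X Y"
    and scale_add_right:
      "f \<in> hom C X Y \<Longrightarrow> g \<in> hom C X Y \<Longrightarrow> scale C c (f \<oplus> g) = scale C c f \<oplus> scale C c g"
    and scale_add_left: "f \<in> hom C X Y \<Longrightarrow> scale C (c + d) f = scale C c f \<oplus> scale C d f"
    and scale_scale: "f \<in> hom C X Y \<Longrightarrow> scale C c (scale C d f) = scale C (c * d) f"
    and scale_one: "f \<in> hom C X Y \<Longrightarrow> scale C 1 f = f"
    and cmp_add_left:
      "f \<in> hom C X Y \<Longrightarrow> g \<in> hom C Y Z \<Longrightarrow> g' \<in> hom C Y Z \<Longrightarrow> (g \<oplus> g') \<cdot> f = (g \<cdot> f) \<oplus> (g' \<cdot> f)"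
    and cmp_add_right:
      "f \<in> hom C X Y \<Longrightarrow> f' \<in> hom C X Y \<Longrightarrow> g \<in> hom C Y Z \<Longrightarrow> g \<cdot> (f \<oplus> f') = (g \<cdot> f) \<oplus> (g \<cdot> f')"
    and cmp_scale_left:
      "f \<in> hom C X Y \<Longrightarrow> g \<in> hom C Y Z \<Longrightarrow> scale C c g \<cdot> f = scale C c (g \<cdot> f)"
    and cmp_scale_right:
      "f \<in> hom C X Y \<Longrightarrow> g \<in> hom C Y Z \<Longrightarrow> g \<cdot> scale C c f = scale C c (g \<cdot> f)"

locale linear_abelian_category = linear_category +
  assumes zero_object_exists: "\<exists>Z. zero_object C Z"
    and biproduct_exists: "X \<in> objs C \<Longrightarrow> Y \<in> objs C \<Longrightarrow> \<exists>P. biproduct C X Y P"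
    and kernel_exists: "f \<in> arrs C \<Longrightarrow> \<exists>k. is_kernel C k f"
    and cokernel_exists: "f \<in> arrs C \<Longrightarrow> \<exists>q. is_cokernel C q f"
    and mono_normal: "mono C m \<Longrightarrow> \<exists>f. is_kernel C m f"
    and epi_normal: "epi C q \<Longrightarrow> \<exists>f. is_cokernel C q f"

locale finite_tensor_category = linear_abelian_category C + rigid_category C
  for C :: "('o, 'm, 'k::alg_closed_field, 'x) tensorcat_scheme" (structure) +
  assumes hom_finite_dim:
      "X \<in> objs C \<Longrightarrow> Y \<in> objs C \<Longrightarrow> \<exists>S. finite S \<and> S \<subseteq> hom C X Y \<and> hom C X Y = lin_span C X Y S"
    and objects_finite_length: "X \<in> objs C \<Longrightarrow> finite_length C X"
    and finitely_many_simples: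
      "\<exists>F. finite F \<and> (\<forall>S. simple_object C S \<longrightarrow> (\<exists>S' \<in> F. isomorphic C S S'))"
    and enough_projectives:
      "X \<in> objs C \<Longrightarrow> \<exists>P q. projective C P \<and> q \<in> hom C P X \<and> epi C q"
    and tensa_add_left:
      "f \<in> hom C X X' \<Longrightarrow> f' \<in> hom C X X' \<Longrightarrow> g \<in> hom C Y Y' \<Longrightarrow>
       (f \<oplus> f') \<boxtimes> g = (f \<boxtimes> g) \<oplus> (f' \<boxtimes> g)"
    and tensa_add_right:
      "f \<in> hom C X X' \<Longrightarrow> g \<in> hom C Y Y' \<Longrightarrow> g' \<in> hom C Y Y' \<Longrightarrow>
       f \<boxtimes> (g \<oplus> g') = (f \<boxtimes> g) \<oplus> (f \<boxtimes> g')"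
    and tensa_scale_left:
      "f \<in> hom C X X' \<Longrightarrow> g \<in> hom C Y Y' \<Longrightarrow> scale C c f \<boxtimes> g = scale C c (f \<boxtimes> g)"
    and tensa_scale_right:
      "f \<in> hom C X X' \<Longrightarrow> g \<in> hom C Y Y' \<Longrightarrow> f \<boxtimes> scale C c g = scale C c (f \<boxtimes> g)"
    and unit_simple: "simple_object C \<one>"


section \<open>Hopf monads\<close>

text \<open>The data of a monad with a comonoidal structure: \<open>m_comul T U V : T(U \<otimes> V) \<rightarrow> T U \<otimes> T V\<close>
  and \<open>m_counit T : T \<one> \<rightarrow> \<one>\<close>.\<close>

record ('o, 'm) bimonad_data =
  m_ob :: "'o \<Rightarrow> 'o"
  m_ar :: "'m \<Rightarrow> 'm"
  m_mult :: "'o \<Rightarrow> 'm"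
  m_unit :: "'o \<Rightarrow> 'm"
  m_comul :: "'o \<Rightarrow> 'o \<Rightarrow> 'm"
  m_counit :: "'m"

context
  fixes C :: "('o, 'm, 'x) moncat_scheme" (structure)
begin

definition endofunctor :: "('o, 'm) bimonad_data \<Rightarrow> bool" where
  "endofunctor T \<longleftrightarrow>
     (\<forall>X \<in> objs C. m_ob T X \<in> objs C \<and> m_ar T (ide C X) = ide C (m_ob T X)) \<and>
     (\<forall>X Y f. f \<in> hom C X Y \<longrightarrow> m_ar T f \<in> hom C (m_ob T X) (m_ob T Y)) \<and>
     (\<forall>X Y Z f g. f \<in> hom C X Y \<and> g \<in> hom C Y Z \<longrightarrow> m_ar T (g \<cdot> f) = m_ar T g \<cdot> m_ar T f)"

definition is_monad :: "('o, 'm) bimonad_data \<Rightarrow> bool" where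
  "is_monad T \<longleftrightarrow> endofunctor T \<and>
     (\<forall>X \<in> objs C. m_mult T X \<in> hom C (m_ob T (m_ob T X)) (m_ob T X)) \<and>
     (\<forall>X \<in> objs C. m_unit T X \<in> hom C X (m_ob T X)) \<and>
     (\<forall>X Y f. f \<in> hom C X Y \<longrightarrow>
        m_mult T Y \<cdot> m_ar T (m_ar T f) = m_ar T f \<cdot> m_mult T X \<and>
        m_unit T Y \<cdot> f = m_ar T f \<cdot> m_unit T X) \<and>
     (\<forall>X \<in> objs C.
        m_mult T X \<cdot> m_ar T (m_mult T X) = m_mult T X \<cdot> m_mult T (m_ob T X) \<and>
        m_mult T X \<cdot> m_ar T (m_unit T X) = ide C (m_ob T X) \<and>
        m_mult T X \<cdot> m_unit T (m_ob T X) = ide C (m_ob T X))"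

definition comonoidal_functor :: "('o, 'm) bimonad_data \<Rightarrow> bool" where
  "comonoidal_functor T \<longleftrightarrow> endofunctor T \<and>
     (\<forall>X \<in> objs C. \<forall>Y \<in> objs C. m_comul T X Y \<in> hom C (m_ob T (X \<otimes> Y)) (m_ob T X \<otimes> m_ob T Y)) \<and>
     m_counit T \<in> hom C (m_ob T \<one>) \<one> \<and>
     (\<forall>X X' Y Y' f g. f \<in> hom C X X' \<and> g \<in> hom C Y Y' \<longrightarrow>
        m_comul T X' Y' \<cdot> m_ar T (f \<boxtimes> g) = (m_ar T f \<boxtimes> m_ar T g) \<cdot> m_comul T X Y) \<and>
     (\<forall>X \<in> objs C. \<forall>Y \<in> objs C. \<forall>Z \<in> objs C.
        assoc C (m_ob T X) (m_ob T Y) (m_ob T Z) \<cdot>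
            (m_comul T X Y \<boxtimes> ide C (m_ob T Z)) \<cdot> m_comul T (X \<otimes> Y) Z
          = (ide C (m_ob T X) \<boxtimes> m_comul T Y Z) \<cdot> m_comul T X (Y \<otimes> Z) \<cdot> m_ar T (assoc C X Y Z)) \<and>
     (\<forall>X \<in> objs C.
        lun C (m_ob T X) \<cdot> (m_counit T \<boxtimes> ide C (m_ob T X)) \<cdot> m_comul T \<one> X = m_ar T (lun C X) \<and>
        run C (m_ob T X) \<cdot> (ide C (m_ob T X) \<boxtimes> m_counit T) \<cdot> m_comul T X \<one> = m_ar T (run C X))"

text \<open>The last two clauses say that multiplication and unit are comonoidal.\<close>

definition bimonad :: "('o, 'm) bimonad_data \<Rightarrow> bool" where
  "bimonad T \<longleftrightarrow> is_monad T \<and> comonoidal_functor T \<and>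
     (\<forall>X \<in> objs C. \<forall>Y \<in> objs C.
        m_comul T X Y \<cdot> m_mult T (X \<otimes> Y)
          = (m_mult T X \<boxtimes> m_mult T Y) \<cdot> m_comul T (m_ob T X) (m_ob T Y) \<cdot> m_ar T (m_comul T X Y) \<and>
        m_comul T X Y \<cdot> m_unit T (X \<otimes> Y) = m_unit T X \<boxtimes> m_unit T Y) \<and>
     m_counit T \<cdot> m_mult T \<one> = m_counit T \<cdot> m_ar T (m_counit T) \<and>
     m_counit T \<cdot> m_unit T \<one> = ide C \<one>"

definition is_module :: "('o, 'm) bimonad_data \<Rightarrow> 'o \<Rightarrow> 'm \<Rightarrow> bool" where
  "is_module T M r \<longleftrightarrow> M \<in> objs C \<and> r \<in> hom C (m_ob T M) M \<and>
     r \<cdot> m_ar T r = r \<cdot> m_mult T M \<and> r \<cdot> m_unit T M = ide C M"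

definition module_hom :: "('o, 'm) bimonad_data \<Rightarrow> 'o \<Rightarrow> 'm \<Rightarrow> 'o \<Rightarrow> 'm \<Rightarrow> 'm \<Rightarrow> bool" where
  "module_hom T M r N s f \<longleftrightarrow> f \<in> hom C M N \<and> f \<cdot> r = s \<cdot> m_ar T f"

definition tensor_action :: "('o, 'm) bimonad_data \<Rightarrow> 'o \<Rightarrow> 'm \<Rightarrow> 'o \<Rightarrow> 'm \<Rightarrow> 'm" where
  "tensor_action T M r N s = (r \<boxtimes> s) \<cdot> m_comul T M N"

text \<open>\<open>(N, s)\<close> is a left dual of \<open>(M, r)\<close> in the monoidal category of modules, whose unit is
  \<open>\<one>\<close> with the counit as action.\<close>

definition module_dual_pair ::
    "('o, 'm) bimonad_data \<Rightarrow> 'o \<Rightarrow> 'm \<Rightarrow> 'o \<Rightarrow> 'm \<Rightarrow> 'm \<Rightarrow> 'm \<Rightarrow> bool" where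
  "module_dual_pair T M r N s e c \<longleftrightarrow>
     is_module T M r \<and> is_module T N s \<and> dual_pair C M N e c \<and>
     module_hom T (N \<otimes> M) (tensor_action T N s M r) \<one> (m_counit T) e \<and>
     module_hom T \<one> (m_counit T) (M \<otimes> N) (tensor_action T M r N s) c"

definition hopf_monad :: "('o, 'm) bimonad_data \<Rightarrow> bool" where
  "hopf_monad T \<longleftrightarrow> bimonad T \<and>
     (\<forall>M r. is_module T M r \<longrightarrow>
        (\<exists>N s e c. module_dual_pair T M r N s e c) \<and>
        (\<exists>N s e c. module_dual_pair T N s M r e c))"

definition hopf_monad_morphism ::
    "('o, 'm) bimonad_data \<Rightarrow> ('o, 'm) bimonad_data \<Rightarrow> ('o \<Rightarrow> 'm) \<Rightarrow> bool" where
  "hopf_monad_morphism S T \<phi> \<longleftrightarrow> hopf_monad S \<and> hopf_monad T \<and>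
     (\<forall>X \<in> objs C. \<phi> X \<in> hom C (m_ob S X) (m_ob T X)) \<and>
     (\<forall>X Y f. f \<in> hom C X Y \<longrightarrow> \<phi> Y \<cdot> m_ar S f = m_ar T f \<cdot> \<phi> X) \<and>
     (\<forall>X \<in> objs C.
        \<phi> X \<cdot> m_mult S X = m_mult T X \<cdot> \<phi> (m_ob T X) \<cdot> m_ar S (\<phi> X) \<and>
        \<phi> X \<cdot> m_unit S X = m_unit T X) \<and>
     (\<forall>X \<in> objs C. \<forall>Y \<in> objs C.
        m_comul T X Y \<cdot> \<phi> (X \<otimes> Y) = (\<phi> X \<boxtimes> \<phi> Y) \<cdot> m_comul S X Y) \<and>
     m_counit T \<cdot> \<phi> \<one> = m_counit S"

definition hopf_monad_iso ::
    "('o, 'm) bimonad_data \<Rightarrow> ('o, 'm) bimonad_data \<Rightarrow> ('o \<Rightarrow> 'm) \<Rightarrow> bool" where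
  "hopf_monad_iso S T \<phi> \<longleftrightarrow> hopf_monad_morphism S T \<phi> \<and>
     (\<exists>\<psi>. hopf_monad_morphism T S \<psi> \<and>
        (\<forall>X \<in> objs C. \<psi> X \<cdot> \<phi> X = ide C (m_ob S X) \<and> \<phi> X \<cdot> \<psi> X = ide C (m_ob T X)))"

end


section \<open>Canonical morphisms between duals, pivotal structures\<close>

context
  fixes C :: "('o, 'm, 'x) rigidcat_scheme" (structure)
begin

text \<open>\<open>transl Z X f : Z \<rightarrow> ld X\<close> is the mate of \<open>f : Z \<otimes> X \<rightarrow> \<one>\<close>, and
  \<open>transr X Z f : Z \<rightarrow> rd X\<close> is the mate of \<open>f : X \<otimes> Z \<rightarrow> \<one>\<close>.\<close>

definition transl :: "'o \<Rightarrow> 'o \<Rightarrow> 'm \<Rightarrow> 'm" where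
  "transl Z X f =
     lun C (ld C X) \<cdot> (f \<boxtimes> ide C (ld C X)) \<cdot> inv_arr C (assoc C Z X (ld C X)) \<cdot>
     (ide C Z \<boxtimes> coevl C X) \<cdot> inv_arr C (run C Z)"

definition transr :: "'o \<Rightarrow> 'o \<Rightarrow> 'm \<Rightarrow> 'm" where
  "transr X Z f =
     run C (rd C X) \<cdot> (ide C (rd C X) \<boxtimes> f) \<cdot> assoc C (rd C X) X Z \<cdot>
     (coevr C X \<boxtimes> ide C Z) \<cdot> inv_arr C (lun C Z)"

definition ld_arr :: "'m \<Rightarrow> 'm" where
  "ld_arr f = transl (ld C (tgt C f)) (src C f) (evl C (tgt C f) \<cdot> (ide C (ld C (tgt C f)) \<boxtimes> f))"

definition rd_arr :: "'m \<Rightarrow> 'm" where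
  "rd_arr f = transr (src C f) (rd C (tgt C f)) (evr C (tgt C f) \<cdot> (f \<boxtimes> ide C (rd C (tgt C f))))"

text \<open>\<open>gammal V W : ld V \<otimes> ld W \<rightarrow> ld (W \<otimes> V)\<close> and \<open>gammar V W : rd V \<otimes> rd W \<rightarrow> rd (W \<otimes> V)\<close>,
  the mates of the nested evaluations.\<close>

definition gammal :: "'o \<Rightarrow> 'o \<Rightarrow> 'm" where
  "gammal V W = transl (ld C V \<otimes> ld C W) (W \<otimes> V)
     (evl C V \<cdot>
      (ide C (ld C V) \<boxtimes>
         (lun C V \<cdot> (evl C W \<boxtimes> ide C V) \<cdot> inv_arr C (assoc C (ld C W) W V))) \<cdot>
      assoc C (ld C V) (ld C W) (W \<otimes> V))"

definition gammar :: "'o \<Rightarrow> 'o \<Rightarrow> 'm" where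
  "gammar V W = transr (W \<otimes> V) (rd C V \<otimes> rd C W)
     (evr C W \<cdot>
      ((run C W \<cdot> (ide C W \<boxtimes> evr C V) \<cdot> assoc C W V (rd C V)) \<boxtimes> ide C (rd C W)) \<cdot>
      inv_arr C (assoc C (W \<otimes> V) (rd C V) (rd C W)))"

text \<open>The canonical isomorphisms \<open>\<one> \<rightarrow> ld \<one>\<close> and \<open>\<one> \<rightarrow> rd \<one>\<close>.\<close>

definition unitl :: "'m" where
  "unitl = transl \<one> \<one> (lun C \<one>)"

definition unitr :: "'m" where
  "unitr = transr \<one> \<one> (run C \<one>)"

text \<open>\<open>nu X : X \<rightarrow> rd (ld X)\<close>\<close>

definition nu :: "'o \<Rightarrow> 'm" where
  "nu X = transr (ld C X) X (evl C X)"

text \<open>The last two clauses say that \<open>\<delta>\<close> is monoidal.  The monoidal structure of the double dual is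
  the composite of \<open>gammal (ld V) (ld W)\<close> with the inverse of \<open>ld_arr (gammal W V)\<close>, and similarly
  for the unit; the inverses are moved to the other side.\<close>

definition pivotal :: "('o \<Rightarrow> 'm) \<Rightarrow> bool" where
  "pivotal \<delta> \<longleftrightarrow>
     (\<forall>X \<in> objs C. \<delta> X \<in> hom C X (ld C (ld C X)) \<and> iso C (\<delta> X)) \<and>
     (\<forall>X Y f. f \<in> hom C X Y \<longrightarrow> \<delta> Y \<cdot> f = ld_arr (ld_arr f) \<cdot> \<delta> X) \<and>
     (\<forall>V \<in> objs C. \<forall>W \<in> objs C.
        ld_arr (gammal W V) \<cdot> \<delta> (V \<otimes> W) = gammal (ld C V) (ld C W) \<cdot> (\<delta> V \<boxtimes> \<delta> W)) \<and>
     ld_arr unitl \<cdot> \<delta> \<one> = unitl"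

text \<open>\<open>piv_p \<delta> X : ld X \<rightarrow> rd X\<close>\<close>

definition piv_p :: "('o \<Rightarrow> 'm) \<Rightarrow> 'o \<Rightarrow> 'm" where
  "piv_p \<delta> X =
     run C (rd C X) \<cdot> (ide C (rd C X) \<boxtimes> evl C (ld C X)) \<cdot>
     (ide C (rd C X) \<boxtimes> (\<delta> X \<boxtimes> ide C (ld C X))) \<cdot>
     assoc C (rd C X) X (ld C X) \<cdot> (coevr C X \<boxtimes> ide C (ld C X)) \<cdot> inv_arr C (lun C (ld C X))"


section \<open>The four central monads\<close>

text \<open>
  For \<open>i \<in> {1, 2, 3, 4}\<close> the functor \<open>A\<^sub>i\<close> is the coend over \<open>X\<close> of
  \<open>rd X \<otimes> (V \<otimes> X)\<close>, \<open>ld X \<otimes> (V \<otimes> X)\<close>, \<open>(X \<otimes> V) \<otimes> rd X\<close>, \<open>(X \<otimes> V) \<otimes> ld X\<close>, respectively.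
  Thus \<open>du i X\<close> is the dual of \<open>X\<close> that occurs; it stands on the left if \<open>i \<le> 2\<close> and on the right
  otherwise.
  The parameter \<open>\<delta>\<close> below is a candidate pivotal structure; \<open>A\<^sub>2\<close>, \<open>A\<^sub>3\<close> and
  \<open>\<kappa>\<^sub>2\<^sub>,\<^sub>3\<close> do not depend on it.
\<close>

definition du :: "nat \<Rightarrow> 'o \<Rightarrow> 'o" where
  "du i X = (if i = 2 \<or> i = 4 then ld C X else rd C X)"

definition du_arr :: "nat \<Rightarrow> 'm \<Rightarrow> 'm" where
  "du_arr i f = (if i = 2 \<or> i = 4 then ld_arr f else rd_arr f)"

definition du_gamma :: "nat \<Rightarrow> 'o \<Rightarrow> 'o \<Rightarrow> 'm" where
  "du_gamma i V W = (if i = 2 \<or> i = 4 then gammal V W else gammar V W)"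

definition du_unit :: "nat \<Rightarrow> 'm" where
  "du_unit i = (if i = 2 \<or> i = 4 then unitl else unitr)"

text \<open>\<open>summand i X V Y\<close> is the functor under the coend, contravariant in \<open>X\<close> and covariant in
  \<open>V\<close> and \<open>Y\<close>.\<close>

definition summand :: "nat \<Rightarrow> 'o \<Rightarrow> 'o \<Rightarrow> 'o \<Rightarrow> 'o" where
  "summand i X V Y = (if i \<le> 2 then du i X \<otimes> (V \<otimes> Y) else (Y \<otimes> V) \<otimes> du i X)"

definition summand_arr :: "nat \<Rightarrow> 'm \<Rightarrow> 'm \<Rightarrow> 'm \<Rightarrow> 'm" where
  "summand_arr i f g h = (if i \<le> 2 then du_arr i f \<boxtimes> (g \<boxtimes> h) else (h \<boxtimes> g) \<boxtimes> du_arr i f)"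

definition dinatural :: "nat \<Rightarrow> 'o \<Rightarrow> 'o \<Rightarrow> ('o \<Rightarrow> 'm) \<Rightarrow> bool" where
  "dinatural i V Z \<phi> \<longleftrightarrow>
     (\<forall>X \<in> objs C. \<phi> X \<in> hom C (summand i X V X) Z) \<and>
     (\<forall>X Y f. f \<in> hom C X Y \<longrightarrow>
        \<phi> X \<cdot> summand_arr i f (ide C V) (ide C X) = \<phi> Y \<cdot> summand_arr i (ide C Y) (ide C V) f)"

definition is_coend :: "nat \<Rightarrow> 'o \<Rightarrow> 'o \<Rightarrow> ('o \<Rightarrow> 'm) \<Rightarrow> bool" where
  "is_coend i V E \<iota> \<longleftrightarrow> E \<in> objs C \<and> dinatural i V E \<iota> \<and>
     (\<forall>Z \<in> objs C. \<forall>\<phi>. dinatural i V Z \<phi> \<longrightarrow>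
        (\<exists>!h. h \<in> hom C E Z \<and> (\<forall>X \<in> objs C. h \<cdot> \<iota> X = \<phi> X)))"

text \<open>Below, \<open>E V\<close> is the coend \<open>A\<^sub>i(V)\<close> and \<open>\<iota> V X\<close> is the component \<open>\<iota>\<^sub>i(V)\<^sub>X\<close> of its universal
  dinatural transformation.\<close>

definition coends :: "nat \<Rightarrow> ('o \<Rightarrow> 'o) \<Rightarrow> ('o \<Rightarrow> 'o \<Rightarrow> 'm) \<Rightarrow> bool" where
  "coends i E \<iota> \<longleftrightarrow> (\<forall>V \<in> objs C. is_coend i V (E V) (\<iota> V))"

text \<open>The arrow out of \<open>E V\<close> determined by its components \<open>\<phi>\<close>.\<close>

definition desc :: "('o \<Rightarrow> 'o) \<Rightarrow> ('o \<Rightarrow> 'o \<Rightarrow> 'm) \<Rightarrow> 'o \<Rightarrow> 'o \<Rightarrow> ('o \<Rightarrow> 'm) \<Rightarrow> 'm" where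
  "desc E \<iota> V Z \<phi> = (THE h. h \<in> hom C (E V) Z \<and> (\<forall>X \<in> objs C. h \<cdot> \<iota> V X = \<phi> X))"

definition A_ar :: "nat \<Rightarrow> ('o \<Rightarrow> 'o) \<Rightarrow> ('o \<Rightarrow> 'o \<Rightarrow> 'm) \<Rightarrow> 'm \<Rightarrow> 'm" where
  "A_ar i E \<iota> f = desc E \<iota> (src C f) (E (tgt C f))
     (\<lambda>X. \<iota> (tgt C f) X \<cdot> summand_arr i (ide C X) f (ide C X))"

text \<open>
  The reassociation, for \<open>X' = du i X\<close> and \<open>Y' = du i Y\<close>,
  \<open>Y' \<otimes> ((X' \<otimes> (V \<otimes> X)) \<otimes> Y) \<rightarrow> (Y' \<otimes> X') \<otimes> (V \<otimes> (X \<otimes> Y))\<close> if \<open>i \<le> 2\<close>, and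
  \<open>(Y \<otimes> ((X \<otimes> V) \<otimes> X')) \<otimes> Y' \<rightarrow> ((Y \<otimes> X) \<otimes> V) \<otimes> (X' \<otimes> Y')\<close> otherwise.
\<close>

definition mult_coh :: "nat \<Rightarrow> 'o \<Rightarrow> 'o \<Rightarrow> 'o \<Rightarrow> 'm" where
  "mult_coh i V X Y = (let X' = du i X; Y' = du i Y in
     if i \<le> 2 then
       inv_arr C (assoc C Y' X' (V \<otimes> (X \<otimes> Y))) \<cdot>
       (ide C Y' \<boxtimes> (ide C X' \<boxtimes> assoc C V X Y)) \<cdot>
       (ide C Y' \<boxtimes> assoc C X' (V \<otimes> X) Y)
     else
       assoc C ((Y \<otimes> X) \<otimes> V) X' Y' \<cdot>
       ((inv_arr C (assoc C Y X V) \<boxtimes> ide C X') \<boxtimes> ide C Y') \<cdot>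
       (inv_arr C (assoc C Y (X \<otimes> V) X') \<boxtimes> ide C Y'))"

text \<open>The component at \<open>(X, Y)\<close>, with \<open>X\<close> inner and \<open>Y\<close> outer, of the multiplication.\<close>

definition mult_comp :: "nat \<Rightarrow> ('o \<Rightarrow> 'o \<Rightarrow> 'm) \<Rightarrow> 'o \<Rightarrow> 'o \<Rightarrow> 'o \<Rightarrow> 'm" where
  "mult_comp i \<iota> V X Y =
     (if i \<le> 2 then
        \<iota> V (X \<otimes> Y) \<cdot> (du_gamma i Y X \<boxtimes> ide C (V \<otimes> (X \<otimes> Y))) \<cdot> mult_coh i V X Y
      else
        \<iota> V (Y \<otimes> X) \<cdot> (ide C ((Y \<otimes> X) \<otimes> V) \<boxtimes> du_gamma i X Y) \<cdot> mult_coh i V X Y)"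

definition A_mult :: "nat \<Rightarrow> ('o \<Rightarrow> 'o) \<Rightarrow> ('o \<Rightarrow> 'o \<Rightarrow> 'm) \<Rightarrow> 'o \<Rightarrow> 'm" where
  "A_mult i E \<iota> V = (THE m. m \<in> hom C (E (E V)) (E V) \<and>
     (\<forall>X \<in> objs C. \<forall>Y \<in> objs C.
        m \<cdot> \<iota> (E V) Y \<cdot> summand_arr i (ide C Y) (\<iota> V X) (ide C Y) = mult_comp i \<iota> V X Y))"

definition A_unit :: "nat \<Rightarrow> ('o \<Rightarrow> 'o \<Rightarrow> 'm) \<Rightarrow> 'o \<Rightarrow> 'm" where
  "A_unit i \<iota> V =
     (if i \<le> 2 then
        \<iota> V \<one> \<cdot> (du_unit i \<boxtimes> ide C (V \<otimes> \<one>)) \<cdot> inv_arr C (lun C (V \<otimes> \<one>)) \<cdot> inv_arr C (run C V)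
      else
        \<iota> V \<one> \<cdot> (ide C (\<one> \<otimes> V) \<boxtimes> du_unit i) \<cdot> inv_arr C (run C (\<one> \<otimes> V)) \<cdot> inv_arr C (lun C V))"

text \<open>\<open>\<one> \<rightarrow> X \<otimes> du i X\<close> if \<open>i \<le> 2\<close>, and \<open>\<one> \<rightarrow> du i X \<otimes> X\<close> otherwise\<close>

definition cup :: "('o \<Rightarrow> 'm) \<Rightarrow> nat \<Rightarrow> 'o \<Rightarrow> 'm" where
  "cup \<delta> i X =
     (if i = 1 then (ide C X \<boxtimes> piv_p \<delta> X) \<cdot> coevl C X
      else if i = 2 then coevl C X
      else if i = 3 then coevr C X
      else (inv_arr C (piv_p \<delta> X) \<boxtimes> ide C X) \<cdot> coevr C X)"

text \<open>\<open>du i X \<otimes> X \<rightarrow> \<one>\<close> if \<open>i \<le> 2\<close>, and \<open>X \<otimes> du i X \<rightarrow> \<one>\<close> otherwise\<close>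

definition cap :: "('o \<Rightarrow> 'm) \<Rightarrow> nat \<Rightarrow> 'o \<Rightarrow> 'm" where
  "cap \<delta> i X =
     (if i = 1 then evl C X \<cdot> (inv_arr C (piv_p \<delta> X) \<boxtimes> ide C X)
      else if i = 2 then evl C X
      else if i = 3 then evr C X
      else evr C X \<cdot> (ide C X \<boxtimes> piv_p \<delta> X))"

text \<open>
  Insertion of \<open>c : \<one> \<rightarrow> P \<otimes> Q\<close> between \<open>U\<close> and \<open>V\<close>, namely \<open>U \<otimes> V \<rightarrow> (U \<otimes> P) \<otimes> (Q \<otimes> V)\<close>.
\<close>

definition insertion :: "'o \<Rightarrow> 'o \<Rightarrow> 'o \<Rightarrow> 'o \<Rightarrow> 'm \<Rightarrow> 'm" where
  "insertion U V P Q c =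
     assoc C (U \<otimes> P) Q V \<cdot> (inv_arr C (assoc C U P Q) \<boxtimes> ide C V) \<cdot>
     ((ide C U \<boxtimes> c) \<boxtimes> ide C V) \<cdot> (inv_arr C (run C U) \<boxtimes> ide C V)"

text \<open>
  With \<open>X' = du i X\<close>:
  \<open>X' \<otimes> ((U \<otimes> V) \<otimes> X) \<rightarrow> (X' \<otimes> (U \<otimes> X)) \<otimes> (X' \<otimes> (V \<otimes> X))\<close> if \<open>i \<le> 2\<close>, and
  \<open>(X \<otimes> (U \<otimes> V)) \<otimes> X' \<rightarrow> ((X \<otimes> U) \<otimes> X') \<otimes> ((X \<otimes> V) \<otimes> X')\<close> otherwise.
\<close>

definition split_summand :: "('o \<Rightarrow> 'm) \<Rightarrow> nat \<Rightarrow> 'o \<Rightarrow> 'o \<Rightarrow> 'o \<Rightarrow> 'm" where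
  "split_summand \<delta> i U V X = (let X' = du i X in
     if i \<le> 2 then
       inv_arr C (assoc C X' (U \<otimes> X) (X' \<otimes> (V \<otimes> X))) \<cdot>
       (ide C X' \<boxtimes> (ide C (U \<otimes> X) \<boxtimes> assoc C X' V X)) \<cdot>
       (ide C X' \<boxtimes> assoc C (U \<otimes> X) (X' \<otimes> V) X) \<cdot>
       (ide C X' \<boxtimes> (insertion U V X X' (cup \<delta> i X) \<boxtimes> ide C X))
     else
       assoc C ((X \<otimes> U) \<otimes> X') (X \<otimes> V) X' \<cdot>
       ((inv_arr C (assoc C X U X') \<boxtimes> ide C (X \<otimes> V)) \<boxtimes> ide C X') \<cdot>
       (inv_arr C (assoc C X (U \<otimes> X') (X \<otimes> V)) \<boxtimes> ide C X') \<cdot>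
       ((ide C X \<boxtimes> insertion U V X' X (cup \<delta> i X)) \<boxtimes> ide C X'))"

definition A_comul ::
    "('o \<Rightarrow> 'm) \<Rightarrow> nat \<Rightarrow> ('o \<Rightarrow> 'o) \<Rightarrow> ('o \<Rightarrow> 'o \<Rightarrow> 'm) \<Rightarrow> 'o \<Rightarrow> 'o \<Rightarrow> 'm" where
  "A_comul \<delta> i E \<iota> U V = desc E \<iota> (U \<otimes> V) (E U \<otimes> E V)
     (\<lambda>X. (\<iota> U X \<boxtimes> \<iota> V X) \<cdot> split_summand \<delta> i U V X)"

definition A_counit :: "('o \<Rightarrow> 'm) \<Rightarrow> nat \<Rightarrow> ('o \<Rightarrow> 'o) \<Rightarrow> ('o \<Rightarrow> 'o \<Rightarrow> 'm) \<Rightarrow> 'm" where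
  "A_counit \<delta> i E \<iota> = desc E \<iota> \<one> \<one>
     (\<lambda>X. if i \<le> 2 then cap \<delta> i X \<cdot> (ide C (du i X) \<boxtimes> lun C X)
          else cap \<delta> i X \<cdot> (run C X \<boxtimes> ide C (du i X)))"

definition central_monad ::
    "('o \<Rightarrow> 'm) \<Rightarrow> nat \<Rightarrow> ('o \<Rightarrow> 'o) \<Rightarrow> ('o \<Rightarrow> 'o \<Rightarrow> 'm) \<Rightarrow> ('o, 'm) bimonad_data" where
  "central_monad \<delta> i E \<iota> =
     \<lparr>m_ob = E,
      m_ar = A_ar i E \<iota>,
      m_mult = A_mult i E \<iota>,
      m_unit = A_unit i \<iota>,
      m_comul = A_comul \<delta> i E \<iota>,
      m_counit = A_counit \<delta> i E \<iota>\<rparr>"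

text \<open>In the remaining definitions, \<open>A i V\<close> is the object \<open>A\<^sub>i(V)\<close> and \<open>\<iota> i V X\<close> is \<open>\<iota>\<^sub>i(V)\<^sub>X\<close>.
  The arrow \<open>kappa_step \<delta> A \<iota> i V\<close> is \<open>(\<kappa>\<^sub>i\<^sub>,\<^sub>i\<^sub>+\<^sub>1)\<^sub>V\<close>.\<close>

definition kappa_step ::
    "('o \<Rightarrow> 'm) \<Rightarrow> (nat \<Rightarrow> 'o \<Rightarrow> 'o) \<Rightarrow> (nat \<Rightarrow> 'o \<Rightarrow> 'o \<Rightarrow> 'm) \<Rightarrow> nat \<Rightarrow> 'o \<Rightarrow> 'm" where
  "kappa_step \<delta> A \<iota> i V = desc (A i) (\<iota> i) V (A (Suc i) V)
     (\<lambda>X. if i = 1 then \<iota> 2 V X \<cdot> (inv_arr C (piv_p \<delta> X) \<boxtimes> ide C (V \<otimes> X))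
          else if i = 2 then
            \<iota> 3 V (ld C X) \<cdot> (ide C (ld C X \<otimes> V) \<boxtimes> nu X) \<cdot> inv_arr C (assoc C (ld C X) V X)
          else \<iota> 4 V X \<cdot> (ide C (X \<otimes> V) \<boxtimes> inv_arr C (piv_p \<delta> X)))"

primrec kappa_up ::
    "('o \<Rightarrow> 'm) \<Rightarrow> (nat \<Rightarrow> 'o \<Rightarrow> 'o) \<Rightarrow> (nat \<Rightarrow> 'o \<Rightarrow> 'o \<Rightarrow> 'm) \<Rightarrow> nat \<Rightarrow> nat \<Rightarrow> 'o \<Rightarrow> 'm" where
  "kappa_up \<delta> A \<iota> i 0 V = ide C (A i V)"
| "kappa_up \<delta> A \<iota> i (Suc n) V = kappa_step \<delta> A \<iota> (i + n) V \<cdot> kappa_up \<delta> A \<iota> i n V"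

definition kappa ::
    "('o \<Rightarrow> 'm) \<Rightarrow> (nat \<Rightarrow> 'o \<Rightarrow> 'o) \<Rightarrow> (nat \<Rightarrow> 'o \<Rightarrow> 'o \<Rightarrow> 'm) \<Rightarrow> nat \<Rightarrow> nat \<Rightarrow> 'o \<Rightarrow> 'm" where
  "kappa \<delta> A \<iota> i j V =
     (if i \<le> j then kappa_up \<delta> A \<iota> i (j - i) V else inv_arr C (kappa_up \<delta> A \<iota> j (i - j) V))"

end

end

theory Submission
  imports Defs
begin

text \<open>
  By duality, a dinatural family \<open>Q\<^sub>X \<otimes> V \<otimes> P\<^sub>X \<rightarrow> Z\<close>, where \<open>Q\<^sub>X\<close> is dual to \<open>P\<^sub>X\<close>, is the same as a
  natural family \<open>V \<otimes> P \<rightarrow> P \<otimes> Z\<close>.  Hence each of the four coends \<open>A\<^sub>i V\<close> carries a universal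
  natural family \<open>d\<^sub>V\<^sub>,\<^sub>P : V \<otimes> P \<rightarrow> P \<otimes> A\<^sub>i V\<close> (the centralizer of the identity functor), and the whole
  Hopf monad structure is characterized by \<open>d\<close> through equations that do not mention \<open>i\<close>: for
  example the multiplication turns \<open>d\<close> applied twice into \<open>d\<close> at a tensor product.  Each \<open>\<kappa>\<^sub>i\<^sub>,\<^sub>j\<close>
  carries the universal family of \<open>A\<^sub>i\<close> to that of \<open>A\<^sub>j\<close>, so it respects the structure.
  Modules over a centralizer are half-braidings, and these are closed under duals because a
  half-braiding on a rigid category is invertible.
\<close>

section \<open>Arrows of a category\<close>

text \<open>The structure maps are defined with all coherence isomorphisms written out, and several
  start at iterated coends; comparing them directly would mix large coherence diagrams with
  dinaturality. The two difficulties are separated. Coherence is absorbed by a full and faithful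
  embedding of C into a strict monoidal category, where mainly the interchange law and the triangle
  identities of dual pairs remain. Dinaturality gives way to naturality of \<open>d\<close> in an
  object P that runs over all of C. For coends whose right-hand letter is a dual, \<open>d\<close>
  is known at first only at such duals; every object is isomorphic to one of them, and this extends
  it. The multiplication starts at \<open>A (A V)\<close>, so the universal property has to survive
  tensoring with further objects on the right; it does because these can be moved to the codomain as
  their duals. A pivotal structure enters through a second pairing of X with its left dual, which
  makes the latter a right dual as well. The naturality and monoidality of this pairing come from
  those of \<delta> and put A_1 and A_4 on the same footing as A_2 and A_3.\<close>

context category
begin

lemma in_hom: "f \<in> hom C X Y \<longleftrightarrow> f \<in> arrs C \<and> src C f = X \<and> tgt C f = Y"
  by (simp add: hom_def)

lemma arr_in_hom: "f \<in> arrs C \<Longrightarrow> f \<in> hom C (src C f) (tgt C f)"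
  by (simp add: in_hom)

lemma cat_simps [simp]:
  "f \<in> arrs C \<Longrightarrow> src C f \<in> objs C"
  "f \<in> arrs C \<Longrightarrow> tgt C f \<in> objs C"
  "X \<in> objs C \<Longrightarrow> ide C X \<in> arrs C"
  "X \<in> objs C \<Longrightarrow> src C (ide C X) = X"
  "X \<in> objs C \<Longrightarrow> tgt C (ide C X) = X"
  "f \<in> arrs C \<Longrightarrow> g \<in> arrs C \<Longrightarrow> src C g = tgt C f \<Longrightarrow> g \<cdot> f \<in> arrs C"
  "f \<in> arrs C \<Longrightarrow> g \<in> arrs C \<Longrightarrow> src C g = tgt C f \<Longrightarrow> src C (g \<cdot> f) = src C f"
  "f \<in> arrs C \<Longrightarrow> g \<in> arrs C \<Longrightarrow> src C g = tgt C f \<Longrightarrow> tgt C (g \<cdot> f) = tgt C g"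
  "f \<in> arrs C \<Longrightarrow> tgt C f = Y \<Longrightarrow> ide C Y \<cdot> f = f"
  "f \<in> arrs C \<Longrightarrow> src C f = X \<Longrightarrow> f \<cdot> ide C X = f"
  "f \<in> arrs C \<Longrightarrow> g \<in> arrs C \<Longrightarrow> h \<in> arrs C \<Longrightarrow> src C g = tgt C f \<Longrightarrow> src C h = tgt C g \<Longrightarrow>
     (h \<cdot> g) \<cdot> f = h \<cdot> g \<cdot> f"
proof -
  show "f \<in> arrs C \<Longrightarrow> tgt C f = Y \<Longrightarrow> ide C Y \<cdot> f = f"
    using cmp_ide_left[OF arr_in_hom] by blast
  show "f \<in> arrs C \<Longrightarrow> src C f = X \<Longrightarrow> f \<cdot> ide C X = f"
    using cmp_ide_right[OF arr_in_hom] by blast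
qed (simp_all add: src_obj tgt_obj ide_hom[unfolded in_hom] cmp_hom[unfolded in_hom]
      cmp_assoc[unfolded in_hom])

lemma inverse_arrows_unique: "inverse_arrows C f g \<Longrightarrow> inverse_arrows C f h \<Longrightarrow> g = h"
proof -
  assume g: "inverse_arrows C f g" and h: "inverse_arrows C f h"
  have "g = g \<cdot> (f \<cdot> h)"
    using g h by (simp add: inverse_arrows_def in_hom)
  also have "\<dots> = (g \<cdot> f) \<cdot> h"
    using g h unfolding inverse_arrows_def in_hom by (intro cat_simps(11)[symmetric]) auto
  also have "\<dots> = h"
    using g h by (simp add: inverse_arrows_def in_hom)
  finally show ?thesis .
qed

lemma inv_arr_eq: "inverse_arrows C f g \<Longrightarrow> inv_arr C f = g"
  unfolding inv_arr_def by (rule the_equality) (auto intro: inverse_arrows_unique)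

lemma inverse_arrows_inv_arr: "iso C f \<Longrightarrow> inverse_arrows C f (inv_arr C f)"
  by (auto simp: iso_def inv_arr_eq)

text \<open>The last two clauses cancel an isomorphism against its inverse inside a right-nested
  composite, where the product of the two is not a subterm of its own.\<close>

lemma inv_arr_simps [simp]:
  assumes "iso C f"
  shows "inv_arr C f \<in> arrs C"
    "src C (inv_arr C f) = tgt C f"
    "tgt C (inv_arr C f) = src C f"
    "inv_arr C f \<cdot> f = ide C (src C f)"
    "f \<cdot> inv_arr C f = ide C (tgt C f)"
    "g \<in> arrs C \<Longrightarrow> tgt C g = src C f \<Longrightarrow> inv_arr C f \<cdot> f \<cdot> g = g"
    "g \<in> arrs C \<Longrightarrow> tgt C g = tgt C f \<Longrightarrow> f \<cdot> inv_arr C f \<cdot> g = g"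
proof -
  note * = inverse_arrows_inv_arr[OF assms, unfolded inverse_arrows_def in_hom]
  show "inv_arr C f \<in> arrs C" "src C (inv_arr C f) = tgt C f" "tgt C (inv_arr C f) = src C f"
    "inv_arr C f \<cdot> f = ide C (src C f)" "f \<cdot> inv_arr C f = ide C (tgt C f)"
    using * by auto
  show "inv_arr C f \<cdot> f \<cdot> g = g" if "g \<in> arrs C" "tgt C g = src C f"
    using * that by (subst cat_simps(11)[symmetric]) auto
  show "f \<cdot> inv_arr C f \<cdot> g = g" if "g \<in> arrs C" "tgt C g = tgt C f"
    using * that by (subst cat_simps(11)[symmetric]) auto
qed

lemma iso_arr: "iso C f \<Longrightarrow> f \<in> arrs C"
  by (auto simp: iso_def inverse_arrows_def)

lemma isoI: "f \<in> hom C X Y \<Longrightarrow> g \<in> hom C Y X \<Longrightarrow> g \<cdot> f = ide C X \<Longrightarrow> f \<cdot> g = ide C Y \<Longrightarrow> iso C f"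
  by (auto simp: iso_def inverse_arrows_def in_hom)

lemma inv_arr_eqI:
  "f \<in> hom C X Y \<Longrightarrow> g \<in> hom C Y X \<Longrightarrow> g \<cdot> f = ide C X \<Longrightarrow> f \<cdot> g = ide C Y \<Longrightarrow> inv_arr C f = g"
  by (rule inv_arr_eq) (auto simp: inverse_arrows_def in_hom)

lemma iso_inv_arr: "iso C f \<Longrightarrow> iso C (inv_arr C f)"
  by (rule isoI[where X = "tgt C f" and Y = "src C f" and g = f])
    (simp_all add: in_hom iso_arr)

lemma inv_arr_inv_arr: "iso C f \<Longrightarrow> inv_arr C (inv_arr C f) = f"
  by (rule inv_arr_eqI[where X = "tgt C f" and Y = "src C f"]) (simp_all add: in_hom iso_arr)

lemma cancel_iso_left:
  assumes "iso C f" "g \<in> arrs C" "h \<in> arrs C" "tgt C g = src C f" "tgt C h = src C f"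
    and "f \<cdot> g = f \<cdot> h"
  shows "g = h"
  using assms(2-) inv_arr_simps(6)[OF assms(1)] by metis

lemma cancel_iso_right:
  assumes "iso C f" "g \<in> arrs C" "h \<in> arrs C" "src C g = tgt C f" "src C h = tgt C f"
    and eq: "g \<cdot> f = h \<cdot> f"
  shows "g = h"
proof -
  have *: "(k \<cdot> f) \<cdot> inv_arr C f = k" if "k \<in> arrs C" "src C k = tgt C f" for k
    using that assms(1) iso_arr[OF assms(1)] by simp
  show ?thesis
    using *[OF assms(2,4)] *[OF assms(3,5)] unfolding eq by (rule trans[OF sym])
qed

end

context monoidal_category
begin

lemma tens_simps [simp]:
  "\<one> \<in> objs C"
  "X \<in> objs C \<Longrightarrow> Y \<in> objs C \<Longrightarrow> X \<otimes> Y \<in> objs C"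
  "f \<in> arrs C \<Longrightarrow> g \<in> arrs C \<Longrightarrow> f \<boxtimes> g \<in> arrs C"
  "f \<in> arrs C \<Longrightarrow> g \<in> arrs C \<Longrightarrow> src C (f \<boxtimes> g) = src C f \<otimes> src C g"
  "f \<in> arrs C \<Longrightarrow> g \<in> arrs C \<Longrightarrow> tgt C (f \<boxtimes> g) = tgt C f \<otimes> tgt C g"
  "X \<in> objs C \<Longrightarrow> Y \<in> objs C \<Longrightarrow> ide C X \<boxtimes> ide C Y = ide C (X \<otimes> Y)"
  by (simp_all add: uno_obj tens_obj tensa_hom[unfolded in_hom] tensa_ide)

lemma coherence_simps [simp]:
  "X \<in> objs C \<Longrightarrow> Y \<in> objs C \<Longrightarrow> Z \<in> objs C \<Longrightarrow> assoc C X Y Z \<in> arrs C"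
  "X \<in> objs C \<Longrightarrow> Y \<in> objs C \<Longrightarrow> Z \<in> objs C \<Longrightarrow> src C (assoc C X Y Z) = (X \<otimes> Y) \<otimes> Z"
  "X \<in> objs C \<Longrightarrow> Y \<in> objs C \<Longrightarrow> Z \<in> objs C \<Longrightarrow> tgt C (assoc C X Y Z) = X \<otimes> (Y \<otimes> Z)"
  "X \<in> objs C \<Longrightarrow> Y \<in> objs C \<Longrightarrow> Z \<in> objs C \<Longrightarrow> iso C (assoc C X Y Z)"
  "X \<in> objs C \<Longrightarrow> lun C X \<in> arrs C"
  "X \<in> objs C \<Longrightarrow> src C (lun C X) = \<one> \<otimes> X"
  "X \<in> objs C \<Longrightarrow> tgt C (lun C X) = X"
  "X \<in> objs C \<Longrightarrow> iso C (lun C X)"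
  "X \<in> objs C \<Longrightarrow> run C X \<in> arrs C"
  "X \<in> objs C \<Longrightarrow> src C (run C X) = X \<otimes> \<one>"
  "X \<in> objs C \<Longrightarrow> tgt C (run C X) = X"
  "X \<in> objs C \<Longrightarrow> iso C (run C X)"
  by (simp_all add: assoc_hom[unfolded in_hom] assoc_iso lun_hom[unfolded in_hom] lun_iso
      run_hom[unfolded in_hom] run_iso)

lemma tensa_cmp:
  "f \<in> arrs C \<Longrightarrow> f' \<in> arrs C \<Longrightarrow> g \<in> arrs C \<Longrightarrow> g' \<in> arrs C \<Longrightarrow> src C f' = tgt C f \<Longrightarrow>
   src C g' = tgt C g \<Longrightarrow> (f' \<boxtimes> g') \<cdot> (f \<boxtimes> g) = (f' \<cdot> f) \<boxtimes> (g' \<cdot> g)"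
  using interchange[of f "src C f" "tgt C f" f' "tgt C f'" g "src C g" "tgt C g" g' "tgt C g'"]
  by (simp add: in_hom)

lemma tensa_cmp_reassoc:
  "f \<in> arrs C \<Longrightarrow> f' \<in> arrs C \<Longrightarrow> g \<in> arrs C \<Longrightarrow> g' \<in> arrs C \<Longrightarrow> src C f' = tgt C f \<Longrightarrow>
   src C g' = tgt C g \<Longrightarrow> h \<in> arrs C \<Longrightarrow> tgt C h = src C f \<otimes> src C g \<Longrightarrow>
   (f' \<boxtimes> g') \<cdot> (f \<boxtimes> g) \<cdot> h = ((f' \<cdot> f) \<boxtimes> (g' \<cdot> g)) \<cdot> h"
  using tensa_cmp[of f f' g g'] cat_simps(11)[of h "f \<boxtimes> g" "f' \<boxtimes> g'"] by simp

lemma assoc_nat: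
  "f \<in> arrs C \<Longrightarrow> g \<in> arrs C \<Longrightarrow> h \<in> arrs C \<Longrightarrow> X' = tgt C f \<Longrightarrow> Y' = tgt C g \<Longrightarrow> Z' = tgt C h \<Longrightarrow>
   assoc C X' Y' Z' \<cdot> ((f \<boxtimes> g) \<boxtimes> h) = (f \<boxtimes> (g \<boxtimes> h)) \<cdot> assoc C (src C f) (src C g) (src C h)"
  by (simp add: assoc_natural[OF arr_in_hom arr_in_hom arr_in_hom])

lemma iso_tensa [simp]:
  assumes "iso C f" "iso C g"
  shows "iso C (f \<boxtimes> g)"
  using assms iso_arr[of f] iso_arr[of g]
  by (intro isoI[of _ "src C f \<otimes> src C g" "tgt C f \<otimes> tgt C g" "inv_arr C f \<boxtimes> inv_arr C g"])
    (auto simp: in_hom tensa_cmp)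

lemma inv_arr_tensa:
  assumes "iso C f" "iso C g"
  shows "inv_arr C (f \<boxtimes> g) = inv_arr C f \<boxtimes> inv_arr C g"
  using assms iso_arr[of f] iso_arr[of g]
  by (intro inv_arr_eqI[of _ "src C f \<otimes> src C g" "tgt C f \<otimes> tgt C g"])
    (auto simp: in_hom tensa_cmp)

lemma iso_ide [simp]: "X \<in> objs C \<Longrightarrow> iso C (ide C X)"
  by (rule isoI[of _ X X "ide C X"]) (auto simp: in_hom)

text \<open>\<open>lun\<close> is a natural isomorphism from tensoring with \<one> on the left to
  the identity functor, hence that functor is faithful.\<close>

lemma ide_uno_tensa_inject:
  assumes "f \<in> hom C X Y" "g \<in> hom C X Y" "ide C \<one> \<boxtimes> f = ide C \<one> \<boxtimes> g"
  shows "f = g"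
proof -
  have "f \<cdot> lun C X = g \<cdot> lun C X"
    using assms lun_natural[of f X Y] lun_natural[of g X Y] by simp
  moreover have "X \<in> objs C" using assms(1) by (auto simp: in_hom)
  ultimately show ?thesis
    using assms(1,2) cancel_iso_right[of "lun C X" f g] by (simp add: in_hom)
qed

lemma tensa_ide_uno_inject:
  assumes "f \<in> hom C X Y" "g \<in> hom C X Y" "f \<boxtimes> ide C \<one> = g \<boxtimes> ide C \<one>"
  shows "f = g"
proof -
  have "f \<cdot> run C X = g \<cdot> run C X"
    using assms run_natural[of f X Y] run_natural[of g X Y] by simp
  moreover have "X \<in> objs C" using assms(1) by (auto simp: in_hom)
  ultimately show ?thesis
    using assms(1,2) cancel_iso_right[of "run C X" f g] by (simp add: in_hom)
qed

text \<open>Kelly's redundancy of the left unit axiom: \<open>\<one> \<otimes> -\<close> of both sides agree by the pentagon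
  with \<open>\<one>\<close> in the first two places and the triangle.\<close>

lemma lun_tens:
  assumes X: "X \<in> objs C" and Y: "Y \<in> objs C"
  shows "lun C (X \<otimes> Y) \<cdot> assoc C \<one> X Y = lun C X \<boxtimes> ide C Y"
proof (rule ide_uno_tensa_inject[of _ "(\<one> \<otimes> X) \<otimes> Y" "X \<otimes> Y"])
  let ?p = "assoc C \<one> (\<one> \<otimes> X) Y \<cdot> (assoc C \<one> \<one> X \<boxtimes> ide C Y)"
  have iso: "iso C ?p"
    using X Y by (intro isoI[of _ "((\<one> \<otimes> \<one>) \<otimes> X) \<otimes> Y" "\<one> \<otimes> ((\<one> \<otimes> X) \<otimes> Y)"
        "(inv_arr C (assoc C \<one> \<one> X) \<boxtimes> ide C Y) \<cdot> inv_arr C (assoc C \<one> (\<one> \<otimes> X) Y)"])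
      (simp_all add: in_hom tensa_cmp tensa_cmp_reassoc)
  have "(ide C \<one> \<boxtimes> (lun C (X \<otimes> Y) \<cdot> assoc C \<one> X Y)) \<cdot> ?p
      = (ide C \<one> \<boxtimes> lun C (X \<otimes> Y)) \<cdot> (ide C \<one> \<boxtimes> assoc C \<one> X Y) \<cdot> ?p"
    using X Y by (simp add: tensa_cmp_reassoc)
  also have "\<dots> = (ide C \<one> \<boxtimes> lun C (X \<otimes> Y)) \<cdot> assoc C \<one> \<one> (X \<otimes> Y) \<cdot> assoc C (\<one> \<otimes> \<one>) X Y"
    using X Y by (simp add: pentagon)
  also have "\<dots> = (run C \<one> \<boxtimes> ide C (X \<otimes> Y)) \<cdot> assoc C (\<one> \<otimes> \<one>) X Y"
    using X Y triangle[of \<one> "X \<otimes> Y"]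
    by (subst cat_simps(11)[symmetric]) simp_all
  also have "\<dots> = assoc C \<one> X Y \<cdot> ((run C \<one> \<boxtimes> ide C X) \<boxtimes> ide C Y)"
    using X Y assoc_nat[of "run C \<one>" "ide C X" "ide C Y" \<one> X Y] by simp
  also have "\<dots> = assoc C \<one> X Y \<cdot> ((ide C \<one> \<boxtimes> lun C X) \<boxtimes> ide C Y) \<cdot> (assoc C \<one> \<one> X \<boxtimes> ide C Y)"
    using X Y triangle[of \<one> X] by (simp add: tensa_cmp)
  also have "\<dots> = (ide C \<one> \<boxtimes> (lun C X \<boxtimes> ide C Y)) \<cdot> ?p"
    using X Y assoc_nat[of "ide C \<one>" "lun C X" "ide C Y" \<one> X Y]
    by (subst cat_simps(11)[symmetric]) simp_all
  finally show "ide C \<one> \<boxtimes> (lun C (X \<otimes> Y) \<cdot> assoc C \<one> X Y) = ide C \<one> \<boxtimes> (lun C X \<boxtimes> ide C Y)"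
    by (rule cancel_iso_right[OF iso, rotated -1]) (use X Y in simp_all)
qed (use X Y in \<open>simp_all add: in_hom\<close>)

end

section \<open>A strict calculus for a monoidal category\<close>

text \<open>
  An object word \<open>xs = [X\<^sub>1, \<dots>, X\<^sub>n]\<close> acts on \<open>C\<close> by \<open>Z \<mapsto> X\<^sub>1 \<otimes> (\<dots> \<otimes> (X\<^sub>n \<otimes> Z))\<close>.  A strict arrow
  \<open>xs \<rightarrow> ys\<close> is a natural transformation between these functors that is compatible with the right
  action of \<open>C\<close> on itself.  Composition of functors being strictly associative, this is a strict
  monoidal category, and \<open>X \<mapsto> [X]\<close> embeds \<open>C\<close> into it.  An undefined composite is \<open>None\<close>, which
  makes the associativity and whiskering laws unconditional rewrite rules.
\<close>

type_synonym ('o, 'm) sarrow = "('o list \<times> 'o list \<times> ('o \<Rightarrow> 'm)) option"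

context monoidal_category
begin

section \<open>Words of objects acting by tensoring from the left\<close>

primrec act :: "'a list \<Rightarrow> 'a \<Rightarrow> 'a" where
  "act [] Z = Z"
| "act (X # xs) Z = X \<otimes> act xs Z"

primrec act_arr :: "'a list \<Rightarrow> 'b \<Rightarrow> 'b" where
  "act_arr [] f = f"
| "act_arr (X # xs) f = ide C X \<boxtimes> act_arr xs f"

text \<open>The canonical isomorphism from \<open>act xs Z \<otimes> W\<close> to
  \<open>act xs (Z \<otimes> W)\<close>, built from associators. It is the structure that makes
  \<open>act xs\<close> a functor of right C-modules.\<close>

primrec act_assoc :: "'a list \<Rightarrow> 'a \<Rightarrow> 'a \<Rightarrow> 'b" where
  "act_assoc [] Z W = ide C (Z \<otimes> W)"
| "act_assoc (X # xs) Z W = (ide C X \<boxtimes> act_assoc xs Z W) \<cdot> assoc C X (act xs Z) W"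

lemma act_append [simp]: "act (xs @ ys) Z = act xs (act ys Z)"
  by (induction xs) simp_all

lemma act_arr_append [simp]: "act_arr (xs @ ys) f = act_arr xs (act_arr ys f)"
  by (induction xs) simp_all

lemma act_obj [simp]: "set xs \<subseteq> objs C \<Longrightarrow> Z \<in> objs C \<Longrightarrow> act xs Z \<in> objs C"
  by (induction xs) simp_all

lemma act_arr_arr:
  "set xs \<subseteq> objs C \<Longrightarrow> f \<in> arrs C \<Longrightarrow>
   act_arr xs f \<in> arrs C \<and> src C (act_arr xs f) = act xs (src C f) \<and>
   tgt C (act_arr xs f) = act xs (tgt C f)"
  by (induction xs) simp_all

lemma act_arr_simps [simp]:
  assumes "set xs \<subseteq> objs C" "f \<in> arrs C"
  shows "act_arr xs f \<in> arrs C" "src C (act_arr xs f) = act xs (src C f)"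
    "tgt C (act_arr xs f) = act xs (tgt C f)"
  using act_arr_arr[OF assms] by auto

lemma act_assoc_arr:
  "set xs \<subseteq> objs C \<Longrightarrow> Z \<in> objs C \<Longrightarrow> W \<in> objs C \<Longrightarrow>
   act_assoc xs Z W \<in> arrs C \<and> src C (act_assoc xs Z W) = act xs Z \<otimes> W \<and>
   tgt C (act_assoc xs Z W) = act xs (Z \<otimes> W)"
  by (induction xs) simp_all

lemma act_assoc_simps [simp]:
  assumes "set xs \<subseteq> objs C" "Z \<in> objs C" "W \<in> objs C"
  shows "act_assoc xs Z W \<in> arrs C" "src C (act_assoc xs Z W) = act xs Z \<otimes> W"
    "tgt C (act_assoc xs Z W) = act xs (Z \<otimes> W)"
  using act_assoc_arr[OF assms] by auto

lemma act_assoc_append: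
  "set xs \<subseteq> objs C \<Longrightarrow> set ys \<subseteq> objs C \<Longrightarrow> Z \<in> objs C \<Longrightarrow> W \<in> objs C \<Longrightarrow>
   act_assoc (xs @ ys) Z W = act_arr xs (act_assoc ys Z W) \<cdot> act_assoc xs (act ys Z) W"
proof (induction xs)
  case (Cons X xs)
  then show ?case
    by (simp add: tensa_cmp_reassoc)
qed simp

section \<open>Module natural transformations as strict arrows\<close>

definition family :: "'a list \<Rightarrow> 'a list \<Rightarrow> ('a \<Rightarrow> 'b) \<Rightarrow> bool" where
  "family xs ys F \<longleftrightarrow> set xs \<subseteq> objs C \<and> set ys \<subseteq> objs C \<and>
     (\<forall>Z \<in> objs C. F Z \<in> hom C (act xs Z) (act ys Z)) \<and>
     (\<forall>f \<in> arrs C. F (tgt C f) \<cdot> act_arr xs f = act_arr ys f \<cdot> F (src C f)) \<and>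
     (\<forall>Z \<in> objs C. \<forall>W \<in> objs C.
        F (Z \<otimes> W) \<cdot> act_assoc xs Z W = act_assoc ys Z W \<cdot> (F Z \<boxtimes> ide C W))"

text \<open>Components outside the objects of C are set to \<open>undefined\<close>, so that
  equality of strict arrows is equality of domain, codomain and components at objects. A family that
  violates naturality or the action condition yields \<open>None\<close>.\<close>

definition mk :: "'a list \<Rightarrow> 'a list \<Rightarrow> ('a \<Rightarrow> 'b) \<Rightarrow> ('a, 'b) sarrow" where
  "mk xs ys F = (if family xs ys F
     then Some (xs, ys, \<lambda>Z. if Z \<in> objs C then F Z else undefined) else None)"

definition sarr :: "('a, 'b) sarrow \<Rightarrow> bool" where
  "sarr A \<longleftrightarrow> (\<exists>xs ys F. A = mk xs ys F \<and> family xs ys F)"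

definition sdom :: "('a, 'b) sarrow \<Rightarrow> 'a list" where
  "sdom A = fst (the A)"

definition scod :: "('a, 'b) sarrow \<Rightarrow> 'a list" where
  "scod A = fst (snd (the A))"

definition cpt :: "('a, 'b) sarrow \<Rightarrow> 'a \<Rightarrow> 'b" where
  "cpt A = snd (snd (the A))"

definition scmp :: "('a, 'b) sarrow \<Rightarrow> ('a, 'b) sarrow \<Rightarrow> ('a, 'b) sarrow" (infixr "\<bullet>" 55) where
  "B \<bullet> A = (if sarr A \<and> sarr B \<and> sdom B = scod A
     then mk (sdom A) (scod B) (\<lambda>Z. cpt B Z \<cdot> cpt A Z) else None)"

definition lwhisk :: "'a \<Rightarrow> ('a, 'b) sarrow \<Rightarrow> ('a, 'b) sarrow" (infixr "\<rhd>" 63) where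
  "X \<rhd> A = (if X \<in> objs C \<and> sarr A
     then mk (X # sdom A) (X # scod A) (\<lambda>Z. ide C X \<boxtimes> cpt A Z) else None)"

text \<open>Tensoring with \<open>zs\<close> on the right is precomposition with the functor
  \<open>act zs\<close>, so it merely re-indexes components. This is why whole words can be attached
  on the right at once and why no associator appears.\<close>

definition rwhisk :: "('a, 'b) sarrow \<Rightarrow> 'a list \<Rightarrow> ('a, 'b) sarrow" (infixl "\<lhd>" 64) where
  "A \<lhd> zs = (if set zs \<subseteq> objs C \<and> sarr A
     then mk (sdom A @ zs) (scod A @ zs) (\<lambda>Z. cpt A (act zs Z)) else None)"

definition sid :: "'a list \<Rightarrow> ('a, 'b) sarrow" where
  "sid xs = mk xs xs (\<lambda>Z. ide C (act xs Z))"

definition J :: "'b \<Rightarrow> ('a, 'b) sarrow" where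
  "J f = (if f \<in> arrs C then mk [src C f] [tgt C f] (\<lambda>Z. f \<boxtimes> ide C Z) else None)"

text \<open>The strong monoidal structure of the embedding \<open>X \<mapsto> [X]\<close> and its inverse.\<close>

definition pack :: "'a \<Rightarrow> 'a \<Rightarrow> ('a, 'b) sarrow" where
  "pack X Y = mk [X, Y] [X \<otimes> Y] (\<lambda>Z. inv_arr C (assoc C X Y Z))"

definition unpack :: "'a \<Rightarrow> 'a \<Rightarrow> ('a, 'b) sarrow" where
  "unpack X Y = mk [X \<otimes> Y] [X, Y] (\<lambda>Z. assoc C X Y Z)"

definition pack0 :: "('a, 'b) sarrow" where
  "pack0 = mk [] [\<one>] (\<lambda>Z. inv_arr C (lun C Z))"

definition unpack0 :: "('a, 'b) sarrow" where
  "unpack0 = mk [\<one>] [] (\<lambda>Z. lun C Z)"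

lemma mk_simps [simp]:
  assumes "family xs ys F"
  shows "sarr (mk xs ys F)" "sdom (mk xs ys F) = xs" "scod (mk xs ys F) = ys"
    "Z \<in> objs C \<Longrightarrow> cpt (mk xs ys F) Z = F Z"
  using assms unfolding sarr_def by (auto simp: mk_def sdom_def scod_def cpt_def)

lemma not_sarr_None [simp]: "\<not> sarr None"
  by (auto simp: sarr_def mk_def)

lemma familyD:
  assumes "family xs ys F"
  shows "set xs \<subseteq> objs C" "set ys \<subseteq> objs C"
    "Z \<in> objs C \<Longrightarrow> F Z \<in> arrs C" "Z \<in> objs C \<Longrightarrow> src C (F Z) = act xs Z"
    "Z \<in> objs C \<Longrightarrow> tgt C (F Z) = act ys Z"
    "f \<in> arrs C \<Longrightarrow> F (tgt C f) \<cdot> act_arr xs f = act_arr ys f \<cdot> F (src C f)"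
    "Z \<in> objs C \<Longrightarrow> W \<in> objs C \<Longrightarrow>
       F (Z \<otimes> W) \<cdot> act_assoc xs Z W = act_assoc ys Z W \<cdot> (F Z \<boxtimes> ide C W)"
  using assms unfolding family_def in_hom by auto

lemma familyI:
  assumes "set xs \<subseteq> objs C" "set ys \<subseteq> objs C"
    and "\<And>Z. Z \<in> objs C \<Longrightarrow> F Z \<in> arrs C \<and> src C (F Z) = act xs Z \<and> tgt C (F Z) = act ys Z"
    and "\<And>f. f \<in> arrs C \<Longrightarrow> F (tgt C f) \<cdot> act_arr xs f = act_arr ys f \<cdot> F (src C f)"
    and "\<And>Z W. Z \<in> objs C \<Longrightarrow> W \<in> objs C \<Longrightarrow>
       F (Z \<otimes> W) \<cdot> act_assoc xs Z W = act_assoc ys Z W \<cdot> (F Z \<boxtimes> ide C W)"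
  shows "family xs ys F"
  using assms unfolding family_def in_hom by auto

lemma family_cpt:
  assumes "sarr A" "sdom A = xs" "scod A = ys"
  shows "family xs ys (cpt A)"
proof -
  obtain F where F: "A = mk xs ys F" "family xs ys F"
    using assms by (auto simp: sarr_def)
  then show ?thesis
    by (simp add: family_def in_hom)
qed

lemma sarr_eqI:
  assumes "sarr A" "sarr B" "sdom A = sdom B" "scod A = scod B"
    and "\<And>Z. Z \<in> objs C \<Longrightarrow> cpt A Z = cpt B Z"
  shows "A = B"
proof -
  have "S = Some (sdom S, scod S, \<lambda>Z. if Z \<in> objs C then cpt S Z else undefined)"
    if "sarr S" for S
    using that by (auto simp: sarr_def mk_def sdom_def scod_def cpt_def fun_eq_iff)
  note * = this
  have "A = Some (sdom A, scod A, \<lambda>Z. if Z \<in> objs C then cpt A Z else undefined)"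
    by (rule *[OF assms(1)])
  also have "\<dots> = Some (sdom B, scod B, \<lambda>Z. if Z \<in> objs C then cpt B Z else undefined)"
    using assms(3-5) by auto
  also have "\<dots> = B"
    by (rule *[OF assms(2), symmetric])
  finally show ?thesis .
qed

lemmas sarr_cpt [simp] = familyD(1-5)[OF family_cpt[OF _ refl refl]]
lemmas cpt_natural = familyD(6)[OF family_cpt[OF _ refl refl]]
lemmas cpt_module = familyD(7)[OF family_cpt[OF _ refl refl]]

lemma family_scmp:
  assumes "family xs ys F" "family ys zs G"
  shows "family xs zs (\<lambda>Z. G Z \<cdot> F Z)"
proof -
  note F = familyD[OF assms(1)] and G = familyD[OF assms(2)]
  show ?thesis
  proof (rule familyI)
    fix f assume f: "f \<in> arrs C"
    have "(G (tgt C f) \<cdot> F (tgt C f)) \<cdot> act_arr xs f = G (tgt C f) \<cdot> act_arr ys f \<cdot> F (src C f)"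
      using f F G by simp
    also have "\<dots> = (G (tgt C f) \<cdot> act_arr ys f) \<cdot> F (src C f)"
      using f F(1-5) G(1-5) by simp
    also have "\<dots> = act_arr zs f \<cdot> G (src C f) \<cdot> F (src C f)"
      using f F(1-5) G by simp
    finally show "(G (tgt C f) \<cdot> F (tgt C f)) \<cdot> act_arr xs f = act_arr zs f \<cdot> G (src C f) \<cdot> F (src C f)" .
  next
    fix Z W assume ZW: "Z \<in> objs C" "W \<in> objs C"
    have "(G (Z \<otimes> W) \<cdot> F (Z \<otimes> W)) \<cdot> act_assoc xs Z W
        = G (Z \<otimes> W) \<cdot> act_assoc ys Z W \<cdot> (F Z \<boxtimes> ide C W)"
      using ZW F G by simp
    also have "\<dots> = (G (Z \<otimes> W) \<cdot> act_assoc ys Z W) \<cdot> (F Z \<boxtimes> ide C W)"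
      using ZW F(1-5) G(1-5) by simp
    also have "\<dots> = act_assoc zs Z W \<cdot> (G Z \<boxtimes> ide C W) \<cdot> (F Z \<boxtimes> ide C W)"
      using ZW F(1-5) G by simp
    finally show "(G (Z \<otimes> W) \<cdot> F (Z \<otimes> W)) \<cdot> act_assoc xs Z W
        = act_assoc zs Z W \<cdot> ((G Z \<cdot> F Z) \<boxtimes> ide C W)"
      using ZW F(1-5) G(1-5) by (simp add: tensa_cmp)
  qed (use F(1-5) G(1-5) in auto)
qed

lemma family_lwhisk:
  assumes X: "X \<in> objs C" and "family xs ys F"
  shows "family (X # xs) (X # ys) (\<lambda>Z. ide C X \<boxtimes> F Z)"
proof -
  note F = familyD[OF assms(2)]
  show ?thesis
  proof (rule familyI)
    fix f assume "f \<in> arrs C"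
    then show "(ide C X \<boxtimes> F (tgt C f)) \<cdot> act_arr (X # xs) f = act_arr (X # ys) f \<cdot> (ide C X \<boxtimes> F (src C f))"
      using X F by (simp add: tensa_cmp)
  next
    fix Z W assume ZW: "Z \<in> objs C" "W \<in> objs C"
    have "(ide C X \<boxtimes> F (Z \<otimes> W)) \<cdot> act_assoc (X # xs) Z W
        = (ide C X \<boxtimes> (F (Z \<otimes> W) \<cdot> act_assoc xs Z W)) \<cdot> assoc C X (act xs Z) W"
      using ZW X F(1-5) by (simp add: tensa_cmp_reassoc)
    also have "\<dots> = (ide C X \<boxtimes> (act_assoc ys Z W \<cdot> (F Z \<boxtimes> ide C W))) \<cdot> assoc C X (act xs Z) W"
      using ZW F by simp
    also have "\<dots> = (ide C X \<boxtimes> act_assoc ys Z W) \<cdot> (ide C X \<boxtimes> (F Z \<boxtimes> ide C W)) \<cdot> assoc C X (act xs Z) W"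
      using ZW X F(1-5) by (simp add: tensa_cmp_reassoc)
    also have "(ide C X \<boxtimes> (F Z \<boxtimes> ide C W)) \<cdot> assoc C X (act xs Z) W
        = assoc C X (act ys Z) W \<cdot> ((ide C X \<boxtimes> F Z) \<boxtimes> ide C W)"
      using ZW X F(1-5) assoc_nat[of "ide C X" "F Z" "ide C W" X "act ys Z" W] by simp
    finally show "(ide C X \<boxtimes> F (Z \<otimes> W)) \<cdot> act_assoc (X # xs) Z W
        = act_assoc (X # ys) Z W \<cdot> ((ide C X \<boxtimes> F Z) \<boxtimes> ide C W)"
      using ZW X F(1-5) by simp
  qed (use X F(1-5) in auto)
qed

text \<open>For the action condition, \<open>act_assoc_append\<close> splits the canonical
  isomorphism of \<open>xs @ zs\<close>: naturality of \<open>F\<close> along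
  \<open>act_assoc zs Z W\<close> takes care of one factor, the action condition of \<open>F\<close>
  at \<open>act zs Z\<close> of the other.\<close>

lemma family_rwhisk:
  assumes zs: "set zs \<subseteq> objs C" and "family xs ys F"
  shows "family (xs @ zs) (ys @ zs) (\<lambda>Z. F (act zs Z))"
proof -
  note F = familyD[OF assms(2)]
  show ?thesis
  proof (rule familyI)
    fix f assume "f \<in> arrs C"
    then show "F (act zs (tgt C f)) \<cdot> act_arr (xs @ zs) f = act_arr (ys @ zs) f \<cdot> F (act zs (src C f))"
      using zs F(6)[of "act_arr zs f"] by simp
  next
    fix Z W assume ZW: "Z \<in> objs C" "W \<in> objs C"
    have "F (act zs (Z \<otimes> W)) \<cdot> act_assoc (xs @ zs) Z W
        = (F (act zs (Z \<otimes> W)) \<cdot> act_arr xs (act_assoc zs Z W)) \<cdot> act_assoc xs (act zs Z) W"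
      using ZW zs F(1-5) by (simp add: act_assoc_append)
    also have "\<dots> = act_arr ys (act_assoc zs Z W) \<cdot> F (act zs Z \<otimes> W) \<cdot> act_assoc xs (act zs Z) W"
      using ZW zs F(1-5) F(6)[of "act_assoc zs Z W"] by simp
    also have "\<dots> = act_assoc (ys @ zs) Z W \<cdot> (F (act zs Z) \<boxtimes> ide C W)"
      using ZW zs F by (simp add: act_assoc_append)
    finally show "F (act zs (Z \<otimes> W)) \<cdot> act_assoc (xs @ zs) Z W
        = act_assoc (ys @ zs) Z W \<cdot> (F (act zs Z) \<boxtimes> ide C W)" .
  qed (use zs F(1-5) in auto)
qed

lemma family_inv:
  assumes "family xs ys F" and iso: "\<And>Z. Z \<in> objs C \<Longrightarrow> iso C (F Z)"
  shows "family ys xs (\<lambda>Z. inv_arr C (F Z))"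
proof -
  note F = familyD[OF assms(1)]
  show ?thesis
  proof (rule familyI)
    fix f assume f: "f \<in> arrs C"
    show "inv_arr C (F (tgt C f)) \<cdot> act_arr ys f = act_arr xs f \<cdot> inv_arr C (F (src C f))"
    proof (rule cancel_iso_left[OF iso[of "tgt C f"]])
      show "F (tgt C f) \<cdot> inv_arr C (F (tgt C f)) \<cdot> act_arr ys f
          = F (tgt C f) \<cdot> act_arr xs f \<cdot> inv_arr C (F (src C f))"
        using f F(1-5) iso F(6)[OF f]
          cat_simps(11)[of "inv_arr C (F (src C f))" "act_arr xs f" "F (tgt C f)"]
        by simp
    qed (use f F(1-5) iso in simp_all)
  next
    fix Z W assume ZW: "Z \<in> objs C" "W \<in> objs C"
    show "inv_arr C (F (Z \<otimes> W)) \<cdot> act_assoc ys Z W = act_assoc xs Z W \<cdot> (inv_arr C (F Z) \<boxtimes> ide C W)"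
    proof (rule cancel_iso_left[OF iso[of "Z \<otimes> W"]])
      show "F (Z \<otimes> W) \<cdot> inv_arr C (F (Z \<otimes> W)) \<cdot> act_assoc ys Z W
          = F (Z \<otimes> W) \<cdot> act_assoc xs Z W \<cdot> (inv_arr C (F Z) \<boxtimes> ide C W)"
        using ZW F(1-5) iso F(7)[OF ZW]
          cat_simps(11)[of "inv_arr C (F Z) \<boxtimes> ide C W" "act_assoc xs Z W" "F (Z \<otimes> W)"]
        by (simp add: tensa_cmp)
    qed (use ZW F(1-5) iso in simp_all)
  qed (use F(1-5) iso in auto)
qed

lemma family_sid: "set xs \<subseteq> objs C \<Longrightarrow> family xs xs (\<lambda>Z. ide C (act xs Z))"
  by (rule familyI) simp_all

lemma family_J: "f \<in> arrs C \<Longrightarrow> family [src C f] [tgt C f] (\<lambda>Z. f \<boxtimes> ide C Z)"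
  by (rule familyI)
    (simp_all add: tensa_cmp assoc_nat[of f "ide C Z" "ide C W" for Z W, simplified])

text \<open>The action condition for the associator is the pentagon; naturality is that of
  \<open>assoc\<close> in its third argument.\<close>

lemma family_unpack: "X \<in> objs C \<Longrightarrow> Y \<in> objs C \<Longrightarrow> family [X \<otimes> Y] [X, Y] (\<lambda>Z. assoc C X Y Z)"
proof (rule familyI)
  fix f assume "X \<in> objs C" "Y \<in> objs C" "f \<in> arrs C"
  then show "assoc C X Y (tgt C f) \<cdot> act_arr [X \<otimes> Y] f = act_arr [X, Y] f \<cdot> assoc C X Y (src C f)"
    using assoc_nat[of "ide C X" "ide C Y" f X Y "tgt C f"] by simp
qed (simp_all add: pentagon[symmetric])

text \<open>The action condition for the left unitor is the unit coherence
  \<open>lun_tens\<close>.\<close>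

lemma family_unpack0: "family [\<one>] [] (\<lambda>Z. lun C Z)"
  by (rule familyI) (simp_all add: lun_natural[OF arr_in_hom] lun_tens)

lemma family_pack:
  "X \<in> objs C \<Longrightarrow> Y \<in> objs C \<Longrightarrow> family [X, Y] [X \<otimes> Y] (\<lambda>Z. inv_arr C (assoc C X Y Z))"
  by (rule family_inv[OF family_unpack]) simp_all

lemma family_pack0: "family [] [\<one>] (\<lambda>Z. inv_arr C (lun C Z))"
  by (rule family_inv[OF family_unpack0]) simp_all

lemma family_of_sarr:
  "sarr A \<Longrightarrow> sarr B \<Longrightarrow> sdom B = scod A \<Longrightarrow> family (sdom A) (scod B) (\<lambda>Z. cpt B Z \<cdot> cpt A Z)"
  "X \<in> objs C \<Longrightarrow> sarr A \<Longrightarrow> family (X # sdom A) (X # scod A) (\<lambda>Z. ide C X \<boxtimes> cpt A Z)"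
  "set zs \<subseteq> objs C \<Longrightarrow> sarr A \<Longrightarrow> family (sdom A @ zs) (scod A @ zs) (\<lambda>Z. cpt A (act zs Z))"
  by (rule family_scmp[OF family_cpt[OF _ refl refl] family_cpt[OF _ _ refl]]; assumption)
    (rule family_lwhisk[OF _ family_cpt[OF _ refl refl]] family_rwhisk[OF _ family_cpt[OF _ refl refl]];
     assumption)+

lemma sarr_scmp [simp]: "sarr (B \<bullet> A) \<longleftrightarrow> sarr A \<and> sarr B \<and> sdom B = scod A"
  by (auto simp: scmp_def family_of_sarr)

lemma scmp_simps [simp]:
  assumes "sarr A" "sarr B" "sdom B = scod A"
  shows "sdom (B \<bullet> A) = sdom A" "scod (B \<bullet> A) = scod B"
    "Z \<in> objs C \<Longrightarrow> cpt (B \<bullet> A) Z = cpt B Z \<cdot> cpt A Z"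
  using assms family_of_sarr(1)[OF assms] by (simp_all add: scmp_def)

lemma sarr_lwhisk [simp]: "sarr (X \<rhd> A) \<longleftrightarrow> X \<in> objs C \<and> sarr A"
  by (auto simp: lwhisk_def family_of_sarr)

lemma lwhisk_simps [simp]:
  assumes "X \<in> objs C" "sarr A"
  shows "sdom (X \<rhd> A) = X # sdom A" "scod (X \<rhd> A) = X # scod A"
    "Z \<in> objs C \<Longrightarrow> cpt (X \<rhd> A) Z = ide C X \<boxtimes> cpt A Z"
  using assms family_of_sarr(2)[OF assms] by (simp_all add: lwhisk_def)

lemma sarr_rwhisk [simp]: "sarr (A \<lhd> zs) \<longleftrightarrow> set zs \<subseteq> objs C \<and> sarr A"
  by (auto simp: rwhisk_def family_of_sarr)

lemma rwhisk_simps [simp]: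
  assumes "set zs \<subseteq> objs C" "sarr A"
  shows "sdom (A \<lhd> zs) = sdom A @ zs" "scod (A \<lhd> zs) = scod A @ zs"
    "Z \<in> objs C \<Longrightarrow> cpt (A \<lhd> zs) Z = cpt A (act zs Z)"
  using assms family_of_sarr(3)[OF assms] by (simp_all add: rwhisk_def)

lemma sid_simps [simp]:
  "sarr (sid xs) \<longleftrightarrow> set xs \<subseteq> objs C"
  "set xs \<subseteq> objs C \<Longrightarrow> sdom (sid xs) = xs"
  "set xs \<subseteq> objs C \<Longrightarrow> scod (sid xs) = xs"
  "set xs \<subseteq> objs C \<Longrightarrow> Z \<in> objs C \<Longrightarrow> cpt (sid xs) Z = ide C (act xs Z)"
proof -
  show "sarr (sid xs) \<longleftrightarrow> set xs \<subseteq> objs C"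
  proof
    assume "sarr (sid xs)"
    then have "family xs xs (\<lambda>Z. ide C (act xs Z))"
      by (auto simp: sid_def mk_def split: if_splits)
    then show "set xs \<subseteq> objs C" by (rule familyD(1))
  qed (simp add: sid_def family_sid)
qed (simp_all add: sid_def family_sid)

lemma J_simps [simp]:
  "sarr (J f) \<longleftrightarrow> f \<in> arrs C"
  "f \<in> arrs C \<Longrightarrow> sdom (J f) = [src C f]"
  "f \<in> arrs C \<Longrightarrow> scod (J f) = [tgt C f]"
  "f \<in> arrs C \<Longrightarrow> Z \<in> objs C \<Longrightarrow> cpt (J f) Z = f \<boxtimes> ide C Z"
  by (simp_all add: J_def family_J)

lemma pack_simps [simp]:
  assumes "X \<in> objs C" "Y \<in> objs C"
  shows "sarr (pack X Y)" "sdom (pack X Y) = [X, Y]" "scod (pack X Y) = [X \<otimes> Y]"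
    "Z \<in> objs C \<Longrightarrow> cpt (pack X Y) Z = inv_arr C (assoc C X Y Z)"
    "sarr (unpack X Y)" "sdom (unpack X Y) = [X \<otimes> Y]" "scod (unpack X Y) = [X, Y]"
    "Z \<in> objs C \<Longrightarrow> cpt (unpack X Y) Z = assoc C X Y Z"
  using assms by (simp_all add: pack_def family_pack unpack_def family_unpack)

lemma pack0_simps [simp]:
  "sarr pack0" "sdom pack0 = []" "scod pack0 = [\<one>]"
  "Z \<in> objs C \<Longrightarrow> cpt pack0 Z = inv_arr C (lun C Z)"
  "sarr unpack0" "sdom unpack0 = [\<one>]" "scod unpack0 = []"
  "Z \<in> objs C \<Longrightarrow> cpt unpack0 Z = lun C Z"
  by (simp_all add: pack0_def family_pack0 unpack0_def family_unpack0)

lemma mk_null: "mk xs ys F = None \<or> sarr (mk xs ys F)"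
proof (cases "family xs ys F")
  case False
  then show ?thesis by (simp add: mk_def)
qed simp

lemma scmp_null: "B \<bullet> A = None \<or> sarr (B \<bullet> A)"
  using mk_null unfolding scmp_def by auto

lemma lwhisk_null: "X \<rhd> A = None \<or> sarr (X \<rhd> A)"
  using mk_null unfolding lwhisk_def by auto

lemma rwhisk_null: "A \<lhd> zs = None \<or> sarr (A \<lhd> zs)"
  using mk_null unfolding rwhisk_def by auto

lemma sid_null: "sid xs = None \<or> sarr (sid xs)"
  using mk_null unfolding sid_def by auto

text \<open>For an equation between possibly undefined arrows it suffices that both sides are
  defined under the same conditions and then have equal components. Since the operations return
  \<open>None\<close> or a genuine strict arrow, many of the laws that follow can be stated without
  side conditions.\<close>

lemma eq_via_sarr:
  assumes "A = None \<or> sarr A" "B = None \<or> sarr B" "sarr A \<longleftrightarrow> sarr B"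
    and "sarr A \<Longrightarrow> sdom A = sdom B" "sarr A \<Longrightarrow> scod A = scod B"
    and "\<And>Z. sarr A \<Longrightarrow> Z \<in> objs C \<Longrightarrow> cpt A Z = cpt B Z"
  shows "A = B"
  using assms sarr_eqI by (cases "sarr A") auto

lemma scmp_assoc [simp]: "(D \<bullet> B) \<bullet> A = D \<bullet> B \<bullet> A"
  by (rule eq_via_sarr[OF scmp_null scmp_null]) auto

lemma lwhisk_scmp [simp]: "X \<rhd> (B \<bullet> A) = (X \<rhd> B) \<bullet> (X \<rhd> A)"
  by (rule eq_via_sarr[OF lwhisk_null scmp_null]) (auto simp: tensa_cmp)

lemma rwhisk_scmp [simp]: "(B \<bullet> A) \<lhd> zs = (B \<lhd> zs) \<bullet> (A \<lhd> zs)"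
  by (rule eq_via_sarr[OF rwhisk_null scmp_null]) auto

lemma rwhisk_lwhisk [simp]: "(X \<rhd> A) \<lhd> zs = X \<rhd> (A \<lhd> zs)"
  by (rule eq_via_sarr[OF rwhisk_null lwhisk_null]) auto

lemma rwhisk_rwhisk [simp]: "(A \<lhd> zs) \<lhd> ws = A \<lhd> (zs @ ws)"
  by (rule eq_via_sarr[OF rwhisk_null rwhisk_null]) auto

lemma rwhisk_Nil: "sarr A \<Longrightarrow> A \<lhd> [] = A"
  by (rule sarr_eqI) auto

lemma lwhisk_sid [simp]: "X \<rhd> sid xs = sid (X # xs)"
  by (rule eq_via_sarr[OF lwhisk_null sid_null]) auto

lemma rwhisk_sid [simp]: "sid xs \<lhd> zs = sid (xs @ zs)"
  by (rule eq_via_sarr[OF rwhisk_null sid_null]) auto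

lemma sid_scmp [simp]: "sarr A \<Longrightarrow> scod A = xs \<Longrightarrow> sid xs \<bullet> A = A"
  using sarr_cpt(2)[of A] by (intro sarr_eqI) auto

lemma scmp_sid [simp]: "sarr A \<Longrightarrow> sdom A = xs \<Longrightarrow> A \<bullet> sid xs = A"
  using sarr_cpt(1)[of A] by (intro sarr_eqI) auto

primrec lwhisks :: "'a list \<Rightarrow> ('a, 'b) sarrow \<Rightarrow> ('a, 'b) sarrow" where
  "lwhisks [] A = A"
| "lwhisks (X # xs) A = X \<rhd> lwhisks xs A"

lemma lwhisks_append [simp]: "lwhisks (xs @ ys) A = lwhisks xs (lwhisks ys A)"
  by (induction xs) simp_all

lemma lwhisks_scmp [simp]: "lwhisks xs (B \<bullet> A) = lwhisks xs B \<bullet> lwhisks xs A"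
  by (induction xs) simp_all

lemma lwhisks_sid [simp]: "lwhisks xs (sid ys) = sid (xs @ ys)"
  by (induction xs) simp_all

lemma lwhisks_rwhisk [simp]: "lwhisks xs A \<lhd> zs = lwhisks xs (A \<lhd> zs)"
  by (induction xs) simp_all

lemma sarr_lwhisks [simp]: "sarr (lwhisks xs A) \<longleftrightarrow> set xs \<subseteq> objs C \<and> sarr A"
  by (induction xs) auto

lemma lwhisks_simps [simp]:
  assumes "set xs \<subseteq> objs C" "sarr A"
  shows "sdom (lwhisks xs A) = xs @ sdom A" "scod (lwhisks xs A) = xs @ scod A"
    "Z \<in> objs C \<Longrightarrow> cpt (lwhisks xs A) Z = act_arr xs (cpt A Z)"
  using assms by (induction xs) simp_all

text \<open>The interchange law is naturality of the family \<open>A\<close> along the components of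
  \<open>B\<close>: an arrow on the front of a word and an arrow on its rear act on disjoint
  letters.\<close>

lemma exchange:
  "sarr A \<Longrightarrow> sarr B \<Longrightarrow> ws = scod B \<Longrightarrow>
   (A \<lhd> ws) \<bullet> lwhisks (sdom A) B = lwhisks (scod A) B \<bullet> (A \<lhd> sdom B)"
proof (rule sarr_eqI)
  fix Z assume "sarr A" "sarr B" "ws = scod B" "Z \<in> objs C"
  then show "cpt ((A \<lhd> ws) \<bullet> lwhisks (sdom A) B) Z = cpt (lwhisks (scod A) B \<bullet> (A \<lhd> sdom B)) Z"
    using cpt_natural[of A "cpt B Z"] by simp
qed auto

lemma J_ide [simp]: "X \<in> objs C \<Longrightarrow> J (ide C X) = sid [X]"
  by (rule sarr_eqI) auto

lemma J_cmp: "f \<in> arrs C \<Longrightarrow> g \<in> arrs C \<Longrightarrow> src C g = tgt C f \<Longrightarrow> J (g \<cdot> f) = J g \<bullet> J f"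
  by (rule sarr_eqI) (auto simp: tensa_cmp)

text \<open>The component of \<open>J f\<close> at \<one> is \<open>f\<close> tensored with the
  identity of \<one>, and tensoring with \<one> is faithful.\<close>

lemma J_inject:
  assumes "f \<in> hom C X Y" "g \<in> hom C X Y" "J f = J g"
  shows "f = g"
proof -
  have "cpt (J f) \<one> = cpt (J g) \<one>"
    by (simp add: assms(3))
  then show ?thesis
    using assms(1,2) by (intro tensa_ide_uno_inject[of f X Y g]) (auto simp: in_hom)
qed

text \<open>Naturality along \<open>lun Z\<close> and the module condition determine a strict arrow by its
  component at \<open>\<one>\<close>.\<close>

lemma J_full:
  assumes A: "sarr A" "sdom A = [X]" "scod A = [Y]"
  obtains f where "f \<in> hom C X Y" "J f = A"
proof
  have X: "X \<in> objs C" and Y: "Y \<in> objs C"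
    using sarr_cpt(1,2)[OF A(1)] A by auto
  \<comment> \<open>The component at \<one> goes from X \<otimes> \<one> to Y \<otimes> \<one>; the
    right unitors remove the unit.\<close>
  let ?f = "run C Y \<cdot> cpt A \<one> \<cdot> inv_arr C (run C X)"
  show f: "?f \<in> hom C X Y"
    using A X Y by (simp add: in_hom)
  show "J ?f = A"
  proof (rule sarr_eqI)
    fix Z assume Z: "Z \<in> objs C"
    have XlZ: "iso C (ide C X \<boxtimes> lun C Z)"
      using X Z by simp
    have "cpt A Z \<cdot> (ide C X \<boxtimes> lun C Z) \<cdot> assoc C X \<one> Z
        = (ide C Y \<boxtimes> lun C Z) \<cdot> cpt A (\<one> \<otimes> Z) \<cdot> assoc C X \<one> Z"
      using cpt_natural[OF A(1), of "lun C Z"] A X Y Z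
      by (simp flip: cat_simps(11))
    also have "cpt A (\<one> \<otimes> Z) \<cdot> assoc C X \<one> Z = assoc C Y \<one> Z \<cdot> (cpt A \<one> \<boxtimes> ide C Z)"
      using cpt_module[OF A(1), of \<one> Z] A X Y Z by simp
    also have "(ide C Y \<boxtimes> lun C Z) \<cdot> assoc C Y \<one> Z \<cdot> (cpt A \<one> \<boxtimes> ide C Z)
        = (run C Y \<boxtimes> ide C Z) \<cdot> (cpt A \<one> \<boxtimes> ide C Z)"
      using triangle[of Y Z] A X Y Z by (simp flip: cat_simps(11))
    finally have "cpt A Z \<cdot> (run C X \<boxtimes> ide C Z) = (run C Y \<boxtimes> ide C Z) \<cdot> (cpt A \<one> \<boxtimes> ide C Z)"
      using triangle[of X Z] X Z by simp
    then have "(cpt A Z \<cdot> (run C X \<boxtimes> ide C Z)) \<cdot> inv_arr C (run C X \<boxtimes> ide C Z)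
        = ((run C Y \<boxtimes> ide C Z) \<cdot> (cpt A \<one> \<boxtimes> ide C Z)) \<cdot> inv_arr C (run C X \<boxtimes> ide C Z)"
      by simp
    then show "cpt (J ?f) Z = cpt A Z"
      using f A X Y Z by (simp add: in_hom inv_arr_tensa tensa_cmp)
  qed (use f A in \<open>auto simp: in_hom\<close>)
qed

section \<open>The embedding of C into its strict arrows is strong monoidal\<close>

lemma unpack_pack [simp]:
  "X \<in> objs C \<Longrightarrow> Y \<in> objs C \<Longrightarrow> unpack X Y \<bullet> pack X Y = sid [X, Y]"
  "X \<in> objs C \<Longrightarrow> Y \<in> objs C \<Longrightarrow> pack X Y \<bullet> unpack X Y = sid [X \<otimes> Y]"
  "unpack0 \<bullet> pack0 = sid []"
  "pack0 \<bullet> unpack0 = sid [\<one>]"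
  by (rule sarr_eqI; auto)+

lemma J_tensa:
  "f \<in> arrs C \<Longrightarrow> g \<in> arrs C \<Longrightarrow> X = src C f \<Longrightarrow> Y = src C g \<Longrightarrow>
   J (f \<boxtimes> g) \<bullet> pack X Y
     = pack (tgt C f) (tgt C g) \<bullet> (J f \<lhd> [tgt C g]) \<bullet> (X \<rhd> J g)"
proof (rule sarr_eqI)
  fix Z assume *: "f \<in> arrs C" "g \<in> arrs C" "X = src C f" "Y = src C g" "Z \<in> objs C"
  have "assoc C (tgt C f) (tgt C g) Z \<cdot> ((f \<boxtimes> g) \<boxtimes> ide C Z) \<cdot> inv_arr C (assoc C X Y Z)
      = (assoc C (tgt C f) (tgt C g) Z \<cdot> ((f \<boxtimes> g) \<boxtimes> ide C Z)) \<cdot> inv_arr C (assoc C X Y Z)"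
    using * by simp
  also have "\<dots> = (f \<boxtimes> (g \<boxtimes> ide C Z)) \<cdot> assoc C X Y Z \<cdot> inv_arr C (assoc C X Y Z)"
    using * assoc_nat[of f g "ide C Z" "tgt C f" "tgt C g" Z] by simp
  finally have "((f \<boxtimes> g) \<boxtimes> ide C Z) \<cdot> inv_arr C (assoc C X Y Z)
      = inv_arr C (assoc C (tgt C f) (tgt C g) Z) \<cdot> (f \<boxtimes> (g \<boxtimes> ide C Z))"
    using * by (simp add: cancel_iso_left[of "assoc C (tgt C f) (tgt C g) Z"])
  then show "cpt (J (f \<boxtimes> g) \<bullet> pack X Y) Z
      = cpt (pack (tgt C f) (tgt C g) \<bullet> (J f \<lhd> [tgt C g]) \<bullet> (X \<rhd> J g)) Z"
    using * by (simp add: tensa_cmp)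
qed auto

text \<open>In the form with \<open>unpack\<close> this is the pentagon, component by component;
  conjugation with the invertible packings gives the stated form. It says that the associator
  becomes an identity once tensor products are written as words.\<close>

lemma J_assoc:
  assumes "X \<in> objs C" "Y \<in> objs C" "Z \<in> objs C"
  shows "J (assoc C X Y Z) \<bullet> pack (X \<otimes> Y) Z \<bullet> (pack X Y \<lhd> [Z]) = pack X (Y \<otimes> Z) \<bullet> (X \<rhd> pack Y Z)"
    (is "?l = ?r")
proof -
  have "(X \<rhd> unpack Y Z) \<bullet> unpack X (Y \<otimes> Z) \<bullet> J (assoc C X Y Z) = (unpack X Y \<lhd> [Z]) \<bullet> unpack (X \<otimes> Y) Z"
    using assms pentagon[of X Y Z] by (intro sarr_eqI) auto
  then have "pack X (Y \<otimes> Z) \<bullet> (X \<rhd> pack Y Z) \<bullet> ((X \<rhd> unpack Y Z) \<bullet> unpack X (Y \<otimes> Z) \<bullet> J (assoc C X Y Z)) \<bullet>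
      pack (X \<otimes> Y) Z \<bullet> (pack X Y \<lhd> [Z])
    = pack X (Y \<otimes> Z) \<bullet> (X \<rhd> pack Y Z) \<bullet> ((unpack X Y \<lhd> [Z]) \<bullet> unpack (X \<otimes> Y) Z) \<bullet>
      pack (X \<otimes> Y) Z \<bullet> (pack X Y \<lhd> [Z])"
    by (simp only:)
  moreover have "pack X (Y \<otimes> Z) \<bullet> (X \<rhd> pack Y Z) \<bullet> ((X \<rhd> unpack Y Z) \<bullet> unpack X (Y \<otimes> Z) \<bullet> J (assoc C X Y Z)) \<bullet>
      pack (X \<otimes> Y) Z \<bullet> (pack X Y \<lhd> [Z]) = ?l"
    using assms by (intro sarr_eqI) (auto simp: tensa_cmp tensa_cmp_reassoc)
  moreover have "pack X (Y \<otimes> Z) \<bullet> (X \<rhd> pack Y Z) \<bullet> ((unpack X Y \<lhd> [Z]) \<bullet> unpack (X \<otimes> Y) Z) \<bullet>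
      pack (X \<otimes> Y) Z \<bullet> (pack X Y \<lhd> [Z]) = ?r"
    using assms by (intro sarr_eqI) (auto simp: tensa_cmp tensa_cmp_reassoc)
  ultimately show ?thesis by simp
qed

text \<open>By components this is \<open>lun_tens\<close>; for the right unitor the triangle plays
  the same role.\<close>

lemma J_lun: "X \<in> objs C \<Longrightarrow> J (lun C X) \<bullet> pack \<one> X \<bullet> (pack0 \<lhd> [X]) = sid [X]"
proof (rule sarr_eqI)
  fix Z assume *: "X \<in> objs C" "Z \<in> objs C"
  have "(lun C X \<boxtimes> ide C Z) \<cdot> inv_arr C (assoc C \<one> X Z) \<cdot> inv_arr C (lun C (X \<otimes> Z)) = ide C (X \<otimes> Z)"
    using * by (simp flip: lun_tens)
  then show "cpt (J (lun C X) \<bullet> pack \<one> X \<bullet> (pack0 \<lhd> [X])) Z = cpt (sid [X]) Z"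
    using * by simp
qed auto

lemma J_run: "X \<in> objs C \<Longrightarrow> J (run C X) \<bullet> pack X \<one> \<bullet> (X \<rhd> pack0) = sid [X]"
proof (rule sarr_eqI)
  fix Z assume *: "X \<in> objs C" "Z \<in> objs C"
  have "(run C X \<boxtimes> ide C Z) \<cdot> inv_arr C (assoc C X \<one> Z) \<cdot> (ide C X \<boxtimes> inv_arr C (lun C Z)) = ide C (X \<otimes> Z)"
    using * by (simp add: tensa_cmp flip: triangle)
  then show "cpt (J (run C X) \<bullet> pack X \<one> \<bullet> (X \<rhd> pack0)) Z = cpt (sid [X]) Z"
    using * by simp
qed auto

text \<open>Composites are kept nested to the right.  An equation \<open>A \<bullet> B = \<dots>\<close> is therefore used for rewriting
  also with a trailing factor and under left whiskerings; \<open>whisk_cong\<close> followed by \<open>whisk_nf\<close>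
  produces these variants.\<close>

lemma whisk_cong:
  assumes "A = B"
  shows "A \<bullet> E = B \<bullet> E"
    "X \<rhd> A = X \<rhd> B" "(X \<rhd> A) \<bullet> E = (X \<rhd> B) \<bullet> E"
    "X \<rhd> Y \<rhd> A = X \<rhd> Y \<rhd> B" "(X \<rhd> Y \<rhd> A) \<bullet> E = (X \<rhd> Y \<rhd> B) \<bullet> E"
    "X \<rhd> Y \<rhd> Z \<rhd> A = X \<rhd> Y \<rhd> Z \<rhd> B" "(X \<rhd> Y \<rhd> Z \<rhd> A) \<bullet> E = (X \<rhd> Y \<rhd> Z \<rhd> B) \<bullet> E"
  using assms by auto

lemma with_tail: "A = B \<Longrightarrow> A \<lhd> zs = B \<lhd> zs"
  by simp

lemmas whisk_nf = lwhisk_scmp rwhisk_scmp scmp_assoc rwhisk_lwhisk rwhisk_rwhisk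
  rwhisk_sid lwhisk_sid append.simps append_Nil2

text \<open>The interchange law for the short words that occur below, with \<open>lwhisks\<close>
  and word concatenation written out; in this explicit form its sides match concrete
  composites.\<close>

lemma exchange_atom:
  assumes "sarr A" "sarr B" "ws = scod B"
  shows "sdom A = [] \<Longrightarrow> scod A = [] \<Longrightarrow> (A \<lhd> ws) \<bullet> B = B \<bullet> (A \<lhd> sdom B)"
    "sdom A = [] \<Longrightarrow> scod A = [c] \<Longrightarrow> (A \<lhd> ws) \<bullet> B = (c \<rhd> B) \<bullet> (A \<lhd> sdom B)"
    "sdom A = [] \<Longrightarrow> scod A = [c, d] \<Longrightarrow> (A \<lhd> ws) \<bullet> B = (c \<rhd> d \<rhd> B) \<bullet> (A \<lhd> sdom B)"
    "sdom A = [a] \<Longrightarrow> scod A = [] \<Longrightarrow> (A \<lhd> ws) \<bullet> (a \<rhd> B) = B \<bullet> (A \<lhd> sdom B)"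
    "sdom A = [a] \<Longrightarrow> scod A = [c] \<Longrightarrow> (A \<lhd> ws) \<bullet> (a \<rhd> B) = (c \<rhd> B) \<bullet> (A \<lhd> sdom B)"
    "sdom A = [a] \<Longrightarrow> scod A = [c, d] \<Longrightarrow> (A \<lhd> ws) \<bullet> (a \<rhd> B) = (c \<rhd> d \<rhd> B) \<bullet> (A \<lhd> sdom B)"
    "sdom A = [a, b] \<Longrightarrow> scod A = [] \<Longrightarrow> (A \<lhd> ws) \<bullet> (a \<rhd> b \<rhd> B) = B \<bullet> (A \<lhd> sdom B)"
    "sdom A = [a, b] \<Longrightarrow> scod A = [c] \<Longrightarrow> (A \<lhd> ws) \<bullet> (a \<rhd> b \<rhd> B) = (c \<rhd> B) \<bullet> (A \<lhd> sdom B)"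
    "sdom A = [a, b] \<Longrightarrow> scod A = [c, d] \<Longrightarrow> (A \<lhd> ws) \<bullet> (a \<rhd> b \<rhd> B) = (c \<rhd> d \<rhd> B) \<bullet> (A \<lhd> sdom B)"
    "sdom A = [a, b, c'] \<Longrightarrow> scod A = [c] \<Longrightarrow> (A \<lhd> ws) \<bullet> (a \<rhd> b \<rhd> c' \<rhd> B) = (c \<rhd> B) \<bullet> (A \<lhd> sdom B)"
  using exchange[OF assms] by auto

text \<open>The codomain becomes the empty word instead of the unit object, so that the strict
  triangle identities contain no unitors. The same holds for the domain of
  \<open>coev_of\<close>.\<close>

definition ev_of :: "'a \<Rightarrow> 'a \<Rightarrow> 'b \<Rightarrow> ('a, 'b) sarrow" where
  "ev_of X Y f = unpack0 \<bullet> J f \<bullet> pack X Y"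

definition coev_of :: "'a \<Rightarrow> 'a \<Rightarrow> 'b \<Rightarrow> ('a, 'b) sarrow" where
  "coev_of X Y f = unpack X Y \<bullet> J f \<bullet> pack0"

lemma ev_of_simps [simp]:
  assumes "f \<in> hom C (X \<otimes> Y) \<one>" "X \<in> objs C" "Y \<in> objs C"
  shows "sarr (ev_of X Y f)" "sdom (ev_of X Y f) = [X, Y]" "scod (ev_of X Y f) = []"
  using assms by (auto simp: ev_of_def in_hom)

lemma coev_of_simps [simp]:
  assumes "f \<in> hom C \<one> (X \<otimes> Y)" "X \<in> objs C" "Y \<in> objs C"
  shows "sarr (coev_of X Y f)" "scod (coev_of X Y f) = [X, Y]" "sdom (coev_of X Y f) = []"
  using assms by (auto simp: coev_of_def in_hom)

lemma unpack_pack_tail [simp]: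
  "X \<in> objs C \<Longrightarrow> Y \<in> objs C \<Longrightarrow> (unpack X Y \<lhd> zs) \<bullet> (pack X Y \<lhd> zs) = sid (X # Y # zs)"
  "X \<in> objs C \<Longrightarrow> Y \<in> objs C \<Longrightarrow> (pack X Y \<lhd> zs) \<bullet> (unpack X Y \<lhd> zs) = sid ((X \<otimes> Y) # zs)"
  "(unpack0 \<lhd> zs) \<bullet> (pack0 \<lhd> zs) = sid zs"
  "(pack0 \<lhd> zs) \<bullet> (unpack0 \<lhd> zs) = sid (\<one> # zs)"
  by (simp_all flip: rwhisk_scmp)

lemmas unpack_pack_context [simp] = unpack_pack_tail[THEN whisk_cong(1), unfolded whisk_nf]
  unpack_pack_tail[THEN whisk_cong(2), unfolded whisk_nf]
  unpack_pack_tail[THEN whisk_cong(3), unfolded whisk_nf]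
  unpack_pack_tail[THEN whisk_cong(4), unfolded whisk_nf]
  unpack_pack_tail[THEN whisk_cong(5), unfolded whisk_nf]

lemma J_cmp_tail:
  "f \<in> arrs C \<Longrightarrow> g \<in> arrs C \<Longrightarrow> src C g = tgt C f \<Longrightarrow> J (g \<cdot> f) \<lhd> zs = (J g \<lhd> zs) \<bullet> (J f \<lhd> zs)"
  by (simp add: J_cmp)

lemma J_tensa_tail:
  assumes "f \<in> arrs C" "g \<in> arrs C" "X = src C f" "Y = src C g"
  shows "(J (f \<boxtimes> g) \<lhd> zs) \<bullet> (pack X Y \<lhd> zs)
     = (pack (tgt C f) (tgt C g) \<lhd> zs) \<bullet> (J f \<lhd> (tgt C g # zs)) \<bullet> (X \<rhd> J g \<lhd> zs)"
  using with_tail[OF J_tensa[OF assms], of zs] by simp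

lemma J_assoc_tail:
  assumes "X \<in> objs C" "Y \<in> objs C" "Z \<in> objs C"
  shows "(J (assoc C X Y Z) \<lhd> zs) \<bullet> (pack (X \<otimes> Y) Z \<lhd> zs) \<bullet> (pack X Y \<lhd> Z # zs)
     = (pack X (Y \<otimes> Z) \<lhd> zs) \<bullet> (X \<rhd> pack Y Z \<lhd> zs)"
  using with_tail[OF J_assoc[OF assms], of zs] by simp

lemma J_lun_tail:
  "X \<in> objs C \<Longrightarrow> (J (lun C X) \<lhd> zs) \<bullet> (pack \<one> X \<lhd> zs) \<bullet> (pack0 \<lhd> X # zs) = sid (X # zs)"
  using with_tail[OF J_lun, of X zs] by simp

lemma J_run_tail:
  "X \<in> objs C \<Longrightarrow> (J (run C X) \<lhd> zs) \<bullet> (pack X \<one> \<lhd> zs) \<bullet> (X \<rhd> pack0 \<lhd> zs) = sid (X # zs)"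
  using with_tail[OF J_run, of X zs] by simp

lemma J_inv:
  assumes f: "iso C f" and A: "J f \<bullet> A = B" "sarr A" "scod A = [src C f]"
  shows "J (inv_arr C f) \<bullet> B = A"
proof -
  have "J (inv_arr C f) \<bullet> J f = sid [src C f]"
    using f iso_arr[OF f] by (simp flip: J_cmp)
  from this[THEN whisk_cong(1), of A] show ?thesis
    using A by simp
qed

lemma J_inv_assoc_tail:
  assumes "X \<in> objs C" "Y \<in> objs C" "Z \<in> objs C"
  shows "(J (inv_arr C (assoc C X Y Z)) \<lhd> zs) \<bullet> (pack X (Y \<otimes> Z) \<lhd> zs) \<bullet> (X \<rhd> pack Y Z \<lhd> zs)
    = (pack (X \<otimes> Y) Z \<lhd> zs) \<bullet> (pack X Y \<lhd> Z # zs)"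
  using with_tail[OF J_inv[OF _ J_assoc[OF assms]], of zs] assms by simp

lemma J_inv_lun_tail:
  "X \<in> objs C \<Longrightarrow> J (inv_arr C (lun C X)) \<lhd> zs = (pack \<one> X \<lhd> zs) \<bullet> (pack0 \<lhd> X # zs)"
  using with_tail[OF J_inv[OF _ J_lun], of X zs] by simp

lemma J_inv_run_tail:
  "X \<in> objs C \<Longrightarrow> J (inv_arr C (run C X)) \<lhd> zs = (pack X \<one> \<lhd> zs) \<bullet> (X \<rhd> pack0 \<lhd> zs)"
  using with_tail[OF J_inv[OF _ J_run], of X zs] by simp

lemma ev_of_tail:
  assumes "f \<in> hom C (X \<otimes> Y) \<one>" "X \<in> objs C" "Y \<in> objs C"
  shows "(J f \<lhd> zs) \<bullet> (pack X Y \<lhd> zs) = (pack0 \<lhd> zs) \<bullet> (ev_of X Y f \<lhd> zs)"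
proof -
  have "J f \<bullet> pack X Y = pack0 \<bullet> ev_of X Y f"
    using assms by (simp add: ev_of_def in_hom flip: scmp_assoc)
  from with_tail[OF this, of zs] show ?thesis by simp
qed

lemma coev_of_tail:
  assumes "f \<in> hom C \<one> (X \<otimes> Y)" "X \<in> objs C" "Y \<in> objs C"
  shows "(J f \<lhd> zs) \<bullet> (pack0 \<lhd> zs) = (pack X Y \<lhd> zs) \<bullet> (coev_of X Y f \<lhd> zs)"
proof -
  have "J f \<bullet> pack0 = pack X Y \<bullet> coev_of X Y f"
    using assms by (simp add: coev_of_def in_hom flip: scmp_assoc)
  from with_tail[OF this, of zs] show ?thesis by simp
qed

lemma pack_exchange:
  assumes "X \<in> objs C" "Y \<in> objs C" "sarr B" "XY = X \<otimes> Y" "zs = sdom B"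
  shows "(XY \<rhd> B) \<bullet> (pack X Y \<lhd> zs) = (pack X Y \<lhd> scod B) \<bullet> (X \<rhd> Y \<rhd> B)"
  using exchange_atom(8)[of "pack X Y" B "scod B" X Y "X \<otimes> Y"] assms by simp

lemma pack0_exchange:
  assumes "sarr B" "zs = sdom B"
  shows "(\<one> \<rhd> B) \<bullet> (pack0 \<lhd> zs) = (pack0 \<lhd> scod B) \<bullet> B"
  using exchange_atom(2)[of "pack0" B "scod B" \<one>] assms by simp

text \<open>These rules express the image under \<open>J\<close> of any structural arrow by means of packings, and move all
  packings to the left of a composite.\<close>

lemmas push0 = J_tensa_tail J_assoc_tail J_lun_tail J_run_tail J_inv_assoc_tail
  J_inv_lun_tail J_inv_run_tail pack_exchange pack0_exchange J_cmp_tail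

lemmas push = push0 push0[THEN whisk_cong(1), unfolded whisk_nf]
  push0[THEN whisk_cong(2), unfolded whisk_nf]
  push0[THEN whisk_cong(3), unfolded whisk_nf]
  push0[THEN whisk_cong(4), unfolded whisk_nf]
  push0[THEN whisk_cong(5), unfolded whisk_nf]

text \<open>The laws for \<open>J\<close> of structural arrows apply to composites that start with
  packings. Equations are therefore proved after composition with an invertible \<open>K\<close>,
  which is cancelled here.\<close>

lemma split_cancel:
  assumes "sarr A" "sdom A = scod K" "sarr B" "sdom B = scod K" "K \<bullet> K' = sid (scod K)"
    and eq: "A \<bullet> K = B \<bullet> K"
  shows "A = B"
proof -
  have "(A \<bullet> K) \<bullet> K' = (B \<bullet> K) \<bullet> K'"
    by (simp only: eq)
  then show ?thesis
    using assms(1-5) unfolding scmp_assoc by simp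
qed

lemma split_cancel_left:
  assumes "sarr A" "scod A = sdom K" "sarr B" "scod B = sdom K" "K' \<bullet> K = sid (sdom K)"
    and eq: "K \<bullet> A = K \<bullet> B"
  shows "A = B"
proof -
  have "(K' \<bullet> K) \<bullet> A = (K' \<bullet> K) \<bullet> B"
    by (simp only: eq scmp_assoc)
  then show ?thesis
    using assms(1-5) by simp
qed

lemma pack_cancel:
  assumes "X \<in> objs C" "Y \<in> objs C" "sarr A" "sdom A = (X \<otimes> Y) # zs" "sarr B" "sdom B = (X \<otimes> Y) # zs"
    and "A \<bullet> (pack X Y \<lhd> zs) = B \<bullet> (pack X Y \<lhd> zs)"
  shows "A = B"
proof -
  have "set zs \<subseteq> objs C" using sarr_cpt(1)[OF assms(3)] assms(4) by simp
  then show ?thesis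
    using assms by (intro split_cancel[OF _ _ _ _ _ assms(7), of "unpack X Y \<lhd> zs"]) simp_all
qed

lemma pack0_cancel:
  assumes "sarr A" "sdom A = \<one> # zs" "sarr B" "sdom B = \<one> # zs"
    and "A \<bullet> (pack0 \<lhd> zs) = B \<bullet> (pack0 \<lhd> zs)"
  shows "A = B"
proof -
  have "set zs \<subseteq> objs C" using sarr_cpt(1)[OF assms(1)] assms(2) by simp
  then show ?thesis
    using assms by (intro split_cancel[OF _ _ _ _ _ assms(5), of "unpack0 \<lhd> zs"]) simp_all
qed

lemma pack0_cancel_inner:
  assumes "V \<in> objs C" "sarr A" "sdom A = V # \<one> # zs" "sarr B" "sdom B = V # \<one> # zs"
    and "A \<bullet> (V \<rhd> pack0 \<lhd> zs) = B \<bullet> (V \<rhd> pack0 \<lhd> zs)"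
  shows "A = B"
proof -
  have "set zs \<subseteq> objs C" using sarr_cpt(1)[OF assms(2)] assms(3) by simp
  moreover have "(V \<rhd> pack0 \<lhd> zs) \<bullet> (V \<rhd> unpack0 \<lhd> zs) = V \<rhd> sid (\<one> # zs)"
    by (simp flip: lwhisk_scmp del: lwhisk_sid)
  ultimately show ?thesis
    using assms by (intro split_cancel[OF _ _ _ _ _ assms(6), of "V \<rhd> unpack0 \<lhd> zs"]) simp_all
qed

lemma pack0_cancel_left:
  assumes "sarr A" "scod A = zs" "sarr B" "scod B = zs"
    and "(pack0 \<lhd> zs) \<bullet> A = (pack0 \<lhd> zs) \<bullet> B"
  shows "A = B"
proof -
  have "set zs \<subseteq> objs C" using sarr_cpt(2)[OF assms(1)] assms(2) by simp
  then show ?thesis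
    using assms by (intro split_cancel_left[OF _ _ _ _ _ assms(5), of "unpack0 \<lhd> zs"]) simp_all
qed

section \<open>Duality without coherence isomorphisms\<close>

definition sdual :: "'a \<Rightarrow> 'a \<Rightarrow> ('a, 'b) sarrow \<Rightarrow> ('a, 'b) sarrow \<Rightarrow> bool" where
  "sdual X Y e c \<longleftrightarrow> X \<in> objs C \<and> Y \<in> objs C \<and> sarr e \<and> sdom e = [Y, X] \<and> scod e = [] \<and>
     sarr c \<and> sdom c = [] \<and> scod c = [X, Y] \<and>
     (X \<rhd> e) \<bullet> (c \<lhd> [X]) = sid [X] \<and> (e \<lhd> [Y]) \<bullet> (Y \<rhd> c) = sid [Y]"

text \<open>Under \<open>J\<close>, both triangle identities are rewritten by \<open>push\<close>
  until every associator and unitor has disappeared; what is left of them are the strict identities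
  of \<open>sdual\<close>.\<close>

lemma sdual_of_dual_pair:
  assumes "dual_pair C X Y e c"
  shows "sdual X Y (ev_of Y X e) (coev_of X Y c)"
proof -
  have *: "X \<in> objs C" "Y \<in> objs C" "e \<in> hom C (Y \<otimes> X) \<one>" "c \<in> hom C \<one> (X \<otimes> Y)"
    and 1: "run C X \<cdot> (ide C X \<boxtimes> e) \<cdot> assoc C X Y X \<cdot> (c \<boxtimes> ide C X) \<cdot> inv_arr C (lun C X) = ide C X"
    and 2: "lun C Y \<cdot> (e \<boxtimes> ide C Y) \<cdot> inv_arr C (assoc C Y X Y) \<cdot> (ide C Y \<boxtimes> c) \<cdot> inv_arr C (run C Y) = ide C Y"
    using assms by (auto simp: dual_pair_def)
  note ** = *(1,2) *(3,4)[unfolded in_hom]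
  note ev = ev_of_tail[OF *(3,2,1)] and co = coev_of_tail[OF *(4,1,2)]
  note push = push ev co whisk_cong[OF ev, unfolded whisk_nf] whisk_cong[OF co, unfolded whisk_nf]
  have "J (run C X \<cdot> (ide C X \<boxtimes> e) \<cdot> assoc C X Y X \<cdot> (c \<boxtimes> ide C X) \<cdot> inv_arr C (lun C X)) \<lhd> []
     = (X \<rhd> ev_of Y X e \<lhd> []) \<bullet> (coev_of X Y c \<lhd> [X])"
    using * ** by (simp add: push)
  then have a: "(X \<rhd> ev_of Y X e) \<bullet> (coev_of X Y c \<lhd> [X]) = sid [X]"
    using * by (simp add: 1 rwhisk_Nil)
  have "J (lun C Y \<cdot> (e \<boxtimes> ide C Y) \<cdot> inv_arr C (assoc C Y X Y) \<cdot> (ide C Y \<boxtimes> c) \<cdot> inv_arr C (run C Y)) \<lhd> []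
     = (ev_of Y X e \<lhd> [Y]) \<bullet> (Y \<rhd> coev_of X Y c \<lhd> [])"
    using * ** by (simp add: push)
  then have b: "(ev_of Y X e \<lhd> [Y]) \<bullet> (Y \<rhd> coev_of X Y c) = sid [Y]"
    using * by (simp add: 2 rwhisk_Nil)
  show ?thesis
    using * a b by (simp add: sdual_def)
qed

text \<open>Interchange with a fixed orientation: the arrow that acts on the front letter is moved
  to the left of the composite, past arrows on later letters. The rules named \<open>rex\<close>
  share this orientation, so that composites on disjoint letters can be compared.\<close>

lemma rex_J:
  "f \<in> arrs C \<Longrightarrow> sarr B \<Longrightarrow> c = tgt C f \<Longrightarrow> zs = sdom B \<Longrightarrow>
   (c \<rhd> B) \<bullet> (J f \<lhd> zs) = (J f \<lhd> scod B) \<bullet> (src C f \<rhd> B)"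
  using exchange_atom(5)[of "J f" B "scod B" "src C f" "tgt C f"] by simp

lemma rex_unpack:
  "X \<in> objs C \<Longrightarrow> Y \<in> objs C \<Longrightarrow> sarr B \<Longrightarrow> zs = sdom B \<Longrightarrow>
   (X \<rhd> Y \<rhd> B) \<bullet> (unpack X Y \<lhd> zs) = (unpack X Y \<lhd> scod B) \<bullet> (X \<otimes> Y \<rhd> B)"
  using exchange_atom(6)[of "unpack X Y" B "scod B" "X \<otimes> Y" X Y] by simp

lemmas rex0 = rex_J rex_unpack
lemmas rex = rex0 rex0[THEN whisk_cong(1), unfolded whisk_nf]
  rex0[THEN whisk_cong(2), unfolded whisk_nf]
  rex0[THEN whisk_cong(3), unfolded whisk_nf]
  rex0[THEN whisk_cong(4), unfolded whisk_nf]
  rex0[THEN whisk_cong(5), unfolded whisk_nf]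

lemma sdualD:
  assumes "sdual X Y e c"
  shows "X \<in> objs C" "Y \<in> objs C" "sarr e" "sdom e = [Y, X]" "scod e = []"
    "sarr c" "sdom c = []" "scod c = [X, Y]"
    "(X \<rhd> e \<lhd> zs) \<bullet> (c \<lhd> X # zs) = sid (X # zs)" "(e \<lhd> Y # zs) \<bullet> (Y \<rhd> c \<lhd> zs) = sid (Y # zs)"
proof -
  show "X \<in> objs C" "Y \<in> objs C" "sarr e" "sdom e = [Y, X]" "scod e = []"
    "sarr c" "sdom c = []" "scod c = [X, Y]"
    using assms by (auto simp: sdual_def)
  have zz: "(X \<rhd> e) \<bullet> (c \<lhd> [X]) = sid [X]" "(e \<lhd> [Y]) \<bullet> (Y \<rhd> c) = sid [Y]"
    using assms by (auto simp: sdual_def)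
  show "(X \<rhd> e \<lhd> zs) \<bullet> (c \<lhd> X # zs) = sid (X # zs)" "(e \<lhd> Y # zs) \<bullet> (Y \<rhd> c \<lhd> zs) = sid (Y # zs)"
    using zz[THEN with_tail, of zs] by simp_all
qed

text \<open>Bending the first letter \<open>Y\<close> of the domain to the codomain with
  \<open>c\<close> and back with \<open>e\<close> changes nothing: \<open>A\<close> slides past
  \<open>e\<close> by interchange, and a triangle identity remains.\<close>

lemma bend_left:
  assumes d: "sdual X Y e c" and A: "sarr A" "sdom A = Y # vs" "scod A = ws"
  shows "(e \<lhd> ws) \<bullet> (Y \<rhd> X \<rhd> A) \<bullet> (Y \<rhd> c \<lhd> vs) = A"
proof -
  note d' = sdualD[OF d]
  have vs: "set vs \<subseteq> objs C" using sarr_cpt(1)[OF A(1)] A(2) by simp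
  have "(e \<lhd> ws) \<bullet> (Y \<rhd> X \<rhd> A) = A \<bullet> (e \<lhd> Y # vs)"
    using exchange_atom(7)[of e A ws Y X] A d' by simp
  from this[THEN whisk_cong(1), of "Y \<rhd> c \<lhd> vs"] show ?thesis
    using d' A vs by simp
qed

lemma bend_right:
  assumes d: "sdual X Y e c" and A: "sarr A" "sdom A = vs" "scod A = X # ws"
  shows "(X \<rhd> e \<lhd> ws) \<bullet> (X \<rhd> Y \<rhd> A) \<bullet> (c \<lhd> vs) = A"
proof -
  note d' = sdualD[OF d]
  have ws: "set ws \<subseteq> objs C" using sarr_cpt(2)[OF A(1)] A(3) by simp
  have "(X \<rhd> Y \<rhd> A) \<bullet> (c \<lhd> vs) = (c \<lhd> X # ws) \<bullet> A"
    using exchange_atom(3)[of c A "X # ws" X Y] A d' by simp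
  then have "(X \<rhd> e \<lhd> ws) \<bullet> (X \<rhd> Y \<rhd> A) \<bullet> (c \<lhd> vs) = ((X \<rhd> e \<lhd> ws) \<bullet> (c \<lhd> X # ws)) \<bullet> A"
    by simp
  also have "\<dots> = A" unfolding d'(9) using A by simp
  finally show ?thesis .
qed

text \<open>An arrow is recovered from its mate by bending back with \<open>c\<close>, so equations
  may be tested after pairing the first letter of the codomain with \<open>e\<close>.\<close>

lemma bend_left_inject:
  assumes d: "sdual X Y e c" and AB: "sarr A" "scod A = X # ws" "sarr B" "scod B = X # ws" "sdom A = sdom B"
    and eq: "(e \<lhd> ws) \<bullet> (Y \<rhd> A) = (e \<lhd> ws) \<bullet> (Y \<rhd> B)"
  shows "A = B"
proof -
  have "(X \<rhd> ((e \<lhd> ws) \<bullet> (Y \<rhd> A))) \<bullet> (c \<lhd> sdom A) = (X \<rhd> ((e \<lhd> ws) \<bullet> (Y \<rhd> B))) \<bullet> (c \<lhd> sdom B)"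
    unfolding eq AB(5) ..
  then show ?thesis
    using bend_right[OF d AB(1) refl AB(2)] bend_right[OF d AB(3) refl AB(4)] by simp
qed

lemma bend_tail_left:
  assumes d: "sdual X Y e c" and A: "sarr A" "sdom A = vs" "scod A = ws @ [Y]"
  shows "(lwhisks ws e \<lhd> [Y]) \<bullet> (A \<lhd> [X, Y]) \<bullet> lwhisks vs c = A"
proof -
  note d' = sdualD[OF d]
  have ws: "set ws \<subseteq> objs C" using sarr_cpt(2)[OF A(1)] A(3) by simp
  have "(A \<lhd> [X, Y]) \<bullet> lwhisks vs c = lwhisks (ws @ [Y]) c \<bullet> A"
    using exchange[of A c "[X, Y]"] A d' by (simp add: rwhisk_Nil)
  then have "(lwhisks ws e \<lhd> [Y]) \<bullet> (A \<lhd> [X, Y]) \<bullet> lwhisks vs c = lwhisks ws ((e \<lhd> [Y]) \<bullet> (Y \<rhd> c)) \<bullet> A"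
    by simp
  also have "(e \<lhd> [Y]) \<bullet> (Y \<rhd> c) = sid [Y]"
    using d'(10)[of "[]"] d' by (simp add: rwhisk_Nil)
  finally show ?thesis using A by simp
qed

lemma bend_tail_right:
  assumes d: "sdual X Y e c" and A: "sarr A" "sdom A = vs @ [X]" "scod A = ws"
  shows "lwhisks ws e \<bullet> (A \<lhd> [Y, X]) \<bullet> (lwhisks vs c \<lhd> [X]) = A"
proof -
  note d' = sdualD[OF d]
  have vs: "set vs \<subseteq> objs C" using sarr_cpt(1)[OF A(1)] A(2) by simp
  have "lwhisks ws e \<bullet> (A \<lhd> [Y, X]) = A \<bullet> lwhisks (vs @ [X]) e"
    using exchange[of A e "[]"] A d' by (simp add: rwhisk_Nil)
  then have "lwhisks ws e \<bullet> (A \<lhd> [Y, X]) \<bullet> (lwhisks vs c \<lhd> [X]) = A \<bullet> lwhisks vs ((X \<rhd> e) \<bullet> (c \<lhd> [X]))"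
    by (simp flip: scmp_assoc)
  also have "(X \<rhd> e) \<bullet> (c \<lhd> [X]) = sid [X]"
    using d'(9)[of "[]"] d' by (simp add: rwhisk_Nil)
  finally show ?thesis using A vs by simp
qed

text \<open>Iterated packing contracts a word to a single object. Universal properties that C
  provides for objects thereby become available with words as codomains.\<close>

lemma pack_word:
  "set ws \<subseteq> objs C \<Longrightarrow> \<exists>Z k k'. Z \<in> objs C \<and> sarr k \<and> sdom k = ws \<and> scod k = [Z] \<and>
     sarr k' \<and> sdom k' = [Z] \<and> scod k' = ws \<and> k' \<bullet> k = sid ws \<and> k \<bullet> k' = sid [Z]"
proof (induction ws)
  case Nil
  then show ?case
    by (intro exI[of _ \<one>] exI[of _ pack0] exI[of _ unpack0]) simp
next
  case (Cons X ws)
  then obtain Z k k' where *: "Z \<in> objs C" "sarr k" "sdom k = ws" "scod k = [Z]"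
     "sarr k'" "sdom k' = [Z]" "scod k' = ws" "k' \<bullet> k = sid ws" "k \<bullet> k' = sid [Z]"
    by auto
  have 1: "((X \<rhd> k') \<bullet> unpack X Z) \<bullet> (pack X Z \<bullet> (X \<rhd> k)) = sid (X # ws)"
  proof -
    have "((X \<rhd> k') \<bullet> unpack X Z) \<bullet> (pack X Z \<bullet> (X \<rhd> k)) = (X \<rhd> k') \<bullet> (unpack X Z \<bullet> pack X Z) \<bullet> (X \<rhd> k)"
      by simp
    also have "\<dots> = X \<rhd> (k' \<bullet> k)"
      using * Cons.prems by (simp del: lwhisk_scmp add: lwhisk_scmp[symmetric])
    finally show ?thesis using * by simp
  qed
  have 2: "(pack X Z \<bullet> (X \<rhd> k)) \<bullet> ((X \<rhd> k') \<bullet> unpack X Z) = sid [X \<otimes> Z]"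
  proof -
    have "(pack X Z \<bullet> (X \<rhd> k)) \<bullet> ((X \<rhd> k') \<bullet> unpack X Z) = pack X Z \<bullet> (X \<rhd> (k \<bullet> k')) \<bullet> unpack X Z"
      by simp
    then show ?thesis using * Cons.prems by (simp del: lwhisk_scmp)
  qed
  show ?case
    using * Cons.prems 1 2
    by (intro exI[of _ "X \<otimes> Z"] exI[of _ "pack X Z \<bullet> (X \<rhd> k)"] exI[of _ "(X \<rhd> k') \<bullet> unpack X Z"]) simp
qed

text \<open>Inserting a unit before or after an existing one gives the same arrow: by interchange
  the two agree after one more \<open>pack0\<close>, which is invertible. This carries the
  coincidence of the left and right unitor at \<one>.\<close>

lemma pack0_swap: "pack0 \<lhd> [\<one>] = \<one> \<rhd> pack0"
proof (rule split_cancel[where K = pack0 and K' = unpack0])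
  show "(pack0 \<lhd> [\<one>]) \<bullet> pack0 = (\<one> \<rhd> pack0) \<bullet> pack0"
    using exchange_atom(2)[of pack0 pack0 "[\<one>]" \<one>] by (simp add: rwhisk_Nil)
qed simp_all

lemma sdual_transport_left:
  assumes d: "sdual P Q e c" and h: "h \<in> hom C Q Q'" "iso C h"
  shows "sdual P Q' (e \<bullet> (J (inv_arr C h) \<lhd> [P])) ((P \<rhd> J h) \<bullet> c)"
proof -
  note d' = sdualD[OF d]
  have h': "h \<in> arrs C" "src C h = Q" "tgt C h = Q'" using h by (auto simp: in_hom)
  have Q': "Q' \<in> objs C" using h' by auto
  have hh: "(J (inv_arr C h) \<lhd> zs) \<bullet> (J h \<lhd> zs) = sid (Q # zs)" "(J h \<lhd> zs) \<bullet> (J (inv_arr C h) \<lhd> zs) = sid (Q' # zs)" for zs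
    using h h' d' Q' by (simp_all flip: J_cmp_tail)
  have 1: "(P \<rhd> (e \<bullet> (J (inv_arr C h) \<lhd> [P]))) \<bullet> (((P \<rhd> J h) \<bullet> c) \<lhd> [P]) = sid [P]"
    using hh(1)[of "[P]", THEN whisk_cong(3), of P "c \<lhd> [P]"] d'(9)[of "[]"] d'(1-8) by (simp add: rwhisk_Nil)
  have "((e \<bullet> (J (inv_arr C h) \<lhd> [P])) \<lhd> [Q']) \<bullet> (Q' \<rhd> ((P \<rhd> J h) \<bullet> c))
    = (e \<lhd> [Q']) \<bullet> (J (inv_arr C h) \<lhd> [P, Q']) \<bullet> (Q' \<rhd> ((P \<rhd> J h) \<bullet> c))"
    by simp
  also have "(J (inv_arr C h) \<lhd> [P, Q']) \<bullet> (Q' \<rhd> ((P \<rhd> J h) \<bullet> c)) = (Q \<rhd> ((P \<rhd> J h) \<bullet> c)) \<bullet> (J (inv_arr C h) \<lhd> [])"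
    using exchange_atom(5)[of "J (inv_arr C h)" "(P \<rhd> J h) \<bullet> c" "[P, Q']" Q' Q] h h' d'(1-8) by simp
  also have "(e \<lhd> [Q']) \<bullet> (Q \<rhd> ((P \<rhd> J h) \<bullet> c)) \<bullet> (J (inv_arr C h) \<lhd> [])
    = ((e \<lhd> [Q']) \<bullet> (Q \<rhd> P \<rhd> J h)) \<bullet> (Q \<rhd> c) \<bullet> (J (inv_arr C h) \<lhd> [])"
    by simp
  also have "(e \<lhd> [Q']) \<bullet> (Q \<rhd> P \<rhd> J h) = J h \<bullet> (e \<lhd> [Q])"
    using exchange_atom(7)[of e "J h" "[Q']" Q P] h' d'(1-8) by simp
  also have "(J h \<bullet> (e \<lhd> [Q])) \<bullet> (Q \<rhd> c) \<bullet> (J (inv_arr C h) \<lhd> []) = J h \<bullet> J (inv_arr C h)"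
    using d'(10)[of "[]", THEN whisk_cong(1), of "J (inv_arr C h)"] h h' d'(1-8) by (simp add: rwhisk_Nil)
  also have "\<dots> = sid [Q']"
    using hh(2)[of "[]"] h h' by (simp add: rwhisk_Nil)
  finally show ?thesis
    using 1 h h' Q' d'(1-8) by (simp add: sdual_def del: lwhisk_scmp rwhisk_scmp)
qed

lemma sdual_transport_right:
  assumes d: "sdual P Q e c" and g: "g \<in> hom C P P'" "iso C g"
  shows "sdual P' Q (e \<bullet> (Q \<rhd> J (inv_arr C g))) ((J g \<lhd> [Q]) \<bullet> c)"
proof -
  note d' = sdualD[OF d]
  have g': "g \<in> arrs C" "src C g = P" "tgt C g = P'" using g by (auto simp: in_hom)
  have P': "P' \<in> objs C" using g' by auto
  have gg: "J (inv_arr C g) \<bullet> J g = sid [P]" "J g \<bullet> J (inv_arr C g) = sid [P']"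
    using g g' d' P' by (simp_all flip: J_cmp)
  have 2: "((e \<bullet> (Q \<rhd> J (inv_arr C g))) \<lhd> [Q]) \<bullet> (Q \<rhd> ((J g \<lhd> [Q]) \<bullet> c)) = sid [Q]"
    using gg(1)[THEN with_tail, of "[Q]", THEN whisk_cong(3), of Q "Q \<rhd> c"] d'(10)[of "[]"] d'(1-8)
    by (simp add: rwhisk_Nil)
  have "(P' \<rhd> (e \<bullet> (Q \<rhd> J (inv_arr C g)))) \<bullet> (((J g \<lhd> [Q]) \<bullet> c) \<lhd> [P'])
    = ((P' \<rhd> (e \<bullet> (Q \<rhd> J (inv_arr C g)))) \<bullet> (J g \<lhd> [Q, P'])) \<bullet> (c \<lhd> [P'])"
    by simp
  also have "(P' \<rhd> (e \<bullet> (Q \<rhd> J (inv_arr C g)))) \<bullet> (J g \<lhd> [Q, P']) = (J g \<lhd> []) \<bullet> (P \<rhd> (e \<bullet> (Q \<rhd> J (inv_arr C g))))"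
    using rex_J[of g "e \<bullet> (Q \<rhd> J (inv_arr C g))" P' "[Q, P']"] g g' d'(1-8) by simp
  also have "((J g \<lhd> []) \<bullet> (P \<rhd> (e \<bullet> (Q \<rhd> J (inv_arr C g))))) \<bullet> (c \<lhd> [P'])
    = (J g \<lhd> []) \<bullet> (P \<rhd> e) \<bullet> ((P \<rhd> Q \<rhd> J (inv_arr C g)) \<bullet> (c \<lhd> [P']))"
    by simp
  also have "(P \<rhd> Q \<rhd> J (inv_arr C g)) \<bullet> (c \<lhd> [P']) = (c \<lhd> [P]) \<bullet> J (inv_arr C g)"
    using exchange_atom(3)[of c "J (inv_arr C g)" "[P]" P Q] g g' d'(1-8) by simp
  also have "(J g \<lhd> []) \<bullet> (P \<rhd> e) \<bullet> (c \<lhd> [P]) \<bullet> J (inv_arr C g) = sid [P']"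
    using d'(9)[of "[]", THEN whisk_cong(1), of "J (inv_arr C g)"] gg(2) g g' d'(1-8) by (simp add: rwhisk_Nil)
  finally show ?thesis
    using 2 g g' P' d'(1-8) by (simp add: sdual_def del: lwhisk_scmp rwhisk_scmp)
qed

text \<open>Two objects with the same left dual \<open>Q\<close> are compared by the arrow that
  matches their pairings. The same recipe with the roles exchanged gives \<open>m\<close>, and both
  composites are identities because they preserve a pairing, which determines them.\<close>

lemma sdual_compare_iso:
  assumes d: "sdual P Q e c" and d': "sdual P' Q e' c'" and n: "n \<in> hom C P P'" and en: "e' \<bullet> (Q \<rhd> J n) = e"
  shows "iso C n"
proof -
  note D = sdualD[OF d] and D' = sdualD[OF d']
  obtain m where m: "m \<in> hom C P' P" "J m = (P \<rhd> e') \<bullet> (c \<lhd> [P'])"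
    using J_full[of "(P \<rhd> e') \<bullet> (c \<lhd> [P'])" P' P] D(1-8) D'(1-8) by auto
  have em: "e \<bullet> (Q \<rhd> J m) = e'"
    using bend_left[OF d, of e' "[P']" "[]"] D(1-8) D'(1-8) by (simp add: m(2) rwhisk_Nil)
  have n': "n \<in> arrs C" "src C n = P" "tgt C n = P'" and m': "m \<in> arrs C" "src C m = P'" "tgt C m = P"
    using n m by (auto simp: in_hom)
  have "J (m \<cdot> n) = J (ide C P)"
  proof (rule bend_left_inject[OF d, where ws = "[]"])
    have "(e \<lhd> []) \<bullet> (Q \<rhd> J (m \<cdot> n)) = (e \<bullet> (Q \<rhd> J m)) \<bullet> (Q \<rhd> J n)"
      using n' m' D(1-8) by (simp add: J_cmp rwhisk_Nil)
    then show "(e \<lhd> []) \<bullet> (Q \<rhd> J (m \<cdot> n)) = (e \<lhd> []) \<bullet> (Q \<rhd> J (ide C P))"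
      using en em D(1-8) by (simp add: rwhisk_Nil)
  qed (use n' m' D in simp_all)
  moreover have "J (n \<cdot> m) = J (ide C P')"
  proof (rule bend_left_inject[OF d', where ws = "[]"])
    have "(e' \<lhd> []) \<bullet> (Q \<rhd> J (n \<cdot> m)) = (e' \<bullet> (Q \<rhd> J n)) \<bullet> (Q \<rhd> J m)"
      using n' m' D'(1-8) by (simp add: J_cmp rwhisk_Nil)
    then show "(e' \<lhd> []) \<bullet> (Q \<rhd> J (n \<cdot> m)) = (e' \<lhd> []) \<bullet> (Q \<rhd> J (ide C P'))"
      using en em D'(1-8) by (simp add: rwhisk_Nil)
  qed (use n' m' D' in simp_all)
  ultimately have "m \<cdot> n = ide C P" "n \<cdot> m = ide C P'"
    using J_inject[of "m \<cdot> n" P P "ide C P"] J_inject[of "n \<cdot> m" P' P' "ide C P'"] n' m' D(1) D'(1)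
    by (simp_all add: in_hom)
  then show ?thesis
    using n m isoI by blast
qed

text \<open>On the left-hand side the packings occur in an order to which the rule for the inverse
  associator does not apply; interchanging the packing of \<open>Y\<close> and \<open>X\<close> with
  that of \<open>A\<close> and \<open>B\<close> repairs this. The situation arises for nested right
  evaluations.\<close>

lemma J_inv_assoc_tens_tail:
  assumes "Y \<in> objs C" "X \<in> objs C" "A \<in> objs C" "B \<in> objs C"
  shows "(J (inv_arr C (assoc C (Y \<otimes> X) A B)) \<lhd> zs) \<bullet> (pack (Y \<otimes> X) (A \<otimes> B) \<lhd> zs) \<bullet>
      (pack Y X \<lhd> A \<otimes> B # zs) \<bullet> (Y \<rhd> X \<rhd> pack A B \<lhd> zs)
    = (pack ((Y \<otimes> X) \<otimes> A) B \<lhd> zs) \<bullet> (pack (Y \<otimes> X) A \<lhd> B # zs) \<bullet> (pack Y X \<lhd> A # B # zs)"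
proof (cases "set zs \<subseteq> objs C")
  case True
  have "(pack Y X \<lhd> A \<otimes> B # zs) \<bullet> (Y \<rhd> X \<rhd> pack A B \<lhd> zs) = (Y \<otimes> X \<rhd> pack A B \<lhd> zs) \<bullet> (pack Y X \<lhd> A # B # zs)"
    using pack_exchange[of Y X "pack A B \<lhd> zs" "Y \<otimes> X" "A # B # zs"] assms True by simp
  then show ?thesis
    using J_inv_assoc_tail[of "Y \<otimes> X" A B zs, THEN whisk_cong(1), of "pack Y X \<lhd> A # B # zs"] assms by simp
next
  case False
  \<comment> \<open>If \<open>zs\<close> contains a non-object, both sides are
    \<open>None\<close>.\<close>
  then have "pack Y X \<lhd> A # B # zs = None" "Y \<rhd> X \<rhd> pack A B \<lhd> zs = None"
    using rwhisk_null[of "pack Y X" "A # B # zs"] lwhisk_null[of Y "X \<rhd> pack A B \<lhd> zs"] by auto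
  then show ?thesis
    by (simp add: scmp_def)
qed

end

section \<open>Centralizers of objects\<close>

text \<open>\<open>E V\<close> represents the functor that sends Z to the natural families from V
  \<otimes> P to P \<otimes> Z. Naturality and universality are formulated with words, so neither
  mentions an associator.\<close>

locale centralizer = rigid_category +
  fixes E :: "'a \<Rightarrow> 'a" and d :: "'a \<Rightarrow> 'a \<Rightarrow> ('a, 'b) sarrow"
  assumes E_obj [simp]: "V \<in> objs C \<Longrightarrow> E V \<in> objs C"
    and d_arr [simp]: "V \<in> objs C \<Longrightarrow> P \<in> objs C \<Longrightarrow> sarr (d V P)"
      "V \<in> objs C \<Longrightarrow> P \<in> objs C \<Longrightarrow> sdom (d V P) = [V, P]"
      "V \<in> objs C \<Longrightarrow> P \<in> objs C \<Longrightarrow> scod (d V P) = [P, E V]"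
    and d_nat: "V \<in> objs C \<Longrightarrow> f \<in> arrs C \<Longrightarrow>
      (J f \<lhd> [E V]) \<bullet> d V (src C f) = d V (tgt C f) \<bullet> (V \<rhd> J f)"
    and d_univ: "\<lbrakk>V \<in> objs C; Z \<in> objs C;
       \<And>P. P \<in> objs C \<Longrightarrow> sarr (\<psi> P) \<and> sdom (\<psi> P) = [V, P] \<and> scod (\<psi> P) = [P, Z];
       \<And>f. f \<in> arrs C \<Longrightarrow> (J f \<lhd> [Z]) \<bullet> \<psi> (src C f) = \<psi> (tgt C f) \<bullet> (V \<rhd> J f)\<rbrakk> \<Longrightarrow>
      \<exists>!h. h \<in> hom C (E V) Z \<and> (\<forall>P \<in> objs C. (P \<rhd> J h) \<bullet> d V P = \<psi> P)"
begin

lemma d_nat_tail: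
  "V \<in> objs C \<Longrightarrow> f \<in> arrs C \<Longrightarrow>
    (J f \<lhd> E V # zs) \<bullet> (d V (src C f) \<lhd> zs) = (d V (tgt C f) \<lhd> zs) \<bullet> (V \<rhd> J f \<lhd> zs)"
  using with_tail[OF d_nat, of V f zs] by simp

lemma rex_d:
  "V \<in> objs C \<Longrightarrow> P \<in> objs C \<Longrightarrow> sarr B \<Longrightarrow> X = E V \<Longrightarrow> zs = sdom B \<Longrightarrow>
   (P \<rhd> X \<rhd> B) \<bullet> (d V P \<lhd> zs) = (d V P \<lhd> scod B) \<bullet> (V \<rhd> P \<rhd> B)"
  using exchange_atom(9)[of "d V P" B "scod B" V P P "E V"] by simp

text \<open>The universal property is stable under tensoring with objects on the right. The codomain
  word is contracted to one object; a trailing letter of the domain is bent to the codomain as its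
  left dual, which shortens \<open>zs\<close> by one. Trailing letters are what iterated
  centralizers such as \<open>E (E V)\<close> call for.\<close>

lemma univ_word:
  assumes "V \<in> objs C" "set zs \<subseteq> objs C" "set ws \<subseteq> objs C"
    and "\<And>P. P \<in> objs C \<Longrightarrow> sarr (\<psi> P) \<and> sdom (\<psi> P) = V # P # zs \<and> scod (\<psi> P) = P # ws"
    and "\<And>f. f \<in> arrs C \<Longrightarrow> (J f \<lhd> ws) \<bullet> \<psi> (src C f) = \<psi> (tgt C f) \<bullet> (V \<rhd> J f \<lhd> zs)"
  shows "\<exists>!G. sarr G \<and> sdom G = E V # zs \<and> scod G = ws \<and>
    (\<forall>P \<in> objs C. (P \<rhd> G) \<bullet> (d V P \<lhd> zs) = \<psi> P)"
  using assms
proof (induction zs arbitrary: ws \<psi> rule: rev_induct)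
  case Nil
  note V = Nil(1) and ws = Nil(3) and \<psi> = Nil(4) and nat = Nil(5)
  obtain Z k k' where k: "Z \<in> objs C" "sarr k" "sdom k = ws" "scod k = [Z]"
     "sarr k'" "sdom k' = [Z]" "scod k' = ws" "k' \<bullet> k = sid ws" "k \<bullet> k' = sid [Z]"
    using pack_word[OF ws] by blast
  have "\<exists>!h. h \<in> hom C (E V) Z \<and> (\<forall>P \<in> objs C. (P \<rhd> J h) \<bullet> d V P = (P \<rhd> k) \<bullet> \<psi> P)"
  proof (rule d_univ)
    fix f assume f: "f \<in> arrs C"
    have "(J f \<lhd> [Z]) \<bullet> (src C f \<rhd> k) = (tgt C f \<rhd> k) \<bullet> (J f \<lhd> ws)"
      using rex_J[of f k "tgt C f" ws] f k by simp
    then have "(J f \<lhd> [Z]) \<bullet> (src C f \<rhd> k) \<bullet> \<psi> (src C f) = (tgt C f \<rhd> k) \<bullet> (J f \<lhd> ws) \<bullet> \<psi> (src C f)"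
      by (metis scmp_assoc)
    also have "\<dots> = (tgt C f \<rhd> k) \<bullet> \<psi> (tgt C f) \<bullet> (V \<rhd> J f)"
      using nat[OF f] f by (simp add: rwhisk_Nil)
    finally show "(J f \<lhd> [Z]) \<bullet> (src C f \<rhd> k) \<bullet> \<psi> (src C f) = ((tgt C f \<rhd> k) \<bullet> \<psi> (tgt C f)) \<bullet> (V \<rhd> J f)"
      by simp
  qed (use V k \<psi> in simp_all)
  then obtain h where h: "h \<in> hom C (E V) Z" "\<And>P. P \<in> objs C \<Longrightarrow> (P \<rhd> J h) \<bullet> d V P = (P \<rhd> k) \<bullet> \<psi> P"
    and uniq: "\<And>h'. h' \<in> hom C (E V) Z \<Longrightarrow> (\<And>P. P \<in> objs C \<Longrightarrow> (P \<rhd> J h') \<bullet> d V P = (P \<rhd> k) \<bullet> \<psi> P) \<Longrightarrow> h' = h"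
    by blast
  have kk: "(P \<rhd> k') \<bullet> (P \<rhd> k) \<bullet> A = A" if "P \<in> objs C" "sarr A" "scod A = P # ws" for P A
    using that k(8) by (metis lwhisk_scmp lwhisk_sid scmp_assoc sid_scmp)
  show ?case
  proof (rule ex1I[of _ "k' \<bullet> J h"])
    show "sarr (k' \<bullet> J h) \<and> sdom (k' \<bullet> J h) = [E V] \<and> scod (k' \<bullet> J h) = ws \<and>
      (\<forall>P\<in>objs C. (P \<rhd> (k' \<bullet> J h)) \<bullet> (d V P \<lhd> []) = \<psi> P)"
      using V h k \<psi> kk by (auto simp: in_hom rwhisk_Nil)
  next
    fix G assume G: "sarr G \<and> sdom G = [E V] \<and> scod G = ws \<and> (\<forall>P\<in>objs C. (P \<rhd> G) \<bullet> (d V P \<lhd> []) = \<psi> P)"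
    obtain g where g: "g \<in> hom C (E V) Z" "J g = k \<bullet> G"
      using J_full[of "k \<bullet> G"] G k by auto
    have "g = h"
      using G g V by (intro uniq) (auto simp: rwhisk_Nil)
    then show "G = k' \<bullet> J h"
      using g k G by (metis scmp_assoc sid_scmp)
  qed
next
  case (snoc Y zs)
  note V = snoc(2) and ws = snoc(4) and \<psi> = snoc(5) and nat = snoc(6)
  have Y: "Y \<in> objs C" and zs: "set zs \<subseteq> objs C" using snoc(3) by auto
  define e c where "e = ev_of (ld C Y) Y (evl C Y)" and "c = coev_of Y (ld C Y) (coevl C Y)"
  have du: "sdual Y (ld C Y) e c"
    unfolding e_def c_def by (rule sdual_of_dual_pair[OF left_dual[OF Y]])
  note d' = sdualD(1-8)[OF du]
  \<comment> \<open>The mate of \<open>\<psi> P\<close> in its last letter \<open>Y\<close>: the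
    domain becomes shorter, and \<open>ld C Y\<close> is appended to the codomain.\<close>
  define \<psi>' where "\<psi>' P = (\<psi> P \<lhd> [ld C Y]) \<bullet> lwhisks (V # P # zs) c" for P
  have ex: "\<exists>!G. sarr G \<and> sdom G = E V # zs \<and> scod G = ws @ [ld C Y] \<and>
      (\<forall>P \<in> objs C. (P \<rhd> G) \<bullet> (d V P \<lhd> zs) = \<psi>' P)"
  proof (rule snoc(1)[OF V zs])
    fix f assume f: "f \<in> arrs C"
    have "lwhisks (src C f # zs) c = src C f \<rhd> lwhisks zs c" by simp
    have "(J f \<lhd> (ws @ [ld C Y])) \<bullet> \<psi>' (src C f)
        = (\<psi> (tgt C f) \<lhd> [ld C Y]) \<bullet> (V \<rhd> J f \<lhd> (zs @ [Y, ld C Y])) \<bullet> (V \<rhd> src C f \<rhd> lwhisks zs c)"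
      using with_tail[OF nat[OF f], of "[ld C Y]", THEN whisk_cong(1)] unfolding \<psi>'_def by simp
    also have "(V \<rhd> J f \<lhd> (zs @ [Y, ld C Y])) \<bullet> (V \<rhd> src C f \<rhd> lwhisks zs c)
        = (V \<rhd> tgt C f \<rhd> lwhisks zs c) \<bullet> (V \<rhd> J f \<lhd> zs)"
      using f zs d' by (simp flip: lwhisk_scmp add: rex_J)
    finally show "(J f \<lhd> (ws @ [ld C Y])) \<bullet> \<psi>' (src C f) = \<psi>' (tgt C f) \<bullet> (V \<rhd> J f \<lhd> zs)"
      by (simp add: \<psi>'_def)
  qed (use V Y zs ws \<psi> d' in \<open>auto simp: \<psi>'_def\<close>)
  then obtain G where G: "sarr G" "sdom G = E V # zs" "scod G = ws @ [ld C Y]"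
      "\<And>P. P \<in> objs C \<Longrightarrow> (P \<rhd> G) \<bullet> (d V P \<lhd> zs) = \<psi>' P"
    and uniq: "\<And>G'. sarr G' \<Longrightarrow> sdom G' = E V # zs \<Longrightarrow> scod G' = ws @ [ld C Y] \<Longrightarrow>
      (\<And>P. P \<in> objs C \<Longrightarrow> (P \<rhd> G') \<bullet> (d V P \<lhd> zs) = \<psi>' P) \<Longrightarrow> G' = G"
    by blast
  show ?case
  proof (rule ex1I[of _ "lwhisks ws e \<bullet> (G \<lhd> [Y])"])
    have "(P \<rhd> (lwhisks ws e \<bullet> (G \<lhd> [Y]))) \<bullet> (d V P \<lhd> (zs @ [Y])) = \<psi> P" if P: "P \<in> objs C" for P
    proof -
      have "(P \<rhd> (lwhisks ws e \<bullet> (G \<lhd> [Y]))) \<bullet> (d V P \<lhd> (zs @ [Y]))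
          = lwhisks (P # ws) e \<bullet> (\<psi>' P \<lhd> [Y])"
        using G(4)[OF P, THEN with_tail, of "[Y]"] by simp
      also have "\<dots> = lwhisks (P # ws) e \<bullet> (\<psi> P \<lhd> [ld C Y, Y]) \<bullet> (lwhisks (V # P # zs) c \<lhd> [Y])"
        by (simp add: \<psi>'_def)
      also have "\<dots> = \<psi> P"
        using \<psi>[OF P] by (intro bend_tail_right[OF du]) simp_all
      finally show ?thesis .
    qed
    then show "sarr (lwhisks ws e \<bullet> (G \<lhd> [Y])) \<and> sdom (lwhisks ws e \<bullet> (G \<lhd> [Y])) = E V # zs @ [Y] \<and>
        scod (lwhisks ws e \<bullet> (G \<lhd> [Y])) = ws \<and>
        (\<forall>P\<in>objs C. (P \<rhd> (lwhisks ws e \<bullet> (G \<lhd> [Y]))) \<bullet> (d V P \<lhd> (zs @ [Y])) = \<psi> P)"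
      using G ws Y d' by simp
  next
    fix H assume H: "sarr H \<and> sdom H = E V # zs @ [Y] \<and> scod H = ws \<and>
        (\<forall>P\<in>objs C. (P \<rhd> H) \<bullet> (d V P \<lhd> (zs @ [Y])) = \<psi> P)"
    let ?H = "(H \<lhd> [ld C Y]) \<bullet> lwhisks (E V # zs) c"
    \<comment> \<open>For uniqueness, the mate of any other solution solves the shorter problem,
      hence is \<open>G\<close>, and bending back recovers the solution.\<close>
    have HG: "?H = G"
    proof (rule uniq)
      fix P assume P: "P \<in> objs C"
      have "(d V P \<lhd> (zs @ [Y, ld C Y])) \<bullet> lwhisks (V # P # zs) c = lwhisks (P # E V # zs) c \<bullet> (d V P \<lhd> zs)"
        using exchange[of "d V P" "lwhisks zs c" "zs @ [Y, ld C Y]"] P V zs d' by simp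
      then have "(P \<rhd> ?H) \<bullet> (d V P \<lhd> zs)
          = (((P \<rhd> H) \<bullet> (d V P \<lhd> (zs @ [Y]))) \<lhd> [ld C Y]) \<bullet> lwhisks (V # P # zs) c"
        by simp
      then show "(P \<rhd> ?H) \<bullet> (d V P \<lhd> zs) = \<psi>' P"
        using H P by (simp add: \<psi>'_def)
    qed (use H V zs ws d' in simp_all)
    show "H = lwhisks ws e \<bullet> (G \<lhd> [Y])"
      using bend_tail_right[OF du, of H "E V # zs" ws] H by (simp flip: HG)
  qed
qed

text \<open>Any arrow out of \<open>E V # zs\<close> induces a natural family by composition with
  \<open>d\<close>. For the family of \<open>A\<close>, \<open>univ_word\<close> admits only one
  solution, and both \<open>A\<close> and \<open>B\<close> are solutions.\<close>

lemma centr_eqI: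
  assumes V: "V \<in> objs C" and A: "sarr A" "sdom A = E V # zs" and B: "sarr B" "sdom B = E V # zs" "scod B = scod A"
    and eq: "\<And>P. P \<in> objs C \<Longrightarrow> (P \<rhd> A) \<bullet> (d V P \<lhd> zs) = (P \<rhd> B) \<bullet> (d V P \<lhd> zs)"
  shows "A = B"
proof -
  have zs: "set zs \<subseteq> objs C" "set (scod A) \<subseteq> objs C"
    using sarr_cpt(1,2)[OF A(1)] A(2) by auto
  have ex: "\<exists>!G. sarr G \<and> sdom G = E V # zs \<and> scod G = scod A \<and>
    (\<forall>P \<in> objs C. (P \<rhd> G) \<bullet> (d V P \<lhd> zs) = (P \<rhd> A) \<bullet> (d V P \<lhd> zs))"
  proof (rule univ_word[OF V zs])
    fix f assume f: "f \<in> arrs C"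
    have "(J f \<lhd> scod A) \<bullet> (src C f \<rhd> A) = (tgt C f \<rhd> A) \<bullet> (J f \<lhd> E V # zs)"
      using rex_J[of f A "tgt C f" "E V # zs"] f A by simp
    from this[THEN whisk_cong(1), of "d V (src C f) \<lhd> zs"]
    show "(J f \<lhd> scod A) \<bullet> (src C f \<rhd> A) \<bullet> (d V (src C f) \<lhd> zs)
      = ((tgt C f \<rhd> A) \<bullet> (d V (tgt C f) \<lhd> zs)) \<bullet> (V \<rhd> J f \<lhd> zs)"
      using d_nat_tail[OF V f, of zs] by simp
  qed (use V A zs in auto)
  show ?thesis
    by (rule trans[OF the1_equality[OF ex, symmetric] the1_equality[OF ex]]) (use A B eq in simp_all)
qed

lemma J_centr_eqI:
  assumes V: "V \<in> objs C" and fg: "f \<in> hom C (E V) Z" "g \<in> hom C (E V) Z"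
    and eq: "\<And>X. X \<in> objs C \<Longrightarrow>
      (X \<rhd> J f \<lhd> []) \<bullet> (d V X \<lhd> []) = (X \<rhd> J g \<lhd> []) \<bullet> (d V X \<lhd> [])"
  shows "f = g"
proof (rule J_inject[OF fg])
  show "J f = J g"
    by (rule centr_eqI[OF V, of _ "[]"]) (use fg eq in \<open>auto simp: in_hom rwhisk_Nil\<close>)
qed

text \<open>The outer centralizer is tested at \<open>Y\<close> first. The inner one then stands
  before the letter \<open>Y\<close>, and \<open>centr_eqI\<close> is applied with that letter as
  trailing word.\<close>

lemma J_centr_eqI2:
  assumes V: "V \<in> objs C" and fg: "f \<in> hom C (E (E V)) Z" "g \<in> hom C (E (E V)) Z"
    and eq: "\<And>X Y. X \<in> objs C \<Longrightarrow> Y \<in> objs C \<Longrightarrow>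
      (X \<rhd> Y \<rhd> J f \<lhd> []) \<bullet> (X \<rhd> d (E V) Y \<lhd> []) \<bullet> (d V X \<lhd> [Y])
      = (X \<rhd> Y \<rhd> J g \<lhd> []) \<bullet> (X \<rhd> d (E V) Y \<lhd> []) \<bullet> (d V X \<lhd> [Y])"
  shows "f = g"
proof (rule J_centr_eqI[OF E_obj[OF V] fg])
  fix Y assume Y: "Y \<in> objs C"
  show "(Y \<rhd> J f \<lhd> []) \<bullet> (d (E V) Y \<lhd> []) = (Y \<rhd> J g \<lhd> []) \<bullet> (d (E V) Y \<lhd> [])"
    by (rule centr_eqI[OF V, of _ "[Y]"]) (use V Y fg eq in \<open>auto simp: in_hom\<close>)
qed

lemma J_centr_eqI3:
  assumes V: "V \<in> objs C" and fg: "f \<in> hom C (E (E (E V))) Z" "g \<in> hom C (E (E (E V))) Z"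
    and eq: "\<And>X Y W. X \<in> objs C \<Longrightarrow> Y \<in> objs C \<Longrightarrow> W \<in> objs C \<Longrightarrow>
      (X \<rhd> Y \<rhd> W \<rhd> J f \<lhd> []) \<bullet> (X \<rhd> Y \<rhd> d (E (E V)) W \<lhd> []) \<bullet> (X \<rhd> d (E V) Y \<lhd> [W]) \<bullet> (d V X \<lhd> [Y, W])
      = (X \<rhd> Y \<rhd> W \<rhd> J g \<lhd> []) \<bullet> (X \<rhd> Y \<rhd> d (E (E V)) W \<lhd> []) \<bullet> (X \<rhd> d (E V) Y \<lhd> [W]) \<bullet> (d V X \<lhd> [Y, W])"
  shows "f = g"
proof (rule J_centr_eqI2[OF E_obj[OF V] fg])
  fix Y W assume Y: "Y \<in> objs C" "W \<in> objs C"
  show "(Y \<rhd> W \<rhd> J f \<lhd> []) \<bullet> (Y \<rhd> d (E (E V)) W \<lhd> []) \<bullet> (d (E V) Y \<lhd> [W])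
    = (Y \<rhd> W \<rhd> J g \<lhd> []) \<bullet> (Y \<rhd> d (E (E V)) W \<lhd> []) \<bullet> (d (E V) Y \<lhd> [W])"
    by (rule centr_eqI[OF V, of _ "[Y, W]"]) (use V Y fg eq in \<open>auto simp: in_hom\<close>)
qed

end

text \<open>The equations \<open>ar_d\<close>, \<open>mult_d\<close>, \<open>comul_d\<close> and
  \<open>counit_d\<close> have at most one solution each by universality of \<open>d\<close>, and
  \<open>unit_d\<close> determines the unit because \<open>pack0\<close> is invertible. In terms of
  letters passing each other: the multiplication lets a tensor product pass factor by factor, the
  comultiplication lets X pass V first and then U, and unit and counit belong to trivial
  passages.\<close>

locale centralizer_bimonad = centralizer C "m_ob T" d
  for C :: "('o, 'm, 'x) rigidcat_scheme" (structure) and T :: "('o, 'm) bimonad_data" and d +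
  assumes ar_arr [simp]: "f \<in> arrs C \<Longrightarrow> m_ar T f \<in> arrs C"
      "f \<in> arrs C \<Longrightarrow> src C (m_ar T f) = m_ob T (src C f)"
      "f \<in> arrs C \<Longrightarrow> tgt C (m_ar T f) = m_ob T (tgt C f)"
    and mult_arr [simp]: "V \<in> objs C \<Longrightarrow> m_mult T V \<in> arrs C"
      "V \<in> objs C \<Longrightarrow> src C (m_mult T V) = m_ob T (m_ob T V)"
      "V \<in> objs C \<Longrightarrow> tgt C (m_mult T V) = m_ob T V"
    and unit_arr [simp]: "V \<in> objs C \<Longrightarrow> m_unit T V \<in> arrs C"
      "V \<in> objs C \<Longrightarrow> src C (m_unit T V) = V"
      "V \<in> objs C \<Longrightarrow> tgt C (m_unit T V) = m_ob T V"
    and comul_arr [simp]: "U \<in> objs C \<Longrightarrow> V \<in> objs C \<Longrightarrow> m_comul T U V \<in> arrs C"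
      "U \<in> objs C \<Longrightarrow> V \<in> objs C \<Longrightarrow> src C (m_comul T U V) = m_ob T (U \<otimes> V)"
      "U \<in> objs C \<Longrightarrow> V \<in> objs C \<Longrightarrow> tgt C (m_comul T U V) = m_ob T U \<otimes> m_ob T V"
    and counit_arr [simp]: "m_counit T \<in> arrs C" "src C (m_counit T) = m_ob T \<one>" "tgt C (m_counit T) = \<one>"
    and ar_d: "f \<in> arrs C \<Longrightarrow> P \<in> objs C \<Longrightarrow>
      (P \<rhd> J (m_ar T f)) \<bullet> d (src C f) P = d (tgt C f) P \<bullet> (J f \<lhd> [P])"
    and mult_d: "V \<in> objs C \<Longrightarrow> X \<in> objs C \<Longrightarrow> Y \<in> objs C \<Longrightarrow>
      (X \<rhd> Y \<rhd> J (m_mult T V)) \<bullet> (X \<rhd> d (m_ob T V) Y) \<bullet> (d V X \<lhd> [Y])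
      = (unpack X Y \<lhd> [m_ob T V]) \<bullet> d V (X \<otimes> Y) \<bullet> (V \<rhd> pack X Y)"
    and unit_d: "V \<in> objs C \<Longrightarrow> d V \<one> \<bullet> (V \<rhd> pack0) = (pack0 \<lhd> [m_ob T V]) \<bullet> J (m_unit T V)"
    and comul_d: "U \<in> objs C \<Longrightarrow> V \<in> objs C \<Longrightarrow> X \<in> objs C \<Longrightarrow>
      (X \<rhd> J (m_comul T U V)) \<bullet> d (U \<otimes> V) X \<bullet> (pack U V \<lhd> [X])
      = (X \<rhd> pack (m_ob T U) (m_ob T V)) \<bullet> (d U X \<lhd> [m_ob T V]) \<bullet> (U \<rhd> d V X)"
    and counit_d: "X \<in> objs C \<Longrightarrow> (X \<rhd> J (m_counit T)) \<bullet> d \<one> X \<bullet> (pack0 \<lhd> [X]) = X \<rhd> pack0"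
begin

lemma ar_tail:
  "f \<in> arrs C \<Longrightarrow> P \<in> objs C \<Longrightarrow> V = src C f \<Longrightarrow>
      (P \<rhd> J (m_ar T f) \<lhd> zs) \<bullet> (d V P \<lhd> zs) = (d (tgt C f) P \<lhd> zs) \<bullet> (J f \<lhd> P # zs)"
  using ar_d[of f P, THEN with_tail, of zs] by simp

lemma mult_tail: "V \<in> objs C \<Longrightarrow> X \<in> objs C \<Longrightarrow> Y \<in> objs C \<Longrightarrow> EV = m_ob T V \<Longrightarrow>
      (X \<rhd> Y \<rhd> J (m_mult T V) \<lhd> zs) \<bullet> (X \<rhd> d EV Y \<lhd> zs) \<bullet> (d V X \<lhd> Y # zs)
      = (unpack X Y \<lhd> m_ob T V # zs) \<bullet> (d V (X \<otimes> Y) \<lhd> zs) \<bullet> (V \<rhd> pack X Y \<lhd> zs)"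
  using mult_d[of V X Y, THEN with_tail, of zs] by simp

lemma unit_tail: "V \<in> objs C \<Longrightarrow>
    (d V \<one> \<lhd> zs) \<bullet> (V \<rhd> pack0 \<lhd> zs) = (pack0 \<lhd> m_ob T V # zs) \<bullet> (J (m_unit T V) \<lhd> zs)"
  using unit_d[of V, THEN with_tail, of zs] by simp

lemma comul_tail: "U \<in> objs C \<Longrightarrow> V \<in> objs C \<Longrightarrow> X \<in> objs C \<Longrightarrow> UV = U \<otimes> V \<Longrightarrow>
      (X \<rhd> J (m_comul T U V) \<lhd> zs) \<bullet> (d UV X \<lhd> zs) \<bullet> (pack U V \<lhd> X # zs)
      = (X \<rhd> pack (m_ob T U) (m_ob T V) \<lhd> zs) \<bullet> (d U X \<lhd> m_ob T V # zs) \<bullet> (U \<rhd> d V X \<lhd> zs)"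
  using comul_d[of U V X, THEN with_tail, of zs] by simp

lemma counit_tail: "X \<in> objs C \<Longrightarrow>
    (X \<rhd> J (m_counit T) \<lhd> zs) \<bullet> (d \<one> X \<lhd> zs) \<bullet> (pack0 \<lhd> X # zs) = X \<rhd> pack0 \<lhd> zs"
  using counit_d[of X, THEN with_tail, of zs] by simp

lemmas str0 = ar_tail mult_tail unit_tail comul_tail counit_tail

lemmas str = str0 str0[THEN whisk_cong(1), unfolded whisk_nf]
  str0[THEN whisk_cong(2), unfolded whisk_nf] str0[THEN whisk_cong(3), unfolded whisk_nf]
  str0[THEN whisk_cong(4), unfolded whisk_nf] str0[THEN whisk_cong(5), unfolded whisk_nf]

lemmas rexd = rex_d rex_d[THEN whisk_cong(1), unfolded whisk_nf]
  rex_d[THEN whisk_cong(2), unfolded whisk_nf] rex_d[THEN whisk_cong(3), unfolded whisk_nf]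
  rex_d[THEN whisk_cong(4), unfolded whisk_nf] rex_d[THEN whisk_cong(5), unfolded whisk_nf]

text \<open>The method for all axioms between arrows out of a value of \<open>m_ob T\<close>: both
  sides are composed with \<open>d\<close>, and the defining equations turn the structure maps into
  expressions in \<open>d\<close> and packings.\<close>

lemma endofunctor: "endofunctor C T"
  unfolding endofunctor_def
proof (intro conjI allI ballI impI)
  fix V assume V: "V \<in> objs C"
  then show "m_ob T V \<in> objs C" by simp
  show "m_ar T (ide C V) = ide C (m_ob T V)"
    by (rule J_centr_eqI[OF V]) (use V in \<open>simp_all add: in_hom str\<close>)
next
  fix X Y Z f g assume "f \<in> hom C X Y \<and> g \<in> hom C Y Z"
  then show "m_ar T (g \<cdot> f) = m_ar T g \<cdot> m_ar T f"
    by (intro J_centr_eqI[of X _ "m_ob T Z"]) (auto simp: in_hom str J_cmp)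
qed (auto simp: in_hom)

lemma comul_natural:
  assumes "f \<in> arrs C" "g \<in> arrs C"
  shows "m_comul T (tgt C f) (tgt C g) \<cdot> m_ar T (f \<boxtimes> g)
    = (m_ar T f \<boxtimes> m_ar T g) \<cdot> m_comul T (src C f) (src C g)"
proof (rule J_centr_eqI)
  fix X assume X: "X \<in> objs C"
  show "(X \<rhd> J (m_comul T (tgt C f) (tgt C g) \<cdot> m_ar T (f \<boxtimes> g)) \<lhd> []) \<bullet> (d (src C f \<otimes> src C g) X \<lhd> [])
     = (X \<rhd> J ((m_ar T f \<boxtimes> m_ar T g) \<cdot> m_comul T (src C f) (src C g)) \<lhd> []) \<bullet> (d (src C f \<otimes> src C g) X \<lhd> [])"
    by (rule pack_cancel[of "src C f" "src C g" _ "[X]"]) (use X assms in \<open>simp_all add: push rex str rexd\<close>)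
qed (use assms in \<open>simp_all add: in_hom\<close>)

lemma comul_coassoc:
  assumes "U \<in> objs C" "V \<in> objs C" "W \<in> objs C"
  shows "assoc C (m_ob T U) (m_ob T V) (m_ob T W) \<cdot>
            (m_comul T U V \<boxtimes> ide C (m_ob T W)) \<cdot> m_comul T (U \<otimes> V) W
          = (ide C (m_ob T U) \<boxtimes> m_comul T V W) \<cdot> m_comul T U (V \<otimes> W) \<cdot> m_ar T (assoc C U V W)"
    (is "?l = ?r")
proof (rule J_centr_eqI)
  fix X assume X: "X \<in> objs C"
  show "(X \<rhd> J ?l \<lhd> []) \<bullet> (d ((U \<otimes> V) \<otimes> W) X \<lhd> []) = (X \<rhd> J ?r \<lhd> []) \<bullet> (d ((U \<otimes> V) \<otimes> W) X \<lhd> [])"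
    by (rule pack_cancel[of "U \<otimes> V" W _ "[X]"], use X assms in simp_all,
        rule pack_cancel[of U V _ "[W, X]"]) (use X assms in \<open>simp_all add: push rex str rexd\<close>)
qed (use assms in \<open>simp_all add: in_hom\<close>)

lemma comul_counit:
  assumes "V \<in> objs C"
  shows "lun C (m_ob T V) \<cdot> (m_counit T \<boxtimes> ide C (m_ob T V)) \<cdot> m_comul T \<one> V = m_ar T (lun C V)"
      (is "?l = ?r")
    and "run C (m_ob T V) \<cdot> (ide C (m_ob T V) \<boxtimes> m_counit T) \<cdot> m_comul T V \<one> = m_ar T (run C V)"
      (is "?l' = ?r'")
proof -
  show "?l = ?r"
  proof (rule J_centr_eqI)
    fix X assume X: "X \<in> objs C"
    show "(X \<rhd> J ?l \<lhd> []) \<bullet> (d (\<one> \<otimes> V) X \<lhd> []) = (X \<rhd> J ?r \<lhd> []) \<bullet> (d (\<one> \<otimes> V) X \<lhd> [])"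
      by (rule pack_cancel[of \<one> V _ "[X]"], use X assms in simp_all,
        rule pack0_cancel[of _ "[V, X]"]) (use X assms in \<open>simp_all add: push rex str rexd\<close>)
  qed (use assms in \<open>simp_all add: in_hom\<close>)
  show "?l' = ?r'"
  proof (rule J_centr_eqI)
    fix X assume X: "X \<in> objs C"
    have "(X \<rhd> J ?l' \<lhd> []) \<bullet> (d (V \<otimes> \<one>) X \<lhd> []) \<bullet> (pack V \<one> \<lhd> [X]) \<bullet> (V \<rhd> pack0 \<lhd> [X])
      = (X \<rhd> J (run C (m_ob T V)) \<lhd> []) \<bullet> (X \<rhd> pack (m_ob T V) \<one> \<lhd> []) \<bullet> (d V X \<lhd> [\<one>]) \<bullet> (V \<rhd> X \<rhd> pack0 \<lhd> [])"
      using X assms by (simp add: push rex str rexd)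
    \<comment> \<open>Interchange is used against the orientation of \<open>rex_d\<close>:
      \<open>pack0\<close> has to pass \<open>d\<close> in order to meet the right unitor.\<close>
    also have "\<dots> = (X \<rhd> J (run C (m_ob T V)) \<lhd> []) \<bullet> (X \<rhd> pack (m_ob T V) \<one> \<lhd> []) \<bullet> (X \<rhd> m_ob T V \<rhd> pack0 \<lhd> []) \<bullet> (d V X \<lhd> [])"
      using X assms rex_d[of V X "pack0 \<lhd> []" "m_ob T V" "[]"] by simp
    also have "\<dots> = (X \<rhd> J ?r' \<lhd> []) \<bullet> (d (V \<otimes> \<one>) X \<lhd> []) \<bullet> (pack V \<one> \<lhd> [X]) \<bullet> (V \<rhd> pack0 \<lhd> [X])"
      using X assms by (simp add: push str)
    finally have "((X \<rhd> J ?l' \<lhd> []) \<bullet> (d (V \<otimes> \<one>) X \<lhd> []) \<bullet> (pack V \<one> \<lhd> [X])) \<bullet> (V \<rhd> pack0 \<lhd> [X])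
        = ((X \<rhd> J ?r' \<lhd> []) \<bullet> (d (V \<otimes> \<one>) X \<lhd> []) \<bullet> (pack V \<one> \<lhd> [X])) \<bullet> (V \<rhd> pack0 \<lhd> [X])"
      by simp
    then have "(X \<rhd> J ?l' \<lhd> []) \<bullet> (d (V \<otimes> \<one>) X \<lhd> []) \<bullet> (pack V \<one> \<lhd> [X])
        = (X \<rhd> J ?r' \<lhd> []) \<bullet> (d (V \<otimes> \<one>) X \<lhd> []) \<bullet> (pack V \<one> \<lhd> [X])"
      by (rule pack0_cancel_inner[rotated -1]) (use X assms in simp_all)
    then have "((X \<rhd> J ?l' \<lhd> []) \<bullet> (d (V \<otimes> \<one>) X \<lhd> [])) \<bullet> (pack V \<one> \<lhd> [X])
        = ((X \<rhd> J ?r' \<lhd> []) \<bullet> (d (V \<otimes> \<one>) X \<lhd> [])) \<bullet> (pack V \<one> \<lhd> [X])"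
      by (simp only: scmp_assoc)
    then show "(X \<rhd> J ?l' \<lhd> []) \<bullet> (d (V \<otimes> \<one>) X \<lhd> []) = (X \<rhd> J ?r' \<lhd> []) \<bullet> (d (V \<otimes> \<one>) X \<lhd> [])"
      by (rule pack_cancel[rotated -1]) (use X assms in simp_all)
  qed (use assms in \<open>simp_all add: in_hom\<close>)
qed

lemma mult_natural:
  assumes "f \<in> arrs C"
  shows "m_mult T (tgt C f) \<cdot> m_ar T (m_ar T f) = m_ar T f \<cdot> m_mult T (src C f)"
    (is "?l = ?r")
proof (rule J_centr_eqI2)
  fix X Y assume X: "X \<in> objs C" "Y \<in> objs C"
  show "(X \<rhd> Y \<rhd> J ?l \<lhd> []) \<bullet> (X \<rhd> d (m_ob T (src C f)) Y \<lhd> []) \<bullet> (d (src C f) X \<lhd> [Y])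
      = (X \<rhd> Y \<rhd> J ?r \<lhd> []) \<bullet> (X \<rhd> d (m_ob T (src C f)) Y \<lhd> []) \<bullet> (d (src C f) X \<lhd> [Y])"
    using X assms by (simp add: push rex str rexd)
qed (use assms in \<open>simp_all add: in_hom\<close>)

lemma mult_comul:
  assumes "U \<in> objs C" "V \<in> objs C"
  shows "m_comul T U V \<cdot> m_mult T (U \<otimes> V)
    = (m_mult T U \<boxtimes> m_mult T V) \<cdot> m_comul T (m_ob T U) (m_ob T V) \<cdot> m_ar T (m_comul T U V)"
    (is "?l = ?r")
proof (rule J_centr_eqI2)
  fix X Y assume X: "X \<in> objs C" "Y \<in> objs C"
  show "(X \<rhd> Y \<rhd> J ?l \<lhd> []) \<bullet> (X \<rhd> d (m_ob T (U \<otimes> V)) Y \<lhd> []) \<bullet> (d (U \<otimes> V) X \<lhd> [Y])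
      = (X \<rhd> Y \<rhd> J ?r \<lhd> []) \<bullet> (X \<rhd> d (m_ob T (U \<otimes> V)) Y \<lhd> []) \<bullet> (d (U \<otimes> V) X \<lhd> [Y])"
    by (rule pack_cancel[of U V _ "[X, Y]"]) (use X assms in \<open>simp_all add: push rex str rexd\<close>)
qed (use assms in \<open>simp_all add: in_hom\<close>)

lemma mult_counit: "m_counit T \<cdot> m_mult T \<one> = m_counit T \<cdot> m_ar T (m_counit T)" (is "?l = ?r")
proof (rule J_centr_eqI2)
  fix X Y assume X: "X \<in> objs C" "Y \<in> objs C"
  show "(X \<rhd> Y \<rhd> J ?l \<lhd> []) \<bullet> (X \<rhd> d (m_ob T \<one>) Y \<lhd> []) \<bullet> (d \<one> X \<lhd> [Y])
      = (X \<rhd> Y \<rhd> J ?r \<lhd> []) \<bullet> (X \<rhd> d (m_ob T \<one>) Y \<lhd> []) \<bullet> (d \<one> X \<lhd> [Y])"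
    by (rule pack0_cancel[of _ "[X, Y]"]) (use X in \<open>simp_all add: push rex str rexd\<close>)
qed (simp_all add: in_hom)

text \<open>The domain is not a value of \<open>m_ob T\<close>, so \<open>d\<close> cannot serve as
  a test. Instead a unit letter is put in front of the codomain: by \<open>unit_d\<close> this turns
  \<open>m_unit T\<close> into \<open>d\<close> at \<one>, and \<open>pack0\<close> is cancelled
  afterwards. The axioms \<open>unit_comul\<close> and \<open>unit_counit\<close> are treated
  likewise.\<close>

lemma unit_natural:
  assumes "f \<in> arrs C"
  shows "m_unit T (tgt C f) \<cdot> f = m_ar T f \<cdot> m_unit T (src C f)" (is "?l = ?r")
proof (rule J_inject)
  have "(pack0 \<lhd> [m_ob T (tgt C f)]) \<bullet> (J ?l \<lhd> []) = (pack0 \<lhd> [m_ob T (tgt C f)]) \<bullet> (J ?r \<lhd> [])"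
  proof -
    have "(pack0 \<lhd> [m_ob T (tgt C f)]) \<bullet> (J ?l \<lhd> []) = (d (tgt C f) \<one> \<lhd> []) \<bullet> (tgt C f \<rhd> pack0 \<lhd> []) \<bullet> (J f \<lhd> [])"
      using assms by (simp add: push str)
    also have "\<dots> = (\<one> \<rhd> J (m_ar T f) \<lhd> []) \<bullet> (d (src C f) \<one> \<lhd> []) \<bullet> (src C f \<rhd> pack0 \<lhd> [])"
      using assms by (simp add: push rex ar_tail[THEN whisk_cong(1), unfolded whisk_nf])
    also have "\<dots> = (pack0 \<lhd> [m_ob T (tgt C f)]) \<bullet> (J ?r \<lhd> [])"
      using assms by (simp add: unit_tail push)
    finally show ?thesis .
  qed
  then have "J ?l \<lhd> [] = J ?r \<lhd> []"
    by (rule pack0_cancel_left[rotated -1]) (use assms in simp_all)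
  then show "J ?l = J ?r"
    using assms by (simp add: rwhisk_Nil)
qed (use assms in \<open>simp_all add: in_hom\<close>)

lemma unit_comul:
  assumes "U \<in> objs C" "V \<in> objs C"
  shows "m_comul T U V \<cdot> m_unit T (U \<otimes> V) = m_unit T U \<boxtimes> m_unit T V" (is "?l = ?r")
proof (rule J_inject)
  let ?p = "pack0 \<lhd> [m_ob T U \<otimes> m_ob T V]"
  have "?p \<bullet> (J ?l \<lhd> []) \<bullet> (pack U V \<lhd> []) = ?p \<bullet> (J ?r \<lhd> []) \<bullet> (pack U V \<lhd> [])"
  proof -
    have "?p \<bullet> (J ?l \<lhd> []) \<bullet> (pack U V \<lhd> [])
      = (\<one> \<rhd> J (m_comul T U V) \<lhd> []) \<bullet> (pack0 \<lhd> [m_ob T (U \<otimes> V)]) \<bullet> (J (m_unit T (U \<otimes> V)) \<lhd> []) \<bullet> (pack U V \<lhd> [])"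
      using assms by (simp add: push)
    also have "\<dots> = (\<one> \<rhd> J (m_comul T U V) \<lhd> []) \<bullet> (d (U \<otimes> V) \<one> \<lhd> []) \<bullet> (U \<otimes> V \<rhd> pack0 \<lhd> []) \<bullet> (pack U V \<lhd> [])"
      using assms unit_tail[of "U \<otimes> V" "[]", THEN whisk_cong(1), of "pack U V \<lhd> []"] by simp
    also have "\<dots> = ?p \<bullet> (J ?r \<lhd> []) \<bullet> (pack U V \<lhd> [])"
      using assms by (simp add: push rex str rexd)
    finally show ?thesis .
  qed
  then have "(J ?l \<lhd> []) \<bullet> (pack U V \<lhd> []) = (J ?r \<lhd> []) \<bullet> (pack U V \<lhd> [])"
    by (rule pack0_cancel_left[rotated -1]) (use assms in simp_all)
  then have "J ?l \<lhd> [] = J ?r \<lhd> []"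
    by (rule pack_cancel[rotated -1]) (use assms in simp_all)
  then show "J ?l = J ?r"
    using assms by (simp add: rwhisk_Nil)
qed (use assms in \<open>simp_all add: in_hom\<close>)

lemma unit_counit: "m_counit T \<cdot> m_unit T \<one> = ide C \<one>" (is "?l = ?r")
proof (rule J_inject)
  have "(pack0 \<lhd> [\<one>]) \<bullet> (J ?l \<lhd> []) \<bullet> (pack0 \<lhd> []) = (pack0 \<lhd> [\<one>]) \<bullet> (J ?r \<lhd> []) \<bullet> (pack0 \<lhd> [])"
  proof -
    have "(pack0 \<lhd> [\<one>]) \<bullet> (J ?l \<lhd> []) \<bullet> (pack0 \<lhd> [])
      = (\<one> \<rhd> J (m_counit T) \<lhd> []) \<bullet> (pack0 \<lhd> [m_ob T \<one>]) \<bullet> (J (m_unit T \<one>) \<lhd> []) \<bullet> (pack0 \<lhd> [])"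
      by (simp add: push)
    also have "\<dots> = (\<one> \<rhd> J (m_counit T) \<lhd> []) \<bullet> (d \<one> \<one> \<lhd> []) \<bullet> (\<one> \<rhd> pack0 \<lhd> []) \<bullet> (pack0 \<lhd> [])"
      using unit_tail[of \<one> "[]", THEN whisk_cong(1), of "pack0 \<lhd> []"] by simp
    also have "\<dots> = (pack0 \<lhd> [\<one>]) \<bullet> (J ?r \<lhd> []) \<bullet> (pack0 \<lhd> [])"
      by (simp add: push rex str rexd)
    finally show ?thesis .
  qed
  then have "(J ?l \<lhd> []) \<bullet> (pack0 \<lhd> []) = (J ?r \<lhd> []) \<bullet> (pack0 \<lhd> [])"
    by (rule pack0_cancel_left[rotated -1]) simp_all
  then have "J ?l \<lhd> [] = J ?r \<lhd> []"
    by (rule pack0_cancel[rotated -1]) simp_all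
  then show "J ?l = J ?r"
    by (simp add: rwhisk_Nil)
qed (simp_all add: in_hom)

text \<open>Naturality of \<open>d\<close> along the associator, with both bracketings unpacked to
  the same three letters. It carries the associativity of the multiplication.\<close>

lemma d_assoc:
  assumes "V \<in> objs C" "X \<in> objs C" "Y \<in> objs C" "Z \<in> objs C"
  shows "(unpack X Y \<lhd> [Z, m_ob T V]) \<bullet> (unpack (X \<otimes> Y) Z \<lhd> [m_ob T V]) \<bullet> (d V ((X \<otimes> Y) \<otimes> Z) \<lhd> []) \<bullet>
      (V \<rhd> pack (X \<otimes> Y) Z \<lhd> []) \<bullet> (V \<rhd> pack X Y \<lhd> [Z])
    = (X \<rhd> unpack Y Z \<lhd> [m_ob T V]) \<bullet> (unpack X (Y \<otimes> Z) \<lhd> [m_ob T V]) \<bullet> (d V (X \<otimes> (Y \<otimes> Z)) \<lhd> []) \<bullet>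
      (V \<rhd> pack X (Y \<otimes> Z) \<lhd> []) \<bullet> (V \<rhd> X \<rhd> pack Y Z \<lhd> [])" (is "?l = ?r")
proof -
  have u: "(X \<rhd> unpack Y Z \<lhd> zs) \<bullet> (unpack X (Y \<otimes> Z) \<lhd> zs) \<bullet> (J (assoc C X Y Z) \<lhd> zs)
      = (unpack X Y \<lhd> Z # zs) \<bullet> (unpack (X \<otimes> Y) Z \<lhd> zs)" (is "?a = ?b") for zs
  proof -
    have "(X \<rhd> unpack Y Z) \<bullet> unpack X (Y \<otimes> Z) \<bullet> J (assoc C X Y Z) = (unpack X Y \<lhd> [Z]) \<bullet> unpack (X \<otimes> Y) Z"
      using assms pentagon[of X Y Z] by (intro sarr_eqI) auto
    from with_tail[OF this, of zs] show ?thesis by simp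
  qed
  have "?r = (X \<rhd> unpack Y Z \<lhd> [m_ob T V]) \<bullet> (unpack X (Y \<otimes> Z) \<lhd> [m_ob T V]) \<bullet> (d V (X \<otimes> (Y \<otimes> Z)) \<lhd> []) \<bullet>
      (V \<rhd> J (assoc C X Y Z) \<lhd> []) \<bullet> (V \<rhd> pack (X \<otimes> Y) Z \<lhd> []) \<bullet> (V \<rhd> pack X Y \<lhd> [Z])"
    using assms by (simp add: push)
  also have "\<dots> = ((X \<rhd> unpack Y Z \<lhd> [m_ob T V]) \<bullet> (unpack X (Y \<otimes> Z) \<lhd> [m_ob T V]) \<bullet> (J (assoc C X Y Z) \<lhd> [m_ob T V])) \<bullet>
      (d V ((X \<otimes> Y) \<otimes> Z) \<lhd> []) \<bullet> (V \<rhd> pack (X \<otimes> Y) Z \<lhd> []) \<bullet> (V \<rhd> pack X Y \<lhd> [Z])"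
    using assms d_nat_tail[of V "assoc C X Y Z" "[]", THEN whisk_cong(1)] by simp
  also have "\<dots> = ?l"
    unfolding u by simp
  finally show ?thesis ..
qed

lemma mult_assoc:
  assumes "V \<in> objs C"
  shows "m_mult T V \<cdot> m_ar T (m_mult T V) = m_mult T V \<cdot> m_mult T (m_ob T V)" (is "?l = ?r")
proof (rule J_centr_eqI3)
  fix X Y Z assume X: "X \<in> objs C" "Y \<in> objs C" "Z \<in> objs C"
  show "(X \<rhd> Y \<rhd> Z \<rhd> J ?l \<lhd> []) \<bullet> (X \<rhd> Y \<rhd> d (m_ob T (m_ob T V)) Z \<lhd> []) \<bullet> (X \<rhd> d (m_ob T V) Y \<lhd> [Z]) \<bullet> (d V X \<lhd> [Y, Z])
    = (X \<rhd> Y \<rhd> Z \<rhd> J ?r \<lhd> []) \<bullet> (X \<rhd> Y \<rhd> d (m_ob T (m_ob T V)) Z \<lhd> []) \<bullet> (X \<rhd> d (m_ob T V) Y \<lhd> [Z]) \<bullet> (d V X \<lhd> [Y, Z])"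
    using X assms d_assoc[OF assms X] by (simp add: push rex str rexd)
qed (use assms in \<open>simp_all add: in_hom\<close>)

text \<open>By \<open>mult_d\<close> at (\<one>, X) and at (X, \<one>), the two laws become
  naturality of \<open>d\<close> along the inverse unitors from X to \<one> \<otimes> X and to X
  \<otimes> \<one>.\<close>

lemma mult_unit:
  assumes "V \<in> objs C"
  shows "m_mult T V \<cdot> m_ar T (m_unit T V) = ide C (m_ob T V)" (is "?l = ?i")
    and "m_mult T V \<cdot> m_unit T (m_ob T V) = ide C (m_ob T V)" (is "?r = ?i")
proof -
  show "?l = ?i"
  proof (rule J_centr_eqI[OF assms])
    fix X assume X: "X \<in> objs C"
    let ?p = "pack0 \<lhd> [X, m_ob T V]"
    have "?p \<bullet> (X \<rhd> J ?l \<lhd> []) \<bullet> (d V X \<lhd> [])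
      = (\<one> \<rhd> X \<rhd> J (m_mult T V) \<lhd> []) \<bullet> (\<one> \<rhd> d (m_ob T V) X \<lhd> []) \<bullet> (pack0 \<lhd> [m_ob T V, X]) \<bullet> (J (m_unit T V) \<lhd> [X])"
      using X assms by (simp add: push str)
    also have "\<dots> = (unpack \<one> X \<lhd> [m_ob T V]) \<bullet> (d V (\<one> \<otimes> X) \<lhd> []) \<bullet> (V \<rhd> J (inv_arr C (lun C X)) \<lhd> [])"
      using X assms unit_tail[of V "[X]"]
      by (simp add: str push del: unit_tail flip: unit_tail)
    also have "\<dots> = (unpack \<one> X \<lhd> [m_ob T V]) \<bullet> (J (inv_arr C (lun C X)) \<lhd> [m_ob T V]) \<bullet> (d V X \<lhd> [])"
      using X assms d_nat_tail[of V "inv_arr C (lun C X)" "[]"] by simp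
    also have "\<dots> = ?p \<bullet> (X \<rhd> J ?i \<lhd> []) \<bullet> (d V X \<lhd> [])"
      using X assms by (simp add: push flip: scmp_assoc)
    finally show "(X \<rhd> J ?l \<lhd> []) \<bullet> (d V X \<lhd> []) = (X \<rhd> J ?i \<lhd> []) \<bullet> (d V X \<lhd> [])"
      by (rule pack0_cancel_left[rotated -1]) (use X assms in simp_all)
  qed (use assms in \<open>simp_all add: in_hom\<close>)
  show "?r = ?i"
  proof (rule J_centr_eqI[OF assms])
    fix X assume X: "X \<in> objs C"
    let ?p = "X \<rhd> pack0 \<lhd> [m_ob T V]"
    have "?p \<bullet> (X \<rhd> J ?r \<lhd> []) \<bullet> (d V X \<lhd> [])
      = (X \<rhd> \<one> \<rhd> J (m_mult T V) \<lhd> []) \<bullet> (X \<rhd> pack0 \<lhd> [m_ob T (m_ob T V)]) \<bullet> (X \<rhd> J (m_unit T (m_ob T V)) \<lhd> []) \<bullet> (d V X \<lhd> [])"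
      using X assms by (simp add: push)
    also have "\<dots> = (X \<rhd> \<one> \<rhd> J (m_mult T V) \<lhd> []) \<bullet> (X \<rhd> d (m_ob T V) \<one> \<lhd> []) \<bullet> (X \<rhd> m_ob T V \<rhd> pack0 \<lhd> []) \<bullet> (d V X \<lhd> [])"
      using X assms unit_tail[of "m_ob T V" "[]", THEN whisk_cong(3), of X "d V X \<lhd> []"] by simp
    also have "\<dots> = (unpack X \<one> \<lhd> [m_ob T V]) \<bullet> (d V (X \<otimes> \<one>) \<lhd> []) \<bullet> (V \<rhd> J (inv_arr C (run C X)) \<lhd> [])"
      using X assms by (simp add: push rexd mult_tail mult_tail[THEN whisk_cong(1), unfolded whisk_nf])
    also have "\<dots> = (unpack X \<one> \<lhd> [m_ob T V]) \<bullet> (J (inv_arr C (run C X)) \<lhd> [m_ob T V]) \<bullet> (d V X \<lhd> [])"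
      using X assms d_nat_tail[of V "inv_arr C (run C X)" "[]"] by simp
    also have "\<dots> = ?p \<bullet> (X \<rhd> J ?i \<lhd> []) \<bullet> (d V X \<lhd> [])"
      using X assms by (simp add: push flip: scmp_assoc)
    finally have "(X \<rhd> unpack0 \<lhd> [m_ob T V]) \<bullet> ?p \<bullet> (X \<rhd> J ?r \<lhd> []) \<bullet> (d V X \<lhd> [])
        = (X \<rhd> unpack0 \<lhd> [m_ob T V]) \<bullet> ?p \<bullet> (X \<rhd> J ?i \<lhd> []) \<bullet> (d V X \<lhd> [])"
      by (simp only:)
    moreover have "(X \<rhd> unpack0 \<lhd> zs) \<bullet> (X \<rhd> pack0 \<lhd> zs) = sid (X # zs)" for zs
      by (simp flip: lwhisk_scmp)
    ultimately show "(X \<rhd> J ?r \<lhd> []) \<bullet> (d V X \<lhd> []) = (X \<rhd> J ?i \<lhd> []) \<bullet> (d V X \<lhd> [])"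
      using X assms unfolding scmp_assoc[symmetric] by simp
  qed (use assms in \<open>simp_all add: in_hom\<close>)
qed

end

section \<open>Half-braidings\<close>

context monoidal_category
begin

text \<open>Invertibility is obtained as a theorem, \<open>half_braiding_invertible\<close>: the
  families that come from modules are at first only known to be natural and multiplicative.\<close>

definition half_braiding :: "'a \<Rightarrow> ('a \<Rightarrow> ('a, 'b) sarrow) \<Rightarrow> bool" where
  "half_braiding M \<sigma> \<longleftrightarrow> M \<in> objs C \<and>
     (\<forall>X \<in> objs C. sarr (\<sigma> X) \<and> sdom (\<sigma> X) = [M, X] \<and> scod (\<sigma> X) = [X, M]) \<and>
     (\<forall>f \<in> arrs C. (J f \<lhd> [M]) \<bullet> \<sigma> (src C f) = \<sigma> (tgt C f) \<bullet> (M \<rhd> J f)) \<and>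
     (\<forall>X \<in> objs C. \<forall>Y \<in> objs C.
        (X \<rhd> \<sigma> Y) \<bullet> (\<sigma> X \<lhd> [Y]) = (unpack X Y \<lhd> [M]) \<bullet> \<sigma> (X \<otimes> Y) \<bullet> (M \<rhd> pack X Y)) \<and>
     \<sigma> \<one> \<bullet> (M \<rhd> pack0) = pack0 \<lhd> [M]"

text \<open>The type and the axioms of the inverses of a half-braiding; the transpose of a
  half-braiding on a dual object is of this type as well.\<close>

definition anti_half_braiding :: "'a \<Rightarrow> ('a \<Rightarrow> ('a, 'b) sarrow) \<Rightarrow> bool" where
  "anti_half_braiding M \<rho> \<longleftrightarrow> M \<in> objs C \<and>
     (\<forall>X \<in> objs C. sarr (\<rho> X) \<and> sdom (\<rho> X) = [X, M] \<and> scod (\<rho> X) = [M, X]) \<and>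
     (\<forall>f \<in> arrs C. (M \<rhd> J f) \<bullet> \<rho> (src C f) = \<rho> (tgt C f) \<bullet> (J f \<lhd> [M])) \<and>
     (\<forall>X \<in> objs C. \<forall>Y \<in> objs C.
        (\<rho> X \<lhd> [Y]) \<bullet> (X \<rhd> \<rho> Y) = (M \<rhd> unpack X Y) \<bullet> \<rho> (X \<otimes> Y) \<bullet> (pack X Y \<lhd> [M])) \<and>
     \<rho> \<one> \<bullet> (pack0 \<lhd> [M]) = M \<rhd> pack0"

definition mutually_inverse :: "'a \<Rightarrow> ('a \<Rightarrow> ('a, 'b) sarrow) \<Rightarrow> ('a \<Rightarrow> ('a, 'b) sarrow) \<Rightarrow> bool" where
  "mutually_inverse M \<sigma> \<rho> \<longleftrightarrow>
     (\<forall>X \<in> objs C. \<rho> X \<bullet> \<sigma> X = sid [M, X] \<and> \<sigma> X \<bullet> \<rho> X = sid [X, M])"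

text \<open>The letter X starts between N and M. It may leave to the left past N by
  \<open>\<tau>\<close> or to the right past M by \<open>\<rho>\<close>, and the pairing
  \<open>e\<close> does not see the difference.\<close>

definition transposed :: "'a \<Rightarrow> 'a \<Rightarrow> ('a, 'b) sarrow \<Rightarrow> ('a \<Rightarrow> ('a, 'b) sarrow) \<Rightarrow> ('a \<Rightarrow> ('a, 'b) sarrow) \<Rightarrow> bool" where
  "transposed M N e \<rho> \<tau> \<longleftrightarrow>
     (\<forall>X \<in> objs C. (X \<rhd> e) \<bullet> (\<tau> X \<lhd> [M]) = (e \<lhd> [X]) \<bullet> (N \<rhd> \<rho> X))"

lemma half_braidingD:
  assumes "half_braiding M \<sigma>"
  shows "M \<in> objs C" "X \<in> objs C \<Longrightarrow> sarr (\<sigma> X)" "X \<in> objs C \<Longrightarrow> sdom (\<sigma> X) = [M, X]"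
    "X \<in> objs C \<Longrightarrow> scod (\<sigma> X) = [X, M]"
    "f \<in> arrs C \<Longrightarrow> (J f \<lhd> M # zs) \<bullet> (\<sigma> (src C f) \<lhd> zs) = (\<sigma> (tgt C f) \<lhd> zs) \<bullet> (M \<rhd> J f \<lhd> zs)"
    "X \<in> objs C \<Longrightarrow> Y \<in> objs C \<Longrightarrow> (X \<rhd> \<sigma> Y \<lhd> zs) \<bullet> (\<sigma> X \<lhd> Y # zs)
       = (unpack X Y \<lhd> M # zs) \<bullet> (\<sigma> (X \<otimes> Y) \<lhd> zs) \<bullet> (M \<rhd> pack X Y \<lhd> zs)"
    "(\<sigma> \<one> \<lhd> zs) \<bullet> (M \<rhd> pack0 \<lhd> zs) = pack0 \<lhd> M # zs"
proof -
  note * = assms[unfolded half_braiding_def]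
  show "M \<in> objs C" "X \<in> objs C \<Longrightarrow> sarr (\<sigma> X)" "X \<in> objs C \<Longrightarrow> sdom (\<sigma> X) = [M, X]"
    "X \<in> objs C \<Longrightarrow> scod (\<sigma> X) = [X, M]"
    using * by auto
  show "(J f \<lhd> M # zs) \<bullet> (\<sigma> (src C f) \<lhd> zs) = (\<sigma> (tgt C f) \<lhd> zs) \<bullet> (M \<rhd> J f \<lhd> zs)" if "f \<in> arrs C"
  proof -
    have "(J f \<lhd> [M]) \<bullet> \<sigma> (src C f) = \<sigma> (tgt C f) \<bullet> (M \<rhd> J f)" using * that by blast
    from with_tail[OF this, of zs] show ?thesis by simp
  qed
  show "(X \<rhd> \<sigma> Y \<lhd> zs) \<bullet> (\<sigma> X \<lhd> Y # zs)
       = (unpack X Y \<lhd> M # zs) \<bullet> (\<sigma> (X \<otimes> Y) \<lhd> zs) \<bullet> (M \<rhd> pack X Y \<lhd> zs)"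
    if "X \<in> objs C" "Y \<in> objs C"
  proof -
    have "(X \<rhd> \<sigma> Y) \<bullet> (\<sigma> X \<lhd> [Y]) = (unpack X Y \<lhd> [M]) \<bullet> \<sigma> (X \<otimes> Y) \<bullet> (M \<rhd> pack X Y)"
      using * that by blast
    from with_tail[OF this, of zs] show ?thesis by simp
  qed
  show "(\<sigma> \<one> \<lhd> zs) \<bullet> (M \<rhd> pack0 \<lhd> zs) = pack0 \<lhd> M # zs"
  proof -
    have "\<sigma> \<one> \<bullet> (M \<rhd> pack0) = pack0 \<lhd> [M]" using * by blast
    from with_tail[OF this, of zs] show ?thesis by simp
  qed
qed

lemma anti_half_braidingD:
  assumes "anti_half_braiding M \<rho>"
  shows "M \<in> objs C" "X \<in> objs C \<Longrightarrow> sarr (\<rho> X)" "X \<in> objs C \<Longrightarrow> sdom (\<rho> X) = [X, M]"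
    "X \<in> objs C \<Longrightarrow> scod (\<rho> X) = [M, X]"
    "f \<in> arrs C \<Longrightarrow> (M \<rhd> J f \<lhd> zs) \<bullet> (\<rho> (src C f) \<lhd> zs) = (\<rho> (tgt C f) \<lhd> zs) \<bullet> (J f \<lhd> M # zs)"
    "X \<in> objs C \<Longrightarrow> Y \<in> objs C \<Longrightarrow> (\<rho> X \<lhd> Y # zs) \<bullet> (X \<rhd> \<rho> Y \<lhd> zs)
       = (M \<rhd> unpack X Y \<lhd> zs) \<bullet> (\<rho> (X \<otimes> Y) \<lhd> zs) \<bullet> (pack X Y \<lhd> M # zs)"
    "(\<rho> \<one> \<lhd> zs) \<bullet> (pack0 \<lhd> M # zs) = M \<rhd> pack0 \<lhd> zs"
proof -
  note * = assms[unfolded anti_half_braiding_def]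
  show "M \<in> objs C" "X \<in> objs C \<Longrightarrow> sarr (\<rho> X)" "X \<in> objs C \<Longrightarrow> sdom (\<rho> X) = [X, M]"
    "X \<in> objs C \<Longrightarrow> scod (\<rho> X) = [M, X]"
    using * by auto
  show "(M \<rhd> J f \<lhd> zs) \<bullet> (\<rho> (src C f) \<lhd> zs) = (\<rho> (tgt C f) \<lhd> zs) \<bullet> (J f \<lhd> M # zs)" if "f \<in> arrs C"
  proof -
    have "(M \<rhd> J f) \<bullet> \<rho> (src C f) = \<rho> (tgt C f) \<bullet> (J f \<lhd> [M])" using * that by blast
    from with_tail[OF this, of zs] show ?thesis by simp
  qed
  show "(\<rho> X \<lhd> Y # zs) \<bullet> (X \<rhd> \<rho> Y \<lhd> zs)
       = (M \<rhd> unpack X Y \<lhd> zs) \<bullet> (\<rho> (X \<otimes> Y) \<lhd> zs) \<bullet> (pack X Y \<lhd> M # zs)"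
    if "X \<in> objs C" "Y \<in> objs C"
  proof -
    have "(\<rho> X \<lhd> [Y]) \<bullet> (X \<rhd> \<rho> Y) = (M \<rhd> unpack X Y) \<bullet> \<rho> (X \<otimes> Y) \<bullet> (pack X Y \<lhd> [M])"
      using * that by blast
    from with_tail[OF this, of zs] show ?thesis by simp
  qed
  show "(\<rho> \<one> \<lhd> zs) \<bullet> (pack0 \<lhd> M # zs) = M \<rhd> pack0 \<lhd> zs"
  proof -
    have "\<rho> \<one> \<bullet> (pack0 \<lhd> [M]) = M \<rhd> pack0" using * by blast
    from with_tail[OF this, of zs] show ?thesis by simp
  qed
qed

lemma rex_half_braiding:
  assumes "half_braiding M \<sigma>" "X \<in> objs C" "sarr B" "zs = sdom B"
  shows "(X \<rhd> M \<rhd> B) \<bullet> (\<sigma> X \<lhd> zs) = (\<sigma> X \<lhd> scod B) \<bullet> (M \<rhd> X \<rhd> B)"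
  using half_braidingD[OF assms(1)] exchange_atom(9)[of "\<sigma> X" B "scod B" M X X M] assms by simp

lemma rex_anti_half_braiding:
  assumes "anti_half_braiding M \<rho>" "X \<in> objs C" "sarr B" "zs = sdom B"
  shows "(M \<rhd> X \<rhd> B) \<bullet> (\<rho> X \<lhd> zs) = (\<rho> X \<lhd> scod B) \<bullet> (X \<rhd> M \<rhd> B)"
  using anti_half_braidingD[OF assms(1)] exchange_atom(9)[of "\<rho> X" B "scod B" X M M X] assms by simp

text \<open>Multiplicativity merges the passages of P and Q into that of P \<otimes> Q; naturality
  along \<open>k\<close> replaces it by the passage of \<one>, which is trivial. The companions for
  evaluations and for anti-half-braidings rest on the same three steps.\<close>

lemma half_braiding_coev:
  assumes "half_braiding M \<sigma>" "P \<in> objs C" "Q \<in> objs C" "k \<in> hom C \<one> (P \<otimes> Q)"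
  shows "(P \<rhd> \<sigma> Q \<lhd> zs) \<bullet> (\<sigma> P \<lhd> Q # zs) \<bullet> (M \<rhd> coev_of P Q k \<lhd> zs) = coev_of P Q k \<lhd> M # zs"
proof -
  note h = half_braidingD[OF assms(1)]
  have k: "k \<in> arrs C" "src C k = \<one>" "tgt C k = P \<otimes> Q" using assms(4) by (auto simp: in_hom)
  note co = coev_of_tail[OF assms(4,2,3)]
  have "(P \<rhd> \<sigma> Q \<lhd> zs) \<bullet> (\<sigma> P \<lhd> Q # zs) \<bullet> (M \<rhd> coev_of P Q k \<lhd> zs)
      = (unpack P Q \<lhd> M # zs) \<bullet> (\<sigma> (P \<otimes> Q) \<lhd> zs) \<bullet> (M \<rhd> ((pack P Q \<lhd> zs) \<bullet> (coev_of P Q k \<lhd> zs)))"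
    using h(6)[OF assms(2,3), of zs, THEN whisk_cong(1)] by simp
  also have "\<dots> = (unpack P Q \<lhd> M # zs) \<bullet> (\<sigma> (P \<otimes> Q) \<lhd> zs) \<bullet> (M \<rhd> J k \<lhd> zs) \<bullet> (M \<rhd> pack0 \<lhd> zs)"
    unfolding co[symmetric] by simp
  also have "\<dots> = (unpack P Q \<lhd> M # zs) \<bullet> (J k \<lhd> M # zs) \<bullet> (pack0 \<lhd> M # zs)"
    using k h(5)[OF k(1), of zs, THEN whisk_cong(1), of "M \<rhd> pack0 \<lhd> zs"] h(7)[of zs] by simp
  also have "\<dots> = coev_of P Q k \<lhd> M # zs"
    by (simp add: coev_of_def)
  finally show ?thesis .
qed

lemma half_braiding_ev:
  assumes "half_braiding M \<sigma>" "P \<in> objs C" "Q \<in> objs C" "k \<in> hom C (P \<otimes> Q) \<one>"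
    and zs: "set zs \<subseteq> objs C"
  shows "(ev_of P Q k \<lhd> M # zs) \<bullet> (P \<rhd> \<sigma> Q \<lhd> zs) \<bullet> (\<sigma> P \<lhd> Q # zs) = M \<rhd> ev_of P Q k \<lhd> zs"
proof -
  note h = half_braidingD[OF assms(1)]
  have k: "k \<in> arrs C" "src C k = P \<otimes> Q" "tgt C k = \<one>" using assms(4) by (auto simp: in_hom)
  note ev = ev_of_tail[OF assms(4,2,3)]
  have "(pack0 \<lhd> M # zs) \<bullet> (ev_of P Q k \<lhd> M # zs) \<bullet> (P \<rhd> \<sigma> Q \<lhd> zs) \<bullet> (\<sigma> P \<lhd> Q # zs)
      = (J k \<lhd> M # zs) \<bullet> (pack P Q \<lhd> M # zs) \<bullet> (P \<rhd> \<sigma> Q \<lhd> zs) \<bullet> (\<sigma> P \<lhd> Q # zs)"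
    using ev[of "M # zs", THEN whisk_cong(1)] by simp
  also have "\<dots> = (J k \<lhd> M # zs) \<bullet> (\<sigma> (P \<otimes> Q) \<lhd> zs) \<bullet> (M \<rhd> pack P Q \<lhd> zs)"
    using assms zs h by simp
  also have "\<dots> = (\<sigma> \<one> \<lhd> zs) \<bullet> (M \<rhd> ((J k \<lhd> zs) \<bullet> (pack P Q \<lhd> zs)))"
    using k h(5)[OF k(1), of zs, THEN whisk_cong(1), of "M \<rhd> pack P Q \<lhd> zs"] by simp
  also have "\<dots> = (pack0 \<lhd> M # zs) \<bullet> (M \<rhd> ev_of P Q k \<lhd> zs)"
    unfolding ev using h(7)[of zs, THEN whisk_cong(1), of "M \<rhd> ev_of P Q k \<lhd> zs"] by simp
  finally show ?thesis
    by (rule pack0_cancel_left[rotated -1]) (use assms zs h in simp_all)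
qed

lemma anti_half_braiding_coev:
  assumes "anti_half_braiding M \<rho>" "P \<in> objs C" "Q \<in> objs C" "k \<in> hom C \<one> (P \<otimes> Q)"
  shows "(\<rho> P \<lhd> Q # zs) \<bullet> (P \<rhd> \<rho> Q \<lhd> zs) \<bullet> (coev_of P Q k \<lhd> M # zs) = M \<rhd> coev_of P Q k \<lhd> zs"
proof -
  note h = anti_half_braidingD[OF assms(1)]
  have k: "k \<in> arrs C" "src C k = \<one>" "tgt C k = P \<otimes> Q" using assms(4) by (auto simp: in_hom)
  note co = coev_of_tail[OF assms(4,2,3)]
  have "(\<rho> P \<lhd> Q # zs) \<bullet> (P \<rhd> \<rho> Q \<lhd> zs) \<bullet> (coev_of P Q k \<lhd> M # zs)
      = (M \<rhd> unpack P Q \<lhd> zs) \<bullet> (\<rho> (P \<otimes> Q) \<lhd> zs) \<bullet> ((pack P Q \<lhd> M # zs) \<bullet> (coev_of P Q k \<lhd> M # zs))"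
    using h(6)[OF assms(2,3), of zs, THEN whisk_cong(1)] by simp
  also have "\<dots> = (M \<rhd> unpack P Q \<lhd> zs) \<bullet> (\<rho> (P \<otimes> Q) \<lhd> zs) \<bullet> (J k \<lhd> M # zs) \<bullet> (pack0 \<lhd> M # zs)"
    unfolding co[symmetric] by simp
  also have "\<dots> = (M \<rhd> unpack P Q \<lhd> zs) \<bullet> (M \<rhd> J k \<lhd> zs) \<bullet> (M \<rhd> pack0 \<lhd> zs)"
    using k h(5)[OF k(1), of zs, THEN whisk_cong(1), of "pack0 \<lhd> M # zs"] h(7)[of zs] by simp
  also have "\<dots> = M \<rhd> coev_of P Q k \<lhd> zs"
    by (simp add: coev_of_def)
  finally show ?thesis .
qed

lemma anti_half_braiding_ev:
  assumes "anti_half_braiding M \<rho>" "P \<in> objs C" "Q \<in> objs C" "k \<in> hom C (P \<otimes> Q) \<one>"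
    and zs: "set zs \<subseteq> objs C"
  shows "(M \<rhd> ev_of P Q k \<lhd> zs) \<bullet> (\<rho> P \<lhd> Q # zs) \<bullet> (P \<rhd> \<rho> Q \<lhd> zs) = ev_of P Q k \<lhd> M # zs"
proof -
  note h = anti_half_braidingD[OF assms(1)]
  have k: "k \<in> arrs C" "src C k = P \<otimes> Q" "tgt C k = \<one>" using assms(4) by (auto simp: in_hom)
  note ev = ev_of_tail[OF assms(4,2,3)]
  have "(M \<rhd> pack0 \<lhd> zs) \<bullet> (M \<rhd> ev_of P Q k \<lhd> zs) \<bullet> (\<rho> P \<lhd> Q # zs) \<bullet> (P \<rhd> \<rho> Q \<lhd> zs)
      = (M \<rhd> J k \<lhd> zs) \<bullet> (M \<rhd> pack P Q \<lhd> zs) \<bullet> (\<rho> P \<lhd> Q # zs) \<bullet> (P \<rhd> \<rho> Q \<lhd> zs)"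
    using ev[of zs, THEN whisk_cong(3), of M] by simp
  also have "\<dots> = (M \<rhd> J k \<lhd> zs) \<bullet> (\<rho> (P \<otimes> Q) \<lhd> zs) \<bullet> (pack P Q \<lhd> M # zs)"
    using assms zs h by simp
  also have "\<dots> = (\<rho> \<one> \<lhd> zs) \<bullet> ((J k \<lhd> M # zs) \<bullet> (pack P Q \<lhd> M # zs))"
    using k h(5)[OF k(1), of zs, THEN whisk_cong(1), of "pack P Q \<lhd> M # zs"] by simp
  also have "\<dots> = (M \<rhd> pack0 \<lhd> zs) \<bullet> (ev_of P Q k \<lhd> M # zs)"
    unfolding ev using h(7)[of zs, THEN whisk_cong(1), of "ev_of P Q k \<lhd> M # zs"] by simp
  finally show ?thesis
    by (rule split_cancel_left[where K' = "M \<rhd> unpack0 \<lhd> zs", rotated -1]) (use assms zs h in simp_all)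
qed

text \<open>Each axiom follows by composition with the invertible \<open>\<sigma>\<close>. Inverting
  the composite passage of X and Y reverses the order of the factors, which is why multiplicativity
  of an anti-half-braiding has \<open>\<rho> Y\<close> applied first.\<close>

lemma anti_half_braidingI_inverse:
  assumes s: "half_braiding M \<sigma>" and inv: "mutually_inverse M \<sigma> \<rho>"
    and \<rho>: "\<And>X. X \<in> objs C \<Longrightarrow> sarr (\<rho> X) \<and> sdom (\<rho> X) = [X, M] \<and> scod (\<rho> X) = [M, X]"
  shows "anti_half_braiding M \<rho>"
proof -
  note h = half_braidingD[OF s]
  have \<rho>\<sigma>: "(\<rho> X \<lhd> zs) \<bullet> (\<sigma> X \<lhd> zs) = sid (M # X # zs)" "(\<sigma> X \<lhd> zs) \<bullet> (\<rho> X \<lhd> zs) = sid (X # M # zs)"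
    if "X \<in> objs C" for X zs
    using inv that with_tail[of "\<rho> X \<bullet> \<sigma> X" _ zs] with_tail[of "\<sigma> X \<bullet> \<rho> X" _ zs]
    unfolding mutually_inverse_def by (metis append.simps rwhisk_scmp rwhisk_sid)+
  show ?thesis
    unfolding anti_half_braiding_def
  proof (intro conjI ballI)
    fix f assume f: "f \<in> arrs C"
    show "(M \<rhd> J f) \<bullet> \<rho> (src C f) = \<rho> (tgt C f) \<bullet> (J f \<lhd> [M])"
    proof (rule split_cancel_left[where K = "\<sigma> (tgt C f) \<lhd> []" and K' = "\<rho> (tgt C f) \<lhd> []"])
      have "(\<sigma> (tgt C f) \<lhd> []) \<bullet> (M \<rhd> J f \<lhd> []) \<bullet> (\<rho> (src C f) \<lhd> []) = (J f \<lhd> [M]) \<bullet> (\<sigma> (src C f) \<lhd> []) \<bullet> (\<rho> (src C f) \<lhd> [])"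
        using h(5)[OF f, of "[]", THEN whisk_cong(1)] by simp
      also have "\<dots> = (\<sigma> (tgt C f) \<lhd> []) \<bullet> (\<rho> (tgt C f) \<lhd> []) \<bullet> (J f \<lhd> [M])"
        using f h(1) \<rho>\<sigma>[of "tgt C f" "[]", THEN whisk_cong(1)] \<rho>\<sigma>[of "src C f" "[]"] by simp
      finally show "(\<sigma> (tgt C f) \<lhd> []) \<bullet> (M \<rhd> J f) \<bullet> \<rho> (src C f) = (\<sigma> (tgt C f) \<lhd> []) \<bullet> \<rho> (tgt C f) \<bullet> (J f \<lhd> [M])"
        using f \<rho> by (simp add: rwhisk_Nil)
    qed (use f h(1-4) \<rho> \<rho>\<sigma> in simp_all)
  next
    fix X Y assume X: "X \<in> objs C" "Y \<in> objs C"
    let ?K = "(X \<rhd> \<sigma> Y \<lhd> []) \<bullet> (\<sigma> X \<lhd> [Y])"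
    let ?K' = "(\<rho> X \<lhd> [Y]) \<bullet> (X \<rhd> \<rho> Y \<lhd> [])"
    have XY: "(X \<rhd> \<rho> Y \<lhd> zs) \<bullet> (X \<rhd> \<sigma> Y \<lhd> zs) = sid (X # M # Y # zs)"
      "(X \<rhd> \<sigma> Y \<lhd> zs) \<bullet> (X \<rhd> \<rho> Y \<lhd> zs) = sid (X # Y # M # zs)" for zs
      using \<rho>\<sigma>[OF X(2), of zs, THEN whisk_cong(2), of X] by simp_all
    show "(\<rho> X \<lhd> [Y]) \<bullet> (X \<rhd> \<rho> Y) = (M \<rhd> unpack X Y) \<bullet> \<rho> (X \<otimes> Y) \<bullet> (pack X Y \<lhd> [M])"
    proof (rule split_cancel_left[where K = ?K and K' = ?K'])
      have "?K \<bullet> ?K' = sid [X, Y, M]"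
        using X h(1-4) \<rho> XY \<rho>\<sigma>(2)[OF X(1), THEN whisk_cong(1)] by simp
      moreover have "?K \<bullet> (M \<rhd> unpack X Y \<lhd> []) \<bullet> (\<rho> (X \<otimes> Y) \<lhd> []) \<bullet> (pack X Y \<lhd> [M]) = sid [X, Y, M]"
        using X h(1-4) \<rho> \<rho>\<sigma>(2)[of "X \<otimes> Y", THEN whisk_cong(1)] h(6)[OF X, of "[]", THEN whisk_cong(1)] by simp
      ultimately show "?K \<bullet> (\<rho> X \<lhd> [Y]) \<bullet> (X \<rhd> \<rho> Y) = ?K \<bullet> (M \<rhd> unpack X Y) \<bullet> \<rho> (X \<otimes> Y) \<bullet> (pack X Y \<lhd> [M])"
        using X \<rho> by (simp add: rwhisk_Nil)
      show "?K' \<bullet> ?K = sid (sdom ?K)"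
        using X h(1-4) \<rho> XY[THEN whisk_cong(1)] \<rho>\<sigma>[OF X(1)] by simp
    qed (use X h(1-4) \<rho> in simp_all)
  next
    have "(\<rho> \<one> \<lhd> []) \<bullet> (pack0 \<lhd> [M]) = (\<rho> \<one> \<lhd> []) \<bullet> (\<sigma> \<one> \<lhd> []) \<bullet> (M \<rhd> pack0 \<lhd> [])"
      using h(7)[of "[]"] by simp
    then show "\<rho> \<one> \<bullet> (pack0 \<lhd> [M]) = M \<rhd> pack0"
      using h(1) \<rho> \<rho>\<sigma>(1)[OF uno_obj, of "[]", THEN whisk_cong(1)] by (simp add: rwhisk_Nil)
  qed (use h \<rho> in auto)
qed

lemma half_braidingI_inverse:
  assumes r: "anti_half_braiding M \<rho>" and inv: "mutually_inverse M \<sigma> \<rho>"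
    and \<sigma>: "\<And>X. X \<in> objs C \<Longrightarrow> sarr (\<sigma> X) \<and> sdom (\<sigma> X) = [M, X] \<and> scod (\<sigma> X) = [X, M]"
  shows "half_braiding M \<sigma>"
proof -
  note h = anti_half_braidingD[OF r]
  have \<rho>\<sigma>: "(\<rho> X \<lhd> zs) \<bullet> (\<sigma> X \<lhd> zs) = sid (M # X # zs)" "(\<sigma> X \<lhd> zs) \<bullet> (\<rho> X \<lhd> zs) = sid (X # M # zs)"
    if "X \<in> objs C" for X zs
    using inv that with_tail[of "\<rho> X \<bullet> \<sigma> X" _ zs] with_tail[of "\<sigma> X \<bullet> \<rho> X" _ zs]
    unfolding mutually_inverse_def by (metis append.simps rwhisk_scmp rwhisk_sid)+
  show ?thesis
    unfolding half_braiding_def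
  proof (intro conjI ballI)
    fix f assume f: "f \<in> arrs C"
    show "(J f \<lhd> [M]) \<bullet> \<sigma> (src C f) = \<sigma> (tgt C f) \<bullet> (M \<rhd> J f)"
    proof (rule split_cancel_left[where K = "\<rho> (tgt C f) \<lhd> []" and K' = "\<sigma> (tgt C f) \<lhd> []"])
      have "(\<rho> (tgt C f) \<lhd> []) \<bullet> (J f \<lhd> [M]) \<bullet> (\<sigma> (src C f) \<lhd> []) = (M \<rhd> J f \<lhd> []) \<bullet> (\<rho> (src C f) \<lhd> []) \<bullet> (\<sigma> (src C f) \<lhd> [])"
        using h(5)[OF f, of "[]", THEN whisk_cong(1)] by simp
      also have "\<dots> = (\<rho> (tgt C f) \<lhd> []) \<bullet> (\<sigma> (tgt C f) \<lhd> []) \<bullet> (M \<rhd> J f \<lhd> [])"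
        using f h(1) \<rho>\<sigma>[of "tgt C f" "[]", THEN whisk_cong(1)] \<rho>\<sigma>[of "src C f" "[]"] by simp
      finally show "(\<rho> (tgt C f) \<lhd> []) \<bullet> (J f \<lhd> [M]) \<bullet> \<sigma> (src C f) = (\<rho> (tgt C f) \<lhd> []) \<bullet> \<sigma> (tgt C f) \<bullet> (M \<rhd> J f)"
        using f \<sigma> by (simp add: rwhisk_Nil)
    qed (use f h(1-4) \<sigma> \<rho>\<sigma> in simp_all)
  next
    fix X Y assume X: "X \<in> objs C" "Y \<in> objs C"
    let ?K = "(\<rho> X \<lhd> [Y]) \<bullet> (X \<rhd> \<rho> Y \<lhd> [])"
    let ?K' = "(X \<rhd> \<sigma> Y \<lhd> []) \<bullet> (\<sigma> X \<lhd> [Y])"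
    have XY: "(X \<rhd> \<rho> Y \<lhd> zs) \<bullet> (X \<rhd> \<sigma> Y \<lhd> zs) = sid (X # M # Y # zs)"
      "(X \<rhd> \<sigma> Y \<lhd> zs) \<bullet> (X \<rhd> \<rho> Y \<lhd> zs) = sid (X # Y # M # zs)" for zs
      using \<rho>\<sigma>[OF X(2), of zs, THEN whisk_cong(2), of X] by simp_all
    show "(X \<rhd> \<sigma> Y) \<bullet> (\<sigma> X \<lhd> [Y]) = (unpack X Y \<lhd> [M]) \<bullet> \<sigma> (X \<otimes> Y) \<bullet> (M \<rhd> pack X Y)"
    proof (rule split_cancel_left[where K = ?K and K' = ?K'])
      have "?K \<bullet> ?K' = sid [M, X, Y]"
        using X h(1-4) \<sigma> XY(1)[THEN whisk_cong(1)] \<rho>\<sigma>(1)[OF X(1)] by simp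
      moreover have "?K \<bullet> (unpack X Y \<lhd> [M]) \<bullet> (\<sigma> (X \<otimes> Y) \<lhd> []) \<bullet> (M \<rhd> pack X Y \<lhd> []) = sid [M, X, Y]"
        using X h(1-4) \<sigma> \<rho>\<sigma>(1)[of "X \<otimes> Y", THEN whisk_cong(1)] h(6)[OF X, of "[]", THEN whisk_cong(1)] by simp
      ultimately show "?K \<bullet> (X \<rhd> \<sigma> Y) \<bullet> (\<sigma> X \<lhd> [Y]) = ?K \<bullet> (unpack X Y \<lhd> [M]) \<bullet> \<sigma> (X \<otimes> Y) \<bullet> (M \<rhd> pack X Y)"
        using X \<sigma> by (simp add: rwhisk_Nil)
      show "?K' \<bullet> ?K = sid (sdom ?K)"
        using X h(1-4) \<sigma> XY(2) \<rho>\<sigma>(2)[OF X(1), THEN whisk_cong(1)] by simp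
    qed (use X h(1-4) \<sigma> in simp_all)
  next
    have "(\<sigma> \<one> \<lhd> []) \<bullet> (M \<rhd> pack0 \<lhd> []) = (\<sigma> \<one> \<lhd> []) \<bullet> (\<rho> \<one> \<lhd> []) \<bullet> (pack0 \<lhd> [M])"
      using h(7)[of "[]"] by simp
    then show "\<sigma> \<one> \<bullet> (M \<rhd> pack0) = pack0 \<lhd> [M]"
      using h(1) \<sigma> \<rho>\<sigma>(2)[OF uno_obj, of "[]", THEN whisk_cong(1)] by (simp add: rwhisk_Nil)
  qed (use h \<sigma> in auto)
qed

end

section \<open>Inverting half-braidings by rotation\<close>

context rigid_category
begin

text \<open>The inverse at X is the passage at the right dual of X, rotated by \<open>evr\<close>
  and \<open>coevr\<close>. In either composite X and its dual pass M together, so an evaluation or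
  coevaluation slides through M, and a triangle identity finishes.\<close>

lemma half_braiding_invertible:
  assumes s: "half_braiding M \<sigma>"
  obtains \<rho> where "anti_half_braiding M \<rho>" "mutually_inverse M \<sigma> \<rho>"
proof -
  note h = half_braidingD[OF s]
  define e c where "e X = ev_of X (rd C X) (evr C X)" and "c X = coev_of (rd C X) X (coevr C X)" for X
  have du: "sdual (rd C X) X (e X) (c X)" if "X \<in> objs C" for X
    unfolding e_def c_def by (rule sdual_of_dual_pair[OF right_dual[OF that]])
  define \<rho> where "\<rho> X = (e X \<lhd> [M, X]) \<bullet> (X \<rhd> \<sigma> (rd C X) \<lhd> [X]) \<bullet> (X \<rhd> M \<rhd> c X)" for X
  have \<rho>: "sarr (\<rho> X) \<and> sdom (\<rho> X) = [X, M] \<and> scod (\<rho> X) = [M, X]" if X: "X \<in> objs C" for X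
    using X h(1-4) sdualD(1-8)[OF du[OF X]] by (simp add: \<rho>_def)
  have inv: "mutually_inverse M \<sigma> \<rho>"
    unfolding mutually_inverse_def
  proof (intro ballI conjI)
    fix X assume X: "X \<in> objs C"
    note d = sdualD[OF du[OF X]]
    have dp: "evr C X \<in> hom C (X \<otimes> rd C X) \<one>" "coevr C X \<in> hom C \<one> (rd C X \<otimes> X)"
      using right_dual[OF X] by (auto simp: dual_pair_def)
    have "\<rho> X \<bullet> \<sigma> X = (e X \<lhd> [M, X]) \<bullet> (X \<rhd> \<sigma> (rd C X) \<lhd> [X]) \<bullet> (X \<rhd> M \<rhd> c X) \<bullet> (\<sigma> X \<lhd> [])"
      using X h(1-4) by (simp add: \<rho>_def rwhisk_Nil)
    also have "\<dots> = ((e X \<lhd> [M, X]) \<bullet> (X \<rhd> \<sigma> (rd C X) \<lhd> [X]) \<bullet> (\<sigma> X \<lhd> [rd C X, X])) \<bullet> (M \<rhd> X \<rhd> c X)"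
      using X h(1-4) d(1-8) rex_half_braiding[OF s X, of "c X" "[]"] by simp
    also have "\<dots> = (M \<rhd> e X \<lhd> [X]) \<bullet> (M \<rhd> X \<rhd> c X)"
      unfolding e_def using half_braiding_ev[OF s X d(1) dp(1), of "[X]"] X by simp
    also have "\<dots> = sid [M, X]"
      using d(10)[of "[]", THEN whisk_cong(2), of M] d(1-8) by (simp add: rwhisk_Nil)
    finally show "\<rho> X \<bullet> \<sigma> X = sid [M, X]" .
    have "\<sigma> X \<bullet> \<rho> X = ((\<sigma> X \<lhd> []) \<bullet> (e X \<lhd> [M, X])) \<bullet> (X \<rhd> \<sigma> (rd C X) \<lhd> [X]) \<bullet> (X \<rhd> M \<rhd> c X)"
      using X h(1-4) by (simp add: \<rho>_def rwhisk_Nil)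
    also have "(\<sigma> X \<lhd> []) \<bullet> (e X \<lhd> [M, X]) = (e X \<lhd> [X, M]) \<bullet> (X \<rhd> rd C X \<rhd> \<sigma> X \<lhd> [])"
      using exchange_atom(7)[of "e X" "\<sigma> X \<lhd> []" "[X, M]" X "rd C X"] X h(1-4) d(1-8) by simp
    also have "((e X \<lhd> [X, M]) \<bullet> (X \<rhd> rd C X \<rhd> \<sigma> X \<lhd> [])) \<bullet> (X \<rhd> \<sigma> (rd C X) \<lhd> [X]) \<bullet> (X \<rhd> M \<rhd> c X)
        = (e X \<lhd> [X, M]) \<bullet> (X \<rhd> c X \<lhd> [M])"
      unfolding c_def
      using half_braiding_coev[OF s d(1) X dp(2), of "[]", THEN whisk_cong(2), of X] X d(1) dp by (simp add: rwhisk_Nil)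
    also have "\<dots> = sid [X, M]"
      using d(10)[of "[M]"] by simp
    finally show "\<sigma> X \<bullet> \<rho> X = sid [X, M]" .
  qed
  show ?thesis
    by (rule that[OF anti_half_braidingI_inverse[OF s inv \<rho>] inv])
qed

text \<open>X now passes in the other direction, so the rotation uses the left dual.\<close>

lemma anti_half_braiding_invertible:
  assumes r: "anti_half_braiding M \<rho>"
  obtains \<sigma> where "half_braiding M \<sigma>" "mutually_inverse M \<sigma> \<rho>"
proof -
  note h = anti_half_braidingD[OF r]
  define e c where "e X = ev_of (ld C X) X (evl C X)" and "c X = coev_of X (ld C X) (coevl C X)" for X
  have du: "sdual X (ld C X) (e X) (c X)" if "X \<in> objs C" for X
    unfolding e_def c_def by (rule sdual_of_dual_pair[OF left_dual[OF that]])
  define \<sigma> where "\<sigma> X = (X \<rhd> M \<rhd> e X) \<bullet> (X \<rhd> \<rho> (ld C X) \<lhd> [X]) \<bullet> (c X \<lhd> [M, X])" for X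
  have \<sigma>: "sarr (\<sigma> X) \<and> sdom (\<sigma> X) = [M, X] \<and> scod (\<sigma> X) = [X, M]" if X: "X \<in> objs C" for X
    using X h(1-4) sdualD(1-8)[OF du[OF X]] by (simp add: \<sigma>_def)
  have inv: "mutually_inverse M \<sigma> \<rho>"
    unfolding mutually_inverse_def
  proof (intro ballI conjI)
    fix X assume X: "X \<in> objs C"
    note d = sdualD[OF du[OF X]]
    have dp: "evl C X \<in> hom C (ld C X \<otimes> X) \<one>" "coevl C X \<in> hom C \<one> (X \<otimes> ld C X)"
      using left_dual[OF X] by (auto simp: dual_pair_def)
    have "\<rho> X \<bullet> \<sigma> X = ((\<rho> X \<lhd> []) \<bullet> (X \<rhd> M \<rhd> e X)) \<bullet> (X \<rhd> \<rho> (ld C X) \<lhd> [X]) \<bullet> (c X \<lhd> [M, X])"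
      using X h(1-4) by (simp add: \<sigma>_def rwhisk_Nil)
    also have "(\<rho> X \<lhd> []) \<bullet> (X \<rhd> M \<rhd> e X) = (M \<rhd> X \<rhd> e X) \<bullet> (\<rho> X \<lhd> [ld C X, X])"
      using X h(1-4) d(1-8) rex_anti_half_braiding[OF r X, of "e X" "[ld C X, X]"] by simp
    also have "((M \<rhd> X \<rhd> e X) \<bullet> (\<rho> X \<lhd> [ld C X, X])) \<bullet> (X \<rhd> \<rho> (ld C X) \<lhd> [X]) \<bullet> (c X \<lhd> [M, X])
        = (M \<rhd> X \<rhd> e X) \<bullet> (M \<rhd> c X \<lhd> [X])"
      unfolding c_def using anti_half_braiding_coev[OF r X d(2) dp(2), of "[X]"] X by simp
    also have "\<dots> = sid [M, X]"
      using d(9)[of "[]", THEN whisk_cong(2), of M] d(1-8) by (simp add: rwhisk_Nil)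
    finally show "\<rho> X \<bullet> \<sigma> X = sid [M, X]" .
    have "\<sigma> X \<bullet> \<rho> X = (X \<rhd> M \<rhd> e X) \<bullet> (X \<rhd> \<rho> (ld C X) \<lhd> [X]) \<bullet> (c X \<lhd> [M, X]) \<bullet> (\<rho> X \<lhd> [])"
      using X h(1-4) by (simp add: \<sigma>_def rwhisk_Nil)
    also have "\<dots> = (X \<rhd> M \<rhd> e X) \<bullet> (X \<rhd> \<rho> (ld C X) \<lhd> [X]) \<bullet> (X \<rhd> ld C X \<rhd> \<rho> X \<lhd> []) \<bullet> (c X \<lhd> [X, M])"
      using exchange_atom(3)[of "c X" "\<rho> X \<lhd> []" "[M, X]" X "ld C X"] X h(1-4) d(1-8) by simp
    also have "\<dots> = (X \<rhd> e X \<lhd> [M]) \<bullet> (c X \<lhd> [X, M])"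
      unfolding e_def
      using anti_half_braiding_ev[OF r d(2) X dp(1), of "[]", THEN whisk_cong(3), of X "c X \<lhd> [X, M]"] X d(1-8) dp
      by (simp add: rwhisk_Nil)
    also have "\<dots> = sid [X, M]"
      using d(9)[of "[M]"] by simp
    finally show "\<sigma> X \<bullet> \<rho> X = sid [X, M]" .
  qed
  show ?thesis
    by (rule that[OF half_braidingI_inverse[OF r inv \<sigma>] inv])
qed

end

section \<open>Half-braidings on dual objects\<close>

context monoidal_category
begin

lemma transposed_tail:
  assumes "transposed M N e \<rho> \<tau>" "X \<in> objs C"
  shows "(X \<rhd> e \<lhd> zs) \<bullet> (\<tau> X \<lhd> M # zs) = (e \<lhd> X # zs) \<bullet> (N \<rhd> \<rho> X \<lhd> zs)"
proof -
  have "(X \<rhd> e) \<bullet> (\<tau> X \<lhd> [M]) = (e \<lhd> [X]) \<bullet> (N \<rhd> \<rho> X)"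
    using assms by (simp add: transposed_def)
  from with_tail[OF this, of zs] show ?thesis by simp
qed

lemma dual_test_inject:
  assumes d: "sdual M N e c"
    and A: "sarr A" "scod A = ws @ [N]" and B: "sarr B" "scod B = ws @ [N]" "sdom A = sdom B"
    and eq: "lwhisks ws e \<bullet> (A \<lhd> [M]) = lwhisks ws e \<bullet> (B \<lhd> [M])"
  shows "A = B"
proof -
  have "((lwhisks ws e \<bullet> (A \<lhd> [M])) \<lhd> [N]) \<bullet> lwhisks (sdom A) c
      = ((lwhisks ws e \<bullet> (B \<lhd> [M])) \<lhd> [N]) \<bullet> lwhisks (sdom B) c"
    by (simp only: eq B(3))
  then show ?thesis
    using bend_tail_left[OF d A(1) refl A(2)] bend_tail_left[OF d B(1) refl B(2)] by simp
qed

text \<open>Y is next to M and therefore changes sides of the pairing first, then X. The order of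
  the two passages is thus reversed, in accordance with the multiplicativity axioms of
  half-braidings and anti-half-braidings.\<close>

lemma transposed_mult:
  assumes d: "sdual M N e c" and tr: "transposed M N e \<rho> \<tau>"
    and \<rho>: "\<And>X. X \<in> objs C \<Longrightarrow> sarr (\<rho> X) \<and> sdom (\<rho> X) = [X, M] \<and> scod (\<rho> X) = [M, X]"
    and \<tau>: "\<And>X. X \<in> objs C \<Longrightarrow> sarr (\<tau> X) \<and> sdom (\<tau> X) = [N, X] \<and> scod (\<tau> X) = [X, N]"
    and X: "X \<in> objs C" "Y \<in> objs C"
  shows "(X \<rhd> Y \<rhd> e \<lhd> []) \<bullet> (X \<rhd> \<tau> Y \<lhd> [M]) \<bullet> (\<tau> X \<lhd> [Y, M])
    = (e \<lhd> [X, Y]) \<bullet> (N \<rhd> \<rho> X \<lhd> [Y]) \<bullet> (N \<rhd> X \<rhd> \<rho> Y \<lhd> [])"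
proof -
  note d' = sdualD(1-8)[OF d]
  have "(X \<rhd> Y \<rhd> e \<lhd> []) \<bullet> (X \<rhd> \<tau> Y \<lhd> [M]) \<bullet> (\<tau> X \<lhd> [Y, M])
      = (X \<rhd> e \<lhd> [Y]) \<bullet> ((X \<rhd> N \<rhd> \<rho> Y \<lhd> []) \<bullet> (\<tau> X \<lhd> [Y, M]))"
    using transposed_tail[OF tr X(2), of "[]", THEN whisk_cong(3), of X "\<tau> X \<lhd> [Y, M]"] by simp
  also have "(X \<rhd> N \<rhd> \<rho> Y \<lhd> []) \<bullet> (\<tau> X \<lhd> [Y, M]) = (\<tau> X \<lhd> [M, Y]) \<bullet> (N \<rhd> X \<rhd> \<rho> Y \<lhd> [])"
    using exchange_atom(9)[of "\<tau> X" "\<rho> Y \<lhd> []" "[M, Y]" N X X N] X d' \<rho> \<tau> by simp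
  also have "(X \<rhd> e \<lhd> [Y]) \<bullet> (\<tau> X \<lhd> [M, Y]) \<bullet> (N \<rhd> X \<rhd> \<rho> Y \<lhd> [])
      = (e \<lhd> [X, Y]) \<bullet> (N \<rhd> \<rho> X \<lhd> [Y]) \<bullet> (N \<rhd> X \<rhd> \<rho> Y \<lhd> [])"
    using transposed_tail[OF tr X(1), of "[Y]", THEN whisk_cong(1), of "N \<rhd> X \<rhd> \<rho> Y \<lhd> []"] by simp
  finally show ?thesis .
qed

lemma transposed_natural:
  assumes d: "sdual M N e c" and tr: "transposed M N e \<rho> \<tau>"
    and \<rho>: "\<And>X. X \<in> objs C \<Longrightarrow> sarr (\<rho> X) \<and> sdom (\<rho> X) = [X, M] \<and> scod (\<rho> X) = [M, X]"
    and \<tau>: "\<And>X. X \<in> objs C \<Longrightarrow> sarr (\<tau> X) \<and> sdom (\<tau> X) = [N, X] \<and> scod (\<tau> X) = [X, N]"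
    and f: "f \<in> arrs C"
  shows "(tgt C f \<rhd> e \<lhd> []) \<bullet> (J f \<lhd> [N, M]) \<bullet> (\<tau> (src C f) \<lhd> [M])
      = (e \<lhd> [tgt C f]) \<bullet> (N \<rhd> M \<rhd> J f \<lhd> []) \<bullet> (N \<rhd> \<rho> (src C f) \<lhd> [])"
    "(tgt C f \<rhd> e \<lhd> []) \<bullet> (\<tau> (tgt C f) \<lhd> [M]) \<bullet> (N \<rhd> J f \<lhd> [M])
      = (e \<lhd> [tgt C f]) \<bullet> (N \<rhd> \<rho> (tgt C f) \<lhd> []) \<bullet> (N \<rhd> J f \<lhd> [M])"
proof -
  note d' = sdualD(1-8)[OF d]
  have "((tgt C f \<rhd> e \<lhd> []) \<bullet> (J f \<lhd> [N, M])) \<bullet> (\<tau> (src C f) \<lhd> [M])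
      = (J f \<lhd> []) \<bullet> (src C f \<rhd> e \<lhd> []) \<bullet> (\<tau> (src C f) \<lhd> [M])"
    using rex_J[OF f, of "e \<lhd> []" "tgt C f" "[N, M]"] d' by simp
  also have "\<dots> = ((J f \<lhd> []) \<bullet> (e \<lhd> [src C f])) \<bullet> (N \<rhd> \<rho> (src C f) \<lhd> [])"
    using transposed_tail[OF tr, of "src C f" "[]"] f by simp
  also have "(J f \<lhd> []) \<bullet> (e \<lhd> [src C f]) = (e \<lhd> [tgt C f]) \<bullet> (N \<rhd> M \<rhd> J f \<lhd> [])"
    using exchange_atom(7)[of e "J f \<lhd> []" "[tgt C f]" N M] f d' by simp
  finally show "(tgt C f \<rhd> e \<lhd> []) \<bullet> (J f \<lhd> [N, M]) \<bullet> (\<tau> (src C f) \<lhd> [M])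
      = (e \<lhd> [tgt C f]) \<bullet> (N \<rhd> M \<rhd> J f \<lhd> []) \<bullet> (N \<rhd> \<rho> (src C f) \<lhd> [])"
    by simp
  show "(tgt C f \<rhd> e \<lhd> []) \<bullet> (\<tau> (tgt C f) \<lhd> [M]) \<bullet> (N \<rhd> J f \<lhd> [M])
      = (e \<lhd> [tgt C f]) \<bullet> (N \<rhd> \<rho> (tgt C f) \<lhd> []) \<bullet> (N \<rhd> J f \<lhd> [M])"
    using transposed_tail[OF tr, of "tgt C f" "[]", THEN whisk_cong(1), of "N \<rhd> J f \<lhd> [M]"] f by simp
qed

text \<open>Arrows into a word that ends in N are determined by their pairing with M, and after this
  pairing each axiom for \<open>\<tau>\<close> becomes the corresponding axiom for
  \<open>\<rho>\<close>.\<close>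

lemma half_braiding_transposed:
  assumes d: "sdual M N e c" and tr: "transposed M N e \<rho> \<tau>" and r: "anti_half_braiding M \<rho>"
    and \<tau>: "\<And>X. X \<in> objs C \<Longrightarrow> sarr (\<tau> X) \<and> sdom (\<tau> X) = [N, X] \<and> scod (\<tau> X) = [X, N]"
  shows "half_braiding N \<tau>"
proof -
  note d' = sdualD(1-8)[OF d] and h = anti_half_braidingD[OF r]
  have \<rho>: "\<And>X. X \<in> objs C \<Longrightarrow> sarr (\<rho> X) \<and> sdom (\<rho> X) = [X, M] \<and> scod (\<rho> X) = [M, X]"
    using h(2-4) by simp
  have rex_e: "B \<bullet> (e \<lhd> zs) = (e \<lhd> ws) \<bullet> (N \<rhd> M \<rhd> B)" if "sarr B" "zs = sdom B" "ws = scod B" for B zs ws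
    using exchange_atom(7)[of e B ws N M] that d' by simp
  show ?thesis
    unfolding half_braiding_def
  proof (intro conjI ballI)
    fix f assume f: "f \<in> arrs C"
    show "(J f \<lhd> [N]) \<bullet> \<tau> (src C f) = \<tau> (tgt C f) \<bullet> (N \<rhd> J f)"
      by (rule dual_test_inject[OF d, where ws = "[tgt C f]"])
        (use f d' \<tau> transposed_natural[OF d tr \<rho> \<tau> f] h(5)[OF f, of "[]", THEN whisk_cong(2), of N] in
          \<open>simp_all add: rwhisk_Nil\<close>)
  next
    fix X Y assume X: "X \<in> objs C" "Y \<in> objs C"
    have "(X \<rhd> Y \<rhd> e \<lhd> []) \<bullet> (X \<rhd> \<tau> Y \<lhd> [M]) \<bullet> (\<tau> X \<lhd> [Y, M])
      = ((e \<lhd> [X, Y]) \<bullet> (N \<rhd> M \<rhd> unpack X Y \<lhd> [])) \<bullet> (N \<rhd> \<rho> (X \<otimes> Y) \<lhd> []) \<bullet> (N \<rhd> pack X Y \<lhd> [M])"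
      using transposed_mult[OF d tr \<rho> \<tau> X] h(6)[OF X, of "[]", THEN whisk_cong(2), of N] by simp
    also have "(e \<lhd> [X, Y]) \<bullet> (N \<rhd> M \<rhd> unpack X Y \<lhd> []) = (unpack X Y \<lhd> []) \<bullet> (e \<lhd> [X \<otimes> Y])"
      using rex_e[of "unpack X Y \<lhd> []" "[X \<otimes> Y]" "[X, Y]"] X by simp
    also have "((unpack X Y \<lhd> []) \<bullet> (e \<lhd> [X \<otimes> Y])) \<bullet> (N \<rhd> \<rho> (X \<otimes> Y) \<lhd> []) \<bullet> (N \<rhd> pack X Y \<lhd> [M])
      = ((unpack X Y \<lhd> []) \<bullet> (X \<otimes> Y \<rhd> e \<lhd> [])) \<bullet> (\<tau> (X \<otimes> Y) \<lhd> [M]) \<bullet> (N \<rhd> pack X Y \<lhd> [M])"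
      using transposed_tail[OF tr, of "X \<otimes> Y" "[]", THEN whisk_cong(1), of "N \<rhd> pack X Y \<lhd> [M]"] X by simp
    also have "(unpack X Y \<lhd> []) \<bullet> (X \<otimes> Y \<rhd> e \<lhd> []) = (X \<rhd> Y \<rhd> e \<lhd> []) \<bullet> (unpack X Y \<lhd> [N, M])"
      using rex_unpack[of X Y "e \<lhd> []" "[N, M]"] X d' by simp
    finally have *: "(X \<rhd> Y \<rhd> e \<lhd> []) \<bullet> (X \<rhd> \<tau> Y \<lhd> [M]) \<bullet> (\<tau> X \<lhd> [Y, M])
      = (X \<rhd> Y \<rhd> e \<lhd> []) \<bullet> (unpack X Y \<lhd> [N, M]) \<bullet> (\<tau> (X \<otimes> Y) \<lhd> [M]) \<bullet> (N \<rhd> pack X Y \<lhd> [M])"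
      by simp
    show "(X \<rhd> \<tau> Y) \<bullet> (\<tau> X \<lhd> [Y]) = (unpack X Y \<lhd> [N]) \<bullet> \<tau> (X \<otimes> Y) \<bullet> (N \<rhd> pack X Y)"
      by (rule dual_test_inject[OF d, where ws = "[X, Y]"])
        (use X d' \<tau> * in \<open>simp_all add: rwhisk_Nil\<close>)
  next
    have "(\<one> \<rhd> e \<lhd> []) \<bullet> (\<tau> \<one> \<lhd> [M]) \<bullet> (N \<rhd> pack0 \<lhd> [M]) = (e \<lhd> [\<one>]) \<bullet> (N \<rhd> M \<rhd> pack0 \<lhd> [])"
      using transposed_tail[OF tr, of \<one> "[]", THEN whisk_cong(1), of "N \<rhd> pack0 \<lhd> [M]"]
        h(7)[of "[]", THEN whisk_cong(2), of N] by simp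
    also have "\<dots> = (pack0 \<lhd> []) \<bullet> (e \<lhd> [])"
      using rex_e[of "pack0 \<lhd> []" "[]" "[\<one>]"] by simp
    also have "\<dots> = (\<one> \<rhd> e \<lhd> []) \<bullet> (pack0 \<lhd> [N, M])"
      using exchange_atom(2)[of pack0 "e \<lhd> []" "[]" \<one>] d' by simp
    finally have *: "(\<one> \<rhd> e \<lhd> []) \<bullet> (\<tau> \<one> \<lhd> [M]) \<bullet> (N \<rhd> pack0 \<lhd> [M]) = (\<one> \<rhd> e \<lhd> []) \<bullet> (pack0 \<lhd> [N, M])" .
    show "\<tau> \<one> \<bullet> (N \<rhd> pack0) = pack0 \<lhd> [N]"
      by (rule dual_test_inject[OF d, where ws = "[\<one>]"])
        (use d' \<tau> * in \<open>simp_all add: rwhisk_Nil\<close>)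
  qed (use d' \<tau> in auto)
qed

lemma anti_half_braiding_transposed:
  assumes d: "sdual M N e c" and tr: "transposed M N e \<rho> \<tau>" and t: "half_braiding N \<tau>"
    and \<rho>: "\<And>X. X \<in> objs C \<Longrightarrow> sarr (\<rho> X) \<and> sdom (\<rho> X) = [X, M] \<and> scod (\<rho> X) = [M, X]"
  shows "anti_half_braiding M \<rho>"
proof -
  note d' = sdualD(1-8)[OF d] and h = half_braidingD[OF t]
  have \<tau>: "\<And>X. X \<in> objs C \<Longrightarrow> sarr (\<tau> X) \<and> sdom (\<tau> X) = [N, X] \<and> scod (\<tau> X) = [X, N]"
    using h(2-4) by simp
  have rex_e: "B \<bullet> (e \<lhd> zs) = (e \<lhd> ws) \<bullet> (N \<rhd> M \<rhd> B)" if "sarr B" "zs = sdom B" "ws = scod B" for B zs ws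
    using exchange_atom(7)[of e B ws N M] that d' by simp
  show ?thesis
    unfolding anti_half_braiding_def
  proof (intro conjI ballI)
    fix f assume f: "f \<in> arrs C"
    show "(M \<rhd> J f) \<bullet> \<rho> (src C f) = \<rho> (tgt C f) \<bullet> (J f \<lhd> [M])"
    proof (rule bend_left_inject[OF d, where ws = "[tgt C f]"])
      show "(e \<lhd> [tgt C f]) \<bullet> (N \<rhd> ((M \<rhd> J f) \<bullet> \<rho> (src C f))) = (e \<lhd> [tgt C f]) \<bullet> (N \<rhd> (\<rho> (tgt C f) \<bullet> (J f \<lhd> [M])))"
        using f \<rho> d' transposed_natural[OF d tr \<rho> \<tau> f] h(5)[OF f, of "[M]"]
        by (simp add: rwhisk_Nil)
    qed (use f d' \<rho> in simp_all)
  next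
    fix X Y assume X: "X \<in> objs C" "Y \<in> objs C"
    have "(e \<lhd> [X, Y]) \<bullet> (N \<rhd> \<rho> X \<lhd> [Y]) \<bullet> (N \<rhd> X \<rhd> \<rho> Y \<lhd> [])
      = ((X \<rhd> Y \<rhd> e \<lhd> []) \<bullet> (unpack X Y \<lhd> [N, M])) \<bullet> (\<tau> (X \<otimes> Y) \<lhd> [M]) \<bullet> (N \<rhd> pack X Y \<lhd> [M])"
      using transposed_mult[OF d tr \<rho> \<tau> X] h(6)[OF X, of "[M]"] by simp
    also have "(X \<rhd> Y \<rhd> e \<lhd> []) \<bullet> (unpack X Y \<lhd> [N, M]) = (unpack X Y \<lhd> []) \<bullet> (X \<otimes> Y \<rhd> e \<lhd> [])"
      using rex_unpack[of X Y "e \<lhd> []" "[N, M]"] X d' by simp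
    also have "((unpack X Y \<lhd> []) \<bullet> (X \<otimes> Y \<rhd> e \<lhd> [])) \<bullet> (\<tau> (X \<otimes> Y) \<lhd> [M]) \<bullet> (N \<rhd> pack X Y \<lhd> [M])
      = ((unpack X Y \<lhd> []) \<bullet> (e \<lhd> [X \<otimes> Y])) \<bullet> (N \<rhd> \<rho> (X \<otimes> Y) \<lhd> []) \<bullet> (N \<rhd> pack X Y \<lhd> [M])"
      using transposed_tail[OF tr, of "X \<otimes> Y" "[]", THEN whisk_cong(1), of "N \<rhd> pack X Y \<lhd> [M]"] X by simp
    also have "(unpack X Y \<lhd> []) \<bullet> (e \<lhd> [X \<otimes> Y]) = (e \<lhd> [X, Y]) \<bullet> (N \<rhd> M \<rhd> unpack X Y \<lhd> [])"
      using rex_e[of "unpack X Y \<lhd> []" "[X \<otimes> Y]" "[X, Y]"] X by simp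
    finally have *: "(e \<lhd> [X, Y]) \<bullet> (N \<rhd> \<rho> X \<lhd> [Y]) \<bullet> (N \<rhd> X \<rhd> \<rho> Y \<lhd> [])
      = (e \<lhd> [X, Y]) \<bullet> (N \<rhd> M \<rhd> unpack X Y \<lhd> []) \<bullet> (N \<rhd> \<rho> (X \<otimes> Y) \<lhd> []) \<bullet> (N \<rhd> pack X Y \<lhd> [M])"
      by simp
    show "(\<rho> X \<lhd> [Y]) \<bullet> (X \<rhd> \<rho> Y) = (M \<rhd> unpack X Y) \<bullet> \<rho> (X \<otimes> Y) \<bullet> (pack X Y \<lhd> [M])"
      by (rule bend_left_inject[OF d, where ws = "[X, Y]"])
        (use X d' \<rho> * in \<open>simp_all add: rwhisk_Nil\<close>)
  next
    have "(e \<lhd> [\<one>]) \<bullet> (N \<rhd> \<rho> \<one> \<lhd> []) \<bullet> (N \<rhd> pack0 \<lhd> [M]) = (\<one> \<rhd> e \<lhd> []) \<bullet> (pack0 \<lhd> [N, M])"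
      using transposed_tail[OF tr, of \<one> "[]", THEN whisk_cong(1), of "N \<rhd> pack0 \<lhd> [M]"]
        h(7)[of "[M]"] by simp
    also have "\<dots> = (pack0 \<lhd> []) \<bullet> (e \<lhd> [])"
      using exchange_atom(2)[of pack0 "e \<lhd> []" "[]" \<one>] d' by simp
    also have "\<dots> = (e \<lhd> [\<one>]) \<bullet> (N \<rhd> M \<rhd> pack0 \<lhd> [])"
      using rex_e[of "pack0 \<lhd> []" "[]" "[\<one>]"] by simp
    finally have *: "(e \<lhd> [\<one>]) \<bullet> (N \<rhd> \<rho> \<one> \<lhd> []) \<bullet> (N \<rhd> pack0 \<lhd> [M]) = (e \<lhd> [\<one>]) \<bullet> (N \<rhd> M \<rhd> pack0 \<lhd> [])" .
    show "\<rho> \<one> \<bullet> (pack0 \<lhd> [M]) = M \<rhd> pack0"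
      by (rule bend_left_inject[OF d, where ws = "[\<one>]"])
        (use d' \<rho> * in \<open>simp_all add: rwhisk_Nil\<close>)
  qed (use d' \<rho> in auto)
qed

text \<open>The witness is \<open>\<rho>\<close> rotated around the dual pair; a triangle identity
  shows that it is transposed to \<open>\<rho>\<close>.\<close>

lemma ex_transposed_half_braiding:
  assumes d: "sdual M N e c" and r: "anti_half_braiding M \<rho>"
  obtains \<tau> where "half_braiding N \<tau>" "transposed M N e \<rho> \<tau>"
proof -
  note d' = sdualD[OF d] and h = anti_half_braidingD[OF r]
  define \<tau> where "\<tau> X = (e \<lhd> [X, N]) \<bullet> (N \<rhd> \<rho> X \<lhd> [N]) \<bullet> (N \<rhd> X \<rhd> c)" for X
  have \<tau>: "sarr (\<tau> X) \<and> sdom (\<tau> X) = [N, X] \<and> scod (\<tau> X) = [X, N]" if "X \<in> objs C" for X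
    using that d'(1-8) h(2-4) by (simp add: \<tau>_def)
  have "transposed M N e \<rho> \<tau>"
    unfolding transposed_def
  proof
    fix X assume X: "X \<in> objs C"
    show "(X \<rhd> e) \<bullet> (\<tau> X \<lhd> [M]) = (e \<lhd> [X]) \<bullet> (N \<rhd> \<rho> X)"
      using bend_tail_right[OF d, of "(e \<lhd> [X]) \<bullet> (N \<rhd> \<rho> X)" "[N, X]" "[X]"] X d'(1-8) h(2-4)
      by (simp add: \<tau>_def)
  qed
  from that[OF half_braiding_transposed[OF d this r \<tau>] this] show ?thesis .
qed

lemma ex_transposed_anti_half_braiding:
  assumes d: "sdual M N e c" and t: "half_braiding N \<tau>"
  obtains \<rho> where "anti_half_braiding M \<rho>" "transposed M N e \<rho> \<tau>"
proof -
  note d' = sdualD[OF d] and h = half_braidingD[OF t]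
  define \<rho> where "\<rho> X = (M \<rhd> X \<rhd> e) \<bullet> (M \<rhd> \<tau> X \<lhd> [M]) \<bullet> (c \<lhd> [X, M])" for X
  have \<rho>: "sarr (\<rho> X) \<and> sdom (\<rho> X) = [X, M] \<and> scod (\<rho> X) = [M, X]" if "X \<in> objs C" for X
    using that d'(1-8) h(2-4) by (simp add: \<rho>_def)
  have "transposed M N e \<rho> \<tau>"
    unfolding transposed_def
  proof
    fix X assume X: "X \<in> objs C"
    show "(X \<rhd> e) \<bullet> (\<tau> X \<lhd> [M]) = (e \<lhd> [X]) \<bullet> (N \<rhd> \<rho> X)"
      using bend_left[OF d, of "(X \<rhd> e) \<bullet> (\<tau> X \<lhd> [M])" "[X, M]" "[X]"] X d'(1-8) h(2-4)
      by (simp add: \<rho>_def)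
  qed
  from that[OF anti_half_braiding_transposed[OF d this t \<rho>] this] show ?thesis .
qed

text \<open>The relation for the pairing implies the one for the copairing: after pairing the first
  letter with \<open>e\<close>, triangle identities reduce either side to
  \<open>\<tau> X\<close>.\<close>

lemma transposed_coev:
  assumes d: "sdual M N e c" and tr: "transposed M N e \<rho> \<tau>"
    and r: "anti_half_braiding M \<rho>" and t: "half_braiding N \<tau>" and X: "X \<in> objs C"
  shows "(\<rho> X \<lhd> [N]) \<bullet> (X \<rhd> c \<lhd> []) = (M \<rhd> \<tau> X \<lhd> []) \<bullet> (c \<lhd> [X])"
proof (rule bend_left_inject[OF d, where ws = "[X, N]"])
  note d' = sdualD[OF d] and h = half_braidingD[OF t] anti_half_braidingD(2-4)[OF r]
  have "(e \<lhd> [X, N]) \<bullet> (N \<rhd> \<rho> X \<lhd> [N]) \<bullet> (N \<rhd> X \<rhd> c \<lhd> []) = (X \<rhd> e \<lhd> [N]) \<bullet> (\<tau> X \<lhd> [M, N]) \<bullet> (N \<rhd> X \<rhd> c \<lhd> [])"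
    using transposed_tail[OF tr X, of "[N]", THEN whisk_cong(1), of "N \<rhd> X \<rhd> c \<lhd> []"] by simp
  also have "(\<tau> X \<lhd> [M, N]) \<bullet> (N \<rhd> X \<rhd> c \<lhd> []) = (X \<rhd> N \<rhd> c \<lhd> []) \<bullet> (\<tau> X \<lhd> [])"
    using exchange_atom(9)[of "\<tau> X" "c \<lhd> []" "[M, N]" N X X N] X d'(1-8) h by simp
  also have "(X \<rhd> e \<lhd> [N]) \<bullet> (X \<rhd> N \<rhd> c \<lhd> []) \<bullet> (\<tau> X \<lhd> []) = \<tau> X"
    using d'(10)[of "[]", THEN whisk_cong(3), of X "\<tau> X \<lhd> []"] X d'(1-8) h(1-4) by (simp add: rwhisk_Nil)
  also have "\<dots> = (\<tau> X \<lhd> []) \<bullet> (e \<lhd> [N, X]) \<bullet> (N \<rhd> c \<lhd> [X])"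
    using d'(10)[of "[X]"] X d'(1-8) h(1-4) by (simp add: rwhisk_Nil)
  also have "\<dots> = (e \<lhd> [X, N]) \<bullet> (N \<rhd> M \<rhd> \<tau> X \<lhd> []) \<bullet> (N \<rhd> c \<lhd> [X])"
    using exchange_atom(7)[of e "\<tau> X \<lhd> []" "[X, N]" N M, THEN whisk_cong(1), of "N \<rhd> c \<lhd> [X]"] X d'(1-8) h(1-4) by simp
  finally show "(e \<lhd> [X, N]) \<bullet> (N \<rhd> ((\<rho> X \<lhd> [N]) \<bullet> (X \<rhd> c \<lhd> []))) = (e \<lhd> [X, N]) \<bullet> (N \<rhd> ((M \<rhd> \<tau> X \<lhd> []) \<bullet> (c \<lhd> [X])))"
    by simp
qed (use X sdualD(1-8)[OF d] half_braidingD(1-4)[OF t] anti_half_braidingD(2-4)[OF r] in simp_all)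

end

section \<open>Modules over the centralizer bimonad\<close>

context centralizer_bimonad
begin

lemma bimonad: "bimonad C T"
proof -
  have "is_monad C T"
    unfolding is_monad_def
    using endofunctor mult_natural unit_natural mult_assoc mult_unit by (auto simp: in_hom)
  moreover have "comonoidal_functor C T"
    unfolding comonoidal_functor_def
    using endofunctor comul_natural comul_coassoc comul_counit by (auto simp: in_hom)
  ultimately show ?thesis
    unfolding bimonad_def using mult_comul unit_comul mult_counit unit_counit by auto
qed

text \<open>By \<open>mult_d\<close> and \<open>unit_d\<close>, associativity of the action becomes
  multiplicativity, and its unit law becomes triviality at \<one>.\<close>

lemma half_braiding_of_module:
  assumes m: "is_module C T M r"
  shows "half_braiding M (\<lambda>X. (X \<rhd> J r) \<bullet> d M X)"
proof -
  have M: "M \<in> objs C" and r: "r \<in> arrs C" "src C r = m_ob T M" "tgt C r = M"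
    and mm: "r \<cdot> m_ar T r = r \<cdot> m_mult T M" and mu: "r \<cdot> m_unit T M = ide C M"
    using m by (auto simp: is_module_def in_hom)
  show ?thesis
    unfolding half_braiding_def
  proof (intro conjI ballI)
    fix f assume f: "f \<in> arrs C"
    show "(J f \<lhd> [M]) \<bullet> (src C f \<rhd> J r) \<bullet> d M (src C f) = ((tgt C f \<rhd> J r) \<bullet> d M (tgt C f)) \<bullet> (M \<rhd> J f)"
      using rex_J[OF f, of "J r" "tgt C f" "[m_ob T M]", THEN whisk_cong(1), of "d M (src C f)"]
        d_nat[OF M f] r M f by simp
  next
    fix X Y assume X: "X \<in> objs C" "Y \<in> objs C"
    have "(X \<rhd> Y \<rhd> J r \<lhd> []) \<bullet> (X \<rhd> d M Y \<lhd> []) \<bullet> (X \<rhd> J r \<lhd> [Y]) \<bullet> (d M X \<lhd> [Y])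
      = (X \<rhd> Y \<rhd> J (r \<cdot> m_ar T r) \<lhd> []) \<bullet> (X \<rhd> d (m_ob T M) Y \<lhd> []) \<bullet> (d M X \<lhd> [Y])"
      using X M r ar_tail[of r Y "m_ob T M" "[]", THEN whisk_cong(3), of X "d M X \<lhd> [Y]"] by (simp add: J_cmp)
    also have "\<dots> = (unpack X Y \<lhd> [M]) \<bullet> (X \<otimes> Y \<rhd> J r \<lhd> []) \<bullet> (d M (X \<otimes> Y) \<lhd> []) \<bullet> (M \<rhd> pack X Y \<lhd> [])"
      unfolding mm using X M r by (simp add: push rex str)
    finally show "(X \<rhd> ((Y \<rhd> J r) \<bullet> d M Y)) \<bullet> (((X \<rhd> J r) \<bullet> d M X) \<lhd> [Y]) =
          (unpack X Y \<lhd> [M]) \<bullet> ((X \<otimes> Y \<rhd> J r) \<bullet> d M (X \<otimes> Y)) \<bullet> (M \<rhd> pack X Y)"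
      using X M r by (simp add: rwhisk_Nil)
  next
    have "(\<one> \<rhd> J r \<lhd> []) \<bullet> (d M \<one> \<lhd> []) \<bullet> (M \<rhd> pack0 \<lhd> []) = (pack0 \<lhd> [M]) \<bullet> (J (r \<cdot> m_unit T M) \<lhd> [])"
      using M r by (simp add: push str)
    then show "((\<one> \<rhd> J r) \<bullet> d M \<one>) \<bullet> (M \<rhd> pack0) = pack0 \<lhd> [M]"
      unfolding mu using M r by (simp add: rwhisk_Nil)
  qed (use M r in auto)
qed

text \<open>The action is the arrow that universality of \<open>d\<close> assigns to
  \<open>\<tau>\<close>. Associativity is tested against iterated \<open>d\<close>, the unit law
  behind an inserted unit letter.\<close>

lemma module_of_half_braiding:
  assumes h: "half_braiding N \<tau>"
  obtains s where "is_module C T N s" "\<And>X. X \<in> objs C \<Longrightarrow> (X \<rhd> J s) \<bullet> d N X = \<tau> X"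
proof -
  note h' = half_braidingD[OF h]
  have "\<exists>!s. s \<in> hom C (m_ob T N) N \<and> (\<forall>X \<in> objs C. (X \<rhd> J s) \<bullet> d N X = \<tau> X)"
    by (rule d_univ) (use h h' in \<open>auto simp: half_braiding_def\<close>)
  then obtain s where s: "s \<in> hom C (m_ob T N) N" and \<tau>: "\<And>X. X \<in> objs C \<Longrightarrow> (X \<rhd> J s) \<bullet> d N X = \<tau> X"
    by blast
  have N: "N \<in> objs C" and s': "s \<in> arrs C" "src C s = m_ob T N" "tgt C s = N"
    using h' s by (auto simp: in_hom)
  have \<tau>_tail: "(X \<rhd> J s \<lhd> zs) \<bullet> (d N X \<lhd> zs) = \<tau> X \<lhd> zs" if "X \<in> objs C" for X zs
    using with_tail[OF \<tau>[OF that], of zs] by simp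
  have "s \<cdot> m_ar T s = s \<cdot> m_mult T N"
  proof (rule J_centr_eqI2[OF N])
    fix X Y assume X: "X \<in> objs C" "Y \<in> objs C"
    have "(X \<rhd> Y \<rhd> J (s \<cdot> m_ar T s) \<lhd> []) \<bullet> (X \<rhd> d (m_ob T N) Y \<lhd> []) \<bullet> (d N X \<lhd> [Y])
      = (X \<rhd> Y \<rhd> J s \<lhd> []) \<bullet> (X \<rhd> d N Y \<lhd> []) \<bullet> (X \<rhd> J s \<lhd> [Y]) \<bullet> (d N X \<lhd> [Y])"
      using X N s' ar_tail[of s Y "m_ob T N" "[]", THEN whisk_cong(3), of X "d N X \<lhd> [Y]"] by (simp add: J_cmp)
    also have "\<dots> = (X \<rhd> \<tau> Y \<lhd> []) \<bullet> (\<tau> X \<lhd> [Y])"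
      using X by (simp add: \<tau>_tail \<tau>_tail[THEN whisk_cong(3), unfolded whisk_nf])
    also have "\<dots> = (unpack X Y \<lhd> [N]) \<bullet> (X \<otimes> Y \<rhd> J s \<lhd> []) \<bullet> (d N (X \<otimes> Y) \<lhd> []) \<bullet> (N \<rhd> pack X Y \<lhd> [])"
      using X h'(6)[OF X, of "[]"] \<tau>_tail[of "X \<otimes> Y" "[]", THEN whisk_cong(1)] by simp
    also have "\<dots> = (X \<rhd> Y \<rhd> J (s \<cdot> m_mult T N) \<lhd> []) \<bullet> (X \<rhd> d (m_ob T N) Y \<lhd> []) \<bullet> (d N X \<lhd> [Y])"
      using X N s' by (simp add: push rex str)
    finally show "(X \<rhd> Y \<rhd> J (s \<cdot> m_ar T s) \<lhd> []) \<bullet> (X \<rhd> d (m_ob T N) Y \<lhd> []) \<bullet> (d N X \<lhd> [Y])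
      = (X \<rhd> Y \<rhd> J (s \<cdot> m_mult T N) \<lhd> []) \<bullet> (X \<rhd> d (m_ob T N) Y \<lhd> []) \<bullet> (d N X \<lhd> [Y])" .
  qed (use N s' in \<open>simp_all add: in_hom\<close>)
  moreover have "s \<cdot> m_unit T N = ide C N"
  proof (rule J_inject)
    have "(pack0 \<lhd> [N]) \<bullet> (J (s \<cdot> m_unit T N) \<lhd> []) = (\<one> \<rhd> J s \<lhd> []) \<bullet> (d N \<one> \<lhd> []) \<bullet> (N \<rhd> pack0 \<lhd> [])"
      using N s' by (simp add: push str)
    also have "\<dots> = (pack0 \<lhd> [N]) \<bullet> (J (ide C N) \<lhd> [])"
      using \<tau>_tail[of \<one> "[]", THEN whisk_cong(1), of "N \<rhd> pack0 \<lhd> []"] h'(7)[of "[]"] N by simp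
    finally have "J (s \<cdot> m_unit T N) \<lhd> [] = J (ide C N) \<lhd> []"
      by (rule pack0_cancel_left[rotated -1]) (use N s' in simp_all)
    then show "J (s \<cdot> m_unit T N) = J (ide C N)"
      using N s' by (simp add: rwhisk_Nil)
  qed (use N s' in \<open>simp_all add: in_hom\<close>)
  ultimately show ?thesis
    using N s by (intro that[OF _ \<tau>]) (auto simp: is_module_def)
qed

text \<open>Pairing and copairing are module maps if a letter X that passes both M and N passes them
  trivially. By transposition the passage at N can be exchanged for \<open>\<rho>\<close>, which is
  inverse to the passage at M.\<close>

lemma module_dual_pairI:
  assumes M: "is_module C T M r" and N: "is_module C T N s" and dp: "dual_pair C M N k l"
    and tr: "transposed M N (ev_of N M k) \<rho> (\<lambda>X. (X \<rhd> J s) \<bullet> d N X)"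
    and rh: "anti_half_braiding M \<rho>"
    and inv: "mutually_inverse M (\<lambda>X. (X \<rhd> J r) \<bullet> d M X) \<rho>"
  shows "module_dual_pair C T M r N s k l"
proof -
  define e c where "e = ev_of N M k" and "c = coev_of M N l"
  define \<sigma> \<tau> where "\<sigma> X = (X \<rhd> J r) \<bullet> d M X" and "\<tau> X = (X \<rhd> J s) \<bullet> d N X" for X
  have d: "sdual M N e c"
    unfolding e_def c_def by (rule sdual_of_dual_pair[OF dp])
  note d' = sdualD[OF d]
  have r: "r \<in> arrs C" "src C r = m_ob T M" "tgt C r = M" and s: "s \<in> arrs C" "src C s = m_ob T N" "tgt C s = N"
    and k: "k \<in> hom C (N \<otimes> M) \<one>" and l: "l \<in> hom C \<one> (M \<otimes> N)"
    using M N dp by (auto simp: is_module_def in_hom dual_pair_def)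
  note k' = k[unfolded in_hom] and l' = l[unfolded in_hom]
  have MN: "M \<in> objs C" "N \<in> objs C" using d' by auto
  have \<sigma>h: "half_braiding M \<sigma>" and \<tau>h: "half_braiding N \<tau>"
    unfolding \<sigma>_def[abs_def] \<tau>_def[abs_def]
    by (rule half_braiding_of_module[OF M] half_braiding_of_module[OF N])+
  have tr': "transposed M N e \<rho> \<tau>" and inv': "mutually_inverse M \<sigma> \<rho>"
    using tr inv unfolding e_def \<tau>_def[abs_def] \<sigma>_def[abs_def] by this+
  have \<sigma>_tail: "(X \<rhd> J r \<lhd> zs) \<bullet> (d M X \<lhd> zs) = \<sigma> X \<lhd> zs" and \<tau>_tail: "(X \<rhd> J s \<lhd> zs) \<bullet> (d N X \<lhd> zs) = \<tau> X \<lhd> zs" for X zs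
    by (simp_all add: \<sigma>_def \<tau>_def)
  have \<rho>\<sigma>: "(\<rho> X \<lhd> zs) \<bullet> (\<sigma> X \<lhd> zs) = sid (M # X # zs)" "(\<sigma> X \<lhd> zs) \<bullet> (\<rho> X \<lhd> zs) = sid (X # M # zs)"
    if "X \<in> objs C" for X zs
    using inv' that with_tail[of "\<rho> X \<bullet> \<sigma> X" _ zs] with_tail[of "\<sigma> X \<bullet> \<rho> X" _ zs]
    unfolding mutually_inverse_def by (metis append.simps rwhisk_scmp rwhisk_sid)+
  note \<sigma>\<tau>_tails = \<sigma>_tail \<tau>_tail whisk_cong[OF \<sigma>_tail, unfolded whisk_nf] whisk_cong[OF \<tau>_tail, unfolded whisk_nf]
  note ev = ev_of_tail[OF k MN(2,1), folded e_def] and co = coev_of_tail[OF l MN, folded c_def]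
  note evco = ev co whisk_cong[OF ev, unfolded whisk_nf] whisk_cong[OF co, unfolded whisk_nf]
  \<comment> \<open>The action on a tensor product corresponds to the composite half-braiding: X
    passes V first and then U.\<close>
  have act: "(X \<rhd> J (tensor_action C T U a V b) \<lhd> []) \<bullet> (d (U \<otimes> V) X \<lhd> []) \<bullet> (pack U V \<lhd> [X])
      = (X \<rhd> pack U V \<lhd> []) \<bullet> (X \<rhd> J a \<lhd> [V]) \<bullet> (d U X \<lhd> [V]) \<bullet> (U \<rhd> X \<rhd> J b \<lhd> []) \<bullet> (U \<rhd> d V X \<lhd> [])"
    if "X \<in> objs C" "U \<in> objs C" "V \<in> objs C" "a \<in> arrs C" "src C a = m_ob T U" "tgt C a = U"
      "b \<in> arrs C" "src C b = m_ob T V" "tgt C b = V" for X U V a b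
    using that by (simp add: tensor_action_def push str rexd)
  have "module_hom C T (N \<otimes> M) (tensor_action C T N s M r) \<one> (m_counit T) k"
    unfolding module_hom_def
  proof
    show "k \<cdot> tensor_action C T N s M r = m_counit T \<cdot> m_ar T k" (is "?l = ?r")
    proof (rule J_centr_eqI[of "N \<otimes> M" _ \<one>])
      fix X assume X: "X \<in> objs C"
      have "((X \<rhd> J ?l \<lhd> []) \<bullet> (d (N \<otimes> M) X \<lhd> [])) \<bullet> (pack N M \<lhd> [X])
        = (X \<rhd> J k \<lhd> []) \<bullet> (X \<rhd> J (tensor_action C T N s M r) \<lhd> []) \<bullet> (d (N \<otimes> M) X \<lhd> []) \<bullet> (pack N M \<lhd> [X])"
        using X MN k' r s by (simp add: tensor_action_def J_cmp)
      also have "\<dots> = (X \<rhd> pack0 \<lhd> []) \<bullet> (X \<rhd> e \<lhd> []) \<bullet> (\<tau> X \<lhd> [M]) \<bullet> (N \<rhd> \<sigma> X \<lhd> [])"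
        using X MN r s k' by (simp add: act evco \<sigma>\<tau>_tails)
      also have "\<dots> = (X \<rhd> pack0 \<lhd> []) \<bullet> (e \<lhd> [X])"
        using X transposed_tail[OF tr' X, of "[]", THEN whisk_cong(1), of "N \<rhd> \<sigma> X \<lhd> []"]
          \<rho>\<sigma>(1)[OF X, of "[]", THEN whisk_cong(2), of N] d'(1-8) by simp
      also have "\<dots> = ((X \<rhd> J ?r \<lhd> []) \<bullet> (d (N \<otimes> M) X \<lhd> [])) \<bullet> (pack N M \<lhd> [X])"
        using X MN k' by (simp add: J_cmp str evco)
      finally show "(X \<rhd> J ?l \<lhd> []) \<bullet> (d (N \<otimes> M) X \<lhd> []) = (X \<rhd> J ?r \<lhd> []) \<bullet> (d (N \<otimes> M) X \<lhd> [])"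
        by (rule pack_cancel[rotated -1]) (use X MN k' r s in \<open>simp_all add: tensor_action_def\<close>)
    qed (use MN k' r s in \<open>simp_all add: in_hom tensor_action_def\<close>)
  qed (rule k)
  moreover have "module_hom C T \<one> (m_counit T) (M \<otimes> N) (tensor_action C T M r N s) l"
    unfolding module_hom_def
  proof
    show "l \<cdot> m_counit T = tensor_action C T M r N s \<cdot> m_ar T l" (is "?l = ?r")
    proof (rule J_centr_eqI[of \<one> _ "M \<otimes> N"])
      fix X assume X: "X \<in> objs C"
      have "((X \<rhd> J ?r \<lhd> []) \<bullet> (d \<one> X \<lhd> [])) \<bullet> (pack0 \<lhd> [X])
        = (X \<rhd> J (tensor_action C T M r N s) \<lhd> []) \<bullet> (d (M \<otimes> N) X \<lhd> []) \<bullet> (pack M N \<lhd> [X]) \<bullet> (c \<lhd> [X])"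
        using X MN l' r s ar_tail[of l X \<one> "[]", THEN whisk_cong(1), of "pack0 \<lhd> [X]"] co[of "[X]"]
        by (simp add: tensor_action_def J_cmp_tail J_cmp)
      also have "\<dots> = (X \<rhd> pack M N \<lhd> []) \<bullet> (\<sigma> X \<lhd> [N]) \<bullet> (M \<rhd> \<tau> X \<lhd> []) \<bullet> (c \<lhd> [X])"
        using X MN r s act[THEN whisk_cong(1), of X M N r s "c \<lhd> [X]"] by (simp add: \<sigma>\<tau>_tails)
      also have "\<dots> = (X \<rhd> pack M N \<lhd> []) \<bullet> (X \<rhd> c \<lhd> [])"
        using X transposed_coev[OF d tr' rh \<tau>h X] \<rho>\<sigma>(2)[OF X, of "[N]", THEN whisk_cong(1), of "X \<rhd> c \<lhd> []"] d'(1-8) by simp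
      also have "\<dots> = ((X \<rhd> J ?l \<lhd> []) \<bullet> (d \<one> X \<lhd> [])) \<bullet> (pack0 \<lhd> [X])"
        using X MN l' by (simp add: J_cmp str evco)
      finally have "((X \<rhd> J ?l \<lhd> []) \<bullet> (d \<one> X \<lhd> [])) \<bullet> (pack0 \<lhd> [X]) = ((X \<rhd> J ?r \<lhd> []) \<bullet> (d \<one> X \<lhd> [])) \<bullet> (pack0 \<lhd> [X])"
        by (rule sym)
      then show "(X \<rhd> J ?l \<lhd> []) \<bullet> (d \<one> X \<lhd> []) = (X \<rhd> J ?r \<lhd> []) \<bullet> (d \<one> X \<lhd> [])"
        by (rule pack0_cancel[rotated -1]) (use X MN l' r s in \<open>simp_all add: tensor_action_def\<close>)
    qed (use MN l' r s in \<open>simp_all add: in_hom tensor_action_def\<close>)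
  qed (rule l)
  ultimately show ?thesis
    using M N dp by (simp add: module_dual_pair_def)
qed

text \<open>A left dual of a module carries the transpose of the inverse half-braiding, a right dual
  the inverse of the transpose. In the second case the given module takes the place of N in
  \<open>transposed\<close>.\<close>

theorem hopf_monad: "hopf_monad C T"
  unfolding hopf_monad_def
proof (intro conjI allI impI)
  show "bimonad C T" by (rule bimonad)
next
  fix M r assume M: "is_module C T M r"
  then have Mo: "M \<in> objs C" by (simp add: is_module_def)
  note h = half_braiding_of_module[OF M]
  obtain \<rho> where \<rho>: "anti_half_braiding M \<rho>" "mutually_inverse M (\<lambda>X. (X \<rhd> J r) \<bullet> d M X) \<rho>"
    using half_braiding_invertible[OF h] .
  note dp = left_dual[OF Mo]
  obtain \<tau> where \<tau>: "half_braiding (ld C M) \<tau>" "transposed M (ld C M) (ev_of (ld C M) M (evl C M)) \<rho> \<tau>"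
    using ex_transposed_half_braiding[OF sdual_of_dual_pair[OF dp] \<rho>(1)] .
  obtain s where s: "is_module C T (ld C M) s" "\<And>X. X \<in> objs C \<Longrightarrow> (X \<rhd> J s) \<bullet> d (ld C M) X = \<tau> X"
    using module_of_half_braiding[OF \<tau>(1)] by blast
  have "transposed M (ld C M) (ev_of (ld C M) M (evl C M)) \<rho> (\<lambda>X. (X \<rhd> J s) \<bullet> d (ld C M) X)"
    using \<tau>(2) s(2) by (simp add: transposed_def)
  then show "\<exists>N s e c. module_dual_pair C T M r N s e c"
    using module_dual_pairI[OF M s(1) dp _ \<rho>] by blast
  note dp = right_dual[OF Mo]
  let ?e = "ev_of M (rd C M) (evr C M)"
  obtain \<rho> where \<rho>: "anti_half_braiding (rd C M) \<rho>" "transposed (rd C M) M ?e \<rho> (\<lambda>X. (X \<rhd> J r) \<bullet> d M X)"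
    using ex_transposed_anti_half_braiding[OF sdual_of_dual_pair[OF dp] h] .
  obtain \<sigma> where \<sigma>: "half_braiding (rd C M) \<sigma>" "mutually_inverse (rd C M) \<sigma> \<rho>"
    using anti_half_braiding_invertible[OF \<rho>(1)] .
  obtain s where s: "is_module C T (rd C M) s" "\<And>X. X \<in> objs C \<Longrightarrow> (X \<rhd> J s) \<bullet> d (rd C M) X = \<sigma> X"
    using module_of_half_braiding[OF \<sigma>(1)] by blast
  have "mutually_inverse (rd C M) (\<lambda>X. (X \<rhd> J s) \<bullet> d (rd C M) X) \<rho>"
    using \<sigma>(2) s(2) by (simp add: mutually_inverse_def)
  then show "\<exists>N s e c. module_dual_pair C T N s M r e c"
    using module_dual_pairI[OF s(1) M dp \<rho>(2,1)] by blast
qed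

end

section \<open>Comparison of two centralizer bimonads\<close>

locale centralizer_comparison =
  S?: centralizer_bimonad C S d + T: centralizer_bimonad C T d'
  for C :: "('o, 'm, 'x) rigidcat_scheme" (structure) and S T :: "('o, 'm) bimonad_data" and d d' +
  fixes \<psi> :: "'o \<Rightarrow> 'm"
  assumes psi_hom: "V \<in> objs C \<Longrightarrow> \<psi> V \<in> hom C (m_ob S V) (m_ob T V)"
    and psi_d: "V \<in> objs C \<Longrightarrow> X \<in> objs C \<Longrightarrow> (X \<rhd> J (\<psi> V)) \<bullet> d V X = d' V X"
begin

lemma psi_arr [simp]:
  assumes "V \<in> objs C"
  shows "\<psi> V \<in> arrs C" "src C (\<psi> V) = m_ob S V" "tgt C (\<psi> V) = m_ob T V"
  using psi_hom[OF assms] by (auto simp: S.in_hom)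

lemma psi_tail:
  "V \<in> objs C \<Longrightarrow> X \<in> objs C \<Longrightarrow> (X \<rhd> J (\<psi> V) \<lhd> zs) \<bullet> (d V X \<lhd> zs) = d' V X \<lhd> zs"
  using psi_d[of V X, THEN S.with_tail[where zs = zs]] by simp

lemmas psi_tails = psi_tail psi_tail[THEN S.whisk_cong(1), unfolded S.whisk_nf]
  psi_tail[THEN S.whisk_cong(2), unfolded S.whisk_nf] psi_tail[THEN S.whisk_cong(3), unfolded S.whisk_nf]
  psi_tail[THEN S.whisk_cong(4), unfolded S.whisk_nf] psi_tail[THEN S.whisk_cong(5), unfolded S.whisk_nf]

text \<open>The structure equations of S and T have the same form, one in terms of \<open>d\<close>
  and one in terms of \<open>d'\<close>, and \<open>\<psi>\<close> converts the former family into
  the latter. Each axiom is thus checked by composing with the family of S, or with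
  \<open>pack0\<close> in the case of the unit.\<close>

lemma hopf_monad_morphism: "hopf_monad_morphism C S T \<psi>"
  unfolding hopf_monad_morphism_def
proof (intro conjI allI ballI impI)
  show "hopf_monad C S" "hopf_monad C T"
    by (rule S.hopf_monad T.hopf_monad)+
  show "\<psi> X \<in> hom C (m_ob S X) (m_ob T X)" if "X \<in> objs C" for X
    by (rule psi_hom[OF that])
next
  fix V W f assume "f \<in> hom C V W"
  then have f: "f \<in> arrs C" "src C f = V" "tgt C f = W" and V: "V \<in> objs C" and W: "W \<in> objs C"
    by (auto simp: S.in_hom)
  show "\<psi> W \<cdot> m_ar S f = m_ar T f \<cdot> \<psi> V" (is "?l = ?r")
  proof (rule S.J_centr_eqI[OF V])
    fix X assume X: "X \<in> objs C"
    show "(X \<rhd> J ?l \<lhd> []) \<bullet> (d V X \<lhd> []) = (X \<rhd> J ?r \<lhd> []) \<bullet> (d V X \<lhd> [])"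
      using X V W f by (simp add: S.push S.str T.str psi_tails)
  qed (use V W f in \<open>simp_all add: S.in_hom\<close>)
next
  fix V assume V: "V \<in> objs C"
  show "\<psi> V \<cdot> m_mult S V = m_mult T V \<cdot> \<psi> (m_ob T V) \<cdot> m_ar S (\<psi> V)" (is "?l = ?r")
  proof (rule S.J_centr_eqI2[OF V])
    fix X Y assume X: "X \<in> objs C" "Y \<in> objs C"
    show "(X \<rhd> Y \<rhd> J ?l \<lhd> []) \<bullet> (X \<rhd> d (m_ob S V) Y \<lhd> []) \<bullet> (d V X \<lhd> [Y])
      = (X \<rhd> Y \<rhd> J ?r \<lhd> []) \<bullet> (X \<rhd> d (m_ob S V) Y \<lhd> []) \<bullet> (d V X \<lhd> [Y])"
      using X V by (simp add: S.push S.rex S.str T.str psi_tails)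
  qed (use V in \<open>simp_all add: S.in_hom\<close>)
  show "\<psi> V \<cdot> m_unit S V = m_unit T V" (is "?l = ?r")
  proof (rule S.J_inject)
    have "(pack0 \<lhd> [m_ob T V]) \<bullet> (J ?l \<lhd> []) = (\<one> \<rhd> J (\<psi> V) \<lhd> []) \<bullet> (d V \<one> \<lhd> []) \<bullet> (V \<rhd> pack0 \<lhd> [])"
      using V by (simp add: S.push S.str)
    also have "\<dots> = (pack0 \<lhd> [m_ob T V]) \<bullet> (J ?r \<lhd> [])"
      using V by (simp add: psi_tails T.str)
    finally have "J ?l \<lhd> [] = J ?r \<lhd> []"
      by (rule S.pack0_cancel_left[rotated -1]) (use V in simp_all)
    then show "J ?l = J ?r"
      using V by (simp add: S.rwhisk_Nil)
  qed (use V in \<open>simp_all add: S.in_hom\<close>)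
next
  fix U V assume U: "U \<in> objs C" and V: "V \<in> objs C"
  show "m_comul T U V \<cdot> \<psi> (U \<otimes> V) = (\<psi> U \<boxtimes> \<psi> V) \<cdot> m_comul S U V" (is "?l = ?r")
  proof (rule S.J_centr_eqI[of "U \<otimes> V"])
    fix X assume X: "X \<in> objs C"
    show "(X \<rhd> J ?l \<lhd> []) \<bullet> (d (U \<otimes> V) X \<lhd> []) = (X \<rhd> J ?r \<lhd> []) \<bullet> (d (U \<otimes> V) X \<lhd> [])"
      by (rule S.pack_cancel[of U V _ "[X]"])
        (use X U V in \<open>simp_all add: S.push S.rex S.str T.str S.rexd T.rexd psi_tails\<close>)
  qed (use U V in \<open>simp_all add: S.in_hom\<close>)
next
  show "m_counit T \<cdot> \<psi> \<one> = m_counit S" (is "?l = ?r")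
  proof (rule S.J_centr_eqI[of \<one>])
    fix X assume X: "X \<in> objs C"
    show "(X \<rhd> J ?l \<lhd> []) \<bullet> (d \<one> X \<lhd> []) = (X \<rhd> J ?r \<lhd> []) \<bullet> (d \<one> X \<lhd> [])"
      by (rule S.pack0_cancel[of _ "[X]"])
        (use X in \<open>simp_all add: S.push S.rex S.str T.str psi_tails\<close>)
  qed (simp_all add: S.in_hom)
qed

text \<open>The inverse comes from universality of \<open>d'\<close> applied to the family
  \<open>d\<close>. It satisfies the assumptions of this locale with the roles exchanged, so it is a
  morphism of Hopf monads for the same reason; that the composites are identities is again a
  uniqueness statement.\<close>

theorem hopf_monad_iso: "hopf_monad_iso C S T \<psi>"
proof -
  have "\<exists>h. h \<in> hom C (m_ob T V) (m_ob S V) \<and> (\<forall>X \<in> objs C. (X \<rhd> J h) \<bullet> d' V X = d V X)"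
    if V: "V \<in> objs C" for V
  proof -
    have "\<exists>!h. h \<in> hom C (m_ob T V) (m_ob S V) \<and> (\<forall>X \<in> objs C. (X \<rhd> J h) \<bullet> d' V X = d V X)"
      by (rule T.d_univ) (use V S.d_nat in auto)
    then show ?thesis by blast
  qed
  then obtain \<phi> where \<phi>: "\<And>V. V \<in> objs C \<Longrightarrow> \<phi> V \<in> hom C (m_ob T V) (m_ob S V)"
      "\<And>V X. V \<in> objs C \<Longrightarrow> X \<in> objs C \<Longrightarrow> (X \<rhd> J (\<phi> V)) \<bullet> d' V X = d V X"
    by metis
  interpret inv: centralizer_comparison C T S d' d \<phi>
    by unfold_locales (use \<phi> in auto)
  have "\<phi> V \<cdot> \<psi> V = ide C (m_ob S V)" if V: "V \<in> objs C" for V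
    by (rule S.J_centr_eqI[OF V])
      (use V in \<open>simp_all add: S.in_hom S.J_cmp psi_tails inv.psi_tails\<close>)
  moreover have "\<psi> V \<cdot> \<phi> V = ide C (m_ob T V)" if V: "V \<in> objs C" for V
    by (rule T.J_centr_eqI[OF V])
      (use V in \<open>simp_all add: S.in_hom S.J_cmp psi_tails inv.psi_tails\<close>)
  ultimately show ?thesis
    unfolding hopf_monad_iso_def
    using hopf_monad_morphism inv.hopf_monad_morphism by blast
qed

end

section \<open>Coends over dual pairs\<close>

text \<open>
  In each of the four monads the coend runs over a family of dual pairs \<open>(P X, Q X)\<close>, with \<open>Q X\<close>
  left dual to \<open>P X\<close>, of the objects \<open>Q X \<otimes> V \<otimes> P X\<close>; dinaturality is expressed by mates
  \<open>g : P X \<rightarrow> P Y\<close> and \<open>h : Q Y \<rightarrow> Q X\<close>.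
\<close>

locale dual_coend = rigid_category +
  fixes E PP QQ :: "'a \<Rightarrow> 'a" and ee cc :: "'a \<Rightarrow> ('a, 'b) sarrow"
    and jj :: "'a \<Rightarrow> 'a \<Rightarrow> ('a, 'b) sarrow"
  assumes E_obj [simp]: "V \<in> objs C \<Longrightarrow> E V \<in> objs C"
    and dual: "X \<in> objs C \<Longrightarrow> sdual (PP X) (QQ X) (ee X) (cc X)"
    and jj_arr [simp]: "V \<in> objs C \<Longrightarrow> X \<in> objs C \<Longrightarrow> sarr (jj V X)"
      "V \<in> objs C \<Longrightarrow> X \<in> objs C \<Longrightarrow> sdom (jj V X) = [QQ X, V, PP X]"
      "V \<in> objs C \<Longrightarrow> X \<in> objs C \<Longrightarrow> scod (jj V X) = [E V]"
    and jj_dinat: "\<lbrakk>V \<in> objs C; X \<in> objs C; Y \<in> objs C; g \<in> hom C (PP X) (PP Y); h \<in> hom C (QQ Y) (QQ X);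
        ee Y \<bullet> (QQ Y \<rhd> J g) = ee X \<bullet> (J h \<lhd> [PP X])\<rbrakk> \<Longrightarrow>
      jj V Y \<bullet> (QQ Y \<rhd> V \<rhd> J g) = jj V X \<bullet> (J h \<lhd> [V, PP X])"
    and jj_univ: "\<lbrakk>V \<in> objs C; Z \<in> objs C;
       \<And>X. X \<in> objs C \<Longrightarrow> sarr (\<phi> X) \<and> sdom (\<phi> X) = [QQ X, V, PP X] \<and> scod (\<phi> X) = [Z];
       \<And>X Y g h. \<lbrakk>X \<in> objs C; Y \<in> objs C; g \<in> hom C (PP X) (PP Y); h \<in> hom C (QQ Y) (QQ X);
          ee Y \<bullet> (QQ Y \<rhd> J g) = ee X \<bullet> (J h \<lhd> [PP X])\<rbrakk> \<Longrightarrow>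
          \<phi> Y \<bullet> (QQ Y \<rhd> V \<rhd> J g) = \<phi> X \<bullet> (J h \<lhd> [V, PP X])\<rbrakk> \<Longrightarrow>
      \<exists>!h. h \<in> hom C (E V) Z \<and> (\<forall>X \<in> objs C. J h \<bullet> jj V X = \<phi> X)"
    and PP_surj: "P \<in> objs C \<Longrightarrow> \<exists>X \<in> objs C. \<exists>n \<in> hom C P (PP X). iso C n"
begin

lemma dual_simps [simp]:
  assumes "X \<in> objs C"
  shows "PP X \<in> objs C" "QQ X \<in> objs C" "sarr (ee X)" "sdom (ee X) = [QQ X, PP X]" "scod (ee X) = []"
    "sarr (cc X)" "sdom (cc X) = []" "scod (cc X) = [PP X, QQ X]"
  using sdualD(1-8)[OF dual[OF assms]] by auto

lemma rex_ee:
  "X \<in> objs C \<Longrightarrow> sarr B \<Longrightarrow> zs = sdom B \<Longrightarrow> ws = scod B \<Longrightarrow>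
    B \<bullet> (ee X \<lhd> zs) = (ee X \<lhd> ws) \<bullet> (QQ X \<rhd> PP X \<rhd> B)"
  using exchange_atom(7)[of "ee X" B ws "QQ X" "PP X"] by simp

lemma ex_mate:
  assumes X: "X \<in> objs C" and Y: "Y \<in> objs C" and g: "g \<in> hom C (PP X) (PP Y)"
  obtains h where "h \<in> hom C (QQ Y) (QQ X)" "ee Y \<bullet> (QQ Y \<rhd> J g) = ee X \<bullet> (J h \<lhd> [PP X])"
proof -
  have g': "g \<in> arrs C" "src C g = PP X" "tgt C g = PP Y" using g by (auto simp: in_hom)
  let ?A = "ee Y \<bullet> (QQ Y \<rhd> J g)"
  obtain h where h: "h \<in> hom C (QQ Y) (QQ X)" "J h = (?A \<lhd> [QQ X]) \<bullet> (QQ Y \<rhd> cc X)"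
    using X Y g' J_full[of "(?A \<lhd> [QQ X]) \<bullet> (QQ Y \<rhd> cc X)" "QQ Y" "QQ X"] by auto
  have "ee X \<bullet> (J h \<lhd> [PP X]) = ?A"
    using bend_tail_right[OF dual[OF X], of ?A "[QQ Y]" "[]"] X Y g' by (simp add: h(2))
  then show ?thesis
    using that[OF h(1)] by simp
qed

text \<open>The mate of the injection \<open>jj V X\<close>: the letter \<open>QQ X\<close> is bent
  to the codomain, where it becomes \<open>PP X\<close>.\<close>

definition d0 :: "'a \<Rightarrow> 'a \<Rightarrow> ('a, 'b) sarrow" where
  "d0 V X = (PP X \<rhd> jj V X) \<bullet> (cc X \<lhd> [V, PP X])"

lemma d0_simps [simp]:
  assumes "V \<in> objs C" "X \<in> objs C"
  shows "sarr (d0 V X)" "sdom (d0 V X) = [V, PP X]" "scod (d0 V X) = [PP X, E V]"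
  using assms by (simp_all add: d0_def)

lemma jj_d0:
  assumes "V \<in> objs C" "X \<in> objs C"
  shows "jj V X = (ee X \<lhd> [E V]) \<bullet> (QQ X \<rhd> d0 V X)"
  using bend_left[OF dual[OF assms(2)], of "jj V X" "[V, PP X]" "[E V]"] assms by (simp add: d0_def)

lemma mate_left:
  assumes X: "X \<in> objs C" and Y: "Y \<in> objs C" and V: "V \<in> objs C"
    and g: "g \<in> hom C (PP X) (PP Y)" and h: "h \<in> hom C (QQ Y) (QQ X)"
    and m: "ee Y \<bullet> (QQ Y \<rhd> J g) = ee X \<bullet> (J h \<lhd> [PP X])"
    and B: "sarr B" "sdom B = [V, PP X]" "scod B = PP X # zs"
  shows "(ee Y \<lhd> zs) \<bullet> (QQ Y \<rhd> J g \<lhd> zs) \<bullet> (QQ Y \<rhd> B) = (ee X \<lhd> zs) \<bullet> (QQ X \<rhd> B) \<bullet> (J h \<lhd> [V, PP X])"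
proof -
  have h': "h \<in> arrs C" "src C h = QQ Y" "tgt C h = QQ X" using h by (auto simp: in_hom)
  have zs: "set zs \<subseteq> objs C" using sarr_cpt(2)[OF B(1)] B(3) by simp
  have "(ee Y \<lhd> zs) \<bullet> (QQ Y \<rhd> J g \<lhd> zs) \<bullet> (QQ Y \<rhd> B) = (ee X \<lhd> zs) \<bullet> (J h \<lhd> PP X # zs) \<bullet> (QQ Y \<rhd> B)"
    using m[THEN with_tail, of zs, THEN whisk_cong(1), of "QQ Y \<rhd> B"] by simp
  also have "(J h \<lhd> PP X # zs) \<bullet> (QQ Y \<rhd> B) = (QQ X \<rhd> B) \<bullet> (J h \<lhd> [V, PP X])"
    using exchange_atom(5)[of "J h" B "PP X # zs" "QQ Y" "QQ X"] h' B by simp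
  finally show ?thesis .
qed

text \<open>Tested against the pairing, naturality along \<open>g\<close> becomes dinaturality of
  \<open>jj\<close> for \<open>g\<close> and its mate \<open>h\<close>.\<close>

lemma d0_nat:
  assumes V: "V \<in> objs C" and X: "X \<in> objs C" and Y: "Y \<in> objs C" and g: "g \<in> hom C (PP X) (PP Y)"
  shows "(J g \<lhd> [E V]) \<bullet> d0 V X = d0 V Y \<bullet> (V \<rhd> J g)"
proof (rule bend_left_inject[OF dual[OF Y], where ws = "[E V]"])
  have g': "g \<in> arrs C" "src C g = PP X" "tgt C g = PP Y" using g by (auto simp: in_hom)
  obtain h where h: "h \<in> hom C (QQ Y) (QQ X)" "ee Y \<bullet> (QQ Y \<rhd> J g) = ee X \<bullet> (J h \<lhd> [PP X])"
    using ex_mate[OF X Y g] .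
  have "(ee Y \<lhd> [E V]) \<bullet> (QQ Y \<rhd> ((J g \<lhd> [E V]) \<bullet> d0 V X)) = jj V X \<bullet> (J h \<lhd> [V, PP X])"
    using mate_left[OF X Y V g h, of "d0 V X" "[E V]"] V X by (simp add: jj_d0)
  also have "\<dots> = jj V Y \<bullet> (QQ Y \<rhd> V \<rhd> J g)"
    using jj_dinat[OF V X Y g h] by simp
  finally show "(ee Y \<lhd> [E V]) \<bullet> (QQ Y \<rhd> ((J g \<lhd> [E V]) \<bullet> d0 V X)) = (ee Y \<lhd> [E V]) \<bullet> (QQ Y \<rhd> (d0 V Y \<bullet> (V \<rhd> J g)))"
    using V Y by (simp add: jj_d0)
qed (use V X Y g in \<open>simp_all add: in_hom\<close>)

text \<open>\<open>d0\<close> is given only at the objects \<open>PP X\<close>. Each P receives an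
  index and an isomorphism \<open>nn P\<close> to some \<open>PP X\<close>, along which
  \<open>d\<close> transports \<open>d0\<close>.\<close>

definition ix :: "'a \<Rightarrow> 'a" where
  "ix P = (SOME X. X \<in> objs C \<and> (\<exists>n \<in> hom C P (PP X). iso C n))"

definition nn :: "'a \<Rightarrow> 'b" where
  "nn P = (SOME n. n \<in> hom C P (PP (ix P)) \<and> iso C n)"

lemma ix_nn:
  assumes "P \<in> objs C"
  shows "ix P \<in> objs C" "nn P \<in> hom C P (PP (ix P))" "iso C (nn P)"
proof -
  have *: "ix P \<in> objs C \<and> (\<exists>n \<in> hom C P (PP (ix P)). iso C n)"
    unfolding ix_def by (rule someI_ex) (use PP_surj[OF assms] in blast)
  then have "nn P \<in> hom C P (PP (ix P)) \<and> iso C (nn P)"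
    unfolding nn_def by (intro someI_ex[where P = "\<lambda>n. n \<in> hom C P (PP (ix P)) \<and> iso C n"]) (auto simp: Bex_def)
  with * show "ix P \<in> objs C" "nn P \<in> hom C P (PP (ix P))" "iso C (nn P)"
    by auto
qed

lemma nn_simps [simp]:
  assumes "P \<in> objs C"
  shows "ix P \<in> objs C" "nn P \<in> arrs C" "src C (nn P) = P" "tgt C (nn P) = PP (ix P)" "iso C (nn P)"
  using ix_nn[OF assms] by (auto simp: in_hom)

lemma J_nn [simp]:
  assumes "P \<in> objs C"
  shows "(J (inv_arr C (nn P)) \<lhd> zs) \<bullet> (J (nn P) \<lhd> zs) = sid (P # zs)"
    "(J (nn P) \<lhd> zs) \<bullet> (J (inv_arr C (nn P)) \<lhd> zs) = sid (PP (ix P) # zs)"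
    "J (inv_arr C (nn P)) \<bullet> J (nn P) = sid [P]"
    "J (nn P) \<bullet> J (inv_arr C (nn P)) = sid [PP (ix P)]"
  using assms by (simp_all flip: J_cmp_tail J_cmp)

lemmas J_nn_context [simp] = J_nn(1,2)[THEN whisk_cong(1), unfolded whisk_nf]
  J_nn(3,4)[THEN whisk_cong(1), unfolded whisk_nf]

definition d :: "'a \<Rightarrow> 'a \<Rightarrow> ('a, 'b) sarrow" where
  "d V P = (J (inv_arr C (nn P)) \<lhd> [E V]) \<bullet> d0 V (ix P) \<bullet> (V \<rhd> J (nn P))"

lemma d_simps [simp]:
  assumes "V \<in> objs C" "P \<in> objs C"
  shows "sarr (d V P)" "sdom (d V P) = [V, P]" "scod (d V P) = [P, E V]"
  using assms by (simp_all add: d_def)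

lemma d_natural:
  assumes V: "V \<in> objs C" and f: "f \<in> arrs C"
  shows "(J f \<lhd> [E V]) \<bullet> d V (src C f) = d V (tgt C f) \<bullet> (V \<rhd> J f)"
proof -
  define P P' where "P = src C f" and "P' = tgt C f"
  have P: "P \<in> objs C" "P' \<in> objs C" using f by (auto simp: P_def P'_def)
  let ?g = "nn P' \<cdot> f \<cdot> inv_arr C (nn P)"
  have g: "?g \<in> hom C (PP (ix P)) (PP (ix P'))"
    using f P by (simp add: in_hom P_def P'_def)
  have Jg: "J ?g = J (nn P') \<bullet> J f \<bullet> J (inv_arr C (nn P))"
    using f P by (simp add: J_cmp P_def P'_def)
  have "(J f \<lhd> [E V]) \<bullet> d V P
      = (J (inv_arr C (nn P')) \<lhd> [E V]) \<bullet> ((J ?g \<lhd> [E V]) \<bullet> d0 V (ix P)) \<bullet> (V \<rhd> J (nn P))"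
    using V P f unfolding Jg
    by (simp add: d_def P_def P'_def)
  also have "\<dots> = (J (inv_arr C (nn P')) \<lhd> [E V]) \<bullet> d0 V (ix P') \<bullet> (V \<rhd> (J ?g \<bullet> J (nn P)))"
    unfolding d0_nat[OF V nn_simps(1)[OF P(1)] nn_simps(1)[OF P(2)] g] by simp
  also have "J ?g \<bullet> J (nn P) = J (nn P') \<bullet> J f"
    using P f unfolding Jg by (simp add: P_def P'_def)
  finally show ?thesis
    by (simp add: d_def P_def P'_def)
qed

text \<open>The isomorphism chosen at \<open>PP X\<close> may lead to another index; naturality of
  \<open>d0\<close> shows that the transport does not depend on it.\<close>

lemma d_PP:
  assumes V: "V \<in> objs C" and X: "X \<in> objs C"
  shows "d V (PP X) = d0 V X"
proof -
  have P: "PP X \<in> objs C" using X by simp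
  have "d V (PP X) = (J (inv_arr C (nn (PP X))) \<lhd> [E V]) \<bullet> (J (nn (PP X)) \<lhd> [E V]) \<bullet> d0 V X"
    unfolding d_def using d0_nat[OF V X _ ix_nn(2)[OF P]] P by simp
  also have "\<dots> = d0 V X"
    using P V X by simp
  finally show ?thesis .
qed

lemma jj_d: "V \<in> objs C \<Longrightarrow> X \<in> objs C \<Longrightarrow> jj V X = (ee X \<lhd> [E V]) \<bullet> (QQ X \<rhd> d V (PP X))"
  by (simp add: jj_d0 d_PP)

text \<open>Both sides are natural in P, and every P is isomorphic to some
  \<open>PP X\<close>.\<close>

lemma eq_at_PP:
  assumes V: "V \<in> objs C"
    and A: "sarr A" "sdom A = E V # zs" "scod A = ws"
    and \<psi>: "\<And>P. P \<in> objs C \<Longrightarrow> sarr (\<psi> P) \<and> sdom (\<psi> P) = V # P # zs \<and> scod (\<psi> P) = P # ws"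
      "\<And>f. f \<in> arrs C \<Longrightarrow> (J f \<lhd> ws) \<bullet> \<psi> (src C f) = \<psi> (tgt C f) \<bullet> (V \<rhd> J f \<lhd> zs)"
    and eq: "\<And>X. X \<in> objs C \<Longrightarrow> (PP X \<rhd> A) \<bullet> (d V (PP X) \<lhd> zs) = \<psi> (PP X)"
    and P: "P \<in> objs C"
  shows "(P \<rhd> A) \<bullet> (d V P \<lhd> zs) = \<psi> P"
proof -
  let ?n = "nn P" and ?X = "ix P"
  have zs: "set zs \<subseteq> objs C" using sarr_cpt(1)[OF A(1)] A(2) by simp
  have "(J ?n \<lhd> ws) \<bullet> (P \<rhd> A) \<bullet> (d V P \<lhd> zs) = (PP ?X \<rhd> A) \<bullet> (J ?n \<lhd> E V # zs) \<bullet> (d V P \<lhd> zs)"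
    using exchange_atom(5)[of "J ?n" A ws P "PP ?X", THEN whisk_cong(1), of "d V P \<lhd> zs"] A P by simp
  also have "\<dots> = ((PP ?X \<rhd> A) \<bullet> (d V (PP ?X) \<lhd> zs)) \<bullet> (V \<rhd> J ?n \<lhd> zs)"
    using d_natural[OF V, of ?n, THEN with_tail, of zs] P by simp
  also have "\<dots> = (J ?n \<lhd> ws) \<bullet> \<psi> P"
    using eq[of ?X] \<psi>(2)[of ?n] P by simp
  finally show ?thesis
    by (rule split_cancel_left[where K' = "J (inv_arr C ?n) \<lhd> ws", rotated -1])
      (use A P V \<psi>(1) zs in auto)
qed

sublocale centralizer C E d
proof
  fix V Z \<psi> assume V: "V \<in> objs C" and Z: "Z \<in> objs C"
    and \<psi>: "\<And>P. P \<in> objs C \<Longrightarrow> sarr (\<psi> P) \<and> sdom (\<psi> P) = [V, P] \<and> scod (\<psi> P) = [P, Z]"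
    and nat: "\<And>f. f \<in> arrs C \<Longrightarrow> (J f \<lhd> [Z]) \<bullet> \<psi> (src C f) = \<psi> (tgt C f) \<bullet> (V \<rhd> J f)"
  \<comment> \<open>The dinatural family whose mates are the values of \<open>\<psi>\<close> at the
    objects \<open>PP X\<close>.\<close>
  let ?\<phi> = "\<lambda>X. (ee X \<lhd> [Z]) \<bullet> (QQ X \<rhd> \<psi> (PP X))"
  have ex: "\<exists>!h. h \<in> hom C (E V) Z \<and> (\<forall>X \<in> objs C. J h \<bullet> jj V X = ?\<phi> X)"
  proof (rule jj_univ[OF V Z])
    fix X Y g h
    assume X: "X \<in> objs C" and Y: "Y \<in> objs C" and g: "g \<in> hom C (PP X) (PP Y)" and h: "h \<in> hom C (QQ Y) (QQ X)"
      and m: "ee Y \<bullet> (QQ Y \<rhd> J g) = ee X \<bullet> (J h \<lhd> [PP X])"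
    show "((ee Y \<lhd> [Z]) \<bullet> (QQ Y \<rhd> \<psi> (PP Y))) \<bullet> (QQ Y \<rhd> V \<rhd> J g) = ((ee X \<lhd> [Z]) \<bullet> (QQ X \<rhd> \<psi> (PP X))) \<bullet> (J h \<lhd> [V, PP X])"
      using mate_left[OF X Y V g h m, of "\<psi> (PP X)" "[Z]"] \<psi>[of "PP X"] X Y g
        nat[of g, THEN whisk_cong(2), of "QQ Y"] by (simp add: in_hom)
  qed (use V Z \<psi> in auto)
  \<comment> \<open>The dinatural and the natural problem have the same solutions, so existence and
    uniqueness carry over together.\<close>
  have iff: "(\<forall>X \<in> objs C. J h \<bullet> jj V X = ?\<phi> X) \<longleftrightarrow> (\<forall>P \<in> objs C. (P \<rhd> J h) \<bullet> d V P = \<psi> P)"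
    if h: "h \<in> hom C (E V) Z" for h
  proof
    have h': "h \<in> arrs C" "src C h = E V" "tgt C h = Z" using h by (auto simp: in_hom)
    have hjj: "J h \<bullet> jj V X = (ee X \<lhd> [Z]) \<bullet> (QQ X \<rhd> ((PP X \<rhd> J h) \<bullet> d V (PP X)))" if X: "X \<in> objs C" for X
      using rex_ee[OF X, of "J h" "[E V]" "[Z]", THEN whisk_cong(1), of "QQ X \<rhd> d V (PP X)"] V X h'
      by (simp add: jj_d)
    show "\<forall>X \<in> objs C. J h \<bullet> jj V X = ?\<phi> X" if "\<forall>P \<in> objs C. (P \<rhd> J h) \<bullet> d V P = \<psi> P"
      using that by (simp add: hjj del: lwhisk_scmp)
    assume *: "\<forall>X \<in> objs C. J h \<bullet> jj V X = ?\<phi> X"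
    have "(PP X \<rhd> J h) \<bullet> d V (PP X) = \<psi> (PP X)" if X: "X \<in> objs C" for X
    proof (rule bend_left_inject[OF dual[OF X], where ws = "[Z]"])
      show "(ee X \<lhd> [Z]) \<bullet> (QQ X \<rhd> ((PP X \<rhd> J h) \<bullet> d V (PP X))) = (ee X \<lhd> [Z]) \<bullet> (QQ X \<rhd> \<psi> (PP X))"
        using * X hjj[OF X] by simp
    qed (use V X h' \<psi>[of "PP X"] in simp_all)
    then show "\<forall>P \<in> objs C. (P \<rhd> J h) \<bullet> d V P = \<psi> P"
      using eq_at_PP[OF V, of "J h" "[]" "[Z]" \<psi>] V h' \<psi> nat by (auto simp: rwhisk_Nil)
  qed
  from ex show "\<exists>!h. h \<in> hom C (E V) Z \<and> (\<forall>P \<in> objs C. (P \<rhd> J h) \<bullet> d V P = \<psi> P)"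
    using iff by (auto simp: Ex1_def)
qed (use d_natural in auto)

text \<open>Coend injections stay jointly epimorphic when objects are tensored on the right: bending
  turns the hypothesis into an equation with \<open>d\<close> at the objects \<open>PP X\<close>,
  naturality extends it to all objects, and \<open>centr_eqI\<close> applies.\<close>

lemma jj_inject:
  assumes V: "V \<in> objs C" and A: "sarr A" "sdom A = E V # zs" and B: "sarr B" "sdom B = E V # zs" "scod B = scod A"
    and eq: "\<And>X. X \<in> objs C \<Longrightarrow> A \<bullet> (jj V X \<lhd> zs) = B \<bullet> (jj V X \<lhd> zs)"
  shows "A = B"
proof -
  have zs: "set zs \<subseteq> objs C" using sarr_cpt(1)[OF A(1)] A(2) by simp
  have nat: "(J f \<lhd> scod A) \<bullet> (src C f \<rhd> B) \<bullet> (d V (src C f) \<lhd> zs) = ((tgt C f \<rhd> B) \<bullet> (d V (tgt C f) \<lhd> zs)) \<bullet> (V \<rhd> J f \<lhd> zs)"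
    if f: "f \<in> arrs C" for f
    using exchange_atom(5)[of "J f" B "scod A" "src C f" "tgt C f", THEN whisk_cong(1), of "d V (src C f) \<lhd> zs"]
      d_nat_tail[OF V f, of zs] B f by simp
  have AB: "(PP X \<rhd> A) \<bullet> (d V (PP X) \<lhd> zs) = (PP X \<rhd> B) \<bullet> (d V (PP X) \<lhd> zs)" if X: "X \<in> objs C" for X
  proof (rule bend_left_inject[OF dual[OF X], where ws = "scod A"])
    have *: "D \<bullet> (jj V X \<lhd> zs) = (ee X \<lhd> scod A) \<bullet> (QQ X \<rhd> ((PP X \<rhd> D) \<bullet> (d V (PP X) \<lhd> zs)))"
      if "sarr D" "sdom D = E V # zs" "scod D = scod A" for D
      using rex_ee[OF X, of D "E V # zs" "scod A", THEN whisk_cong(1), of "QQ X \<rhd> d V (PP X) \<lhd> zs"] V X that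
      by (simp add: jj_d)
    show "(ee X \<lhd> scod A) \<bullet> (QQ X \<rhd> ((PP X \<rhd> A) \<bullet> (d V (PP X) \<lhd> zs))) = (ee X \<lhd> scod A) \<bullet> (QQ X \<rhd> ((PP X \<rhd> B) \<bullet> (d V (PP X) \<lhd> zs)))"
      using eq[OF X] *[OF A refl] *[OF B] by simp
  qed (use V X A B zs in simp_all)
  show ?thesis
  proof (rule centr_eqI[OF V A B])
    show "(P \<rhd> A) \<bullet> (d V P \<lhd> zs) = (P \<rhd> B) \<bullet> (d V P \<lhd> zs)" if "P \<in> objs C" for P
      by (rule eq_at_PP[OF V A refl, where \<psi> = "\<lambda>P. (P \<rhd> B) \<bullet> (d V P \<lhd> zs)"])
        (use V A B zs nat AB that in auto)
  qed
qed

end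

section \<open>The central monads\<close>

text \<open>What the dual with number \<open>i\<close> must provide: \<open>cap\<close> and
  \<open>cup\<close> form a duality on the proper side, and the action on arrows,
  \<open>du_gamma\<close> and \<open>du_unit\<close> are mates with respect to \<open>cap\<close>.
  For \<open>i = 1\<close> and \<open>i = 4\<close> the pairing contains \<open>piv_p\<close> or its
  inverse, and the mate conditions then rest on this isomorphism being natural and monoidal.\<close>

locale central_duals = rigid_category +
  fixes \<delta> :: "'a \<Rightarrow> 'b" and i :: nat
  assumes cap_hom: "X \<in> objs C \<Longrightarrow>
      cap C \<delta> i X \<in> hom C (if i \<le> 2 then du C i X \<otimes> X else X \<otimes> du C i X) \<one>"
    and cup_hom: "X \<in> objs C \<Longrightarrow>
      cup C \<delta> i X \<in> hom C \<one> (if i \<le> 2 then X \<otimes> du C i X else du C i X \<otimes> X)"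
    and cap_cup: "X \<in> objs C \<Longrightarrow>
      (if i \<le> 2 then sdual X (du C i X) (ev_of (du C i X) X (cap C \<delta> i X)) (coev_of X (du C i X) (cup C \<delta> i X))
       else sdual (du C i X) X (ev_of X (du C i X) (cap C \<delta> i X)) (coev_of (du C i X) X (cup C \<delta> i X)))"
    and du_arr_hom: "f \<in> arrs C \<Longrightarrow> du_arr C i f \<in> hom C (du C i (tgt C f)) (du C i (src C f))"
    and du_arr_mate_left: "i \<le> 2 \<Longrightarrow> f \<in> arrs C \<Longrightarrow>
      ev_of (du C i (tgt C f)) (tgt C f) (cap C \<delta> i (tgt C f)) \<bullet> (du C i (tgt C f) \<rhd> J f)
      = ev_of (du C i (src C f)) (src C f) (cap C \<delta> i (src C f)) \<bullet> (J (du_arr C i f) \<lhd> [src C f])"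
    and du_arr_mate_right: "\<not> i \<le> 2 \<Longrightarrow> f \<in> arrs C \<Longrightarrow>
      ev_of (tgt C f) (du C i (tgt C f)) (cap C \<delta> i (tgt C f)) \<bullet> (J f \<lhd> [du C i (tgt C f)])
      = ev_of (src C f) (du C i (src C f)) (cap C \<delta> i (src C f)) \<bullet> (src C f \<rhd> J (du_arr C i f))"
    and du_gamma_hom: "X \<in> objs C \<Longrightarrow> Y \<in> objs C \<Longrightarrow>
      du_gamma C i X Y \<in> hom C (du C i X \<otimes> du C i Y) (du C i (Y \<otimes> X))"
    and du_gamma_left: "i \<le> 2 \<Longrightarrow> X \<in> objs C \<Longrightarrow> Y \<in> objs C \<Longrightarrow>
      ev_of (du C i (X \<otimes> Y)) (X \<otimes> Y) (cap C \<delta> i (X \<otimes> Y)) \<bullet> (J (du_gamma C i Y X) \<lhd> [X \<otimes> Y]) \<bullet>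
        (pack (du C i Y) (du C i X) \<lhd> [X \<otimes> Y]) \<bullet> (du C i Y \<rhd> du C i X \<rhd> pack X Y)
      = ev_of (du C i Y) Y (cap C \<delta> i Y) \<bullet> (du C i Y \<rhd> ev_of (du C i X) X (cap C \<delta> i X) \<lhd> [Y])"
    and du_gamma_right: "\<not> i \<le> 2 \<Longrightarrow> X \<in> objs C \<Longrightarrow> Y \<in> objs C \<Longrightarrow>
      ev_of (Y \<otimes> X) (du C i (Y \<otimes> X)) (cap C \<delta> i (Y \<otimes> X)) \<bullet> (Y \<otimes> X \<rhd> J (du_gamma C i X Y)) \<bullet>
        (pack Y X \<lhd> [du C i X \<otimes> du C i Y]) \<bullet> (Y \<rhd> X \<rhd> pack (du C i X) (du C i Y))
      = ev_of Y (du C i Y) (cap C \<delta> i Y) \<bullet> (Y \<rhd> ev_of X (du C i X) (cap C \<delta> i X) \<lhd> [du C i Y])"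
    and du_unit_hom: "du_unit C i \<in> hom C \<one> (du C i \<one>)"
    and du_unit_left: "i \<le> 2 \<Longrightarrow>
      ev_of (du C i \<one>) \<one> (cap C \<delta> i \<one>) \<bullet> (J (du_unit C i) \<lhd> [\<one>]) \<bullet> (pack0 \<lhd> [\<one>]) = unpack0"
    and du_unit_right: "\<not> i \<le> 2 \<Longrightarrow>
      ev_of \<one> (du C i \<one>) (cap C \<delta> i \<one>) \<bullet> (\<one> \<rhd> J (du_unit C i)) \<bullet> (pack0 \<lhd> [\<one>]) = unpack0"
begin

text \<open>The outer letters of a summand: \<open>QQ X\<close> on the left of V,
  \<open>PP X\<close> on the right. In either shape \<open>QQ X\<close> is the left dual of
  \<open>PP X\<close>, which hides the distinction between the two shapes from most of what
  follows.\<close>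

definition PP :: "'a \<Rightarrow> 'a" where "PP X = (if i \<le> 2 then X else du C i X)"
definition QQ :: "'a \<Rightarrow> 'a" where "QQ X = (if i \<le> 2 then du C i X else X)"
definition ee :: "'a \<Rightarrow> ('a, 'b) sarrow" where "ee X = ev_of (QQ X) (PP X) (cap C \<delta> i X)"
definition cc :: "'a \<Rightarrow> ('a, 'b) sarrow" where "cc X = coev_of (PP X) (QQ X) (cup C \<delta> i X)"

lemma PQ_dual: "X \<in> objs C \<Longrightarrow> sdual (PP X) (QQ X) (ee X) (cc X)"
  using cap_cup[of X] by (auto simp: PP_def QQ_def ee_def cc_def)

lemma PQ_obj [simp]:
  assumes "X \<in> objs C"
  shows "PP X \<in> objs C" "QQ X \<in> objs C" "du C i X \<in> objs C"
  using sdualD(1,2)[OF PQ_dual[OF assms]] by (auto simp: PP_def QQ_def split: if_splits)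

lemma cap_arr [simp]:
  assumes "X \<in> objs C"
  shows "cap C \<delta> i X \<in> arrs C" "src C (cap C \<delta> i X) = QQ X \<otimes> PP X" "tgt C (cap C \<delta> i X) = \<one>"
    "cup C \<delta> i X \<in> arrs C" "src C (cup C \<delta> i X) = \<one>" "tgt C (cup C \<delta> i X) = PP X \<otimes> QQ X"
  using cap_hom[OF assms] cup_hom[OF assms] by (auto simp: in_hom PP_def QQ_def)

lemma du_arr_simps [simp]:
  assumes "f \<in> arrs C"
  shows "du_arr C i f \<in> arrs C" "src C (du_arr C i f) = du C i (tgt C f)" "tgt C (du_arr C i f) = du C i (src C f)"
  using du_arr_hom[OF assms] by (auto simp: in_hom)

lemma du_gamma_simps [simp]:
  assumes "X \<in> objs C" "Y \<in> objs C"
  shows "du_gamma C i X Y \<in> arrs C" "src C (du_gamma C i X Y) = du C i X \<otimes> du C i Y"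
    "tgt C (du_gamma C i X Y) = du C i (Y \<otimes> X)"
  using du_gamma_hom[OF assms] by (auto simp: in_hom)

lemma du_unit_simps [simp]:
  "du_unit C i \<in> arrs C" "src C (du_unit C i) = \<one>" "tgt C (du_unit C i) = du C i \<one>"
  using du_unit_hom by (auto simp: in_hom)

lemma ee_simps [simp]:
  assumes "X \<in> objs C"
  shows "sarr (ee X)" "sdom (ee X) = [QQ X, PP X]" "scod (ee X) = []"
    "sarr (cc X)" "sdom (cc X) = []" "scod (cc X) = [PP X, QQ X]"
  using sdualD(3-8)[OF PQ_dual[OF assms]] by auto

lemma mates_left:
  assumes "i \<le> 2" and X: "X \<in> objs C" and Y: "Y \<in> objs C" and g: "g \<in> hom C X Y" and h: "h \<in> hom C (du C i Y) (du C i X)"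
  shows "ee Y \<bullet> (QQ Y \<rhd> J g) = ee X \<bullet> (J h \<lhd> [PP X]) \<longleftrightarrow> h = du_arr C i g"
proof -
  have g': "g \<in> arrs C" "src C g = X" "tgt C g = Y" using g by (auto simp: in_hom)
  have *: "ee Y \<bullet> (QQ Y \<rhd> J g) = ee X \<bullet> (J (du_arr C i g) \<lhd> [PP X])"
    using du_arr_mate_left[OF assms(1) g'(1)] assms(1) g' by (simp add: ee_def PP_def QQ_def)
  show ?thesis
  proof
    assume "ee Y \<bullet> (QQ Y \<rhd> J g) = ee X \<bullet> (J h \<lhd> [PP X])"
    then have "lwhisks [] (ee X) \<bullet> (J h \<lhd> [PP X]) = lwhisks [] (ee X) \<bullet> (J (du_arr C i g) \<lhd> [PP X])"
      using * by simp
    then have "J h = J (du_arr C i g)"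
      by (rule dual_test_inject[OF PQ_dual[OF X], rotated -1])
        (use g' h assms(1) in \<open>simp_all add: in_hom QQ_def\<close>)
    then show "h = du_arr C i g"
      using J_inject[OF h] g' by (simp add: in_hom)
  qed (use * in simp)
qed

lemma mates_right:
  assumes "\<not> i \<le> 2" and X: "X \<in> objs C" and Y: "Y \<in> objs C" and g: "g \<in> hom C (du C i X) (du C i Y)" and h: "h \<in> hom C Y X"
  shows "ee Y \<bullet> (QQ Y \<rhd> J g) = ee X \<bullet> (J h \<lhd> [PP X]) \<longleftrightarrow> g = du_arr C i h"
proof -
  have h': "h \<in> arrs C" "src C h = Y" "tgt C h = X" using h by (auto simp: in_hom)
  have *: "ee Y \<bullet> (QQ Y \<rhd> J (du_arr C i h)) = ee X \<bullet> (J h \<lhd> [PP X])"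
    using du_arr_mate_right[OF assms(1) h'(1)] assms(1) h' by (simp add: ee_def PP_def QQ_def)
  show ?thesis
  proof
    assume "ee Y \<bullet> (QQ Y \<rhd> J g) = ee X \<bullet> (J h \<lhd> [PP X])"
    then have "(ee Y \<lhd> []) \<bullet> (QQ Y \<rhd> J g) = (ee Y \<lhd> []) \<bullet> (QQ Y \<rhd> J (du_arr C i h))"
      using * Y by (simp add: rwhisk_Nil)
    then have "J g = J (du_arr C i h)"
      by (rule bend_left_inject[OF PQ_dual[OF Y], rotated -1])
        (use h' g assms(1) in \<open>simp_all add: in_hom PP_def\<close>)
    then show "g = du_arr C i h"
      using J_inject[OF g] h' by (simp add: in_hom)
  qed (use * in simp)
qed

lemma du_arr_ide [simp]: "X \<in> objs C \<Longrightarrow> du_arr C i (ide C X) = ide C (du C i X)"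
  using mates_left[of X X "ide C X" "ide C (du C i X)"] mates_right[of X X "ide C (du C i X)" "ide C X"]
  by (cases "i \<le> 2") (simp_all add: in_hom PP_def QQ_def)

definition pk :: "'a \<Rightarrow> 'a \<Rightarrow> 'a \<Rightarrow> ('a, 'b) sarrow" where
  "pk X V Y = (if i \<le> 2 then pack (du C i X) (V \<otimes> Y) \<bullet> (du C i X \<rhd> pack V Y)
     else pack (Y \<otimes> V) (du C i X) \<bullet> (pack Y V \<lhd> [du C i X]))"

definition upk :: "'a \<Rightarrow> 'a \<Rightarrow> 'a \<Rightarrow> ('a, 'b) sarrow" where
  "upk X V Y = (if i \<le> 2 then (du C i X \<rhd> unpack V Y) \<bullet> unpack (du C i X) (V \<otimes> Y)
     else (unpack Y V \<lhd> [du C i X]) \<bullet> unpack (Y \<otimes> V) (du C i X))"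

definition wd :: "'a \<Rightarrow> 'a \<Rightarrow> 'a \<Rightarrow> 'a list" where
  "wd X V Y = (if i \<le> 2 then [du C i X, V, Y] else [Y, V, du C i X])"

lemma summand_obj [simp]:
  "X \<in> objs C \<Longrightarrow> V \<in> objs C \<Longrightarrow> Y \<in> objs C \<Longrightarrow> summand C i X V Y \<in> objs C"
  by (simp add: summand_def)

lemma summand_arr_simps [simp]:
  assumes "f \<in> arrs C" "g \<in> arrs C" "h \<in> arrs C"
  shows "summand_arr C i f g h \<in> arrs C"
    "src C (summand_arr C i f g h) = summand C i (tgt C f) (src C g) (src C h)"
    "tgt C (summand_arr C i f g h) = summand C i (src C f) (tgt C g) (tgt C h)"
  using assms by (simp_all add: summand_arr_def summand_def)

lemma pk_simps [simp]:
  assumes "X \<in> objs C" "V \<in> objs C" "Y \<in> objs C"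
  shows "sarr (pk X V Y)" "sdom (pk X V Y) = wd X V Y" "scod (pk X V Y) = [summand C i X V Y]"
    "sarr (upk X V Y)" "sdom (upk X V Y) = [summand C i X V Y]" "scod (upk X V Y) = wd X V Y"
  using assms by (auto simp: pk_def upk_def summand_def wd_def)

lemma wd_diag: "wd X V X = [QQ X, V, PP X]"
  by (simp add: wd_def PP_def QQ_def)

lemma pack_unpack_pk [simp]:
  assumes "X \<in> objs C" "V \<in> objs C" "Y \<in> objs C"
  shows "upk X V Y \<bullet> pk X V Y = sid (wd X V Y)" "pk X V Y \<bullet> upk X V Y = sid [summand C i X V Y]"
  using assms unpack_pack[THEN whisk_cong(1), unfolded whisk_nf] unpack_pack[THEN whisk_cong(2), unfolded whisk_nf]
    unpack_pack_tail[THEN whisk_cong(1), unfolded whisk_nf] unpack_pack[THEN whisk_cong(3), unfolded whisk_nf]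
  by (auto simp: pk_def upk_def wd_def summand_def)

lemma summand_arr_pk:
  assumes "f \<in> arrs C" "g \<in> arrs C" "h \<in> arrs C"
  shows "(J (summand_arr C i f g h) \<lhd> []) \<bullet> (pk (tgt C f) (src C g) (src C h) \<lhd> [])
    = (pk (src C f) (tgt C g) (tgt C h) \<lhd> []) \<bullet>
      (if i \<le> 2 then (J (du_arr C i f) \<lhd> [tgt C g, tgt C h]) \<bullet> (du C i (tgt C f) \<rhd> J g \<lhd> [tgt C h]) \<bullet> (du C i (tgt C f) \<rhd> src C g \<rhd> J h \<lhd> [])
       else (J h \<lhd> [tgt C g, du C i (src C f)]) \<bullet> (src C h \<rhd> J g \<lhd> [du C i (src C f)]) \<bullet> (src C h \<rhd> src C g \<rhd> J (du_arr C i f) \<lhd> []))"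
  using assms by (auto simp: summand_arr_def pk_def push rex)

lemma pk_cancel:
  assumes "X \<in> objs C" "V \<in> objs C" "Y \<in> objs C"
    and "f \<in> hom C (summand C i X V Y) Z" "g \<in> hom C (summand C i X V Y) Z"
    and eq: "(J f \<lhd> []) \<bullet> (pk X V Y \<lhd> []) = (J g \<lhd> []) \<bullet> (pk X V Y \<lhd> [])"
  shows "f = g"
proof (rule J_inject[OF assms(4,5)])
  show "J f = J g"
    by (rule split_cancel[where K = "pk X V Y" and K' = "upk X V Y"])
      (use assms in \<open>auto simp: in_hom rwhisk_Nil\<close>)
qed

text \<open>Since mates are unique, quantifying over arrows of C amounts to quantifying over pairs
  of mates. For \<open>i \<le> 2\<close> the arrow is the right-hand mate \<open>g\<close>,
  otherwise the left-hand mate \<open>h\<close>; the version with pairs treats both shapes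
  alike.\<close>

lemma dinatural_iff:
  assumes V: "V \<in> objs C" and \<phi>: "\<And>X. X \<in> objs C \<Longrightarrow> \<phi> X \<in> hom C (summand C i X V X) Z"
  shows "dinatural C i V Z \<phi> \<longleftrightarrow>
    (\<forall>X \<in> objs C. \<forall>Y \<in> objs C. \<forall>g \<in> hom C (PP X) (PP Y). \<forall>h \<in> hom C (QQ Y) (QQ X).
       ee Y \<bullet> (QQ Y \<rhd> J g) = ee X \<bullet> (J h \<lhd> [PP X]) \<longrightarrow>
       (J (\<phi> Y) \<bullet> pk Y V Y) \<bullet> (QQ Y \<rhd> V \<rhd> J g) = (J (\<phi> X) \<bullet> pk X V X) \<bullet> (J h \<lhd> [V, PP X]))"
    (is "?l \<longleftrightarrow> ?r")
proof -
  have \<phi>': "\<phi> X \<in> arrs C" "src C (\<phi> X) = summand C i X V X" "tgt C (\<phi> X) = Z" if "X \<in> objs C" for X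
    using \<phi>[OF that] by (auto simp: in_hom)
  have eq: "\<phi> X \<cdot> summand_arr C i f (ide C V) (ide C X) = \<phi> Y \<cdot> summand_arr C i (ide C Y) (ide C V) f \<longleftrightarrow>
      (if i \<le> 2 then (J (\<phi> X) \<bullet> pk X V X) \<bullet> (J (du_arr C i f) \<lhd> [V, X]) = (J (\<phi> Y) \<bullet> pk Y V Y) \<bullet> (du C i Y \<rhd> V \<rhd> J f)
       else (J (\<phi> X) \<bullet> pk X V X) \<bullet> (X \<rhd> V \<rhd> J (du_arr C i f)) = (J (\<phi> Y) \<bullet> pk Y V Y) \<bullet> (J f \<lhd> [V, du C i Y]))"
    (is "?a = ?b \<longleftrightarrow> ?c") if f: "f \<in> hom C X Y" for f X Y
  proof -
    have f': "f \<in> arrs C" "src C f = X" "tgt C f = Y" "X \<in> objs C" "Y \<in> objs C" using f by (auto simp: in_hom)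
    have ab: "?a \<in> hom C (summand C i Y V X) Z" "?b \<in> hom C (summand C i Y V X) Z"
      using f' V by (simp_all add: \<phi>' in_hom)
    have "?a = ?b \<longleftrightarrow> (J ?a \<lhd> []) \<bullet> (pk Y V X \<lhd> []) = (J ?b \<lhd> []) \<bullet> (pk Y V X \<lhd> [])"
      using pk_cancel[OF f'(5) V f'(4) ab] by auto
    moreover have "(J ?a \<lhd> []) \<bullet> (pk Y V X \<lhd> [])
        = (if i \<le> 2 then (J (\<phi> X) \<bullet> pk X V X) \<bullet> (J (du_arr C i f) \<lhd> [V, X]) else (J (\<phi> X) \<bullet> pk X V X) \<bullet> (X \<rhd> V \<rhd> J (du_arr C i f)))"
      using summand_arr_pk[of f "ide C V" "ide C X"] f' V by (auto simp: \<phi>' J_cmp wd_def rwhisk_Nil)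
    moreover have "(J ?b \<lhd> []) \<bullet> (pk Y V X \<lhd> [])
        = (if i \<le> 2 then (J (\<phi> Y) \<bullet> pk Y V Y) \<bullet> (du C i Y \<rhd> V \<rhd> J f) else (J (\<phi> Y) \<bullet> pk Y V Y) \<bullet> (J f \<lhd> [V, du C i Y]))"
      using summand_arr_pk[of "ide C Y" "ide C V" f] f' V by (auto simp: \<phi>' J_cmp wd_def rwhisk_Nil)
    ultimately show ?thesis by auto
  qed
  have l: "?l \<longleftrightarrow> (\<forall>X Y f. f \<in> hom C X Y \<longrightarrow> \<phi> X \<cdot> summand_arr C i f (ide C V) (ide C X) = \<phi> Y \<cdot> summand_arr C i (ide C Y) (ide C V) f)"
    using \<phi> by (auto simp: dinatural_def)
  have obj: "X \<in> objs C \<and> Y \<in> objs C" if "f \<in> hom C X Y" for f X Y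
    using that by (auto simp: in_hom)
  show ?thesis
  proof (cases "i \<le> 2")
    case True
    then have PQ: "PP X = X" "QQ X = du C i X" for X by (simp_all add: PP_def QQ_def)
    show ?thesis
    proof
      assume ?l
      then show ?r
        unfolding l using True eq mates_left[OF True] by (auto simp: PQ)
    next
      assume r: ?r
      show ?l
        unfolding l
      proof (intro allI impI)
        fix X Y f assume f: "f \<in> hom C X Y"
        note o = obj[OF f]
        have h: "du_arr C i f \<in> hom C (du C i Y) (du C i X)" using f by (auto simp: in_hom)
        show "\<phi> X \<cdot> summand_arr C i f (ide C V) (ide C X) = \<phi> Y \<cdot> summand_arr C i (ide C Y) (ide C V) f"
          unfolding eq[OF f] using True r o f h mates_left[OF True _ _ f h] by (auto simp: PQ)
      qed
    qed
  next
    case False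
    then have PQ: "QQ X = X" "PP X = du C i X" for X by (simp_all add: PP_def QQ_def)
    show ?thesis
    proof
      assume ?l
      then show ?r
        unfolding l using False eq mates_right[OF False] by (auto simp: PQ)
    next
      assume r: ?r
      show ?l
        unfolding l
      proof (intro allI impI)
        fix X Y f assume f: "f \<in> hom C X Y"
        note o = obj[OF f]
        have h: "du_arr C i f \<in> hom C (du C i Y) (du C i X)" using f by (auto simp: in_hom)
        show "\<phi> X \<cdot> summand_arr C i f (ide C V) (ide C X) = \<phi> Y \<cdot> summand_arr C i (ide C Y) (ide C V) f"
          unfolding eq[OF f] using False r o f h mates_right[OF False _ _ h f] by (auto simp: PQ)
      qed
    qed
  qed
qed

text \<open>If \<open>PP X\<close> is a dual of X, the left dual of P is taken for X: then P and
  \<open>PP X\<close> have the same left dual X, and \<open>sdual_compare_iso\<close> gives the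
  isomorphism.\<close>

lemma PP_surj:
  assumes P: "P \<in> objs C"
  shows "\<exists>X \<in> objs C. \<exists>n \<in> hom C P (PP X). iso C n"
proof (cases "i \<le> 2")
  case True
  then show ?thesis
    using P by (intro bexI[of _ P] bexI[of _ "ide C P"]) (auto simp: PP_def in_hom)
next
  case False
  let ?X = "ld C P"
  have d: "sdual P ?X (ev_of ?X P (evl C P)) (coev_of P ?X (coevl C P))"
    by (rule sdual_of_dual_pair[OF left_dual[OF P]])
  have X: "?X \<in> objs C" and Q: "QQ ?X = ?X"
    using sdualD(2)[OF d] False by (simp_all add: QQ_def)
  note d1 = sdualD(1-8)[OF d] and d2 = sdualD(1-8)[OF PQ_dual[OF X], unfolded Q]
  let ?e = "ev_of ?X P (evl C P)"
  obtain n where n: "n \<in> hom C P (PP ?X)" "J n = (PP ?X \<rhd> ?e) \<bullet> (cc ?X \<lhd> [P])"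
    using J_full[of "(PP ?X \<rhd> ?e) \<bullet> (cc ?X \<lhd> [P])" P "PP ?X"] P d1 d2 by auto
  have "ee ?X \<bullet> (?X \<rhd> J n) = ?e"
    using bend_left[OF PQ_dual[OF X], of ?e "[P]" "[]"] d1 d2 Q by (simp add: n(2) rwhisk_Nil)
  then have "iso C n"
    by (rule sdual_compare_iso[OF d PQ_dual[OF X, unfolded Q] n(1)])
  then show ?thesis
    using n(1) X by blast
qed

end

section \<open>Structure maps of the central monads\<close>

locale central_coend = central_duals +
  fixes A :: "'a \<Rightarrow> 'a" and \<iota> :: "'a \<Rightarrow> 'a \<Rightarrow> 'b"
  assumes coends: "coends C i A \<iota>"
begin

lemma coendD:
  assumes "V \<in> objs C"
  shows "A V \<in> objs C" "dinatural C i V (A V) (\<iota> V)"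
    "Z \<in> objs C \<Longrightarrow> dinatural C i V Z \<phi> \<Longrightarrow> \<exists>!h. h \<in> hom C (A V) Z \<and> (\<forall>X \<in> objs C. h \<cdot> \<iota> V X = \<phi> X)"
  using coends assms by (auto simp: coends_def is_coend_def)

lemma iota_simps [simp]:
  assumes "V \<in> objs C" "X \<in> objs C"
  shows "\<iota> V X \<in> arrs C" "src C (\<iota> V X) = summand C i X V X" "tgt C (\<iota> V X) = A V"
  using coendD(2)[OF assms(1)] assms(2) by (auto simp: dinatural_def in_hom)

definition jj :: "'a \<Rightarrow> 'a \<Rightarrow> ('a, 'b) sarrow" where
  "jj V X = J (\<iota> V X) \<bullet> pk X V X"

lemma cmp_iota_iff:
  assumes V: "V \<in> objs C" and h: "h \<in> hom C (A V) Z" and \<phi>: "f \<in> hom C (summand C i X V X) Z" and X: "X \<in> objs C"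
  shows "h \<cdot> \<iota> V X = f \<longleftrightarrow> J h \<bullet> jj V X = J f \<bullet> pk X V X"
proof
  have h': "h \<in> arrs C" "src C h = A V" "tgt C h = Z" using h by (auto simp: in_hom)
  show "J h \<bullet> jj V X = J f \<bullet> pk X V X" if "h \<cdot> \<iota> V X = f"
    using that[symmetric] h' V X by (simp add: jj_def J_cmp)
  show "h \<cdot> \<iota> V X = f" if "J h \<bullet> jj V X = J f \<bullet> pk X V X"
    by (rule pk_cancel[OF X V X _ \<phi>]) (use that h' V X \<phi> in \<open>auto simp: in_hom jj_def J_cmp rwhisk_Nil\<close>)
qed

lemma iota_hom: "V \<in> objs C \<Longrightarrow> X \<in> objs C \<Longrightarrow> \<iota> V X \<in> hom C (summand C i X V X) (A V)"
  by (simp add: in_hom)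

sublocale co?: dual_coend C A PP QQ ee cc jj
proof
  fix V X Y g h
  assume V: "V \<in> objs C" and "X \<in> objs C" "Y \<in> objs C" "g \<in> hom C (PP X) (PP Y)" "h \<in> hom C (QQ Y) (QQ X)"
    and "ee Y \<bullet> (QQ Y \<rhd> J g) = ee X \<bullet> (J h \<lhd> [PP X])"
  then show "jj V Y \<bullet> (QQ Y \<rhd> V \<rhd> J g) = jj V X \<bullet> (J h \<lhd> [V, PP X])"
    using dinatural_iff[OF V iota_hom[OF V]] coendD(2)[OF V] unfolding jj_def by blast
next
  fix V Z \<phi>
  assume V: "V \<in> objs C" and Z: "Z \<in> objs C"
    and \<phi>: "\<And>X. X \<in> objs C \<Longrightarrow> sarr (\<phi> X) \<and> sdom (\<phi> X) = [QQ X, V, PP X] \<and> scod (\<phi> X) = [Z]"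
    and nat: "\<And>X Y g h. \<lbrakk>X \<in> objs C; Y \<in> objs C; g \<in> hom C (PP X) (PP Y); h \<in> hom C (QQ Y) (QQ X);
          ee Y \<bullet> (QQ Y \<rhd> J g) = ee X \<bullet> (J h \<lhd> [PP X])\<rbrakk> \<Longrightarrow>
          \<phi> Y \<bullet> (QQ Y \<rhd> V \<rhd> J g) = \<phi> X \<bullet> (J h \<lhd> [V, PP X])"
  \<comment> \<open>Fullness of \<open>J\<close> turns a strict family on words into arrows of C on
    the bracketed summands.\<close>
  have "\<exists>f. f \<in> hom C (summand C i X V X) Z \<and> J f \<bullet> pk X V X = \<phi> X" if X: "X \<in> objs C" for X
  proof -
    obtain f where f: "f \<in> hom C (summand C i X V X) Z" "J f = \<phi> X \<bullet> upk X V X"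
      using J_full[of "\<phi> X \<bullet> upk X V X" "summand C i X V X" Z] X V Z \<phi>[OF X] by (auto simp: wd_diag)
    then show ?thesis
      using X V \<phi>[OF X] by (intro exI[of _ f]) (simp add: wd_diag)
  qed
  then obtain \<psi> where \<psi>: "\<And>X. X \<in> objs C \<Longrightarrow> \<psi> X \<in> hom C (summand C i X V X) Z"
    "\<And>X. X \<in> objs C \<Longrightarrow> J (\<psi> X) \<bullet> pk X V X = \<phi> X"
    by metis
  have "dinatural C i V Z \<psi>"
    using dinatural_iff[OF V \<psi>(1)] nat by (simp add: \<psi>(2))
  from coendD(3)[OF V Z this] have "\<exists>!h. h \<in> hom C (A V) Z \<and> (\<forall>X \<in> objs C. h \<cdot> \<iota> V X = \<psi> X)" .
  moreover have "(h \<in> hom C (A V) Z \<and> (\<forall>X \<in> objs C. h \<cdot> \<iota> V X = \<psi> X)) \<longleftrightarrow>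
      (h \<in> hom C (A V) Z \<and> (\<forall>X \<in> objs C. J h \<bullet> jj V X = \<phi> X))" for h
    using cmp_iota_iff[OF V _ \<psi>(1)] \<psi>(2) by auto
  ultimately show "\<exists>!h. h \<in> hom C (A V) Z \<and> (\<forall>X \<in> objs C. J h \<bullet> jj V X = \<phi> X)"
    by simp
qed (use coendD(1) PQ_dual PP_surj in \<open>auto simp: jj_def wd_diag\<close>)

text \<open>The bridge from the components of a structure map to its equation with \<open>d\<close>:
  if the components are the mates of a natural family \<open>\<psi>\<close>, then the arrow that
  represents \<open>\<psi>\<close> has these components, hence it is the one given by
  \<open>desc\<close>.\<close>

lemma desc_eq:
  assumes V: "V \<in> objs C" and Z: "Z \<in> objs C"
    and \<psi>: "\<And>P. P \<in> objs C \<Longrightarrow> sarr (\<psi> P) \<and> sdom (\<psi> P) = [V, P] \<and> scod (\<psi> P) = [P, Z]"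
      "\<And>f. f \<in> arrs C \<Longrightarrow> (J f \<lhd> [Z]) \<bullet> \<psi> (src C f) = \<psi> (tgt C f) \<bullet> (V \<rhd> J f)"
    and \<phi>: "\<And>X. X \<in> objs C \<Longrightarrow> \<phi> X \<in> hom C (summand C i X V X) Z"
      "\<And>X. X \<in> objs C \<Longrightarrow> (J (\<phi> X) \<lhd> []) \<bullet> (pk X V X \<lhd> []) = (ee X \<lhd> [Z]) \<bullet> (QQ X \<rhd> \<psi> (PP X) \<lhd> [])"
  shows "desc C A \<iota> V Z \<phi> \<in> hom C (A V) Z" "P \<in> objs C \<Longrightarrow> (P \<rhd> J (desc C A \<iota> V Z \<phi>)) \<bullet> d V P = \<psi> P"
proof -
  have "\<exists>!h. h \<in> hom C (A V) Z \<and> (\<forall>P \<in> objs C. (P \<rhd> J h) \<bullet> d V P = \<psi> P)"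
    by (rule d_univ[OF V Z \<psi>])
  then obtain h where h: "h \<in> hom C (A V) Z" "\<And>P. P \<in> objs C \<Longrightarrow> (P \<rhd> J h) \<bullet> d V P = \<psi> P"
    by blast
  have h': "h \<in> arrs C" "src C h = A V" "tgt C h = Z" using h by (auto simp: in_hom)
  have hi: "h \<cdot> \<iota> V X = \<phi> X" if X: "X \<in> objs C" for X
  proof -
    have "J h \<bullet> jj V X = (ee X \<lhd> [Z]) \<bullet> (QQ X \<rhd> ((PP X \<rhd> J h) \<bullet> d V (PP X)))"
      using rex_ee[OF X, of "J h" "[A V]" "[Z]", THEN whisk_cong(1), of "QQ X \<rhd> d V (PP X)"] V X h'
      by (simp add: jj_d)
    also have "\<dots> = J (\<phi> X) \<bullet> pk X V X"
      using \<phi>(1,2)[OF X] h(2) X V \<psi>(1)[of "PP X"] by (simp add: in_hom rwhisk_Nil del: lwhisk_scmp)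
    finally show ?thesis
      using cmp_iota_iff[OF V h(1) \<phi>(1)[OF X] X] by simp
  qed
  have "desc C A \<iota> V Z \<phi> = h"
    unfolding desc_def
  proof (rule the_equality)
    show "h \<in> hom C (A V) Z \<and> (\<forall>X\<in>objs C. h \<cdot> \<iota> V X = \<phi> X)"
      using h(1) hi by blast
  next
    fix k assume k: "k \<in> hom C (A V) Z \<and> (\<forall>X\<in>objs C. k \<cdot> \<iota> V X = \<phi> X)"
    have "J k = J h"
    proof (rule jj_inject[OF V, of _ "[]"])
      fix X assume X: "X \<in> objs C"
      show "J k \<bullet> (jj V X \<lhd> []) = J h \<bullet> (jj V X \<lhd> [])"
        using k hi[OF X] X V cmp_iota_iff[OF V h(1) \<phi>(1)[OF X] X]
          cmp_iota_iff[OF V conjunct1[OF k] \<phi>(1)[OF X] X] by (simp add: rwhisk_Nil)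
    qed (use k h' in \<open>auto simp: in_hom\<close>)
    then show "k = h" using J_inject[of k "A V" Z h] k h(1) by simp
  qed
  then show "desc C A \<iota> V Z \<phi> \<in> hom C (A V) Z" "P \<in> objs C \<Longrightarrow> (P \<rhd> J (desc C A \<iota> V Z \<phi>)) \<bullet> d V P = \<psi> P"
    using h by auto
qed

lemma ar_components:
  assumes f: "f \<in> arrs C" and X: "X \<in> objs C"
  shows "(J (\<iota> (tgt C f) X \<cdot> summand_arr C i (ide C X) f (ide C X)) \<lhd> []) \<bullet> (pk X (src C f) X \<lhd> [])
    = (ee X \<lhd> [A (tgt C f)]) \<bullet> (QQ X \<rhd> (d (tgt C f) (PP X) \<bullet> (J f \<lhd> [PP X])) \<lhd> [])"
proof -
  have "(J (\<iota> (tgt C f) X \<cdot> summand_arr C i (ide C X) f (ide C X)) \<lhd> []) \<bullet> (pk X (src C f) X \<lhd> [])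
      = jj (tgt C f) X \<bullet> (QQ X \<rhd> J f \<lhd> [PP X])"
    using summand_arr_pk[of "ide C X" f "ide C X"] f X
    by (auto simp: J_cmp jj_def QQ_def PP_def wd_def rwhisk_Nil)
  then show ?thesis
    using f X by (simp add: jj_d rwhisk_Nil)
qed

lemma A_ar:
  assumes f: "f \<in> arrs C"
  shows "A_ar C i A \<iota> f \<in> hom C (A (src C f)) (A (tgt C f))"
    "P \<in> objs C \<Longrightarrow> (P \<rhd> J (A_ar C i A \<iota> f)) \<bullet> d (src C f) P = d (tgt C f) P \<bullet> (J f \<lhd> [P])"
  unfolding A_ar_def
proof (rule desc_eq(1)[where \<psi> = "\<lambda>P. d (tgt C f) P \<bullet> (J f \<lhd> [P])"])
  show nat: "(J g \<lhd> [A (tgt C f)]) \<bullet> d (tgt C f) (src C g) \<bullet> (J f \<lhd> [src C g])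
     = (d (tgt C f) (tgt C g) \<bullet> (J f \<lhd> [tgt C g])) \<bullet> (src C f \<rhd> J g)" if g: "g \<in> arrs C" for g
    using d_nat[of "tgt C f" g, THEN whisk_cong(1), of "J f \<lhd> [src C g]"] f g
      exchange_atom(5)[of "J f" "J g" "[tgt C g]" "src C f" "tgt C f"] by simp
  show "P \<in> objs C \<Longrightarrow> (P \<rhd> J (desc C A \<iota> (src C f) (A (tgt C f))
       (\<lambda>X. \<iota> (tgt C f) X \<cdot> summand_arr C i (ide C X) f (ide C X)))) \<bullet> d (src C f) P = d (tgt C f) P \<bullet> (J f \<lhd> [P])"
    by (rule desc_eq(2)[where \<psi> = "\<lambda>P. d (tgt C f) P \<bullet> (J f \<lhd> [P])"])
      (use f nat ar_components[OF f] in \<open>auto simp: in_hom\<close>)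
qed (use f ar_components[OF f] in \<open>auto simp: in_hom\<close>)

lemma counit_components:
  assumes X: "X \<in> objs C"
  shows "(J (if i \<le> 2 then cap C \<delta> i X \<cdot> (ide C (du C i X) \<boxtimes> lun C X)
      else cap C \<delta> i X \<cdot> (run C X \<boxtimes> ide C (du C i X))) \<lhd> []) \<bullet> (pk X \<one> X \<lhd> []) \<bullet> (QQ X \<rhd> pack0 \<lhd> [PP X])
    = (pack0 \<lhd> []) \<bullet> (ee X \<lhd> [])"
proof -
  have k: "cap C \<delta> i X \<in> hom C (QQ X \<otimes> PP X) \<one>" using X by (simp add: in_hom)
  note ev = ev_of_tail[OF k PQ_obj(2,1)[OF X], folded ee_def]
  show ?thesis
  proof (cases "i \<le> 2")
    case True
    then have PQ: "PP X = X" "QQ X = du C i X" by (simp_all add: PP_def QQ_def)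
    show ?thesis
      using X True ev by (simp add: push pk_def PQ)
  next
    case False
    then have PQ: "QQ X = X" "PP X = du C i X" by (simp_all add: PP_def QQ_def)
    show ?thesis
      using X False ev by (simp add: push pk_def PQ)
  qed
qed

text \<open>The natural family behind the counit is the canonical isomorphism from \<one> \<otimes>
  P to P \<otimes> \<one>.\<close>

lemma A_counit:
  shows "A_counit C \<delta> i A \<iota> \<in> hom C (A \<one>) \<one>"
    "P \<in> objs C \<Longrightarrow> (P \<rhd> J (A_counit C \<delta> i A \<iota>)) \<bullet> d \<one> P = (P \<rhd> pack0) \<bullet> (unpack0 \<lhd> [P])"
proof -
  let ?\<psi> = "\<lambda>P. (P \<rhd> pack0) \<bullet> (unpack0 \<lhd> [P])"
  have nat: "(J f \<lhd> [\<one>]) \<bullet> (src C f \<rhd> pack0) \<bullet> (unpack0 \<lhd> [src C f]) = ((tgt C f \<rhd> pack0) \<bullet> (unpack0 \<lhd> [tgt C f])) \<bullet> (\<one> \<rhd> J f)"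
    if f: "f \<in> arrs C" for f
  proof -
    have "(J f \<lhd> [\<one>]) \<bullet> (src C f \<rhd> pack0) = (tgt C f \<rhd> pack0) \<bullet> (J f \<lhd> [])"
      using exchange_atom(5)[of "J f" pack0 "[\<one>]" "src C f" "tgt C f"] f by simp
    from this[THEN whisk_cong(1), of "unpack0 \<lhd> [src C f]"]
    have "(J f \<lhd> [\<one>]) \<bullet> (src C f \<rhd> pack0) \<bullet> (unpack0 \<lhd> [src C f]) = (tgt C f \<rhd> pack0) \<bullet> (J f \<lhd> []) \<bullet> (unpack0 \<lhd> [src C f])"
      by simp
    also have "(J f \<lhd> []) \<bullet> (unpack0 \<lhd> [src C f]) = (unpack0 \<lhd> [tgt C f]) \<bullet> (\<one> \<rhd> J f)"
      using exchange_atom(4)[of unpack0 "J f" "[tgt C f]" \<one>] f by (simp add: rwhisk_Nil)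
    finally show ?thesis by simp
  qed
  let ?\<phi> = "\<lambda>X. if i \<le> 2 then cap C \<delta> i X \<cdot> (ide C (du C i X) \<boxtimes> lun C X) else cap C \<delta> i X \<cdot> (run C X \<boxtimes> ide C (du C i X))"
  have \<phi>: "?\<phi> X \<in> hom C (summand C i X \<one> X) \<one>" if X: "X \<in> objs C" for X
    using X by (auto simp: in_hom summand_def PP_def QQ_def)
  have comp: "(J (?\<phi> X) \<lhd> []) \<bullet> (pk X \<one> X \<lhd> []) = (ee X \<lhd> [\<one>]) \<bullet> (QQ X \<rhd> ?\<psi> (PP X) \<lhd> [])" if X: "X \<in> objs C" for X
  proof (rule split_cancel[where K = "QQ X \<rhd> pack0 \<lhd> [PP X]" and K' = "QQ X \<rhd> unpack0 \<lhd> [PP X]"])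
    have "pack0 \<bullet> (ee X \<lhd> []) = (ee X \<lhd> [\<one>]) \<bullet> (QQ X \<rhd> PP X \<rhd> pack0)"
      using rex_ee[OF X, of pack0 "[]" "[\<one>]"] X by simp
    then show "((J (?\<phi> X) \<lhd> []) \<bullet> (pk X \<one> X \<lhd> [])) \<bullet> (QQ X \<rhd> pack0 \<lhd> [PP X])
        = ((ee X \<lhd> [\<one>]) \<bullet> (QQ X \<rhd> ?\<psi> (PP X) \<lhd> [])) \<bullet> (QQ X \<rhd> pack0 \<lhd> [PP X])"
      using counit_components[OF X] X by (simp add: rwhisk_Nil)
  qed (use X \<phi>[OF X] in \<open>auto simp: in_hom wd_diag\<close>)
  show "A_counit C \<delta> i A \<iota> \<in> hom C (A \<one>) \<one>"
    unfolding A_counit_def by (rule desc_eq(1)[where \<psi> = ?\<psi>]) (use nat \<phi> comp in auto)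
  show "P \<in> objs C \<Longrightarrow> (P \<rhd> J (A_counit C \<delta> i A \<iota>)) \<bullet> d \<one> P = ?\<psi> P"
    unfolding A_counit_def by (rule desc_eq(2)[where \<psi> = ?\<psi>]) (use nat \<phi> comp in auto)
qed

text \<open>The unit is the injection at X = \<one>. Written through \<open>d\<close> it contains
  the pairing of \<one> with its dual, and \<open>du_unit\<close> is the arrow that trivialises this
  pairing.\<close>

lemma unit_components:
  assumes V: "V \<in> objs C"
  shows "J (A_unit C i \<iota> V) \<lhd> [] = (unpack0 \<lhd> [A V]) \<bullet> (d V \<one> \<lhd> []) \<bullet> (V \<rhd> pack0 \<lhd> [])"
proof (cases "i \<le> 2")
  case True
  then have PQ: "PP X = X" "QQ X = du C i X" for X by (simp_all add: PP_def QQ_def)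
  have u: "(ee \<one> \<lhd> zs) \<bullet> (J (du_unit C i) \<lhd> \<one> # zs) \<bullet> (pack0 \<lhd> \<one> # zs) = unpack0 \<lhd> zs" for zs
    using du_unit_left[OF True, THEN with_tail, of zs] by (simp add: ee_def PQ)
  have "J (A_unit C i \<iota> V) \<lhd> [] = (jj V \<one> \<lhd> []) \<bullet> (J (du_unit C i) \<lhd> [V, \<one>]) \<bullet> (pack0 \<lhd> [V, \<one>]) \<bullet> (V \<rhd> pack0 \<lhd> [])"
    using V True by (simp add: A_unit_def jj_def pk_def summand_def push rex)
  also have "\<dots> = (ee \<one> \<lhd> [A V]) \<bullet> ((du C i \<one> \<rhd> d V \<one> \<lhd> []) \<bullet> (J (du_unit C i) \<lhd> [V, \<one>])) \<bullet> (pack0 \<lhd> [V, \<one>]) \<bullet> (V \<rhd> pack0 \<lhd> [])"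
    using V by (simp add: jj_d PQ)
  also have "(du C i \<one> \<rhd> d V \<one> \<lhd> []) \<bullet> (J (du_unit C i) \<lhd> [V, \<one>]) = (J (du_unit C i) \<lhd> [\<one>, A V]) \<bullet> (\<one> \<rhd> d V \<one> \<lhd> [])"
    using rex_J[of "du_unit C i" "d V \<one> \<lhd> []" "du C i \<one>" "[V, \<one>]"] V by simp
  also have "(ee \<one> \<lhd> [A V]) \<bullet> ((J (du_unit C i) \<lhd> [\<one>, A V]) \<bullet> (\<one> \<rhd> d V \<one> \<lhd> [])) \<bullet> (pack0 \<lhd> [V, \<one>]) \<bullet> (V \<rhd> pack0 \<lhd> [])
    = ((ee \<one> \<lhd> [A V]) \<bullet> (J (du_unit C i) \<lhd> [\<one>, A V]) \<bullet> (pack0 \<lhd> [\<one>, A V])) \<bullet> (d V \<one> \<lhd> []) \<bullet> (V \<rhd> pack0 \<lhd> [])"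
    using pack0_exchange[of "d V \<one> \<lhd> []" "[V, \<one>]", THEN whisk_cong(1), of "V \<rhd> pack0 \<lhd> []"] V by simp
  finally show ?thesis
    using V by (simp add: u)
next
  case False
  then have PQ: "QQ X = X" "PP X = du C i X" for X by (simp_all add: PP_def QQ_def)
  have u: "(ee \<one> \<lhd> zs) \<bullet> (\<one> \<rhd> J (du_unit C i) \<lhd> zs) \<bullet> (pack0 \<lhd> \<one> # zs) = unpack0 \<lhd> zs" for zs
    using du_unit_right[OF False, THEN with_tail, of zs] by (simp add: ee_def PQ)
  have "J (A_unit C i \<iota> V) \<lhd> [] = (jj V \<one> \<lhd> []) \<bullet> (\<one> \<rhd> V \<rhd> J (du_unit C i) \<lhd> []) \<bullet> (\<one> \<rhd> V \<rhd> pack0 \<lhd> []) \<bullet> (pack0 \<lhd> [V])"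
    using V False by (simp add: A_unit_def jj_def pk_def summand_def push rex)
  also have "\<dots> = (ee \<one> \<lhd> [A V]) \<bullet> (\<one> \<rhd> ((d V (du C i \<one>) \<lhd> []) \<bullet> (V \<rhd> J (du_unit C i) \<lhd> []))) \<bullet> (\<one> \<rhd> V \<rhd> pack0 \<lhd> []) \<bullet> (pack0 \<lhd> [V])"
    using V by (simp add: jj_d PQ)
  also have "(d V (du C i \<one>) \<lhd> []) \<bullet> (V \<rhd> J (du_unit C i) \<lhd> []) = (J (du_unit C i) \<lhd> [A V]) \<bullet> (d V \<one> \<lhd> [])"
    using d_nat_tail[OF V, of "du_unit C i" "[]"] by simp
  also have "(ee \<one> \<lhd> [A V]) \<bullet> (\<one> \<rhd> ((J (du_unit C i) \<lhd> [A V]) \<bullet> (d V \<one> \<lhd> []))) \<bullet> (\<one> \<rhd> V \<rhd> pack0 \<lhd> []) \<bullet> (pack0 \<lhd> [V])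
    = ((ee \<one> \<lhd> [A V]) \<bullet> (\<one> \<rhd> J (du_unit C i) \<lhd> [A V]) \<bullet> (pack0 \<lhd> [\<one>, A V])) \<bullet> (d V \<one> \<lhd> []) \<bullet> (V \<rhd> pack0 \<lhd> [])"
    using pack0_exchange[of "(d V \<one> \<lhd> []) \<bullet> (V \<rhd> pack0 \<lhd> [])" "[V]"] V by simp
  finally show ?thesis
    using V by (simp add: u)
qed

lemma A_unit:
  assumes V: "V \<in> objs C"
  shows "A_unit C i \<iota> V \<in> hom C V (A V)"
    "d V \<one> \<bullet> (V \<rhd> pack0) = (pack0 \<lhd> [A V]) \<bullet> J (A_unit C i \<iota> V)"
proof -
  show h: "A_unit C i \<iota> V \<in> hom C V (A V)"
    using V by (auto simp: in_hom A_unit_def summand_def)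
  show "d V \<one> \<bullet> (V \<rhd> pack0) = (pack0 \<lhd> [A V]) \<bullet> J (A_unit C i \<iota> V)"
    using unit_components[OF V] V h by (simp add: in_hom rwhisk_Nil)
qed

text \<open>What remains of \<open>split_summand\<close> when all bracketings are removed is the
  copairing \<open>cc X\<close>, inserted between U and V.\<close>

lemma comul_components:
  assumes U: "U \<in> objs C" and V: "V \<in> objs C" and X: "X \<in> objs C"
  shows "(J ((\<iota> U X \<boxtimes> \<iota> V X) \<cdot> split_summand C \<delta> i U V X) \<lhd> []) \<bullet> (pk X (U \<otimes> V) X \<lhd> []) \<bullet> (QQ X \<rhd> pack U V \<lhd> [PP X])
    = (pack (A U) (A V) \<lhd> []) \<bullet> (jj U X \<lhd> [A V]) \<bullet> (QQ X \<rhd> U \<rhd> PP X \<rhd> jj V X \<lhd> []) \<bullet> (QQ X \<rhd> U \<rhd> cc X \<lhd> [V, PP X])"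
proof -
  have k: "cup C \<delta> i X \<in> hom C \<one> (PP X \<otimes> QQ X)" using X by (simp add: in_hom)
  note co = coev_of_tail[OF k PQ_obj(1,2)[OF X], folded cc_def]
  note co' = co whisk_cong[OF co, unfolded whisk_nf]
  \<comment> \<open>The second injection stands behind three letters, one more than
    \<open>push\<close> reaches.\<close>
  note push3 = push0[THEN whisk_cong(6), unfolded whisk_nf] push0[THEN whisk_cong(7), unfolded whisk_nf]
  show ?thesis
  proof (cases "i \<le> 2")
    case True
    then have PQ: "PP X = X" "QQ X = du C i X" by (simp_all add: PP_def QQ_def)
    show ?thesis
      using U V X True co'
      by (simp add: split_summand_def insertion_def Let_def jj_def pk_def summand_def PQ push push3 rex)
  next
    case False
    then have PQ: "QQ X = X" "PP X = du C i X" by (simp_all add: PP_def QQ_def)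
    show ?thesis
      using U V X False co'
      by (simp add: split_summand_def insertion_def Let_def jj_def pk_def summand_def PQ push push3 rex)
  qed
qed

lemma A_comul:
  assumes U: "U \<in> objs C" and V: "V \<in> objs C"
  shows "A_comul C \<delta> i A \<iota> U V \<in> hom C (A (U \<otimes> V)) (A U \<otimes> A V)"
    "P \<in> objs C \<Longrightarrow> (P \<rhd> J (A_comul C \<delta> i A \<iota> U V)) \<bullet> d (U \<otimes> V) P
      = (P \<rhd> pack (A U) (A V)) \<bullet> (d U P \<lhd> [A V]) \<bullet> (U \<rhd> d V P) \<bullet> (unpack U V \<lhd> [P])"
proof -
  let ?\<psi> = "\<lambda>P. (P \<rhd> pack (A U) (A V)) \<bullet> (d U P \<lhd> [A V]) \<bullet> (U \<rhd> d V P) \<bullet> (unpack U V \<lhd> [P])"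
  let ?\<phi> = "\<lambda>X. (\<iota> U X \<boxtimes> \<iota> V X) \<cdot> split_summand C \<delta> i U V X"
  have nat: "(J f \<lhd> [A U \<otimes> A V]) \<bullet> ?\<psi> (src C f) = ?\<psi> (tgt C f) \<bullet> (U \<otimes> V \<rhd> J f)" if f: "f \<in> arrs C" for f
  proof -
    let ?P = "src C f" and ?P' = "tgt C f"
    have "(J f \<lhd> [A U \<otimes> A V]) \<bullet> ?\<psi> ?P
      = (?P' \<rhd> pack (A U) (A V)) \<bullet> (J f \<lhd> [A U, A V]) \<bullet> (d U ?P \<lhd> [A V]) \<bullet> (U \<rhd> d V ?P) \<bullet> (unpack U V \<lhd> [?P])"
      using exchange_atom(5)[of "J f" "pack (A U) (A V)" "[A U \<otimes> A V]" ?P ?P', THEN whisk_cong(1), of "(d U ?P \<lhd> [A V]) \<bullet> (U \<rhd> d V ?P) \<bullet> (unpack U V \<lhd> [?P])"] f U V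
      by simp
    also have "\<dots> = (?P' \<rhd> pack (A U) (A V)) \<bullet> (d U ?P' \<lhd> [A V]) \<bullet> (U \<rhd> ((J f \<lhd> [A V]) \<bullet> d V ?P)) \<bullet> (unpack U V \<lhd> [?P])"
      using d_nat_tail[OF U f, of "[A V]", THEN whisk_cong(1), of "(U \<rhd> d V ?P) \<bullet> (unpack U V \<lhd> [?P])"] by simp
    also have "\<dots> = (?P' \<rhd> pack (A U) (A V)) \<bullet> (d U ?P' \<lhd> [A V]) \<bullet> (U \<rhd> d V ?P') \<bullet> ((U \<rhd> V \<rhd> J f) \<bullet> (unpack U V \<lhd> [?P]))"
      unfolding d_nat[OF V f] by simp
    also have "(U \<rhd> V \<rhd> J f) \<bullet> (unpack U V \<lhd> [?P]) = (unpack U V \<lhd> [?P']) \<bullet> (U \<otimes> V \<rhd> J f)"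
      using rex_unpack[OF U V, of "J f" "[?P]"] f by simp
    finally show ?thesis by simp
  qed
  have \<phi>: "?\<phi> X \<in> hom C (summand C i X (U \<otimes> V) X) (A U \<otimes> A V)" if X: "X \<in> objs C" for X
    using U V X cap_arr(4-6)[OF X]
    by (auto simp: in_hom split_summand_def insertion_def Let_def summand_def PP_def QQ_def)
  have comp: "(J (?\<phi> X) \<lhd> []) \<bullet> (pk X (U \<otimes> V) X \<lhd> []) = (ee X \<lhd> [A U \<otimes> A V]) \<bullet> (QQ X \<rhd> ?\<psi> (PP X) \<lhd> [])"
    if X: "X \<in> objs C" for X
  proof (rule split_cancel[where K = "QQ X \<rhd> pack U V \<lhd> [PP X]" and K' = "QQ X \<rhd> unpack U V \<lhd> [PP X]"])
    have e: "pack (A U) (A V) \<bullet> (ee X \<lhd> [A U, A V]) = (ee X \<lhd> [A U \<otimes> A V]) \<bullet> (QQ X \<rhd> PP X \<rhd> pack (A U) (A V))"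
      using rex_ee[OF X, of "pack (A U) (A V)" "[A U, A V]" "[A U \<otimes> A V]"] U V by simp
    \<comment> \<open>The copairing followed by the second injection is \<open>d0\<close> by
      definition, so the second factor appears as \<open>d V (PP X)\<close>.\<close>
    have "((J (?\<phi> X) \<lhd> []) \<bullet> (pk X (U \<otimes> V) X \<lhd> [])) \<bullet> (QQ X \<rhd> pack U V \<lhd> [PP X])
      = pack (A U) (A V) \<bullet> (jj U X \<lhd> [A V]) \<bullet> (QQ X \<rhd> U \<rhd> d V (PP X))"
      using comul_components[OF U V X] U V X by (simp add: d_PP d0_def rwhisk_Nil)
    also have "\<dots> = (pack (A U) (A V) \<bullet> (ee X \<lhd> [A U, A V])) \<bullet> (QQ X \<rhd> d U (PP X) \<lhd> [A V]) \<bullet> (QQ X \<rhd> U \<rhd> d V (PP X))"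
      using U V X by (simp add: jj_d)
    also have "\<dots> = ((ee X \<lhd> [A U \<otimes> A V]) \<bullet> (QQ X \<rhd> ?\<psi> (PP X) \<lhd> [])) \<bullet> (QQ X \<rhd> pack U V \<lhd> [PP X])"
      unfolding e using U V X by (simp add: rwhisk_Nil)
    finally show "((J (?\<phi> X) \<lhd> []) \<bullet> (pk X (U \<otimes> V) X \<lhd> [])) \<bullet> (QQ X \<rhd> pack U V \<lhd> [PP X])
        = ((ee X \<lhd> [A U \<otimes> A V]) \<bullet> (QQ X \<rhd> ?\<psi> (PP X) \<lhd> [])) \<bullet> (QQ X \<rhd> pack U V \<lhd> [PP X])" .
  qed (use U V X \<phi>[OF X] in \<open>auto simp: in_hom wd_diag\<close>)
  show "A_comul C \<delta> i A \<iota> U V \<in> hom C (A (U \<otimes> V)) (A U \<otimes> A V)"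
    unfolding A_comul_def by (rule desc_eq(1)[where \<psi> = ?\<psi>]) (use U V nat \<phi> comp in auto)
  show "P \<in> objs C \<Longrightarrow> (P \<rhd> J (A_comul C \<delta> i A \<iota> U V)) \<bullet> d (U \<otimes> V) P = ?\<psi> P"
    unfolding A_comul_def by (rule desc_eq(2)[where \<psi> = ?\<psi>]) (use U V nat \<phi> comp in auto)
qed

text \<open>\<open>du_gamma\<close> is the mate of the nested pairings. It replaces the pairing of
  the injection at a tensor product by \<open>ee X\<close> inside \<open>ee Y\<close>, after which
  both shapes of the coend give one formula.\<close>

lemma mult_components:
  assumes V: "V \<in> objs C" and X: "X \<in> objs C" and Y: "Y \<in> objs C"
  shows "(J (mult_comp C i \<iota> V X Y) \<lhd> []) \<bullet> (pk Y (summand C i X V X) Y \<lhd> []) \<bullet> (QQ Y \<rhd> pk X V X \<lhd> [PP Y])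
    = (ee Y \<lhd> [A V]) \<bullet> (QQ Y \<rhd> ee X \<lhd> [PP Y, A V]) \<bullet> (QQ Y \<rhd> QQ X \<rhd> unpack (PP X) (PP Y) \<lhd> [A V]) \<bullet>
      (QQ Y \<rhd> QQ X \<rhd> d V (PP X \<otimes> PP Y) \<lhd> []) \<bullet> (QQ Y \<rhd> QQ X \<rhd> V \<rhd> pack (PP X) (PP Y) \<lhd> [])"
proof (cases "i \<le> 2")
  case True
  then have PQ: "PP X = X" "QQ X = du C i X" for X by (simp_all add: PP_def QQ_def)
  let ?g = "du_gamma C i Y X"
  have g: "(ee (X \<otimes> Y) \<lhd> zs) \<bullet> (J ?g \<lhd> X \<otimes> Y # zs) \<bullet> (pack (du C i Y) (du C i X) \<lhd> X \<otimes> Y # zs)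
      = (ee Y \<lhd> zs) \<bullet> (du C i Y \<rhd> ee X \<lhd> Y # zs) \<bullet> (du C i Y \<rhd> du C i X \<rhd> unpack X Y \<lhd> zs)" for zs
  proof -
    have "((ee (X \<otimes> Y)) \<bullet> (J ?g \<lhd> [X \<otimes> Y]) \<bullet> (pack (du C i Y) (du C i X) \<lhd> [X \<otimes> Y])) \<bullet> (du C i Y \<rhd> du C i X \<rhd> pack X Y)
      = ee Y \<bullet> (du C i Y \<rhd> ee X \<lhd> [Y])"
      using du_gamma_left[OF True X Y] by (simp add: ee_def PQ)
    from this[THEN whisk_cong(1), of "du C i Y \<rhd> du C i X \<rhd> unpack X Y"]
    have "ee (X \<otimes> Y) \<bullet> (J ?g \<lhd> [X \<otimes> Y]) \<bullet> (pack (du C i Y) (du C i X) \<lhd> [X \<otimes> Y])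
      = ee Y \<bullet> (du C i Y \<rhd> ee X \<lhd> [Y]) \<bullet> (du C i Y \<rhd> du C i X \<rhd> unpack X Y)"
      using X Y unpack_pack(2)[OF X Y, THEN whisk_cong(4), unfolded whisk_nf] by simp
    from with_tail[OF this, of zs] show ?thesis by simp
  qed
  have "(J (mult_comp C i \<iota> V X Y) \<lhd> []) \<bullet> (pk Y (summand C i X V X) Y \<lhd> []) \<bullet> (QQ Y \<rhd> pk X V X \<lhd> [PP Y])
    = (jj V (X \<otimes> Y) \<lhd> []) \<bullet> (J ?g \<lhd> [V, X \<otimes> Y]) \<bullet> (pack (du C i Y) (du C i X) \<lhd> [V, X \<otimes> Y]) \<bullet> (du C i Y \<rhd> du C i X \<rhd> V \<rhd> pack X Y \<lhd> [])"
    using V X Y True by (simp add: mult_comp_def mult_coh_def Let_def jj_def pk_def summand_def PQ push rex)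
  also have "\<dots> = (ee (X \<otimes> Y) \<lhd> [A V]) \<bullet> (J ?g \<lhd> [X \<otimes> Y, A V]) \<bullet> (pack (du C i Y) (du C i X) \<lhd> [X \<otimes> Y, A V]) \<bullet>
      (du C i Y \<rhd> du C i X \<rhd> d V (X \<otimes> Y) \<lhd> []) \<bullet> (du C i Y \<rhd> du C i X \<rhd> V \<rhd> pack X Y \<lhd> [])"
    using V X Y by (simp add: jj_d PQ rex push rwhisk_Nil)
  also have "\<dots> = ((ee (X \<otimes> Y) \<lhd> [A V]) \<bullet> (J ?g \<lhd> [X \<otimes> Y, A V]) \<bullet> (pack (du C i Y) (du C i X) \<lhd> [X \<otimes> Y, A V])) \<bullet>
      (du C i Y \<rhd> du C i X \<rhd> d V (X \<otimes> Y) \<lhd> []) \<bullet> (du C i Y \<rhd> du C i X \<rhd> V \<rhd> pack X Y \<lhd> [])"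
    by simp
  finally show ?thesis
    unfolding g by (simp add: PQ)
next
  case False
  then have PQ: "QQ X = X" "PP X = du C i X" for X by (simp_all add: PP_def QQ_def)
  let ?g = "du_gamma C i X Y" and ?D = "du C i X \<otimes> du C i Y"
  have g: "(ee (Y \<otimes> X) \<lhd> zs) \<bullet> (Y \<otimes> X \<rhd> J ?g \<lhd> zs) \<bullet> (pack Y X \<lhd> ?D # zs)
      = (ee Y \<lhd> zs) \<bullet> (Y \<rhd> ee X \<lhd> du C i Y # zs) \<bullet> (Y \<rhd> X \<rhd> unpack (du C i X) (du C i Y) \<lhd> zs)" for zs
  proof -
    have "((ee (Y \<otimes> X)) \<bullet> (Y \<otimes> X \<rhd> J ?g) \<bullet> (pack Y X \<lhd> [?D])) \<bullet> (Y \<rhd> X \<rhd> pack (du C i X) (du C i Y))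
      = ee Y \<bullet> (Y \<rhd> ee X \<lhd> [du C i Y])"
      using du_gamma_right[OF False X Y] by (simp add: ee_def PQ)
    from this[THEN whisk_cong(1), of "Y \<rhd> X \<rhd> unpack (du C i X) (du C i Y)"]
    have "ee (Y \<otimes> X) \<bullet> (Y \<otimes> X \<rhd> J ?g) \<bullet> (pack Y X \<lhd> [?D])
      = ee Y \<bullet> (Y \<rhd> ee X \<lhd> [du C i Y]) \<bullet> (Y \<rhd> X \<rhd> unpack (du C i X) (du C i Y))"
      using X Y unpack_pack(2)[of "du C i X" "du C i Y", THEN whisk_cong(4), unfolded whisk_nf] by simp
    from with_tail[OF this, of zs] show ?thesis by simp
  qed
  have "(J (mult_comp C i \<iota> V X Y) \<lhd> []) \<bullet> (pk Y (summand C i X V X) Y \<lhd> []) \<bullet> (QQ Y \<rhd> pk X V X \<lhd> [PP Y])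
    = (jj V (Y \<otimes> X) \<lhd> []) \<bullet> (pack Y X \<lhd> [V, du C i (Y \<otimes> X)]) \<bullet> (Y \<rhd> X \<rhd> V \<rhd> J ?g \<lhd> []) \<bullet> (Y \<rhd> X \<rhd> V \<rhd> pack (du C i X) (du C i Y) \<lhd> [])"
    using V X Y False by (simp add: mult_comp_def mult_coh_def Let_def jj_def pk_def summand_def PQ push rex)
  also have "\<dots> = (ee (Y \<otimes> X) \<lhd> [A V]) \<bullet> (pack Y X \<lhd> [du C i (Y \<otimes> X), A V]) \<bullet>
      (Y \<rhd> X \<rhd> ((d V (du C i (Y \<otimes> X)) \<lhd> []) \<bullet> (V \<rhd> J ?g \<lhd> []))) \<bullet> (Y \<rhd> X \<rhd> V \<rhd> pack (du C i X) (du C i Y) \<lhd> [])"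
    using V X Y by (simp add: jj_d PQ rex push rwhisk_Nil)
  \<comment> \<open>Here \<open>d\<close> is needed at \<open>?D\<close>, a tensor product of duals,
    which need not be one of the objects \<open>PP Z\<close>; this uses that \<open>d\<close> has
    been extended to all objects.\<close>
  also have "(d V (du C i (Y \<otimes> X)) \<lhd> []) \<bullet> (V \<rhd> J ?g \<lhd> []) = (J ?g \<lhd> [A V]) \<bullet> (d V ?D \<lhd> [])"
    using d_nat_tail[OF V, of ?g "[]"] X Y by simp
  also have "(ee (Y \<otimes> X) \<lhd> [A V]) \<bullet> (pack Y X \<lhd> [du C i (Y \<otimes> X), A V]) \<bullet>
      (Y \<rhd> X \<rhd> ((J ?g \<lhd> [A V]) \<bullet> (d V ?D \<lhd> []))) \<bullet> (Y \<rhd> X \<rhd> V \<rhd> pack (du C i X) (du C i Y) \<lhd> [])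
    = (ee (Y \<otimes> X) \<lhd> [A V]) \<bullet> ((pack Y X \<lhd> [du C i (Y \<otimes> X), A V]) \<bullet> (Y \<rhd> X \<rhd> J ?g \<lhd> [A V])) \<bullet>
      (Y \<rhd> X \<rhd> d V ?D \<lhd> []) \<bullet> (Y \<rhd> X \<rhd> V \<rhd> pack (du C i X) (du C i Y) \<lhd> [])"
    by simp
  also have "(pack Y X \<lhd> [du C i (Y \<otimes> X), A V]) \<bullet> (Y \<rhd> X \<rhd> J ?g \<lhd> [A V]) = (Y \<otimes> X \<rhd> J ?g \<lhd> [A V]) \<bullet> (pack Y X \<lhd> [?D, A V])"
    using V X Y pack_exchange[of Y X "J ?g \<lhd> [A V]" "Y \<otimes> X" "[?D, A V]"] by simp
  also have "(ee (Y \<otimes> X) \<lhd> [A V]) \<bullet> ((Y \<otimes> X \<rhd> J ?g \<lhd> [A V]) \<bullet> (pack Y X \<lhd> [?D, A V])) \<bullet>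
      (Y \<rhd> X \<rhd> d V ?D \<lhd> []) \<bullet> (Y \<rhd> X \<rhd> V \<rhd> pack (du C i X) (du C i Y) \<lhd> [])
    = ((ee (Y \<otimes> X) \<lhd> [A V]) \<bullet> (Y \<otimes> X \<rhd> J ?g \<lhd> [A V]) \<bullet> (pack Y X \<lhd> [?D, A V])) \<bullet>
      (Y \<rhd> X \<rhd> d V ?D \<lhd> []) \<bullet> (Y \<rhd> X \<rhd> V \<rhd> pack (du C i X) (du C i Y) \<lhd> [])"
    by simp
  finally show ?thesis
    unfolding g by (simp add: PQ)
qed

end

context monoidal_category
begin

lemma unpack_tensa:
  assumes "f \<in> arrs C" "g \<in> arrs C"
  shows "(unpack (tgt C f) (tgt C g) \<lhd> zs) \<bullet> (J (f \<boxtimes> g) \<lhd> zs)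
    = (J f \<lhd> tgt C g # zs) \<bullet> (src C f \<rhd> J g \<lhd> zs) \<bullet> (unpack (src C f) (src C g) \<lhd> zs)"
proof -
  have "unpack (tgt C f) (tgt C g) \<bullet> J (f \<boxtimes> g) = (J f \<lhd> [tgt C g]) \<bullet> (src C f \<rhd> J g) \<bullet> unpack (src C f) (src C g)"
  proof (rule split_cancel[where K = "pack (src C f) (src C g)" and K' = "unpack (src C f) (src C g)"])
    show "(unpack (tgt C f) (tgt C g) \<bullet> J (f \<boxtimes> g)) \<bullet> pack (src C f) (src C g)
      = ((J f \<lhd> [tgt C g]) \<bullet> (src C f \<rhd> J g) \<bullet> unpack (src C f) (src C g)) \<bullet> pack (src C f) (src C g)"
      using assms J_tensa[OF assms refl refl] unpack_pack(1)[of "tgt C f" "tgt C g", THEN whisk_cong(1), unfolded whisk_nf]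
      by simp
  qed (use assms in simp_all)
  from with_tail[OF this, of zs] show ?thesis by simp
qed

end

context central_coend
begin

text \<open>The family in X and Y is represented in two stages: for fixed Y, the universal property
  of \<open>A V\<close> with trailing letter Y yields \<open>G Y\<close>; then the universal
  property of \<open>A (A V)\<close> turns the family \<open>G\<close> into
  \<open>m\<close>.\<close>

lemma ex_mult:
  assumes V: "V \<in> objs C"
  obtains m where "m \<in> hom C (A (A V)) (A V)"
    "\<And>X Y. X \<in> objs C \<Longrightarrow> Y \<in> objs C \<Longrightarrow> (X \<rhd> Y \<rhd> J m) \<bullet> (X \<rhd> d (A V) Y) \<bullet> (d V X \<lhd> [Y])
      = (unpack X Y \<lhd> [A V]) \<bullet> d V (X \<otimes> Y) \<bullet> (V \<rhd> pack X Y)"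
proof -
  let ?\<psi> = "\<lambda>Y X. (unpack X Y \<lhd> [A V]) \<bullet> d V (X \<otimes> Y) \<bullet> (V \<rhd> pack X Y)"
  have AV: "A V \<in> objs C" using V by simp
  have nat: "(J f \<lhd> [tgt C g, A V]) \<bullet> (src C f \<rhd> J g \<lhd> [A V]) \<bullet> ?\<psi> (src C g) (src C f)
      = ?\<psi> (tgt C g) (tgt C f) \<bullet> (V \<rhd> J f \<lhd> [tgt C g]) \<bullet> (V \<rhd> src C f \<rhd> J g)"
    if f: "f \<in> arrs C" and g: "g \<in> arrs C" for f g
  proof -
    have "(J f \<lhd> [tgt C g, A V]) \<bullet> (src C f \<rhd> J g \<lhd> [A V]) \<bullet> ?\<psi> (src C g) (src C f)
      = (unpack (tgt C f) (tgt C g) \<lhd> [A V]) \<bullet> ((J (f \<boxtimes> g) \<lhd> [A V]) \<bullet> d V (src C f \<otimes> src C g)) \<bullet> (V \<rhd> pack (src C f) (src C g))"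
      using unpack_tensa[OF f g, of "[A V]", THEN whisk_cong(1), of "d V (src C f \<otimes> src C g) \<bullet> (V \<rhd> pack (src C f) (src C g))"]
      by simp
    also have "\<dots> = (unpack (tgt C f) (tgt C g) \<lhd> [A V]) \<bullet> d V (tgt C f \<otimes> tgt C g) \<bullet> (V \<rhd> (J (f \<boxtimes> g) \<bullet> pack (src C f) (src C g)))"
      using d_nat[OF V, of "f \<boxtimes> g"] f g by simp
    finally show ?thesis
      using J_tensa[OF f g refl refl] by simp
  qed
  have "\<exists>!G. sarr G \<and> sdom G = [A V, Y] \<and> scod G = [Y, A V] \<and> (\<forall>X \<in> objs C. (X \<rhd> G) \<bullet> (d V X \<lhd> [Y]) = ?\<psi> Y X)"
    if Y: "Y \<in> objs C" for Y
  proof (rule univ_word[OF V])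
    fix f assume f: "f \<in> arrs C"
    show "(J f \<lhd> [Y, A V]) \<bullet> ?\<psi> Y (src C f) = ?\<psi> Y (tgt C f) \<bullet> (V \<rhd> J f \<lhd> [Y])"
      using nat[OF f, of "ide C Y"] f V Y by simp
  qed (use V Y in auto)
  then have "\<exists>G. \<forall>Y \<in> objs C. sarr (G Y) \<and> sdom (G Y) = [A V, Y] \<and> scod (G Y) = [Y, A V] \<and>
      (\<forall>X \<in> objs C. (X \<rhd> G Y) \<bullet> (d V X \<lhd> [Y]) = ?\<psi> Y X)"
    by (intro bchoice) blast
  then obtain G where G: "\<And>Y. Y \<in> objs C \<Longrightarrow> sarr (G Y) \<and> sdom (G Y) = [A V, Y] \<and> scod (G Y) = [Y, A V]"
      "\<And>X Y. X \<in> objs C \<Longrightarrow> Y \<in> objs C \<Longrightarrow> (X \<rhd> G Y) \<bullet> (d V X \<lhd> [Y]) = ?\<psi> Y X"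
    by blast
  have "\<exists>!m. m \<in> hom C (A (A V)) (A V) \<and> (\<forall>Y \<in> objs C. (Y \<rhd> J m) \<bullet> d (A V) Y = G Y)"
  proof (rule d_univ[OF AV AV])
    fix g assume g: "g \<in> arrs C"
    let ?Y = "src C g" and ?Y' = "tgt C g"
    \<comment> \<open>Naturality of \<open>G\<close> is inherited from the family in two variables,
      by testing against the inner \<open>d\<close>.\<close>
    show "(J g \<lhd> [A V]) \<bullet> G ?Y = G ?Y' \<bullet> (A V \<rhd> J g)"
    proof (rule centr_eqI[OF V, where zs = "[?Y]"])
      fix X assume X: "X \<in> objs C"
      have "(X \<rhd> ((J g \<lhd> [A V]) \<bullet> G ?Y)) \<bullet> (d V X \<lhd> [?Y]) = ?\<psi> ?Y' X \<bullet> (V \<rhd> X \<rhd> J g)"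
        using nat[of "ide C X" g] X V g G(2)[of X ?Y] by simp
      also have "\<dots> = (X \<rhd> G ?Y') \<bullet> ((d V X \<lhd> [?Y']) \<bullet> (V \<rhd> X \<rhd> J g))"
        using G(2)[of X ?Y', THEN whisk_cong(1), of "V \<rhd> X \<rhd> J g"] X g by simp
      also have "(d V X \<lhd> [?Y']) \<bullet> (V \<rhd> X \<rhd> J g) = (X \<rhd> A V \<rhd> J g) \<bullet> (d V X \<lhd> [?Y])"
        using rex_d[OF V X, of "J g" "A V" "[?Y]"] g by simp
      finally show "(X \<rhd> ((J g \<lhd> [A V]) \<bullet> G ?Y)) \<bullet> (d V X \<lhd> [?Y]) = (X \<rhd> (G ?Y' \<bullet> (A V \<rhd> J g))) \<bullet> (d V X \<lhd> [?Y])"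
        by simp
    qed (use V g G(1) in simp_all)
  qed (use G(1) in auto)
  then obtain m where m: "m \<in> hom C (A (A V)) (A V)" "\<And>Y. Y \<in> objs C \<Longrightarrow> (Y \<rhd> J m) \<bullet> d (A V) Y = G Y"
    by blast
  have "(X \<rhd> Y \<rhd> J m) \<bullet> (X \<rhd> d (A V) Y) \<bullet> (d V X \<lhd> [Y]) = ?\<psi> Y X" if X: "X \<in> objs C" and Y: "Y \<in> objs C" for X Y
    using m(2)[OF Y, THEN whisk_cong(3), of X "d V X \<lhd> [Y]"] G(2)[OF X Y] by simp
  then show ?thesis
    using that m(1) by blast
qed

text \<open>Iterated injections are iterated pairings applied to iterated \<open>d\<close>. This
  makes the equation that defines \<open>A_mult\<close> comparable with
  \<open>mult_d\<close>.\<close>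

lemma mult_test:
  assumes V: "V \<in> objs C" and X: "X \<in> objs C" and Y: "Y \<in> objs C" and m: "m \<in> hom C (A (A V)) (A V)"
  shows "J m \<bullet> jj (A V) Y \<bullet> (QQ Y \<rhd> jj V X \<lhd> [PP Y])
    = (ee Y \<lhd> [A V]) \<bullet> (QQ Y \<rhd> ee X \<lhd> [PP Y, A V]) \<bullet>
      (QQ Y \<rhd> QQ X \<rhd> ((PP X \<rhd> PP Y \<rhd> J m) \<bullet> (PP X \<rhd> d (A V) (PP Y)) \<bullet> (d V (PP X) \<lhd> [PP Y])))"
proof -
  have m': "m \<in> arrs C" "src C m = A (A V)" "tgt C m = A V" using m by (auto simp: in_hom)
  let ?H = "(PP Y \<rhd> J m) \<bullet> d (A V) (PP Y)"
  have "J m \<bullet> jj (A V) Y = (ee Y \<lhd> [A V]) \<bullet> (QQ Y \<rhd> ?H)"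
    using rex_ee[OF Y, of "J m" "[A (A V)]" "[A V]", THEN whisk_cong(1), of "QQ Y \<rhd> d (A V) (PP Y)"] V Y m'
    by (simp add: jj_d)
  then have "J m \<bullet> jj (A V) Y \<bullet> (QQ Y \<rhd> jj V X \<lhd> [PP Y]) = (ee Y \<lhd> [A V]) \<bullet> (QQ Y \<rhd> ?H) \<bullet> (QQ Y \<rhd> jj V X \<lhd> [PP Y])"
    by (metis scmp_assoc)
  also have "\<dots> = (ee Y \<lhd> [A V]) \<bullet> (QQ Y \<rhd> (?H \<bullet> (ee X \<lhd> [A V, PP Y]))) \<bullet> (QQ Y \<rhd> QQ X \<rhd> d V (PP X) \<lhd> [PP Y])"
    using V X by (simp add: jj_d)
  also have "?H \<bullet> (ee X \<lhd> [A V, PP Y]) = (ee X \<lhd> [PP Y, A V]) \<bullet> (QQ X \<rhd> PP X \<rhd> ?H)"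
    using rex_ee[OF X, of ?H "[A V, PP Y]" "[PP Y, A V]"] V Y m' by simp
  finally show ?thesis by simp
qed

text \<open>The definite description is resolved by showing that the arrow from
  \<open>ex_mult\<close> satisfies it and that the iterated injections are jointly
  epimorphic.\<close>

lemma A_mult:
  assumes V: "V \<in> objs C"
  shows "A_mult C i A \<iota> V \<in> hom C (A (A V)) (A V)"
    "X \<in> objs C \<Longrightarrow> Y \<in> objs C \<Longrightarrow>
      (X \<rhd> Y \<rhd> J (A_mult C i A \<iota> V)) \<bullet> (X \<rhd> d (A V) Y) \<bullet> (d V X \<lhd> [Y])
      = (unpack X Y \<lhd> [A V]) \<bullet> d V (X \<otimes> Y) \<bullet> (V \<rhd> pack X Y)"
proof -
  obtain m where m: "m \<in> hom C (A (A V)) (A V)"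
    "\<And>X Y. X \<in> objs C \<Longrightarrow> Y \<in> objs C \<Longrightarrow> (X \<rhd> Y \<rhd> J m) \<bullet> (X \<rhd> d (A V) Y) \<bullet> (d V X \<lhd> [Y])
      = (unpack X Y \<lhd> [A V]) \<bullet> d V (X \<otimes> Y) \<bullet> (V \<rhd> pack X Y)"
    using ex_mult[OF V] by blast
  let ?S = "\<lambda>X. summand C i X V X"
  let ?K = "\<lambda>X Y. (pk Y (?S X) Y \<lhd> []) \<bullet> (QQ Y \<rhd> pk X V X \<lhd> [PP Y])"
  let ?lhs = "\<lambda>k X Y. k \<cdot> \<iota> (A V) Y \<cdot> summand_arr C i (ide C Y) (\<iota> V X) (ide C Y)"
  have lhs: "(J (?lhs k X Y) \<lhd> []) \<bullet> ?K X Y = J k \<bullet> jj (A V) Y \<bullet> (QQ Y \<rhd> jj V X \<lhd> [PP Y])"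
    if k: "k \<in> hom C (A (A V)) (A V)" and X: "X \<in> objs C" and Y: "Y \<in> objs C" for k X Y
  proof -
    have k': "k \<in> arrs C" "src C k = A (A V)" "tgt C k = A V" using k by (auto simp: in_hom)
    have "(J (summand_arr C i (ide C Y) (\<iota> V X) (ide C Y)) \<lhd> []) \<bullet> (pk Y (?S X) Y \<lhd> [])
        = (pk Y (A V) Y \<lhd> []) \<bullet> (QQ Y \<rhd> J (\<iota> V X) \<lhd> [PP Y])"
      using summand_arr_pk[of "ide C Y" "\<iota> V X" "ide C Y"] V X Y by (auto simp: PP_def QQ_def)
    from this[THEN whisk_cong(1), of "QQ Y \<rhd> pk X V X \<lhd> [PP Y]"] show ?thesis
      using V X Y k' by (simp add: J_cmp jj_def rwhisk_Nil)
  qed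
  have KI: "f = g" if f: "f \<in> hom C (summand C i Y (?S X) Y) (A V)" and g: "g \<in> hom C (summand C i Y (?S X) Y) (A V)"
    and eq: "(J f \<lhd> []) \<bullet> ?K X Y = (J g \<lhd> []) \<bullet> ?K X Y" and X: "X \<in> objs C" and Y: "Y \<in> objs C" for f g X Y
  proof (rule pk_cancel[OF Y _ Y f g])
    show "(J f \<lhd> []) \<bullet> (pk Y (?S X) Y \<lhd> []) = (J g \<lhd> []) \<bullet> (pk Y (?S X) Y \<lhd> [])"
    proof (rule split_cancel[where K = "QQ Y \<rhd> pk X V X \<lhd> [PP Y]" and K' = "QQ Y \<rhd> upk X V X \<lhd> [PP Y]"])
      show "(QQ Y \<rhd> pk X V X \<lhd> [PP Y]) \<bullet> (QQ Y \<rhd> upk X V X \<lhd> [PP Y]) = sid (scod (QQ Y \<rhd> pk X V X \<lhd> [PP Y]))"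
        using pack_unpack_pk(2)[OF X V X, THEN with_tail, of "[PP Y]", THEN whisk_cong(2), of "QQ Y"] X V Y
        by (simp del: pack_unpack_pk)
    qed (use V X Y f g eq in \<open>auto simp: in_hom wd_diag\<close>)
  qed (use V X in simp)
  have mc: "mult_comp C i \<iota> V X Y \<in> hom C (summand C i Y (?S X) Y) (A V)" if X: "X \<in> objs C" and Y: "Y \<in> objs C" for X Y
    using V X Y by (auto simp: in_hom mult_comp_def mult_coh_def Let_def summand_def)
  have lh: "?lhs k X Y \<in> hom C (summand C i Y (?S X) Y) (A V)"
    if k: "k \<in> hom C (A (A V)) (A V)" and X: "X \<in> objs C" and Y: "Y \<in> objs C" for k X Y
    using k V X Y by (auto simp: in_hom)
  have good: "?lhs m X Y = mult_comp C i \<iota> V X Y" if X: "X \<in> objs C" and Y: "Y \<in> objs C" for X Y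
  proof (rule KI[OF lh[OF m(1) X Y] mc[OF X Y] _ X Y])
    show "(J (?lhs m X Y) \<lhd> []) \<bullet> ?K X Y = (J (mult_comp C i \<iota> V X Y) \<lhd> []) \<bullet> ?K X Y"
      unfolding lhs[OF m(1) X Y] mult_test[OF V X Y m(1)] mult_components[OF V X Y]
      using m(2)[of "PP X" "PP Y"] V X Y by (simp add: rwhisk_Nil)
  qed
  have "A_mult C i A \<iota> V = m"
    unfolding A_mult_def
  proof (rule the_equality)
    show "m \<in> hom C (A (A V)) (A V) \<and> (\<forall>X\<in>objs C. \<forall>Y\<in>objs C. ?lhs m X Y = mult_comp C i \<iota> V X Y)"
      using m(1) good by blast
  next
    fix k assume k: "k \<in> hom C (A (A V)) (A V) \<and> (\<forall>X\<in>objs C. \<forall>Y\<in>objs C. ?lhs k X Y = mult_comp C i \<iota> V X Y)"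
    then have k': "k \<in> arrs C" "src C k = A (A V)" "tgt C k = A V" and m': "m \<in> arrs C" "src C m = A (A V)" "tgt C m = A V"
      using m(1) by (auto simp: in_hom)
    have "J k = J m"
    proof (rule jj_inject[of "A V" _ "[]"])
      fix Y assume Y: "Y \<in> objs C"
      have arr: "J h \<bullet> jj (A V) Y = (ee Y \<lhd> [A V]) \<bullet> (QQ Y \<rhd> ((PP Y \<rhd> (J h \<bullet> jj (A V) Y)) \<bullet> (cc Y \<lhd> [A V, PP Y])))"
        if "h \<in> arrs C" "src C h = A (A V)" "tgt C h = A V" for h
        using bend_left[OF PQ_dual[OF Y], of "J h \<bullet> jj (A V) Y" "[A V, PP Y]" "[A V]"] that V Y by simp
      \<comment> \<open>\<open>jj_inject\<close> requires \<open>A V\<close> to be the first letter,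
        so \<open>QQ Y\<close> is bent to the codomain before the inner injections are
        cancelled.\<close>
      have eq: "(PP Y \<rhd> (J k \<bullet> jj (A V) Y)) \<bullet> (cc Y \<lhd> [A V, PP Y]) = (PP Y \<rhd> (J m \<bullet> jj (A V) Y)) \<bullet> (cc Y \<lhd> [A V, PP Y])"
      proof (rule jj_inject[OF V, where zs = "[PP Y]"])
        fix X assume X: "X \<in> objs C"
        have slide: "((PP Y \<rhd> (J h \<bullet> jj (A V) Y)) \<bullet> (cc Y \<lhd> [A V, PP Y])) \<bullet> (jj V X \<lhd> [PP Y])
          = (PP Y \<rhd> (J h \<bullet> jj (A V) Y \<bullet> (QQ Y \<rhd> jj V X \<lhd> [PP Y]))) \<bullet> (cc Y \<lhd> [QQ X, V, PP X, PP Y])" for h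
          using exchange_atom(3)[of "cc Y" "jj V X \<lhd> [PP Y]" "[A V, PP Y]" "PP Y" "QQ Y"] V X Y by simp
        have "J k \<bullet> jj (A V) Y \<bullet> (QQ Y \<rhd> jj V X \<lhd> [PP Y]) = J m \<bullet> jj (A V) Y \<bullet> (QQ Y \<rhd> jj V X \<lhd> [PP Y])"
          using lhs[OF conjunct1[OF k] X Y] lhs[OF m(1) X Y] k good[OF X Y] X Y by simp
        then show "((PP Y \<rhd> (J k \<bullet> jj (A V) Y)) \<bullet> (cc Y \<lhd> [A V, PP Y])) \<bullet> (jj V X \<lhd> [PP Y])
          = ((PP Y \<rhd> (J m \<bullet> jj (A V) Y)) \<bullet> (cc Y \<lhd> [A V, PP Y])) \<bullet> (jj V X \<lhd> [PP Y])"
          unfolding slide by simp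
      qed (use V Y k' m' in simp_all)
      have "J k \<bullet> jj (A V) Y = J m \<bullet> jj (A V) Y"
        by (rule trans[OF arr[OF k'] trans[OF _ arr[OF m', symmetric]]]) (simp only: eq)
      then show "J k \<bullet> (jj (A V) Y \<lhd> []) = J m \<bullet> (jj (A V) Y \<lhd> [])"
        using V Y by (simp add: rwhisk_Nil)
    qed (use V k' m' in simp_all)
    then show "k = m"
      using J_inject[of k _ _ m] k m(1) by blast
  qed
  then show "A_mult C i A \<iota> V \<in> hom C (A (A V)) (A V)"
    "X \<in> objs C \<Longrightarrow> Y \<in> objs C \<Longrightarrow>
      (X \<rhd> Y \<rhd> J (A_mult C i A \<iota> V)) \<bullet> (X \<rhd> d (A V) Y) \<bullet> (d V X \<lhd> [Y])
      = (unpack X Y \<lhd> [A V]) \<bullet> d V (X \<otimes> Y) \<bullet> (V \<rhd> pack X Y)"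
    using m by auto
qed

theorem central_monad: "centralizer_bimonad C (central_monad C \<delta> i A \<iota>) d"
proof -
  let ?T = "central_monad C \<delta> i A \<iota>"
  have [simp]: "m_ob ?T = A" "m_ar ?T = A_ar C i A \<iota>" "m_mult ?T = A_mult C i A \<iota>" "m_unit ?T = A_unit C i \<iota>"
    "m_comul ?T = A_comul C \<delta> i A \<iota>" "m_counit ?T = A_counit C \<delta> i A \<iota>"
    by (simp_all add: central_monad_def)
  show ?thesis
  proof (intro centralizer_bimonad.intro centralizer_bimonad_axioms.intro)
    show "centralizer C (m_ob ?T) d"
      using centralizer_axioms by simp
    show "(X \<rhd> J (m_comul ?T U V)) \<bullet> d (U \<otimes> V) X \<bullet> (pack U V \<lhd> [X]) = (X \<rhd> pack (m_ob ?T U) (m_ob ?T V)) \<bullet> (d U X \<lhd> [m_ob ?T V]) \<bullet> (U \<rhd> d V X)"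
      if "U \<in> objs C" "V \<in> objs C" "X \<in> objs C" for U V X
      using A_comul(2)[OF that(1,2,3), THEN whisk_cong(1), of "pack U V \<lhd> [X]"] that by simp
    show "(X \<rhd> J (m_counit ?T)) \<bullet> d \<one> X \<bullet> (pack0 \<lhd> [X]) = X \<rhd> pack0" if "X \<in> objs C" for X
      using A_counit(2)[OF that, THEN whisk_cong(1), of "pack0 \<lhd> [X]"] that by simp
  qed (use A_ar A_mult A_unit A_comul A_counit in \<open>auto simp: in_hom\<close>)
qed

end

section \<open>Mates and pivotal structures\<close>

context rigid_category
begin

definition sevl :: "'o \<Rightarrow> ('o, 'm) sarrow" where "sevl X = ev_of (ld C X) X (evl C X)"
definition scoevl :: "'o \<Rightarrow> ('o, 'm) sarrow" where "scoevl X = coev_of X (ld C X) (coevl C X)"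
definition sevr :: "'o \<Rightarrow> ('o, 'm) sarrow" where "sevr X = ev_of X (rd C X) (evr C X)"
definition scoevr :: "'o \<Rightarrow> ('o, 'm) sarrow" where "scoevr X = coev_of (rd C X) X (coevr C X)"

lemma ldual: "X \<in> objs C \<Longrightarrow> sdual X (ld C X) (sevl X) (scoevl X)"
  unfolding sevl_def scoevl_def by (rule sdual_of_dual_pair[OF left_dual])

lemma rdual: "X \<in> objs C \<Longrightarrow> sdual (rd C X) X (sevr X) (scoevr X)"
  unfolding sevr_def scoevr_def by (rule sdual_of_dual_pair[OF right_dual])

lemma dual_arrows [simp]:
  assumes "X \<in> objs C"
  shows "ld C X \<in> objs C" "rd C X \<in> objs C"
    "evl C X \<in> arrs C" "src C (evl C X) = ld C X \<otimes> X" "tgt C (evl C X) = \<one>"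
    "coevl C X \<in> arrs C" "src C (coevl C X) = \<one>" "tgt C (coevl C X) = X \<otimes> ld C X"
    "evr C X \<in> arrs C" "src C (evr C X) = X \<otimes> rd C X" "tgt C (evr C X) = \<one>"
    "coevr C X \<in> arrs C" "src C (coevr C X) = \<one>" "tgt C (coevr C X) = rd C X \<otimes> X"
    "sarr (sevl X)" "sdom (sevl X) = [ld C X, X]" "scod (sevl X) = []"
    "sarr (scoevl X)" "sdom (scoevl X) = []" "scod (scoevl X) = [X, ld C X]"
    "sarr (sevr X)" "sdom (sevr X) = [X, rd C X]" "scod (sevr X) = []"
    "sarr (scoevr X)" "sdom (scoevr X) = []" "scod (scoevr X) = [rd C X, X]"
  using left_dual[OF assms] right_dual[OF assms] sdualD(3-8)[OF ldual[OF assms]] sdualD(3-8)[OF rdual[OF assms]]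
  by (auto simp: dual_pair_def in_hom)

lemma dual_push0:
  assumes "X \<in> objs C"
  shows "(J (evl C X) \<lhd> zs) \<bullet> (pack (ld C X) X \<lhd> zs) = (pack0 \<lhd> zs) \<bullet> (sevl X \<lhd> zs)"
    "(J (coevl C X) \<lhd> zs) \<bullet> (pack0 \<lhd> zs) = (pack X (ld C X) \<lhd> zs) \<bullet> (scoevl X \<lhd> zs)"
    "(J (evr C X) \<lhd> zs) \<bullet> (pack X (rd C X) \<lhd> zs) = (pack0 \<lhd> zs) \<bullet> (sevr X \<lhd> zs)"
    "(J (coevr C X) \<lhd> zs) \<bullet> (pack0 \<lhd> zs) = (pack (rd C X) X \<lhd> zs) \<bullet> (scoevr X \<lhd> zs)"
  unfolding sevl_def scoevl_def sevr_def scoevr_def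
  by (rule ev_of_tail coev_of_tail; use assms in \<open>simp add: in_hom\<close>)+

lemmas dual_push = dual_push0 dual_push0[THEN whisk_cong(1), unfolded whisk_nf]
  dual_push0[THEN whisk_cong(2), unfolded whisk_nf] dual_push0[THEN whisk_cong(3), unfolded whisk_nf]
  dual_push0[THEN whisk_cong(4), unfolded whisk_nf] dual_push0[THEN whisk_cong(5), unfolded whisk_nf]

text \<open>The explicit zigzag reduces to a bent copy of \<open>f\<close>, and pairing with X
  undoes the bending. The dual arrows built with \<open>transl\<close> are handled below through
  this property alone.\<close>

lemma transl:
  assumes f: "f \<in> hom C (Z \<otimes> X) \<one>" and Z: "Z \<in> objs C" and X: "X \<in> objs C"
  shows "transl C Z X f \<in> hom C Z (ld C X)"
    "(sevl X \<lhd> zs) \<bullet> (J (transl C Z X f) \<lhd> X # zs) = ev_of Z X f \<lhd> zs"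
proof -
  have f': "f \<in> arrs C" "src C f = Z \<otimes> X" "tgt C f = \<one>" using f by (auto simp: in_hom)
  show "transl C Z X f \<in> hom C Z (ld C X)"
    using f' Z X by (simp add: transl_def in_hom)
  note ev = ev_of_tail[OF f Z X]
  have "J (transl C Z X f) \<lhd> [] = (ev_of Z X f \<lhd> [ld C X]) \<bullet> (Z \<rhd> scoevl X \<lhd> [])"
    using f f' Z X by (simp add: transl_def push dual_push ev ev[THEN whisk_cong(1), unfolded whisk_nf])
  then have "sevl X \<bullet> (J (transl C Z X f) \<lhd> [X]) = ev_of Z X f"
    using bend_tail_right[OF ldual[OF X], of "ev_of Z X f" "[Z]" "[]"] f f' Z X
    by (simp add: rwhisk_Nil transl_def)
  from with_tail[OF this, of zs]
  show "(sevl X \<lhd> zs) \<bullet> (J (transl C Z X f) \<lhd> X # zs) = ev_of Z X f \<lhd> zs" by simp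
qed

lemma transr:
  assumes f: "f \<in> hom C (X \<otimes> Z) \<one>" and Z: "Z \<in> objs C" and X: "X \<in> objs C"
  shows "transr C X Z f \<in> hom C Z (rd C X)"
    "(sevr X \<lhd> zs) \<bullet> (X \<rhd> J (transr C X Z f) \<lhd> zs) = ev_of X Z f \<lhd> zs"
proof -
  have f': "f \<in> arrs C" "src C f = X \<otimes> Z" "tgt C f = \<one>" using f by (auto simp: in_hom)
  show "transr C X Z f \<in> hom C Z (rd C X)"
    using f' Z X by (simp add: transr_def in_hom)
  note ev = ev_of_tail[OF f X Z]
  have "J (transr C X Z f) \<lhd> [] = (rd C X \<rhd> ev_of X Z f \<lhd> []) \<bullet> (scoevr X \<lhd> [Z])"
    using f f' Z X by (simp add: transr_def push dual_push ev ev[THEN whisk_cong(2), unfolded whisk_nf] ev[THEN whisk_cong(3), unfolded whisk_nf])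
  then have "sevr X \<bullet> (X \<rhd> J (transr C X Z f)) = ev_of X Z f"
    using bend_left[OF rdual[OF X], of "ev_of X Z f" "[Z]" "[]"] f f' Z X
    by (simp add: rwhisk_Nil transr_def)
  from with_tail[OF this, of zs]
  show "(sevr X \<lhd> zs) \<bullet> (X \<rhd> J (transr C X Z f) \<lhd> zs) = ev_of X Z f \<lhd> zs" by simp
qed

lemma ld_arr:
  assumes f: "f \<in> arrs C"
  shows "ld_arr C f \<in> hom C (ld C (tgt C f)) (ld C (src C f))"
    "(sevl (tgt C f) \<lhd> zs) \<bullet> (ld C (tgt C f) \<rhd> J f \<lhd> zs) = (sevl (src C f) \<lhd> zs) \<bullet> (J (ld_arr C f) \<lhd> src C f # zs)"
proof -
  let ?f = "evl C (tgt C f) \<cdot> (ide C (ld C (tgt C f)) \<boxtimes> f)"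
  have h: "?f \<in> hom C (ld C (tgt C f) \<otimes> src C f) \<one>" using f by (simp add: in_hom)
  have "ev_of (ld C (tgt C f)) (src C f) ?f = sevl (tgt C f) \<bullet> (ld C (tgt C f) \<rhd> J f)"
    using f J_tensa[of "ide C (ld C (tgt C f))" f] by (simp add: ev_of_def sevl_def J_cmp)
  from this[THEN with_tail, of zs]
  show "ld_arr C f \<in> hom C (ld C (tgt C f)) (ld C (src C f))"
    "(sevl (tgt C f) \<lhd> zs) \<bullet> (ld C (tgt C f) \<rhd> J f \<lhd> zs) = (sevl (src C f) \<lhd> zs) \<bullet> (J (ld_arr C f) \<lhd> src C f # zs)"
    using transl[OF h] f by (simp_all add: ld_arr_def)
qed

lemma rd_arr:
  assumes f: "f \<in> arrs C"
  shows "rd_arr C f \<in> hom C (rd C (tgt C f)) (rd C (src C f))"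
    "(sevr (tgt C f) \<lhd> zs) \<bullet> (J f \<lhd> rd C (tgt C f) # zs) = (sevr (src C f) \<lhd> zs) \<bullet> (src C f \<rhd> J (rd_arr C f) \<lhd> zs)"
proof -
  let ?f = "evr C (tgt C f) \<cdot> (f \<boxtimes> ide C (rd C (tgt C f)))"
  have h: "?f \<in> hom C (src C f \<otimes> rd C (tgt C f)) \<one>" using f by (simp add: in_hom)
  have "ev_of (src C f) (rd C (tgt C f)) ?f = sevr (tgt C f) \<bullet> (J f \<lhd> [rd C (tgt C f)])"
    using f J_tensa[of f "ide C (rd C (tgt C f))"] by (simp add: ev_of_def sevr_def J_cmp)
  from this[THEN with_tail, of zs]
  show "rd_arr C f \<in> hom C (rd C (tgt C f)) (rd C (src C f))"
    "(sevr (tgt C f) \<lhd> zs) \<bullet> (J f \<lhd> rd C (tgt C f) # zs) = (sevr (src C f) \<lhd> zs) \<bullet> (src C f \<rhd> J (rd_arr C f) \<lhd> zs)"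
    using transr[OF h] f by (simp_all add: rd_arr_def)
qed

text \<open>When the coherence isomorphisms are removed, the arrow of which \<open>gammal\<close> is
  the mate becomes the evaluation of X nested inside that of Y.\<close>

lemma gammal:
  assumes X: "X \<in> objs C" and Y: "Y \<in> objs C"
  shows "gammal C Y X \<in> hom C (ld C Y \<otimes> ld C X) (ld C (X \<otimes> Y))"
    "sevl (X \<otimes> Y) \<bullet> (J (gammal C Y X) \<lhd> [X \<otimes> Y]) \<bullet> (pack (ld C Y) (ld C X) \<lhd> [X \<otimes> Y]) \<bullet> (ld C Y \<rhd> ld C X \<rhd> pack X Y)
      = sevl Y \<bullet> (ld C Y \<rhd> sevl X \<lhd> [Y])"
proof -
  let ?f = "evl C Y \<cdot> (ide C (ld C Y) \<boxtimes> (lun C Y \<cdot> (evl C X \<boxtimes> ide C Y) \<cdot> inv_arr C (assoc C (ld C X) X Y))) \<cdot>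
      assoc C (ld C Y) (ld C X) (X \<otimes> Y)"
  have h: "?f \<in> hom C ((ld C Y \<otimes> ld C X) \<otimes> (X \<otimes> Y)) \<one>" using X Y by (simp add: in_hom)
  have "(pack0 \<lhd> []) \<bullet> (ev_of (ld C Y \<otimes> ld C X) (X \<otimes> Y) ?f \<lhd> []) \<bullet> (pack (ld C Y) (ld C X) \<lhd> [X \<otimes> Y]) \<bullet> (ld C Y \<rhd> ld C X \<rhd> pack X Y \<lhd> [])
    = (J ?f \<lhd> []) \<bullet> (pack (ld C Y \<otimes> ld C X) (X \<otimes> Y) \<lhd> []) \<bullet> (pack (ld C Y) (ld C X) \<lhd> [X \<otimes> Y]) \<bullet> (ld C Y \<rhd> ld C X \<rhd> pack X Y \<lhd> [])"
    using ev_of_tail[OF h, of "[]", THEN whisk_cong(1), of "(pack (ld C Y) (ld C X) \<lhd> [X \<otimes> Y]) \<bullet> (ld C Y \<rhd> ld C X \<rhd> pack X Y \<lhd> [])"] X Y by simp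
  also have "\<dots> = (pack0 \<lhd> []) \<bullet> (sevl Y \<lhd> []) \<bullet> (ld C Y \<rhd> sevl X \<lhd> [Y])"
    using X Y by (simp add: push dual_push)
  finally have "(ev_of (ld C Y \<otimes> ld C X) (X \<otimes> Y) ?f \<lhd> []) \<bullet> (pack (ld C Y) (ld C X) \<lhd> [X \<otimes> Y]) \<bullet> (ld C Y \<rhd> ld C X \<rhd> pack X Y \<lhd> [])
      = (sevl Y \<lhd> []) \<bullet> (ld C Y \<rhd> sevl X \<lhd> [Y])"
    by (rule pack0_cancel_left[rotated -1]) (use X Y h in simp_all)
  then show "gammal C Y X \<in> hom C (ld C Y \<otimes> ld C X) (ld C (X \<otimes> Y))"
    "sevl (X \<otimes> Y) \<bullet> (J (gammal C Y X) \<lhd> [X \<otimes> Y]) \<bullet> (pack (ld C Y) (ld C X) \<lhd> [X \<otimes> Y]) \<bullet> (ld C Y \<rhd> ld C X \<rhd> pack X Y)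
      = sevl Y \<bullet> (ld C Y \<rhd> sevl X \<lhd> [Y])"
    using transl(1)[OF h] transl(2)[OF h, of "[]", THEN whisk_cong(1), of "(pack (ld C Y) (ld C X) \<lhd> [X \<otimes> Y]) \<bullet> (ld C Y \<rhd> ld C X \<rhd> pack X Y)"] X Y h
    by (simp_all add: gammal_def rwhisk_Nil)
qed

lemma gammar:
  assumes X: "X \<in> objs C" and Y: "Y \<in> objs C"
  shows "gammar C X Y \<in> hom C (rd C X \<otimes> rd C Y) (rd C (Y \<otimes> X))"
    "sevr (Y \<otimes> X) \<bullet> (Y \<otimes> X \<rhd> J (gammar C X Y)) \<bullet> (pack Y X \<lhd> [rd C X \<otimes> rd C Y]) \<bullet> (Y \<rhd> X \<rhd> pack (rd C X) (rd C Y))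
      = sevr Y \<bullet> (Y \<rhd> sevr X \<lhd> [rd C Y])"
proof -
  let ?D = "rd C X \<otimes> rd C Y"
  let ?f = "evr C Y \<cdot> ((run C Y \<cdot> (ide C Y \<boxtimes> evr C X) \<cdot> assoc C Y X (rd C X)) \<boxtimes> ide C (rd C Y)) \<cdot>
      inv_arr C (assoc C (Y \<otimes> X) (rd C X) (rd C Y))"
  let ?K = "(pack Y X \<lhd> [?D]) \<bullet> (Y \<rhd> X \<rhd> pack (rd C X) (rd C Y) \<lhd> [])"
  have h: "?f \<in> hom C ((Y \<otimes> X) \<otimes> ?D) \<one>" using X Y by (simp add: in_hom)
  have "(pack0 \<lhd> []) \<bullet> (ev_of (Y \<otimes> X) ?D ?f \<lhd> []) \<bullet> ?K = (J ?f \<lhd> []) \<bullet> (pack (Y \<otimes> X) ?D \<lhd> []) \<bullet> ?K"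
    using ev_of_tail[OF h, of "[]", THEN whisk_cong(1), of ?K] X Y by simp
  also have "\<dots> = (pack0 \<lhd> []) \<bullet> (sevr Y \<lhd> []) \<bullet> (Y \<rhd> sevr X \<lhd> [rd C Y])"
    using X Y by (simp add: push dual_push J_inv_assoc_tens_tail)
  finally have "(ev_of (Y \<otimes> X) ?D ?f \<lhd> []) \<bullet> ?K = (sevr Y \<lhd> []) \<bullet> (Y \<rhd> sevr X \<lhd> [rd C Y])"
    by (rule pack0_cancel_left[rotated -1]) (use X Y h in simp_all)
  then show "gammar C X Y \<in> hom C (rd C X \<otimes> rd C Y) (rd C (Y \<otimes> X))"
    "sevr (Y \<otimes> X) \<bullet> (Y \<otimes> X \<rhd> J (gammar C X Y)) \<bullet> (pack Y X \<lhd> [?D]) \<bullet> (Y \<rhd> X \<rhd> pack (rd C X) (rd C Y))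
      = sevr Y \<bullet> (Y \<rhd> sevr X \<lhd> [rd C Y])"
    using transr(1)[OF h] transr(2)[OF h, of "[]", THEN whisk_cong(1), of "?K"]
      transr(1)[OF h, unfolded in_hom] X Y h
    by (simp_all add: gammar_def rwhisk_Nil)
qed

lemma unitl:
  shows "unitl C \<in> hom C \<one> (ld C \<one>)" "sevl \<one> \<bullet> (J (unitl C) \<lhd> [\<one>]) = ev_of \<one> \<one> (lun C \<one>)"
    "ev_of \<one> \<one> (lun C \<one>) \<bullet> (pack0 \<lhd> [\<one>]) = unpack0"
    "sevl \<one> \<bullet> (J (unitl C) \<lhd> [\<one>]) \<bullet> (pack0 \<lhd> [\<one>]) = unpack0"
proof -
  have h: "lun C \<one> \<in> hom C (\<one> \<otimes> \<one>) \<one>" by (simp add: in_hom)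
  show "unitl C \<in> hom C \<one> (ld C \<one>)" and e: "sevl \<one> \<bullet> (J (unitl C) \<lhd> [\<one>]) = ev_of \<one> \<one> (lun C \<one>)"
    using transl(1)[OF h] transl(2)[OF h, of "[]"] h by (simp_all add: unitl_def rwhisk_Nil in_hom)
  show u: "ev_of \<one> \<one> (lun C \<one>) \<bullet> (pack0 \<lhd> [\<one>]) = unpack0"
    by (simp add: ev_of_def J_lun)
  show "sevl \<one> \<bullet> (J (unitl C) \<lhd> [\<one>]) \<bullet> (pack0 \<lhd> [\<one>]) = unpack0"
    using e u by (simp flip: scmp_assoc)
qed

lemma unitr:
  shows "unitr C \<in> hom C \<one> (rd C \<one>)" "sevr \<one> \<bullet> (\<one> \<rhd> J (unitr C)) = ev_of \<one> \<one> (run C \<one>)"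
    "ev_of \<one> \<one> (run C \<one>) \<bullet> (pack0 \<lhd> [\<one>]) = unpack0"
    "sevr \<one> \<bullet> (\<one> \<rhd> J (unitr C)) \<bullet> (pack0 \<lhd> [\<one>]) = unpack0"
proof -
  have h: "run C \<one> \<in> hom C (\<one> \<otimes> \<one>) \<one>" by (simp add: in_hom)
  show "unitr C \<in> hom C \<one> (rd C \<one>)" and e: "sevr \<one> \<bullet> (\<one> \<rhd> J (unitr C)) = ev_of \<one> \<one> (run C \<one>)"
    using transr(1)[OF h] transr(2)[OF h, of "[]"] h by (simp_all add: unitr_def rwhisk_Nil in_hom)
  show u: "ev_of \<one> \<one> (run C \<one>) \<bullet> (pack0 \<lhd> [\<one>]) = unpack0"
    \<comment> \<open>The right unitor needs the new unit behind the old one;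
      \<open>pack0_swap\<close> moves it there.\<close>
    unfolding pack0_swap by (simp add: ev_of_def J_run)
  show "sevr \<one> \<bullet> (\<one> \<rhd> J (unitr C)) \<bullet> (pack0 \<lhd> [\<one>]) = unpack0"
    using e u by (simp flip: scmp_assoc)
qed

lemma central_duals_2: "central_duals C \<delta> 2"
  by unfold_locales (use ldual ld_arr(1) ld_arr(2)[of _ "[]"] gammal unitl(1,4) in
    \<open>auto simp: cap_def cup_def du_def du_arr_def du_gamma_def du_unit_def in_hom sevl_def scoevl_def rwhisk_Nil\<close>)

lemma central_duals_3: "central_duals C \<delta> 3"
  by unfold_locales (use rdual rd_arr(1) rd_arr(2)[of _ "[]"] gammar unitr(1,4) in
    \<open>auto simp: cap_def cup_def du_def du_arr_def du_gamma_def du_unit_def in_hom sevr_def scoevr_def rwhisk_Nil\<close>)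

text \<open>The evaluation of X against its left dual with X in front, available through \<delta>.
  It makes the left dual of X a right dual as well.\<close>

definition pev :: "('o \<Rightarrow> 'm) \<Rightarrow> 'o \<Rightarrow> ('o, 'm) sarrow" where
  "pev \<delta> X = sevl (ld C X) \<bullet> (J (\<delta> X) \<lhd> [ld C X])"

section \<open>Consequences of a pivotal structure\<close>

context
  fixes \<delta> :: "'o \<Rightarrow> 'm"
  assumes piv: "pivotal C \<delta>"
begin

lemma delta_simps [simp]:
  assumes "X \<in> objs C"
  shows "\<delta> X \<in> arrs C" "src C (\<delta> X) = X" "tgt C (\<delta> X) = ld C (ld C X)" "iso C (\<delta> X)"
  using piv assms by (auto simp: pivotal_def in_hom)

lemma pev_simps [simp]:
  assumes "X \<in> objs C"
  shows "sarr (pev \<delta> X)" "sdom (pev \<delta> X) = [X, ld C X]" "scod (pev \<delta> X) = []"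
  using assms by (simp_all add: pev_def)

text \<open>The double dual is left dual to \<open>ld C X\<close>. This duality is transported along
  the inverse of \<delta>, hence the inverse of an inverse in the pairing.\<close>

lemma pev_dual:
  assumes X: "X \<in> objs C"
  obtains c where "sdual (ld C X) X (pev \<delta> X) c"
proof -
  have "sdual (ld C X) X (sevl (ld C X) \<bullet> (J (inv_arr C (inv_arr C (\<delta> X))) \<lhd> [ld C X]))
      ((ld C X \<rhd> J (inv_arr C (\<delta> X))) \<bullet> scoevl (ld C X))"
    by (rule sdual_transport_left[OF ldual]) (use X in \<open>simp_all add: in_hom iso_inv_arr\<close>)
  then show ?thesis
    using that X by (simp add: inv_arr_inv_arr pev_def)
qed

text \<open>Naturality of \<delta> turns \<open>f\<close> into its double dual, which is the mate of
  \<open>ld_arr C f\<close>.\<close>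

lemma pev_natural:
  assumes f: "f \<in> arrs C"
  shows "pev \<delta> (tgt C f) \<bullet> (J f \<lhd> [ld C (tgt C f)]) = pev \<delta> (src C f) \<bullet> (src C f \<rhd> J (ld_arr C f))"
proof -
  let ?X = "src C f" and ?Y = "tgt C f"
  note l = ld_arr(1)[OF f, unfolded in_hom]
  have l': "ld_arr C f \<in> arrs C" using l by blast
  note ll = ld_arr(1)[OF l', unfolded in_hom]
  have nat: "J (\<delta> ?Y) \<bullet> J f = J (ld_arr C (ld_arr C f)) \<bullet> J (\<delta> ?X)"
  proof -
    have "\<delta> ?Y \<cdot> f = ld_arr C (ld_arr C f) \<cdot> \<delta> ?X"
      using piv f unfolding pivotal_def by (metis arr_in_hom)
    then have "J (\<delta> ?Y \<cdot> f) = J (ld_arr C (ld_arr C f) \<cdot> \<delta> ?X)" by simp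
    then show ?thesis using f l ll by (simp add: J_cmp)
  qed
  have "pev \<delta> ?Y \<bullet> (J f \<lhd> [ld C ?Y]) = sevl (ld C ?Y) \<bullet> (J (ld_arr C (ld_arr C f)) \<lhd> [ld C ?Y]) \<bullet> (J (\<delta> ?X) \<lhd> [ld C ?Y])"
    using nat[THEN with_tail, of "[ld C ?Y]"] by (simp add: pev_def)
  also have "\<dots> = sevl (ld C ?X) \<bullet> (ld C (ld C ?X) \<rhd> J (ld_arr C f)) \<bullet> (J (\<delta> ?X) \<lhd> [ld C ?Y])"
    using ld_arr(2)[OF l', of "[]", THEN whisk_cong(1), of "J (\<delta> ?X) \<lhd> [ld C ?Y]"] f l by (simp add: rwhisk_Nil)
  also have "(ld C (ld C ?X) \<rhd> J (ld_arr C f)) \<bullet> (J (\<delta> ?X) \<lhd> [ld C ?Y]) = (J (\<delta> ?X) \<lhd> [ld C ?X]) \<bullet> (?X \<rhd> J (ld_arr C f))"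
    using rex_J[of "\<delta> ?X" "J (ld_arr C f)" "ld C (ld C ?X)" "[ld C ?Y]"] f l by simp
  finally show ?thesis by (simp add: pev_def)
qed

text \<open>Monoidality of \<delta> enters in the form stated in \<open>pivotal\<close>:
  \<open>?g\<close> is moved across the evaluation as its dual, \<delta> at a tensor product splits,
  and the nested evaluations of the double duals remain.\<close>

lemma pev_gammal:
  assumes X: "X \<in> objs C" and Y: "Y \<in> objs C"
  shows "pev \<delta> (X \<otimes> Y) \<bullet> (X \<otimes> Y \<rhd> J (gammal C Y X)) \<bullet> (pack X Y \<lhd> [ld C Y \<otimes> ld C X]) \<bullet> (X \<rhd> Y \<rhd> pack (ld C Y) (ld C X))
    = pev \<delta> X \<bullet> (X \<rhd> pev \<delta> Y \<lhd> [ld C X])"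
proof -
  let ?g = "gammal C Y X" and ?D = "ld C Y \<otimes> ld C X" and ?h = "gammal C (ld C X) (ld C Y)"
  note g = gammal(1)[OF X Y, unfolded in_hom]
  have g': "?g \<in> arrs C" using g by blast
  note lg = ld_arr(1)[OF g', unfolded in_hom]
  note h = gammal(1)[of "ld C Y" "ld C X", unfolded in_hom]
  have XY: "X \<otimes> Y \<in> objs C" using X Y by simp
  have "ld_arr C ?g \<cdot> \<delta> (X \<otimes> Y) = ?h \<cdot> (\<delta> X \<boxtimes> \<delta> Y)"
    using piv X Y unfolding pivotal_def by blast
  then have "J (ld_arr C ?g \<cdot> \<delta> (X \<otimes> Y)) = J (?h \<cdot> (\<delta> X \<boxtimes> \<delta> Y))" by simp
  then have m: "J (ld_arr C ?g) \<bullet> J (\<delta> (X \<otimes> Y)) = J ?h \<bullet> J (\<delta> X \<boxtimes> \<delta> Y)"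
    using X Y g lg h by (simp add: J_cmp)
  let ?K = "(pack X Y \<lhd> [?D]) \<bullet> (X \<rhd> Y \<rhd> pack (ld C Y) (ld C X))"
  have "pev \<delta> (X \<otimes> Y) \<bullet> (X \<otimes> Y \<rhd> J ?g)
    = sevl (ld C (X \<otimes> Y)) \<bullet> ((J (\<delta> (X \<otimes> Y)) \<lhd> [ld C (X \<otimes> Y)]) \<bullet> (X \<otimes> Y \<rhd> J ?g))"
    by (simp add: pev_def)
  also have "(J (\<delta> (X \<otimes> Y)) \<lhd> [ld C (X \<otimes> Y)]) \<bullet> (X \<otimes> Y \<rhd> J ?g) = (ld C (ld C (X \<otimes> Y)) \<rhd> J ?g) \<bullet> (J (\<delta> (X \<otimes> Y)) \<lhd> [?D])"
    using rex_J[of "\<delta> (X \<otimes> Y)" "J ?g" "ld C (ld C (X \<otimes> Y))" "[?D]"] XY X Y g by simp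
  also have "sevl (ld C (X \<otimes> Y)) \<bullet> (ld C (ld C (X \<otimes> Y)) \<rhd> J ?g) \<bullet> (J (\<delta> (X \<otimes> Y)) \<lhd> [?D])
    = sevl ?D \<bullet> ((J (ld_arr C ?g) \<bullet> J (\<delta> (X \<otimes> Y))) \<lhd> [?D])"
    using ld_arr(2)[OF g', of "[]", THEN whisk_cong(1), of "J (\<delta> (X \<otimes> Y)) \<lhd> [?D]"] g X Y by (simp add: rwhisk_Nil)
  also have "\<dots> = sevl ?D \<bullet> (J ?h \<lhd> [?D]) \<bullet> (J (\<delta> X \<boxtimes> \<delta> Y) \<lhd> [?D])"
    unfolding m by simp
  finally have "pev \<delta> (X \<otimes> Y) \<bullet> (X \<otimes> Y \<rhd> J ?g) \<bullet> ?K = sevl ?D \<bullet> (J ?h \<lhd> [?D]) \<bullet> (J (\<delta> X \<boxtimes> \<delta> Y) \<lhd> [?D]) \<bullet> ?K"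
    by (metis scmp_assoc)
  also have "\<dots> = (sevl ?D \<bullet> (J ?h \<lhd> [?D]) \<bullet> (pack (ld C (ld C X)) (ld C (ld C Y)) \<lhd> [?D]) \<bullet> (ld C (ld C X) \<rhd> ld C (ld C Y) \<rhd> pack (ld C Y) (ld C X))) \<bullet>
      (J (\<delta> X) \<lhd> [ld C (ld C Y), ld C Y, ld C X]) \<bullet> (X \<rhd> J (\<delta> Y) \<lhd> [ld C Y, ld C X])"
    using X Y by (simp add: push rex)
  also have "\<dots> = sevl (ld C X) \<bullet> ((ld C (ld C X) \<rhd> sevl (ld C Y) \<lhd> [ld C X]) \<bullet> (J (\<delta> X) \<lhd> [ld C (ld C Y), ld C Y, ld C X])) \<bullet>
       (X \<rhd> J (\<delta> Y) \<lhd> [ld C Y, ld C X])"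
    using gammal(2)[of "ld C Y" "ld C X"] X Y by simp
  also have "(ld C (ld C X) \<rhd> sevl (ld C Y) \<lhd> [ld C X]) \<bullet> (J (\<delta> X) \<lhd> [ld C (ld C Y), ld C Y, ld C X])
    = (J (\<delta> X) \<lhd> [ld C X]) \<bullet> (X \<rhd> sevl (ld C Y) \<lhd> [ld C X])"
    using rex_J[of "\<delta> X" "sevl (ld C Y) \<lhd> [ld C X]" "ld C (ld C X)" "[ld C (ld C Y), ld C Y, ld C X]"] X Y by simp
  finally show ?thesis by (simp add: pev_def)
qed

lemma pev_unitl: "pev \<delta> \<one> \<bullet> (\<one> \<rhd> J (unitl C)) = ev_of \<one> \<one> (lun C \<one>)"
proof -
  note u = unitl(1)[unfolded in_hom]
  have u': "unitl C \<in> arrs C" using u by blast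
  note lu = ld_arr(1)[OF u', unfolded in_hom]
  have "J (ld_arr C (unitl C) \<cdot> \<delta> \<one>) = J (unitl C)"
    using piv unfolding pivotal_def by simp
  then have m: "J (ld_arr C (unitl C)) \<bullet> J (\<delta> \<one>) = J (unitl C)"
    using u lu by (simp add: J_cmp)
  have "pev \<delta> \<one> \<bullet> (\<one> \<rhd> J (unitl C)) = sevl (ld C \<one>) \<bullet> ((J (\<delta> \<one>) \<lhd> [ld C \<one>]) \<bullet> (\<one> \<rhd> J (unitl C)))"
    by (simp add: pev_def)
  also have "(J (\<delta> \<one>) \<lhd> [ld C \<one>]) \<bullet> (\<one> \<rhd> J (unitl C)) = (ld C (ld C \<one>) \<rhd> J (unitl C)) \<bullet> (J (\<delta> \<one>) \<lhd> [\<one>])"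
    using rex_J[of "\<delta> \<one>" "J (unitl C)" "ld C (ld C \<one>)" "[\<one>]"] u by simp
  also have "sevl (ld C \<one>) \<bullet> (ld C (ld C \<one>) \<rhd> J (unitl C)) \<bullet> (J (\<delta> \<one>) \<lhd> [\<one>])
      = sevl \<one> \<bullet> ((J (ld_arr C (unitl C)) \<bullet> J (\<delta> \<one>)) \<lhd> [\<one>])"
    using ld_arr(2)[OF u', of "[]", THEN whisk_cong(1), of "J (\<delta> \<one>) \<lhd> [\<one>]"] u by (simp add: rwhisk_Nil)
  finally show ?thesis
    unfolding m using unitl(2) by simp
qed

text \<open>The left dual with \<open>pev\<close> and the right dual with \<open>evr\<close> both
  have X as left dual, and \<open>piv_p\<close> is the arrow that matches these pairings; hence it
  is invertible.\<close>

lemma piv_p: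
  assumes X: "X \<in> objs C"
  shows "piv_p C \<delta> X \<in> hom C (ld C X) (rd C X)" "sevr X \<bullet> (X \<rhd> J (piv_p C \<delta> X)) = pev \<delta> X" "iso C (piv_p C \<delta> X)"
proof -
  show h: "piv_p C \<delta> X \<in> hom C (ld C X) (rd C X)"
    using X by (simp add: piv_p_def in_hom)
  have "J (piv_p C \<delta> X) \<lhd> [] = (rd C X \<rhd> sevl (ld C X) \<lhd> []) \<bullet> (rd C X \<rhd> J (\<delta> X) \<lhd> [ld C X]) \<bullet> (scoevr X \<lhd> [ld C X])"
    using X by (simp add: piv_p_def push dual_push)
  then have "J (piv_p C \<delta> X) = (rd C X \<rhd> pev \<delta> X) \<bullet> (scoevr X \<lhd> [ld C X])"
    using X h by (simp add: pev_def rwhisk_Nil in_hom)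
  then show e: "sevr X \<bullet> (X \<rhd> J (piv_p C \<delta> X)) = pev \<delta> X"
    using bend_left[OF rdual[OF X], of "pev \<delta> X" "[ld C X]" "[]"] X by (simp add: rwhisk_Nil)
  obtain c where "sdual (ld C X) X (pev \<delta> X) c"
    using pev_dual[OF X] .
  from sdual_compare_iso[OF this rdual[OF X] h e] show "iso C (piv_p C \<delta> X)" .
qed

lemma piv_p_simps [simp]:
  assumes "X \<in> objs C"
  shows "piv_p C \<delta> X \<in> arrs C" "src C (piv_p C \<delta> X) = ld C X" "tgt C (piv_p C \<delta> X) = rd C X" "iso C (piv_p C \<delta> X)"
  using piv_p[OF assms] by (auto simp: in_hom)

lemma sevr_inject:
  assumes X: "X \<in> objs C" and A: "A \<in> hom C Z (rd C X)" and B: "B \<in> hom C Z (rd C X)"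
    and eq: "sevr X \<bullet> (X \<rhd> J A) = sevr X \<bullet> (X \<rhd> J B)"
  shows "A = B"
proof (rule J_inject[OF A B])
  show "J A = J B"
    by (rule bend_left_inject[OF rdual[OF X], where ws = "[]"])
      (use X A B eq in \<open>auto simp: in_hom rwhisk_Nil\<close>)
qed

text \<open>Composing the right evaluation with \<open>piv_p\<close> gives \<open>pev\<close>, so
  testing against that evaluation reduces the claim to \<open>pev_natural\<close>. Compatibility
  with tensor products and with the unit follows from \<open>pev_gammal\<close> and
  \<open>pev_unitl\<close> in the same way.\<close>

lemma piv_p_natural:
  assumes f: "f \<in> arrs C"
  shows "rd_arr C f \<cdot> piv_p C \<delta> (tgt C f) = piv_p C \<delta> (src C f) \<cdot> ld_arr C f"
proof (rule sevr_inject[of "src C f"])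
  let ?X = "src C f" and ?Y = "tgt C f"
  note l = ld_arr(1)[OF f, unfolded in_hom] and r = rd_arr(1)[OF f, unfolded in_hom]
  have "sevr ?X \<bullet> (?X \<rhd> J (rd_arr C f \<cdot> piv_p C \<delta> ?Y)) = (sevr ?Y \<bullet> (J f \<lhd> [rd C ?Y])) \<bullet> (?X \<rhd> J (piv_p C \<delta> ?Y))"
    using rd_arr(2)[OF f, of "[]"] f l r by (simp add: J_cmp rwhisk_Nil)
  also have "\<dots> = sevr ?Y \<bullet> (J f \<lhd> [rd C ?Y]) \<bullet> (?X \<rhd> J (piv_p C \<delta> ?Y))" by simp
  also have "(J f \<lhd> [rd C ?Y]) \<bullet> (?X \<rhd> J (piv_p C \<delta> ?Y)) = (?Y \<rhd> J (piv_p C \<delta> ?Y)) \<bullet> (J f \<lhd> [ld C ?Y])"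
    using rex_J[OF f, of "J (piv_p C \<delta> ?Y)" ?Y "[ld C ?Y]"] f by simp
  also have "sevr ?Y \<bullet> (?Y \<rhd> J (piv_p C \<delta> ?Y)) \<bullet> (J f \<lhd> [ld C ?Y]) = pev \<delta> ?Y \<bullet> (J f \<lhd> [ld C ?Y])"
    using piv_p(2)[of ?Y, THEN whisk_cong(1), of "J f \<lhd> [ld C ?Y]"] f by simp
  also have "\<dots> = sevr ?X \<bullet> (?X \<rhd> J (piv_p C \<delta> ?X \<cdot> ld_arr C f))"
    using pev_natural[OF f] piv_p(2)[of ?X, THEN whisk_cong(1), of "?X \<rhd> J (ld_arr C f)"] f l by (simp add: J_cmp)
  finally show "sevr ?X \<bullet> (?X \<rhd> J (rd_arr C f \<cdot> piv_p C \<delta> ?Y)) = sevr ?X \<bullet> (?X \<rhd> J (piv_p C \<delta> ?X \<cdot> ld_arr C f))" .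
qed (use f ld_arr(1)[OF f] rd_arr(1)[OF f] in \<open>auto simp: in_hom\<close>)

lemma piv_p_gamma:
  assumes X: "X \<in> objs C" and Y: "Y \<in> objs C"
  shows "piv_p C \<delta> (X \<otimes> Y) \<cdot> gammal C Y X = gammar C Y X \<cdot> (piv_p C \<delta> Y \<boxtimes> piv_p C \<delta> X)"
    (is "?a = ?b")
proof (rule sevr_inject[of "X \<otimes> Y"])
  let ?D = "ld C Y \<otimes> ld C X" and ?XY = "X \<otimes> Y"
  note l = gammal(1)[OF X Y, unfolded in_hom] and r = gammar(1)[OF Y X, unfolded in_hom]
  let ?K = "(pack X Y \<lhd> [?D]) \<bullet> (X \<rhd> Y \<rhd> pack (ld C Y) (ld C X))"
  let ?K' = "(X \<rhd> Y \<rhd> unpack (ld C Y) (ld C X)) \<bullet> (unpack X Y \<lhd> [?D])"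
  have t: "(X \<rhd> Y \<rhd> J (piv_p C \<delta> Y \<boxtimes> piv_p C \<delta> X)) \<bullet> (X \<rhd> Y \<rhd> pack (ld C Y) (ld C X))
    = (X \<rhd> Y \<rhd> pack (rd C Y) (rd C X)) \<bullet> (X \<rhd> Y \<rhd> J (piv_p C \<delta> Y) \<lhd> [rd C X]) \<bullet> (X \<rhd> Y \<rhd> ld C Y \<rhd> J (piv_p C \<delta> X))"
    using J_tensa[of "piv_p C \<delta> Y" "piv_p C \<delta> X" "ld C Y" "ld C X", THEN arg_cong, of "\<lambda>A. X \<rhd> Y \<rhd> A"] X Y by simp
  have KK: "?K \<bullet> ?K' = sid [?XY, ?D]"
    using X Y unpack_pack(2)[of "ld C Y" "ld C X", THEN whisk_cong(5), unfolded whisk_nf] by simp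
  have "(sevr ?XY \<bullet> (?XY \<rhd> J ?a)) \<bullet> ?K = (pev \<delta> ?XY \<bullet> (?XY \<rhd> J (gammal C Y X))) \<bullet> ?K"
    using piv_p(2)[of ?XY, THEN whisk_cong(1), of "(?XY \<rhd> J (gammal C Y X)) \<bullet> ?K"] X Y l by (simp add: J_cmp)
  also have "\<dots> = pev \<delta> X \<bullet> (X \<rhd> pev \<delta> Y \<lhd> [ld C X])"
    using pev_gammal[OF X Y] by simp
  also have "\<dots> = sevr X \<bullet> ((X \<rhd> J (piv_p C \<delta> X)) \<bullet> (X \<rhd> sevr Y \<lhd> [ld C X])) \<bullet> (X \<rhd> Y \<rhd> J (piv_p C \<delta> Y) \<lhd> [ld C X])"
    unfolding piv_p(2)[OF X, symmetric] piv_p(2)[OF Y, symmetric] by simp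
  also have "(X \<rhd> J (piv_p C \<delta> X)) \<bullet> (X \<rhd> sevr Y \<lhd> [ld C X]) = X \<rhd> (J (piv_p C \<delta> X) \<bullet> (sevr Y \<lhd> [ld C X]))"
    by simp
  also have "J (piv_p C \<delta> X) \<bullet> (sevr Y \<lhd> [ld C X]) = (sevr Y \<lhd> [rd C X]) \<bullet> (Y \<rhd> rd C Y \<rhd> J (piv_p C \<delta> X))"
    using exchange_atom(7)[of "sevr Y" "J (piv_p C \<delta> X)" "[rd C X]" Y "rd C Y"] X Y by simp
  also have "sevr X \<bullet> (X \<rhd> ((sevr Y \<lhd> [rd C X]) \<bullet> (Y \<rhd> rd C Y \<rhd> J (piv_p C \<delta> X)))) \<bullet> (X \<rhd> Y \<rhd> J (piv_p C \<delta> Y) \<lhd> [ld C X])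
      = (sevr X \<bullet> (X \<rhd> sevr Y \<lhd> [rd C X])) \<bullet> (X \<rhd> Y \<rhd> rd C Y \<rhd> J (piv_p C \<delta> X)) \<bullet> (X \<rhd> Y \<rhd> J (piv_p C \<delta> Y) \<lhd> [ld C X])"
    by simp
  also have "\<dots> = (sevr ?XY \<bullet> (?XY \<rhd> J ?b)) \<bullet> ?K"
    unfolding gammar(2)[OF Y X, symmetric] using t X Y r by (simp add: push rex rwhisk_Nil J_cmp)
  finally show "sevr ?XY \<bullet> (?XY \<rhd> J ?a) = sevr ?XY \<bullet> (?XY \<rhd> J ?b)"
    by (rule split_cancel[where K' = ?K', rotated -1]) (use X Y l r KK in simp_all)
qed (use X Y gammal(1)[OF X Y] gammar(1)[OF Y X] in \<open>auto simp: in_hom\<close>)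

lemma piv_p_unit: "piv_p C \<delta> \<one> \<cdot> unitl C = unitr C"
proof (rule sevr_inject[of \<one>])
  note l = unitl(1)[unfolded in_hom] and r = unitr(1)[unfolded in_hom]
  have "sevr \<one> \<bullet> (\<one> \<rhd> J (piv_p C \<delta> \<one> \<cdot> unitl C)) = ev_of \<one> \<one> (lun C \<one>)"
    using piv_p(2)[OF uno_obj, THEN whisk_cong(1), of "\<one> \<rhd> J (unitl C)"] pev_unitl l by (simp add: J_cmp)
  \<comment> \<open>Both unitors give \<open>unpack0\<close> after a unit has been inserted, so they
    induce the same pairing of \<one> with itself.\<close>
  also have "\<dots> = ev_of \<one> \<one> (run C \<one>)"
    by (rule pack0_cancel[where zs = "[\<one>]"]) (use unitl(3) unitr(3) in \<open>simp_all add: in_hom\<close>)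
  finally show "sevr \<one> \<bullet> (\<one> \<rhd> J (piv_p C \<delta> \<one> \<cdot> unitl C)) = sevr \<one> \<bullet> (\<one> \<rhd> J (unitr C))"
    using unitr(2) by simp
qed (use unitl(1) unitr(1) in \<open>auto simp: in_hom\<close>)

abbreviation piv_q :: "'o \<Rightarrow> 'm" where "piv_q X \<equiv> inv_arr C (piv_p C \<delta> X)"

lemma piv_q_natural:
  assumes f: "f \<in> arrs C"
  shows "ld_arr C f \<cdot> piv_q (tgt C f) = piv_q (src C f) \<cdot> rd_arr C f"
proof -
  note l = ld_arr(1)[OF f, unfolded in_hom] and r = rd_arr(1)[OF f, unfolded in_hom]
  have "piv_q (src C f) \<cdot> rd_arr C f = piv_q (src C f) \<cdot> (rd_arr C f \<cdot> piv_p C \<delta> (tgt C f)) \<cdot> piv_q (tgt C f)"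
    using f l r by simp
  also have "\<dots> = ld_arr C f \<cdot> piv_q (tgt C f)"
    unfolding piv_p_natural[OF f] using f l r by simp
  finally show ?thesis by simp
qed

lemma piv_q_gamma:
  assumes X: "X \<in> objs C" and Y: "Y \<in> objs C"
  shows "piv_q (X \<otimes> Y) \<cdot> gammar C Y X = gammal C Y X \<cdot> (piv_q Y \<boxtimes> piv_q X)"
proof -
  note l = gammal(1)[OF X Y, unfolded in_hom] and r = gammar(1)[OF Y X, unfolded in_hom]
  have "gammal C Y X \<cdot> (piv_q Y \<boxtimes> piv_q X)
    = piv_q (X \<otimes> Y) \<cdot> (piv_p C \<delta> (X \<otimes> Y) \<cdot> gammal C Y X) \<cdot> (piv_q Y \<boxtimes> piv_q X)"
    using X Y l by simp
  also have "\<dots> = piv_q (X \<otimes> Y) \<cdot> gammar C Y X"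
    unfolding piv_p_gamma[OF X Y] using X Y r by (simp add: tensa_cmp)
  finally show ?thesis by simp
qed

lemma piv_q_unit: "piv_q \<one> \<cdot> unitr C = unitl C"
  unfolding piv_p_unit[symmetric] using unitl(1) by (simp add: in_hom)

lemma cap1: "X \<in> objs C \<Longrightarrow> ev_of (rd C X) X (evl C X \<cdot> (piv_q X \<boxtimes> ide C X)) = sevl X \<bullet> (J (piv_q X) \<lhd> [X])"
  using J_tensa[of "piv_q X" "ide C X"] by (simp add: ev_of_def sevl_def J_cmp)

lemma cup1: "X \<in> objs C \<Longrightarrow> coev_of X (rd C X) ((ide C X \<boxtimes> piv_p C \<delta> X) \<cdot> coevl C X) = (X \<rhd> J (piv_p C \<delta> X)) \<bullet> scoevl X"
  using J_tensa[of "ide C X" "piv_p C \<delta> X" X "ld C X", THEN whisk_cong(1), of "scoevl X"] dual_push0(2)[of X "[]"]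
  by (simp add: coev_of_def J_cmp rwhisk_Nil unpack_pack(1)[THEN whisk_cong(1), unfolded whisk_nf])

lemma cap4: "X \<in> objs C \<Longrightarrow> ev_of X (ld C X) (evr C X \<cdot> (ide C X \<boxtimes> piv_p C \<delta> X)) = pev \<delta> X"
  using J_tensa[of "ide C X" "piv_p C \<delta> X"] piv_p(2)[of X, symmetric] by (simp add: ev_of_def sevr_def J_cmp)

lemma cup4: "X \<in> objs C \<Longrightarrow> coev_of (ld C X) X ((piv_q X \<boxtimes> ide C X) \<cdot> coevr C X) = (J (piv_q X) \<lhd> [X]) \<bullet> scoevr X"
  using J_tensa[of "piv_q X" "ide C X" "rd C X" X, THEN whisk_cong(1), of "scoevr X"] dual_push0(4)[of X "[]"]
  by (simp add: coev_of_def J_cmp rwhisk_Nil unpack_pack(1)[THEN whisk_cong(1), unfolded whisk_nf])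

text \<open>The duality data of A_1 are those of A_2 transported along \<open>piv_p\<close>: the
  pairing is \<open>sevl\<close> after the inverse of \<open>piv_p\<close>, and naturality and
  monoidality of that inverse exchange the arrows for right duals with those for left duals.\<close>

lemma central_duals_1: "central_duals C \<delta> 1"
proof -
  have dual: "sdual X (rd C X) (sevl X \<bullet> (J (piv_q X) \<lhd> [X])) ((X \<rhd> J (piv_p C \<delta> X)) \<bullet> scoevl X)" if X: "X \<in> objs C" for X
    by (rule sdual_transport_left[OF ldual[OF X]]) (use X in \<open>simp_all add: in_hom\<close>)
  have mate: "sevl (tgt C f) \<bullet> (J (piv_q (tgt C f)) \<lhd> [tgt C f]) \<bullet> (rd C (tgt C f) \<rhd> J f)
    = sevl (src C f) \<bullet> (J (piv_q (src C f)) \<lhd> [src C f]) \<bullet> (J (rd_arr C f) \<lhd> [src C f])" if f: "f \<in> arrs C" for f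
  proof -
    let ?X = "src C f" and ?Y = "tgt C f"
    note l = ld_arr(1)[OF f, unfolded in_hom] and r = rd_arr(1)[OF f, unfolded in_hom]
    have "sevl ?Y \<bullet> (J (piv_q ?Y) \<lhd> [?Y]) \<bullet> (rd C ?Y \<rhd> J f) = (sevl ?Y \<bullet> (ld C ?Y \<rhd> J f)) \<bullet> (J (piv_q ?Y) \<lhd> [?X])"
      using rex_J[of "piv_q ?Y" "J f" "ld C ?Y" "[?X]"] f by simp
    also have "\<dots> = sevl ?X \<bullet> (J (ld_arr C f \<cdot> piv_q ?Y) \<lhd> [?X])"
      using ld_arr(2)[OF f, of "[]"] f l by (simp add: rwhisk_Nil J_cmp)
    also have "\<dots> = sevl ?X \<bullet> (J (piv_q ?X) \<lhd> [?X]) \<bullet> (J (rd_arr C f) \<lhd> [?X])"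
      unfolding piv_q_natural[OF f] using f r by (simp add: J_cmp)
    finally show ?thesis .
  qed
  have gamma: "sevl (X \<otimes> Y) \<bullet> (J (piv_q (X \<otimes> Y)) \<lhd> [X \<otimes> Y]) \<bullet> (J (gammar C Y X) \<lhd> [X \<otimes> Y]) \<bullet>
      (pack (rd C Y) (rd C X) \<lhd> [X \<otimes> Y]) \<bullet> (rd C Y \<rhd> rd C X \<rhd> pack X Y)
    = sevl Y \<bullet> (J (piv_q Y) \<lhd> [Y]) \<bullet> (rd C Y \<rhd> sevl X \<lhd> [Y]) \<bullet> (rd C Y \<rhd> J (piv_q X) \<lhd> [X, Y])"
    if X: "X \<in> objs C" and Y: "Y \<in> objs C" for X Y
  proof -
    let ?XY = "X \<otimes> Y"
    note l = gammal(1)[OF X Y, unfolded in_hom] and r = gammar(1)[OF Y X, unfolded in_hom]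
    have "sevl ?XY \<bullet> (J (piv_q ?XY) \<lhd> [?XY]) \<bullet> (J (gammar C Y X) \<lhd> [?XY]) \<bullet> (pack (rd C Y) (rd C X) \<lhd> [?XY]) \<bullet> (rd C Y \<rhd> rd C X \<rhd> pack X Y)
      = sevl ?XY \<bullet> (J (piv_q ?XY \<cdot> gammar C Y X) \<lhd> [?XY]) \<bullet> (pack (rd C Y) (rd C X) \<lhd> [?XY]) \<bullet> (rd C Y \<rhd> rd C X \<rhd> pack X Y)"
      using X Y r by (simp add: J_cmp)
    also have "\<dots> = (sevl ?XY \<bullet> (J (gammal C Y X) \<lhd> [?XY]) \<bullet> (pack (ld C Y) (ld C X) \<lhd> [?XY]) \<bullet> (ld C Y \<rhd> ld C X \<rhd> pack X Y)) \<bullet>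
        (J (piv_q Y) \<lhd> [ld C X, X, Y]) \<bullet> (rd C Y \<rhd> J (piv_q X) \<lhd> [X, Y])"
      unfolding piv_q_gamma[OF X Y] using X Y l by (simp add: J_cmp push rex)
    also have "\<dots> = sevl Y \<bullet> ((ld C Y \<rhd> sevl X \<lhd> [Y]) \<bullet> (J (piv_q Y) \<lhd> [ld C X, X, Y])) \<bullet> (rd C Y \<rhd> J (piv_q X) \<lhd> [X, Y])"
      unfolding gammal(2)[OF X Y] by simp
    also have "(ld C Y \<rhd> sevl X \<lhd> [Y]) \<bullet> (J (piv_q Y) \<lhd> [ld C X, X, Y]) = (J (piv_q Y) \<lhd> [Y]) \<bullet> (rd C Y \<rhd> sevl X \<lhd> [Y])"
      using rex_J[of "piv_q Y" "sevl X \<lhd> [Y]" "ld C Y" "[ld C X, X, Y]"] X Y by simp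
    finally show ?thesis by simp
  qed
  have unit: "sevl \<one> \<bullet> (J (piv_q \<one>) \<lhd> [\<one>]) \<bullet> (J (unitr C) \<lhd> [\<one>]) \<bullet> (pack0 \<lhd> [\<one>]) = unpack0"
    using unitl(4) unitr(1) unfolding piv_q_unit[symmetric] by (simp add: in_hom J_cmp)
  show ?thesis
    by unfold_locales (use dual mate gamma unit rd_arr(1) gammar(1) unitr(1) in
        \<open>auto simp: cap_def cup_def du_def du_arr_def du_gamma_def du_unit_def in_hom cap1 cup1\<close>)
qed

text \<open>Here the pairing is \<open>pev\<close>, so the mate conditions are the lemmas about
  \<open>pev\<close>; the duality is that of the right dual, transported along the inverse of
  \<open>piv_p\<close>.\<close>

lemma central_duals_4: "central_duals C \<delta> 4"
proof -
  have dual: "sdual (ld C X) X (pev \<delta> X) ((J (piv_q X) \<lhd> [X]) \<bullet> scoevr X)" if X: "X \<in> objs C" for X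
  proof -
    have "sdual (ld C X) X (sevr X \<bullet> (X \<rhd> J (inv_arr C (piv_q X)))) ((J (piv_q X) \<lhd> [X]) \<bullet> scoevr X)"
      by (rule sdual_transport_right[OF rdual[OF X]]) (use X in \<open>simp_all add: in_hom iso_inv_arr\<close>)
    then show ?thesis
      using X by (simp add: inv_arr_inv_arr piv_p(2))
  qed
  have unit: "pev \<delta> \<one> \<bullet> (\<one> \<rhd> J (unitl C)) \<bullet> (pack0 \<lhd> [\<one>]) = unpack0"
    using pev_unitl unitl(3) by (simp flip: scmp_assoc)
  show ?thesis
    by unfold_locales (use dual unit pev_natural pev_gammal ld_arr(1) gammal(1) unitl(1) in
        \<open>auto simp: cap_def cup_def du_def du_arr_def du_gamma_def du_unit_def in_hom cap4 cup4\<close>)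
qed

end

end

section \<open>The comparison isomorphisms\<close>

context central_coend
begin

text \<open>Naturality of \<open>d\<close> along \<open>g\<close> and interchange with
  \<open>h\<close> collect everything outside \<open>d\<close> in the pairing, so only the resulting
  pairing \<open>e\<close> matters.\<close>

lemma jj_factor:
  assumes V: "V \<in> objs C" and X: "X \<in> objs C" and h: "h \<in> arrs C" "tgt C h = QQ X"
    and g: "g \<in> arrs C" "tgt C g = PP X"
    and e: "ee X \<bullet> (J h \<lhd> [PP X]) \<bullet> (src C h \<rhd> J g) = e"
  shows "(jj V X \<lhd> []) \<bullet> (J h \<lhd> [V, PP X]) \<bullet> (src C h \<rhd> V \<rhd> J g \<lhd> [])
    = (e \<lhd> [A V]) \<bullet> (src C h \<rhd> d V (src C g) \<lhd> [])"
proof -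
  let ?Q = "src C h"
  have "(jj V X \<lhd> []) \<bullet> (J h \<lhd> [V, PP X]) \<bullet> (?Q \<rhd> V \<rhd> J g \<lhd> [])
    = (ee X \<lhd> [A V]) \<bullet> ((QQ X \<rhd> d V (PP X)) \<bullet> (J h \<lhd> [V, PP X])) \<bullet> (?Q \<rhd> V \<rhd> J g)"
    using V X g h by (simp add: jj_d rwhisk_Nil)
  also have "(QQ X \<rhd> d V (PP X)) \<bullet> (J h \<lhd> [V, PP X]) = (J h \<lhd> [PP X, A V]) \<bullet> (?Q \<rhd> d V (PP X))"
    using rex_J[of h "d V (PP X)" "QQ X" "[V, PP X]"] V X h by simp
  also have "(ee X \<lhd> [A V]) \<bullet> ((J h \<lhd> [PP X, A V]) \<bullet> (?Q \<rhd> d V (PP X))) \<bullet> (?Q \<rhd> V \<rhd> J g)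
    = (ee X \<lhd> [A V]) \<bullet> (J h \<lhd> [PP X, A V]) \<bullet> (?Q \<rhd> (d V (tgt C g) \<bullet> (V \<rhd> J g)))"
    using g by simp
  also have "\<dots> = (e \<lhd> [A V]) \<bullet> (?Q \<rhd> d V (src C g) \<lhd> [])"
    unfolding d_nat[OF V g(1), symmetric] e[symmetric] using V X g h by (simp add: rwhisk_Nil)
  finally show ?thesis .
qed

end

locale central_comparison =
  S?: central_coend C \<delta> i A \<iota> + T: central_coend C \<delta> j A' \<iota>'
  for C :: "('o, 'm, 'x) rigidcat_scheme" (structure) and \<delta> i A \<iota> j A' \<iota>'
begin

text \<open>In the applications, \<open>h\<close> and \<open>g\<close> make up the canonical
  isomorphism from a component of one coend to the component at \<open>X' X\<close> of the other.
  Condition \<open>e\<close>, that they match the two pairings, is what makes the induced arrow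
  carry one universal family to the other.\<close>

lemma desc_compare:
  assumes V: "V \<in> objs C" and X': "\<And>X. X \<in> objs C \<Longrightarrow> X' X \<in> objs C"
    and h: "\<And>X. X \<in> objs C \<Longrightarrow> h X \<in> hom C (QQ X) (T.QQ (X' X))"
    and g: "\<And>X. X \<in> objs C \<Longrightarrow> g X \<in> hom C (PP X) (T.PP (X' X))"
    and e: "\<And>X. X \<in> objs C \<Longrightarrow> T.ee (X' X) \<bullet> (J (h X) \<lhd> [T.PP (X' X)]) \<bullet> (QQ X \<rhd> J (g X)) = ee X"
    and \<phi>: "\<And>X. X \<in> objs C \<Longrightarrow> \<phi> X \<in> hom C (summand C i X V X) (A' V)"
      "\<And>X. X \<in> objs C \<Longrightarrow> (J (\<phi> X) \<lhd> []) \<bullet> (pk X V X \<lhd> [])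
        = (T.jj V (X' X) \<lhd> []) \<bullet> (J (h X) \<lhd> [V, T.PP (X' X)]) \<bullet> (QQ X \<rhd> V \<rhd> J (g X) \<lhd> [])"
  shows "desc C A \<iota> V (A' V) \<phi> \<in> hom C (A V) (A' V)"
    "P \<in> objs C \<Longrightarrow> (P \<rhd> J (desc C A \<iota> V (A' V) \<phi>)) \<bullet> d V P = T.d V P"
proof -
  have "(J (\<phi> X) \<lhd> []) \<bullet> (pk X V X \<lhd> []) = (ee X \<lhd> [A' V]) \<bullet> (QQ X \<rhd> T.d V (PP X) \<lhd> [])" if X: "X \<in> objs C" for X
    using \<phi>(2)[OF X] T.jj_factor[OF V X'[OF X], of "h X" "g X" "ee X"] h[OF X] g[OF X] e[OF X] by (simp add: in_hom)
  then show "desc C A \<iota> V (A' V) \<phi> \<in> hom C (A V) (A' V)"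
    "P \<in> objs C \<Longrightarrow> (P \<rhd> J (desc C A \<iota> V (A' V) \<phi>)) \<bullet> d V P = T.d V P"
    using desc_eq[OF V T.E_obj[OF V], of "T.d V" \<phi>] T.d_nat[OF V] \<phi>(1) V by auto
qed

end

context rigid_category
begin

text \<open>The universal family \<open>d\<close> of the coend with number \<open>i\<close>, named
  outside its locale so that the families for several indices can occur in one equation.\<close>

definition half_braid :: "('o \<Rightarrow> 'm) \<Rightarrow> (nat \<Rightarrow> 'o \<Rightarrow> 'o) \<Rightarrow> (nat \<Rightarrow> 'o \<Rightarrow> 'o \<Rightarrow> 'm) \<Rightarrow> nat \<Rightarrow> 'o \<Rightarrow> 'o \<Rightarrow> ('o, 'm) sarrow" where
  "half_braid \<delta> A \<iota> i = dual_coend.d C (A i) (central_duals.PP C i) (central_duals.cc C \<delta> i) (central_coend.jj C i (\<iota> i))"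

lemma kappa_step_1:
  assumes piv: "pivotal C \<delta>" and i: "i = 1" and j: "j = 2"
    and c: "coends C i (A i) (\<iota> i)" "coends C j (A j) (\<iota> j)" and V: "V \<in> objs C"
  shows "kappa_step C \<delta> A \<iota> i V \<in> hom C (A i V) (A j V)"
    "P \<in> objs C \<Longrightarrow> (P \<rhd> J (kappa_step C \<delta> A \<iota> i V)) \<bullet> half_braid \<delta> A \<iota> i V P = half_braid \<delta> A \<iota> j V P"
proof -
  interpret central_comparison C \<delta> i "A i" "\<iota> i" j "A j" "\<iota> j"
    using central_duals_1[OF piv] central_duals_2[of \<delta>] c
    by (simp add: central_comparison_def central_coend_def central_coend_axioms_def i j)
  note piv_p_simps[OF piv, simp]
  have i': "i \<le> 2" "du C i X = rd C X" "cap C \<delta> i X = evl C X \<cdot> (piv_q \<delta> X \<boxtimes> ide C X)" for X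
    by (simp_all add: i du_def cap_def)
  have j': "j \<le> 2" "du C j X = ld C X" "cap C \<delta> j X = evl C X" for X
    by (simp_all add: j du_def cap_def)
  have S: "PP X = X" "QQ X = rd C X" "summand C i X V X = rd C X \<otimes> (V \<otimes> X)"
      "pk X V X = pack (rd C X) (V \<otimes> X) \<bullet> (rd C X \<rhd> pack V X)"
      "X \<in> objs C \<Longrightarrow> ee X = sevl X \<bullet> (J (piv_q \<delta> X) \<lhd> [X])" for X
    using cap1[OF piv, of X] by (simp_all add: PP_def QQ_def summand_def pk_def ee_def i')
  have T: "T.PP X = X" "T.QQ X = ld C X" "summand C j X V X = ld C X \<otimes> (V \<otimes> X)" "T.ee X = sevl X"
      "T.jj V X = J (\<iota> j V X) \<bullet> pack (ld C X) (V \<otimes> X) \<bullet> (ld C X \<rhd> pack V X)" for X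
    by (simp_all add: T.PP_def T.QQ_def summand_def T.jj_def T.pk_def T.ee_def sevl_def j')
  let ?\<phi> = "\<lambda>X. \<iota> j V X \<cdot> (piv_q \<delta> X \<boxtimes> ide C (V \<otimes> X))"
  have k: "kappa_step C \<delta> A \<iota> i V = desc C (A i) (\<iota> i) V (A j V) ?\<phi>"
    by (simp add: kappa_step_def i j numeral_2_eq_2)
  note iota = T.iota_simps[OF V, unfolded T(3)]
  show "kappa_step C \<delta> A \<iota> i V \<in> hom C (A i V) (A j V)"
    "P \<in> objs C \<Longrightarrow> (P \<rhd> J (kappa_step C \<delta> A \<iota> i V)) \<bullet> half_braid \<delta> A \<iota> i V P = half_braid \<delta> A \<iota> j V P"
    unfolding k half_braid_def
    \<comment> \<open>The left letter changes from the right dual to the left dual by the inverse of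
      \<open>piv_p\<close>, the very arrow by which the pairing of A_1 differs from that of
      A_2.\<close>
    by (rule desc_compare[where X' = "\<lambda>X. X" and h = "piv_q \<delta>" and g = "ide C"];
      use V in \<open>simp add: S T in_hom iota push rex\<close>)+
qed

text \<open>The index changes to the left dual of X, the left letter stays, and \<open>nu\<close>
  moves the right letter. As the mate of \<open>evl\<close>, \<open>nu\<close> matches the two
  evaluations by construction.\<close>

lemma kappa_step_2:
  assumes i: "i = 2" and j: "j = 3"
    and c: "coends C i (A i) (\<iota> i)" "coends C j (A j) (\<iota> j)" and V: "V \<in> objs C"
  shows "kappa_step C \<delta> A \<iota> i V \<in> hom C (A i V) (A j V)"
    "P \<in> objs C \<Longrightarrow> (P \<rhd> J (kappa_step C \<delta> A \<iota> i V)) \<bullet> half_braid \<delta> A \<iota> i V P = half_braid \<delta> A \<iota> j V P"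
proof -
  interpret central_comparison C \<delta> i "A i" "\<iota> i" j "A j" "\<iota> j"
    using central_duals_2[of \<delta>] central_duals_3[of \<delta>] c
    by (simp add: central_comparison_def central_coend_def central_coend_axioms_def i j)
  have i': "i \<le> 2" "du C i X = ld C X" "cap C \<delta> i X = evl C X" for X
    by (simp_all add: i du_def cap_def)
  have j': "\<not> j \<le> 2" "du C j X = rd C X" "cap C \<delta> j X = evr C X" for X
    by (simp_all add: j du_def cap_def)
  have S: "PP X = X" "QQ X = ld C X" "summand C i X V X = ld C X \<otimes> (V \<otimes> X)" "ee X = sevl X"
      "pk X V X = pack (ld C X) (V \<otimes> X) \<bullet> (ld C X \<rhd> pack V X)" for X
    by (simp_all add: PP_def QQ_def summand_def pk_def ee_def i' sevl_def)
  have T: "T.PP X = rd C X" "T.QQ X = X" "summand C j X V X = (X \<otimes> V) \<otimes> rd C X" "T.ee X = sevr X"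
      "T.jj V X = J (\<iota> j V X) \<bullet> pack (X \<otimes> V) (rd C X) \<bullet> (pack X V \<lhd> [rd C X])" for X
    by (simp_all add: T.PP_def T.QQ_def summand_def T.jj_def T.pk_def T.ee_def sevr_def j')
  have nu: "nu C X \<in> hom C X (rd C (ld C X))" "sevr (ld C X) \<bullet> (ld C X \<rhd> J (nu C X)) = sevl X" if "X \<in> objs C" for X
    using transr(1)[of "evl C X" "ld C X" X] transr(2)[of "evl C X" "ld C X" X "[]"] that
    by (simp_all add: nu_def sevl_def in_hom rwhisk_Nil)
  let ?\<phi> = "\<lambda>X. \<iota> j V (ld C X) \<cdot> (ide C (ld C X \<otimes> V) \<boxtimes> nu C X) \<cdot> inv_arr C (assoc C (ld C X) V X)"
  have k: "kappa_step C \<delta> A \<iota> i V = desc C (A i) (\<iota> i) V (A j V) ?\<phi>"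
    by (simp add: kappa_step_def i j numeral_3_eq_3)
  note iota = T.iota_simps[OF V, unfolded T(3)]
  note nu' = nu(1)[unfolded in_hom]
  show "kappa_step C \<delta> A \<iota> i V \<in> hom C (A i V) (A j V)"
    "P \<in> objs C \<Longrightarrow> (P \<rhd> J (kappa_step C \<delta> A \<iota> i V)) \<bullet> half_braid \<delta> A \<iota> i V P = half_braid \<delta> A \<iota> j V P"
    unfolding k half_braid_def
    by (rule desc_compare[where X' = "ld C" and h = "\<lambda>X. ide C (ld C X)" and g = "nu C"];
      use V nu' nu(2) in \<open>simp add: S T in_hom iota push rex\<close>)+
qed

lemma kappa_step_3:
  assumes piv: "pivotal C \<delta>" and i: "i = 3" and j: "j = 4"
    and c: "coends C i (A i) (\<iota> i)" "coends C j (A j) (\<iota> j)" and V: "V \<in> objs C"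
  shows "kappa_step C \<delta> A \<iota> i V \<in> hom C (A i V) (A j V)"
    "P \<in> objs C \<Longrightarrow> (P \<rhd> J (kappa_step C \<delta> A \<iota> i V)) \<bullet> half_braid \<delta> A \<iota> i V P = half_braid \<delta> A \<iota> j V P"
proof -
  interpret central_comparison C \<delta> i "A i" "\<iota> i" j "A j" "\<iota> j"
    using central_duals_4[OF piv] central_duals_3[of \<delta>] c
    by (simp add: central_comparison_def central_coend_def central_coend_axioms_def i j)
  note piv_p_simps[OF piv, simp]
  have i': "\<not> i \<le> 2" "du C i X = rd C X" "cap C \<delta> i X = evr C X" for X
    by (simp_all add: i du_def cap_def)
  have j': "\<not> j \<le> 2" "du C j X = ld C X" "cap C \<delta> j X = evr C X \<cdot> (ide C X \<boxtimes> piv_p C \<delta> X)" for X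
    by (simp_all add: j du_def cap_def)
  have S: "PP X = rd C X" "QQ X = X" "summand C i X V X = (X \<otimes> V) \<otimes> rd C X" "ee X = sevr X"
      "pk X V X = pack (X \<otimes> V) (rd C X) \<bullet> (pack X V \<lhd> [rd C X])" for X
    by (simp_all add: PP_def QQ_def summand_def pk_def ee_def i' sevr_def)
  have T: "T.PP X = ld C X" "T.QQ X = X" "summand C j X V X = (X \<otimes> V) \<otimes> ld C X"
      "T.jj V X = J (\<iota> j V X) \<bullet> pack (X \<otimes> V) (ld C X) \<bullet> (pack X V \<lhd> [ld C X])"
      "X \<in> objs C \<Longrightarrow> T.ee X = sevr X \<bullet> (X \<rhd> J (piv_p C \<delta> X))" for X
    using cap4[OF piv, of X] piv_p(2)[OF piv, of X]
    by (simp_all add: T.PP_def T.QQ_def summand_def T.jj_def T.pk_def T.ee_def j')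
  \<comment> \<open>In the pairing of A_4, \<open>piv_p\<close> cancels against its inverse in the
    comparison arrow.\<close>
  have e: "sevr X \<bullet> (X \<rhd> J (piv_p C \<delta> X)) \<bullet> (X \<rhd> J (piv_q \<delta> X)) = sevr X" if X: "X \<in> objs C" for X
    using X J_cmp[of "piv_q \<delta> X" "piv_p C \<delta> X", symmetric] by (simp flip: lwhisk_scmp)
  let ?\<phi> = "\<lambda>X. \<iota> j V X \<cdot> (ide C (X \<otimes> V) \<boxtimes> piv_q \<delta> X)"
  have k: "kappa_step C \<delta> A \<iota> i V = desc C (A i) (\<iota> i) V (A j V) ?\<phi>"
    by (simp add: kappa_step_def i j eval_nat_numeral)
  note iota = T.iota_simps[OF V, unfolded T(3)]
  show "kappa_step C \<delta> A \<iota> i V \<in> hom C (A i V) (A j V)"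
    "P \<in> objs C \<Longrightarrow> (P \<rhd> J (kappa_step C \<delta> A \<iota> i V)) \<bullet> half_braid \<delta> A \<iota> i V P = half_braid \<delta> A \<iota> j V P"
    unfolding k half_braid_def
    by (rule desc_compare[where X' = "\<lambda>X. X" and h = "ide C" and g = "piv_q \<delta>"];
      use V in \<open>simp add: S T e in_hom iota push rex\<close>)+
qed

end

text \<open>A common frame for both parts of the theorem: the index set is {2, 3}, or {1, 2, 3, 4}
  in the pivotal case. \<open>I_convex\<close> keeps every intermediate index of a chain of steps in
  \<open>I\<close>.\<close>

locale central_family = rigid_category C
  for C :: "('o, 'm, 'x) rigidcat_scheme" (structure) +
  fixes \<delta> :: "'o \<Rightarrow> 'm" and A :: "nat \<Rightarrow> 'o \<Rightarrow> 'o" and \<iota> :: "nat \<Rightarrow> 'o \<Rightarrow> 'o \<Rightarrow> 'm" and I :: "nat set"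
  assumes coend: "i \<in> I \<Longrightarrow> central_coend C \<delta> i (A i) (\<iota> i)"
    and step_hom: "i \<in> I \<Longrightarrow> Suc i \<in> I \<Longrightarrow> V \<in> objs C \<Longrightarrow> kappa_step C \<delta> A \<iota> i V \<in> hom C (A i V) (A (Suc i) V)"
    and step_half_braid: "i \<in> I \<Longrightarrow> Suc i \<in> I \<Longrightarrow> V \<in> objs C \<Longrightarrow> P \<in> objs C \<Longrightarrow>
      (P \<rhd> J (kappa_step C \<delta> A \<iota> i V)) \<bullet> half_braid \<delta> A \<iota> i V P = half_braid \<delta> A \<iota> (Suc i) V P"
    and I_convex: "i \<in> I \<Longrightarrow> i + Suc n \<in> I \<Longrightarrow> i + n \<in> I"
begin

lemma centralizer: "i \<in> I \<Longrightarrow> centralizer_bimonad C (central_monad C \<delta> i (A i) (\<iota> i)) (half_braid \<delta> A \<iota> i)"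
  unfolding half_braid_def by (rule central_coend.central_monad[OF coend])

lemma iso_of_compare:
  assumes "i \<in> I" "j \<in> I"
    and "\<And>V. V \<in> objs C \<Longrightarrow> \<psi> V \<in> hom C (A i V) (A j V)"
    and "\<And>V P. V \<in> objs C \<Longrightarrow> P \<in> objs C \<Longrightarrow> (P \<rhd> J (\<psi> V)) \<bullet> half_braid \<delta> A \<iota> i V P = half_braid \<delta> A \<iota> j V P"
  shows "hopf_monad_iso C (central_monad C \<delta> i (A i) (\<iota> i)) (central_monad C \<delta> j (A j) (\<iota> j)) \<psi>"
  by (rule centralizer_comparison.hopf_monad_iso[where d = "half_braid \<delta> A \<iota> i" and d' = "half_braid \<delta> A \<iota> j"], intro centralizer_comparison.intro centralizer_comparison_axioms.intro)
    (use assms centralizer in \<open>auto simp: central_monad_def\<close>)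

lemma kappa_up:
  assumes "i \<in> I" "i + n \<in> I" and V: "V \<in> objs C"
  shows "kappa_up C \<delta> A \<iota> i n V \<in> hom C (A i V) (A (i + n) V) \<and>
    (\<forall>P \<in> objs C. (P \<rhd> J (kappa_up C \<delta> A \<iota> i n V)) \<bullet> half_braid \<delta> A \<iota> i V P = half_braid \<delta> A \<iota> (i + n) V P)"
  using assms(2)
proof (induction n)
  case 0
  interpret centralizer_bimonad C "central_monad C \<delta> i (A i) (\<iota> i)" "half_braid \<delta> A \<iota> i"
    by (rule centralizer[OF assms(1)])
  have "A i V \<in> objs C"
    using E_obj[OF V] by (simp add: central_monad_def)
  then show ?case
    using V by (simp add: in_hom central_monad_def)
next
  case (Suc n)
  note n = I_convex[OF assms(1) Suc.prems]
  note IH = Suc.IH[OF n, unfolded in_hom]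
  note s = step_hom[OF n _ V, unfolded in_hom] step_half_braid[OF n _ V]
  show ?case
    using Suc.prems IH s
      IH[THEN conjunct2, rule_format, symmetric]
    by (auto simp: in_hom J_cmp)
qed

text \<open>Upward, a chain of steps carries the universal family for \<open>i\<close> to that for
  \<open>j\<close>, and \<open>iso_of_compare\<close> applies. Downward, \<open>kappa\<close> is a
  pointwise inverse: the upward case supplies invertibility, and the inverse carries the families
  back.\<close>

lemma kappa:
  assumes i: "i \<in> I" and j: "j \<in> I"
  shows "hopf_monad_iso C (central_monad C \<delta> i (A i) (\<iota> i)) (central_monad C \<delta> j (A j) (\<iota> j)) (kappa C \<delta> A \<iota> i j)"
proof (cases "i \<le> j")
  case True
  then show ?thesis
    using kappa_up[OF i, of "j - i"] j by (intro iso_of_compare[OF i j]) (auto simp: kappa_def)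
next
  case False
  define \<psi> where "\<psi> = kappa_up C \<delta> A \<iota> j (i - j)"
  have \<psi>: "\<psi> V \<in> hom C (A j V) (A i V)"
    "P \<in> objs C \<Longrightarrow> (P \<rhd> J (\<psi> V)) \<bullet> half_braid \<delta> A \<iota> j V P = half_braid \<delta> A \<iota> i V P" if "V \<in> objs C" for V P
    using kappa_up[OF j, of "i - j" V] that i False by (simp_all add: \<psi>_def)
  have "hopf_monad_iso C (central_monad C \<delta> j (A j) (\<iota> j)) (central_monad C \<delta> i (A i) (\<iota> i)) \<psi>"
    by (rule iso_of_compare[OF j i]) (use \<psi> in auto)
  then have iso: "iso C (\<psi> V)" if "V \<in> objs C" for V
    using that \<psi>(1)[OF that] unfolding hopf_monad_iso_def hopf_monad_morphism_def
    by (auto simp: central_monad_def intro!: isoI[OF \<psi>(1)[OF that]])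
  interpret centralizer_bimonad C "central_monad C \<delta> j (A j) (\<iota> j)" "half_braid \<delta> A \<iota> j"
    by (rule centralizer[OF j])
  have k: "kappa C \<delta> A \<iota> i j V = inv_arr C (\<psi> V)" for V
    using False by (simp add: kappa_def \<psi>_def)
  show ?thesis
  proof (rule iso_of_compare[OF i j])
    fix V assume V: "V \<in> objs C"
    note p = \<psi>(1)[OF V, unfolded in_hom]
    show "kappa C \<delta> A \<iota> i j V \<in> hom C (A i V) (A j V)"
      using p iso[OF V] by (simp add: k in_hom)
    fix P assume P: "P \<in> objs C"
    have "J (inv_arr C (\<psi> V)) \<bullet> J (\<psi> V) = sid [A j V]"
      using p iso[OF V] cat_simps(1)[of "\<psi> V"] by (simp flip: J_cmp)
    then have "P \<rhd> (J (inv_arr C (\<psi> V)) \<bullet> J (\<psi> V)) = sid [P, A j V]"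
      using p P cat_simps(1)[of "\<psi> V"] by simp
    then show "(P \<rhd> J (kappa C \<delta> A \<iota> i j V)) \<bullet> half_braid \<delta> A \<iota> i V P = half_braid \<delta> A \<iota> j V P"
      unfolding k \<psi>(2)[OF V P, symmetric] using V P
      by (simp add: central_monad_def flip: scmp_assoc)
  qed
qed

end

theorem proposition2p4:
  fixes C :: "('o, 'm, 'k::alg_closed_field) tensorcat"
    and A :: "nat \<Rightarrow> 'o \<Rightarrow> 'o"
    and \<iota> :: "nat \<Rightarrow> 'o \<Rightarrow> 'o \<Rightarrow> 'm"
    and \<delta> :: "'o \<Rightarrow> 'm"
  assumes "finite_tensor_category C"
  shows "(coends C 2 (A 2) (\<iota> 2) \<and> coends C 3 (A 3) (\<iota> 3) \<longrightarrow>
            hopf_monad_iso C (central_monad C \<delta> 2 (A 2) (\<iota> 2)) (central_monad C \<delta> 3 (A 3) (\<iota> 3))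
              (kappa C \<delta> A \<iota> 2 3)) \<and>
         (pivotal C \<delta> \<and> (\<forall>i \<in> {1, 2, 3, 4}. coends C i (A i) (\<iota> i)) \<longrightarrow>
            (\<forall>i \<in> {1, 2, 3, 4}. \<forall>j \<in> {1, 2, 3, 4}.
               hopf_monad_iso C (central_monad C \<delta> i (A i) (\<iota> i)) (central_monad C \<delta> j (A j) (\<iota> j))
                 (kappa C \<delta> A \<iota> i j)))"
proof -
  interpret finite_tensor_category C by fact
  have coend: "central_coend C \<delta> i (A i) (\<iota> i)" if "central_duals C \<delta> i" "coends C i (A i) (\<iota> i)" for i
    using that by (simp add: central_coend_def central_coend_axioms_def)
  show ?thesis
  proof (intro conjI impI ballI; elim conjE)
    assume c: "coends C 2 (A 2) (\<iota> 2)" "coends C 3 (A 3) (\<iota> 3)"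
    have "central_family C \<delta> A \<iota> {2, 3}"
    proof (intro central_family.intro central_family_axioms.intro rigid_category_axioms)
      fix i :: nat assume i: "i \<in> {2, 3}"
      then show "central_coend C \<delta> i (A i) (\<iota> i)"
        using coend central_duals_2[of \<delta>] central_duals_3[of \<delta>] c by blast
      assume "Suc i \<in> {2, 3}"
      with i have j: "i = 2" "Suc i = 3" by auto
      fix V assume V: "V \<in> objs C"
      have c': "coends C i (A i) (\<iota> i)" "coends C (Suc i) (A (Suc i)) (\<iota> (Suc i))"
        using c unfolding j by simp_all
      show "kappa_step C \<delta> A \<iota> i V \<in> hom C (A i V) (A (Suc i) V)"
        "P \<in> objs C \<Longrightarrow> (P \<rhd> J (kappa_step C \<delta> A \<iota> i V)) \<bullet> half_braid \<delta> A \<iota> i V P = half_braid \<delta> A \<iota> (Suc i) V P" for P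
        by (rule kappa_step_2[OF j c' V]; assumption?)+
    qed auto
    from central_family.kappa[OF this]
    show "hopf_monad_iso C (central_monad C \<delta> 2 (A 2) (\<iota> 2)) (central_monad C \<delta> 3 (A 3) (\<iota> 3)) (kappa C \<delta> A \<iota> 2 3)"
      by simp
  next
    fix i j :: nat
    assume ij: "i \<in> {1, 2, 3, 4}" "j \<in> {1, 2, 3, 4}"
    assume piv: "pivotal C \<delta>" and c: "\<forall>i \<in> {1, 2, 3, 4}. coends C i (A i) (\<iota> i)"
    have "central_family C \<delta> A \<iota> {1, 2, 3, 4}"
    proof (intro central_family.intro central_family_axioms.intro rigid_category_axioms)
      fix i :: nat assume i: "i \<in> {1, 2, 3, 4}"
      then show "central_coend C \<delta> i (A i) (\<iota> i)"
        using coend central_duals_1[OF piv] central_duals_2[of \<delta>] central_duals_3[of \<delta>] central_duals_4[OF piv] c by blast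
      assume s: "Suc i \<in> {1, 2, 3, 4}"
      fix V assume V: "V \<in> objs C"
      have c': "coends C i (A i) (\<iota> i)" "coends C (Suc i) (A (Suc i)) (\<iota> (Suc i))"
        using c i s by blast+
      from i s consider "i = 1" "Suc i = 2" | "i = 2" "Suc i = 3" | "i = 3" "Suc i = 4" by auto
      then show "kappa_step C \<delta> A \<iota> i V \<in> hom C (A i V) (A (Suc i) V)"
        by cases (rule kappa_step_1(1)[OF piv _ _ c' V] kappa_step_2(1)[OF _ _ c' V] kappa_step_3(1)[OF piv _ _ c' V]; assumption)+
      fix P assume P: "P \<in> objs C"
      from i s consider "i = 1" "Suc i = 2" | "i = 2" "Suc i = 3" | "i = 3" "Suc i = 4" by auto
      then show "(P \<rhd> J (kappa_step C \<delta> A \<iota> i V)) \<bullet> half_braid \<delta> A \<iota> i V P = half_braid \<delta> A \<iota> (Suc i) V P"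
        by cases (rule kappa_step_1(2)[OF piv _ _ c' V P] kappa_step_2(2)[OF _ _ c' V P] kappa_step_3(2)[OF piv _ _ c' V P]; assumption)+
    qed auto
    from central_family.kappa[OF this ij]
    show "hopf_monad_iso C (central_monad C \<delta> i (A i) (\<iota> i)) (central_monad C \<delta> j (A j) (\<iota> j)) (kappa C \<delta> A \<iota> i j)" .
  qed
qed

end
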